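(* There is an orthogonal decomposition $$L^2\big(\mathcal H(0,0)\big)^{\mathrm{gen}}=L^2\big(\mathcal H(0,0)\big)^{\mathrm{gen}}_{\mathrm{cusp}}\oplus\overline{\mathrm{span}}\Big(\bigcup_{M=1}^\infty\mathcal{SV}_{\mathrm{rel},M}\Big),$$ where $\mathcal{SV}_{\mathrm{rel},M}=\overline{\mathrm{span}}\{\mathrm{SV}_{\mathrm{rel},M}(f):f\in C^\infty_{c,0}(\mathbb R^2)\}$ and $C^\infty_{c,0}(\mathbb R^2)$ denotes smooth compactly supported functions with integral zero.
   Context: Write $e(x)=e^{2\pi ix}$. The stratum $\mathcal H(0,0)$ of area-one flat tori with two marked points with Masur–Veech measure is identified (up to a null set) with $G'(\mathbb Z)\backslash G'(\mathbb R)$, where $G'(\mathbb R)=\mathrm{SAff}_2(\mathbb R)=\mathrm{SL}_2(\mathbb R)\ltimes\mathbb R^2$ (elements $(g,w_1,w_2)$, product $(g,w)(\tilde g,\tilde w)=(g\tilde g,w\tilde g+\tilde w)$) and $G'(\mathbb Z)=\mathrm{SL}_2(\mathbb Z)\ltimes\mathbb Z^2$, with Haar measure. $L^2(\mathcal H(0,0))^{\mathrm{gen}}$ is the orthogonal complement of the functions of the form $(g,w)\mapsto F(g)$ (pullbacks from $\mathcal H(0)=\mathrm{SL}_2(\mathbb Z)\backslash\mathrm{SL}_2(\mathbb R)$). For $g=\begin{pmatrix}a&b\\c&d\end{pmatrix}$ and $M\in\mathbb Z_{\ge1}$: $\mathrm{SV}_{\mathrm{rel},M}(f)(g,w_1,w_2)=\sum_{j,l\in\mathbb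 Z}f\big((w_1,w_2)+\frac1M(j(a,b)+l(c,d))\big)$. On $\mathbb H'=\mathbb H\times\mathbb C$ ($\tau=x+iy$, $z=u+iv$), the weight-$k$ slash action is $(\phi|'_k(\begin{pmatrix}a&b\\c&d\end{pmatrix},w_1,w_2))(\tau,z)=(c\tau+d)^{-k}\phi(\frac{a\tau+b}{c\tau+d},\frac{z+w_1\tau+w_2}{c\tau+d})$; $\phi$ is affine modular-invariant of weight $k$ if invariant under $G'(\mathbb Z)$; its lift to $G'(\mathbb R)$ is $\widetilde\phi(g)=(\phi|'_kg)(i,0)$ (these lifts are exactly the left $G'(\mathbb Z)$-invariant functions of $K$-type $k$, $K=\mathrm{SO}_2(\mathbb R)$). Fourier–Heisenberg coefficients: $c^H(\phi;n,r;y,v/y)=\int_0^1\int_0^1\phi(x+iy,u+iv)e(-nx-ru)dx\,du$, $c^{H0}(\phi;n,m;y)=\frac1y\int_0^yc^H(\phi;n,0;y,v/y)e(-mv/y)dv$. A cusp form is such $\phi$ with $c^{H0}(\phi;0,m;y)=0$ for all $m\in\mathbb Z$; $L^2(\mathcal H(0,0))^{\mathrm{gen}}_{\mathrm{cusp}}$ is the closure of the space of lifts of genuine cusp forms. *)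

theory Defs
  imports "HOL-Analysis.Analysis"
begin

section \<open>The special affine group\<close>

text \<open>
  The group \<open>SAff\<^sub>2(\<real>)\<close> is the subset \<open>SAff\<close> of the ambient vector space of pairs
  \<open>(g, w)\<close> of a matrix and a row vector. Functions on the group are total functions on
  this type; everything below depends on their values on \<open>SAff\<close> only.
\<close>

type_synonym saff = "(real^2^2) \<times> (real^2)"

definition SAff :: "saff set" where
  "SAff = {(g, w). det g = 1}"

definition SAff_int :: "saff set" where
  "SAff_int = {(g, w). det g = 1 \<and> (\<forall>i j. g $ i $ j \<in> \<int>) \<and> (\<forall>i. w $ i \<in> \<int>)}"

definition saff_mult :: "saff \<Rightarrow> saff \<Rightarrow> saff" where
  "saff_mult x y = (fst x ** fst y, snd x v* fst y + snd y)"

text \<open>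
  Regularity need not be demanded: \<open>SAff\<close> is locally compact and second countable, so a
  Borel measure that is finite on compact sets is automatically Radon.
\<close>

definition haar_measure :: "saff measure \<Rightarrow> bool" where
  "haar_measure \<mu> \<longleftrightarrow>
     sets \<mu> = sets (restrict_space borel SAff) \<and>
     (\<forall>h\<in>SAff. \<forall>A\<in>sets \<mu>. emeasure \<mu> (saff_mult h ` A) = emeasure \<mu> A) \<and>
     (\<forall>K. compact K \<and> K \<subseteq> SAff \<longrightarrow> emeasure \<mu> K < \<infinity>) \<and>
     emeasure \<mu> SAff \<noteq> 0"

definition fundamental_domain :: "saff measure \<Rightarrow> saff set \<Rightarrow> bool" where
  "fundamental_domain \<mu> D \<longleftrightarrow>
     D \<in> sets \<mu> \<and> (AE x in \<mu>. \<exists>!\<gamma>. \<gamma> \<in> SAff_int \<and> saff_mult \<gamma> x \<in> D)"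


section \<open>The space of square-integrable functions on the quotient\<close>

text \<open>
  Functions on \<open>SAff_int \ SAff\<close> are the left \<open>SAff_int\<close>-invariant functions on \<open>SAff\<close>, and
  integration over the quotient is integration over a fundamental domain \<open>D\<close>. Elements
  of \<open>L2\<close> are functions and not classes modulo null functions; the closures below are
  saturated, that is, closed under changing a function (invariantly) on a null set.
\<close>

definition L2 :: "saff measure \<Rightarrow> saff set \<Rightarrow> (saff \<Rightarrow> complex) set" where
  "L2 \<mu> D = {f. f \<in> borel_measurable \<mu> \<and>
     (\<forall>\<gamma>\<in>SAff_int. \<forall>x\<in>SAff. f (saff_mult \<gamma> x) = f x) \<and>
     set_integrable \<mu> D (\<lambda>x. (norm (f x))\<^sup>2)}"

definition L2_inner ::
  "saff measure \<Rightarrow> saff set \<Rightarrow> (saff \<Rightarrow> complex) \<Rightarrow> (saff \<Rightarrow> complex) \<Rightarrow> complex" where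
  "L2_inner \<mu> D f g = (LINT x:D|\<mu>. f x * cnj (g x))"

definition L2_norm :: "saff measure \<Rightarrow> saff set \<Rightarrow> (saff \<Rightarrow> complex) \<Rightarrow> real" where
  "L2_norm \<mu> D f = sqrt (LINT x:D|\<mu>. (norm (f x))\<^sup>2)"

definition L2_closure ::
  "saff measure \<Rightarrow> saff set \<Rightarrow> (saff \<Rightarrow> complex) set \<Rightarrow> (saff \<Rightarrow> complex) set" where
  "L2_closure \<mu> D S = {f \<in> L2 \<mu> D.
     \<forall>\<epsilon>>0. \<exists>s \<in> S \<inter> L2 \<mu> D. L2_norm \<mu> D (\<lambda>x. f x - s x) < \<epsilon>}"

definition fun_span :: "(saff \<Rightarrow> complex) set \<Rightarrow> (saff \<Rightarrow> complex) set" where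
  "fun_span S = {(\<lambda>x. \<Sum>p\<in>T. c p * p x) | T c. finite T \<and> T \<subseteq> S}"

definition L2_gen :: "saff measure \<Rightarrow> saff set \<Rightarrow> (saff \<Rightarrow> complex) set" where
  "L2_gen \<mu> D = {f \<in> L2 \<mu> D.
     \<forall>p \<in> L2 \<mu> D. (\<exists>F. \<forall>(g, w)\<in>SAff. p (g, w) = F g) \<longrightarrow> L2_inner \<mu> D f p = 0}"

definition orthogonal_decomposition ::
  "saff measure \<Rightarrow> saff set \<Rightarrow> (saff \<Rightarrow> complex) set \<Rightarrow>
     (saff \<Rightarrow> complex) set \<Rightarrow> (saff \<Rightarrow> complex) set \<Rightarrow> bool" where
  "orthogonal_decomposition \<mu> D V A B \<longleftrightarrow>
     V = {(\<lambda>x. a x + b x) | a b. a \<in> A \<and> b \<in> B} \<and>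
     (\<forall>a\<in>A. \<forall>b\<in>B. L2_inner \<mu> D a b = 0)"


section \<open>Affine modular-invariant functions and cusp forms\<close>

definition slash ::
  "int \<Rightarrow> (complex \<Rightarrow> complex \<Rightarrow> complex) \<Rightarrow> saff \<Rightarrow> complex \<Rightarrow> complex \<Rightarrow> complex" where
  "slash k \<phi> h \<tau> z =
     (let a = complex_of_real (fst h $ 1 $ 1); b = complex_of_real (fst h $ 1 $ 2);
          c = complex_of_real (fst h $ 2 $ 1); d = complex_of_real (fst h $ 2 $ 2);
          w1 = complex_of_real (snd h $ 1); w2 = complex_of_real (snd h $ 2)
      in (c * \<tau> + d) powi (- k) *
         \<phi> ((a * \<tau> + b) / (c * \<tau> + d)) ((z + w1 * \<tau> + w2) / (c * \<tau> + d)))"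

definition affine_modular_invariant :: "int \<Rightarrow> (complex \<Rightarrow> complex \<Rightarrow> complex) \<Rightarrow> bool" where
  "affine_modular_invariant k \<phi> \<longleftrightarrow>
     (\<forall>\<gamma>\<in>SAff_int. \<forall>\<tau> z. Im \<tau> > 0 \<longrightarrow> slash k \<phi> \<gamma> \<tau> z = \<phi> \<tau> z)"

definition group_lift :: "int \<Rightarrow> (complex \<Rightarrow> complex \<Rightarrow> complex) \<Rightarrow> saff \<Rightarrow> complex" where
  "group_lift k \<phi> h = slash k \<phi> h \<i> 0"

definition e_fun :: "real \<Rightarrow> complex" where
  "e_fun x = exp (2 * complex_of_real pi * \<i> * complex_of_real x)"

text \<open>The last argument \<open>q\<close> of \<open>c_H\<close> stands for \<open>v / y\<close>.\<close>

definition c_H ::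
  "(complex \<Rightarrow> complex \<Rightarrow> complex) \<Rightarrow> int \<Rightarrow> int \<Rightarrow> real \<Rightarrow> real \<Rightarrow> complex" where
  "c_H \<phi> n r y q =
     (LINT u:{0..1}|lborel. LINT x:{0..1}|lborel.
        \<phi> (Complex x y) (Complex u (q * y)) * e_fun (- of_int n * x - of_int r * u))"

definition c_H0 ::
  "(complex \<Rightarrow> complex \<Rightarrow> complex) \<Rightarrow> int \<Rightarrow> int \<Rightarrow> real \<Rightarrow> complex" where
  "c_H0 \<phi> n m y =
     complex_of_real (1 / y) *
     (LINT v:{0..y}|lborel. c_H \<phi> n 0 y (v / y) * e_fun (- of_int m * v / y))"

definition genuine_cusp_form ::
  "saff measure \<Rightarrow> saff set \<Rightarrow> int \<Rightarrow> (complex \<Rightarrow> complex \<Rightarrow> complex) \<Rightarrow> bool" where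
  "genuine_cusp_form \<mu> D k \<phi> \<longleftrightarrow>
     affine_modular_invariant k \<phi> \<and>
     group_lift k \<phi> \<in> L2_gen \<mu> D \<and>
     (\<forall>m. \<forall>y>0. c_H0 \<phi> 0 m y = 0)"

definition L2_gen_cusp :: "saff measure \<Rightarrow> saff set \<Rightarrow> (saff \<Rightarrow> complex) set" where
  "L2_gen_cusp \<mu> D =
     L2_closure \<mu> D (fun_span {group_lift k \<phi> | k \<phi>. genuine_cusp_form \<mu> D k \<phi>})"


section \<open>Relative Siegel--Veech transforms\<close>

fun Ck :: "nat \<Rightarrow> (real^2 \<Rightarrow> complex) \<Rightarrow> bool" where
  "Ck 0 f \<longleftrightarrow> continuous_on UNIV f"
| "Ck (Suc k) f \<longleftrightarrow>
     (\<forall>x. f differentiable (at x)) \<and> (\<forall>v. Ck k (\<lambda>x. frechet_derivative f (at x) v))"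

definition Cc_smooth0 :: "(real^2 \<Rightarrow> complex) set" where
  "Cc_smooth0 = {f. (\<forall>k. Ck k f) \<and> compact (closure {x. f x \<noteq> 0}) \<and>
     (LINT x|lborel. f x) = 0}"

text \<open>For compactly supported \<open>f\<close> only finitely many summands are nonzero.\<close>

definition SV_rel :: "nat \<Rightarrow> (real^2 \<Rightarrow> complex) \<Rightarrow> saff \<Rightarrow> complex" where
  "SV_rel M f h =
     (\<Sum>\<^sub>\<infinity>(j, l)\<in>(UNIV :: (int \<times> int) set).
        f (snd h + (1 / real M) *\<^sub>R (of_int j *\<^sub>R (fst h $ 1) + of_int l *\<^sub>R (fst h $ 2))))"

definition SV_space :: "saff measure \<Rightarrow> saff set \<Rightarrow> nat \<Rightarrow> (saff \<Rightarrow> complex) set" where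
  "SV_space \<mu> D M = L2_closure \<mu> D (fun_span (SV_rel M ` Cc_smooth0))"

end

theory Submission
 imports Defs
begin

text \<open>
 Fourier expansion along the torus fibre and unfolding turn the pairing of an invariant function \<open>psi\<close> with
 a Siegel--Veech transform of \<open>f\<close> into the sum over \<open>k\<close> of the integrals of \<open>cnj (fhat f (M k xe))\<close> times
 \<open>omg psi (M k) xe\<close>, where \<open>omg psi m xe\<close> is the \<open>m\<close>-th coefficient of \<open>psi\<close> over the unipotent quotient
 above \<open>xe\<close>. Translating \<open>f\<close> and sieving over \<open>M\<close> shows that \<open>psi\<close> is orthogonal to all transforms only if
 these coefficients vanish for \<open>m\<close> nonzero; genuineness gives \<open>m = 0\<close>. Since the coefficients of a \<open>K\<close>-type
 are the \<open>c_H0\<close> of the corresponding form, the \<open>K\<close>-types of such \<open>psi\<close> are lifts of cusp forms off a null set.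
\<close>

\<comment> \<open>Two obstacles shape the proof. A cusp form must have vanishing coefficients for
  every \<open>y\<close> and \<open>m\<close>, whereas orthogonality gives this only for almost
  every \<open>xe\<close>. A correction on a null set has to respect invariance and the K-type and
  may disturb further radii, so exceptional radii are removed together with their whole orbits until
  the set is stable. Moreover the transform for \<open>M\<close> sees only frequencies divisible by
  \<open>M\<close>, and one pairing sums over all of them; only the family of all \<open>M\<close>,
  together with translates of \<open>f\<close>, isolates a single coefficient. The sign of
  \<open>m\<close> needs no extra test functions: minus the identity lies in the lattice, so the
  nonzero frequencies can be listed as positive or as negative multiples of primitive vectors, and
  each listing gives a full formula for the pairing. The Haar measure is given as left invariant;
  invariance under right rotations is derived. The measure \<open>lam\<close> on the quotient by the
  unipotent group is never computed: the estimates rest on its homogeneity under scaling and its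
  finiteness on annuli.\<close>
syntax "_nn_integral_NN" :: "pttrn => 'a measure => ennreal => ennreal" ("(2NN (1_)/|(_)./ _)" [0,110,60] 60)
translations "NN x|M. f" == "CONST nn_integral M (%x. f)"

notation pair_measure (infixr "\<otimes>" 80)
type_synonym R2 = "real \<times> real"
notation infinity ("oo")
abbreviation cor where "cor == complex_of_real"
abbreviation roi where "roi == real_of_int"
abbreviation bmble where "bmble == borel_measurable"
abbreviation mul where "mul == saff_mult"
abbreviation ind where "ind == indicator"
abbreviation cU where "cU == count_space UNIV"
abbreviation nsq where "nsq z == ennreal ((norm z)^2)"

lemmas lint_cong = Bochner_Integration.integral_cong
 and m_cong = measurable_cong_sets
 and intble_bound = Bochner_Integration.integrable_bound
 and bmble_cont = borel_measurable_continuous_onI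

section \<open>Square-integrable functions on a measure space\<close>

definition sqint :: "'a measure => ('a => complex) set" where
 "sqint M = {f. f \<in> bmble M \<and> integrable M (%x. (norm (f x))^2)}"

definition ip :: "'a measure => ('a => complex) => ('a => complex) => complex" where
 "ip M f g = (LINT x|M. f x * cnj (g x))"

definition nrm2 :: "'a measure => ('a => complex) => real" where
 "nrm2 M f = (LINT x|M. (norm (f x))^2)"

lemma sqintD: "f \<in> sqint M ==> f \<in> bmble M"
 "f \<in> sqint M ==> integrable M (%x. (norm (f x))^2)"
 by (auto simp: sqint_def)

lemma measurable_cnj[measurable]: "cnj \<in> bmble borel"
 by (intro bmble_cont continuous_intros)

lemma mult_cnj_norm: "z * cnj z = (cor (norm z))^2"
 using complex_norm_square[of z] by simp

lemma norm_mult_le_half: "norm (a::complex) * norm (b::complex) <= ((norm a)^2 + (norm b)^2) / 2"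
 using sum_squares_bound[of "norm a" "norm b"] by simp

lemma norm_add_sq_le: "(norm ((a::complex) + b))^2 <= 2 * (norm a)^2 + 2 * (norm b)^2"
proof -
 have "(norm (a + b))^2 <= (norm a + norm b)^2"
  by (intro power_mono norm_triangle_ineq) auto
 also have "... <= 2 * (norm a)^2 + 2 * (norm b)^2"
  using sum_squares_bound[of "norm a" "norm b"] by (simp add: power2_sum)
 finally show ?thesis .
qed

lemma sqint_prod_integrable:
 assumes "f \<in> sqint M" "g \<in> sqint M"
 shows "integrable M (%x. f x * cnj (g x))" "integrable M (%x. norm (f x) * norm (g x))"
proof -
 have [measurable]: "f \<in> bmble M" "g \<in> bmble M" using assms by (auto dest: sqintD)
 have *: "integrable M (%x. ((norm (f x))^2 + (norm (g x))^2) / 2)"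
  by (intro integrable_divide Bochner_Integration.integrable_add sqintD assms)
 show "integrable M (%x. f x * cnj (g x))"
  by (rule intble_bound[OF *]) (auto simp: norm_mult norm_mult_le_half simp del: le_divide_eq_numeral1)
 show "integrable M (%x. norm (f x) * norm (g x))"
  by (rule intble_bound[OF *]) (auto simp: norm_mult norm_mult_le_half simp del: le_divide_eq_numeral1)
qed

lemma sqint_bound:
 assumes "f \<in> bmble M" "integrable M g" "AE x in M. (norm (f x))^2 <= g x"
 shows "f \<in> sqint M"
proof -
 have [measurable]: "f \<in> bmble M" by fact
 have "AE x in M. norm ((norm (f x))^2) <= norm (g x)"
  using assms(3) by eventually_elim auto
 then show ?thesis unfolding sqint_def
  using intble_bound[OF assms(2), of "%x. (norm (f x))^2"] by auto
qed

lemma sqint_add: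
 assumes "f \<in> sqint M" "g \<in> sqint M"
 shows "(%x. f x + g x) \<in> sqint M"
proof (rule sqint_bound[where g="%x. 2 * (norm (f x))^2 + 2 * (norm (g x))^2"])
 show "(%x. f x + g x) \<in> bmble M"
  by (intro borel_measurable_add sqintD assms)
 show "integrable M (%x. 2 * (norm (f x))^2 + 2 * (norm (g x))^2)"
  by (intro Bochner_Integration.integrable_add integrable_mult_right sqintD assms)
qed (intro AE_I2 norm_add_sq_le)

lemma sqint_scale: "f \<in> sqint M ==> (%x. c * f x) \<in> sqint M"
 unfolding sqint_def by (auto simp: norm_mult power_mult_distrib)

lemma sqint_diff: "f \<in> sqint M ==> g \<in> sqint M ==> (%x. f x - g x) \<in> sqint M"
 using sqint_add[of f M "%x. (-1) * g x"] sqint_scale[of g M "-1"] by simp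

lemma sqint_zero: "(%x. 0) \<in> sqint M"
 by (simp add: sqint_def)

lemma sqint_sum: "(!!i. i \<in> I ==> f i \<in> sqint M) ==> (%x. \<Sum>i\<in>I. c i * f i x) \<in> sqint M"
 by (induction I rule: infinite_finite_induct) (auto intro!: sqint_add sqint_scale sqint_zero)

lemma nrm2_nonneg[simp]: "nrm2 M f >= 0"
 unfolding nrm2_def by simp

lemma nrm2_swap: "nrm2 M (%x. f x - g x) = nrm2 M (%x. g x - f x)"
 unfolding nrm2_def by (simp add: norm_minus_commute)

lemma nrm2_nn_integral: "f \<in> sqint M ==> (NN x|M. nsq (f x)) = ennreal (nrm2 M f)"
 unfolding nrm2_def by (subst nn_integral_eq_integral) (auto dest: sqintD)

lemma nrm2_eq_0: "f \<in> sqint M ==> nrm2 M f = 0 \<longleftrightarrow> (AE x in M. f x = 0)"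
 unfolding nrm2_def by (subst integral_nonneg_eq_0_iff_AE) (auto dest: sqintD)

lemma ip_self: "ip M f f = cor (nrm2 M f)"
 unfolding ip_def nrm2_def integral_complex_of_real[symmetric]
 by (simp add: complex_norm_square[symmetric])

lemma ip_add_left: "f \<in> sqint M ==> g \<in> sqint M ==> h \<in> sqint M ==> ip M (%x. f x + g x) h = ip M f h + ip M g h"
 unfolding ip_def
 by (subst Bochner_Integration.integral_add[symmetric]) (auto intro: sqint_prod_integrable simp: algebra_simps)

lemma ip_diff_left: "f \<in> sqint M ==> g \<in> sqint M ==> h \<in> sqint M ==> ip M (%x. f x - g x) h = ip M f h - ip M g h"
 unfolding ip_def
 by (subst Bochner_Integration.integral_diff[symmetric]) (auto intro: sqint_prod_integrable simp: algebra_simps)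

lemma ip_scale_left: "ip M (%x. c * f x) g = c * ip M f g"
 unfolding ip_def by (simp add: mult.assoc)

lemma ip_cnj: "ip M g f = cnj (ip M f g)"
proof -
 have "(%x. g x * cnj (f x)) = (%x. cnj (f x * cnj (g x)))" by (simp add: mult.commute)
 then show ?thesis unfolding ip_def by (simp only: Bochner_Integration.integral_cnj)
qed

lemma ip_scale_right: "ip M f (%x. c * g x) = cnj c * ip M f g"
 by (subst (1 2) ip_cnj) (simp add: ip_scale_left)

lemma ip_sum_left:
 "finite I ==> (!!i. i \<in> I ==> f i \<in> sqint M) ==> g \<in> sqint M ==>
 ip M (%x. \<Sum>i\<in>I. c i * f i x) g = (\<Sum>i\<in>I. c i * ip M (f i) g)"
proof (induction I rule: finite_induct)
 case empty then show ?case by (simp add: ip_def)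
next
 case (insert i I)
 then show ?case
  by (simp add: ip_add_left sqint_scale sqint_sum ip_scale_left)
qed

lemma ip_cong_AE:
 assumes "f \<in> bmble M" "g \<in> bmble M" "h \<in> bmble M" "AE x in M. f x = g x"
 shows "ip M f h = ip M g h"
 unfolding ip_def using assms by (intro integral_cong_AE) (auto elim!: eventually_mono)

lemma nrm2_diff:
 assumes "f \<in> sqint M" "g \<in> sqint M"
 shows "nrm2 M (%x. f x - g x) = nrm2 M f - 2 * Re (ip M f g) + nrm2 M g"
proof -
 have "(norm (f x - g x))^2 = (norm (f x))^2 - 2 * Re (f x * cnj (g x)) + (norm (g x))^2" for x
  unfolding cmod_power2 by (simp add: power2_eq_square algebra_simps)
 then have "nrm2 M (%x. f x - g x) = (LINT x|M. (norm (f x))^2 - 2 * Re (f x * cnj (g x)) + (norm (g x))^2)"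
  unfolding nrm2_def by simp
 also have "... = nrm2 M f - 2 * Re (ip M f g) + nrm2 M g"
  unfolding nrm2_def ip_def
  by (simp only: Bochner_Integration.integral_add Bochner_Integration.integral_diff integral_mult_right_zero integral_Re
    sqintD[OF assms(1)] sqintD[OF assms(2)] sqint_prod_integrable(1)[OF assms] integrable_Re integrable_mult_right
    Bochner_Integration.integrable_diff)
 finally show ?thesis .
qed

lemma nrm2_scale: "nrm2 M (%x. c * f x) = (norm c)^2 * nrm2 M f"
 unfolding nrm2_def by (simp add: norm_mult power_mult_distrib)

lemma nrm2_parallelogram:
 assumes "f \<in> sqint M" "g \<in> sqint M"
 shows "nrm2 M (%x. f x + g x) + nrm2 M (%x. f x - g x) = 2 * nrm2 M f + 2 * nrm2 M g"
 using nrm2_diff[OF assms] nrm2_diff[OF assms(1) sqint_scale[OF assms(2), of "-1"]]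
  ip_scale_right[of M f "-1" g] nrm2_scale[of M "-1" g]
 by simp

lemma cauchy_schwarz:
 assumes f: "f \<in> sqint M" and g: "g \<in> sqint M"
 shows "(norm (ip M f g))^2 <= nrm2 M f * nrm2 M g"
proof -
 have *: "nrm2 M f - 2 * Re (cnj c * ip M f g) + (norm c)^2 * nrm2 M g >= 0" for c
  using nrm2_diff[OF f sqint_scale[OF g], of c] nrm2_nonneg[of M "%x. f x - c * g x"]
  by (simp add: ip_scale_right nrm2_scale)
 define p where "p = ip M f g"
 have **: "2 * t * (norm p)^2 <= nrm2 M f + t^2 * (norm p)^2 * nrm2 M g" for t
 proof -
  have "cnj (of_real t * p) * p = of_real t * (p * cnj p)" by simp
  also have "p * cnj p = of_real ((norm p)^2)" by (rule complex_norm_square[symmetric])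
  finally have "cnj (of_real t * p) * p = of_real (t * (norm p)^2)" by simp
  then have "Re (cnj (of_real t * p) * p) = t * (norm p)^2" by (metis Re_complex_of_real)
  then show ?thesis using *[of "of_real t * p"] by (simp add: p_def[symmetric] norm_mult power_mult_distrib)
 qed
 show ?thesis
 proof (cases "nrm2 M g = 0")
  case True
  have "(norm p)^2 = 0"
  proof (rule ccontr)
   assume "(norm p)^2 ~= 0"
   then have pos: "(norm p)^2 > 0" by simp
   \<comment> \<open>For a null \<open>g\<close> the bound \<open>**\<close> is linear in
     \<open>t\<close>, so a large \<open>t\<close> refutes it; in the other case below,
     \<open>t = 1 / nrm2 M g\<close> is the minimiser of the quadratic.\<close>
   have "2 * ((nrm2 M f + 1) / (norm p)^2) * (norm p)^2 <= nrm2 M f"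
    using **[of "(nrm2 M f + 1) / (norm p)^2"] True by simp
   then have "2 * (nrm2 M f + 1) <= nrm2 M f" using pos by simp
   then show False using nrm2_nonneg[of M f] by (auto simp: algebra_simps)
  qed
  then show ?thesis using True p_def by simp
 next
  case False
  then have pos: "nrm2 M g > 0" using nrm2_nonneg[of M g] by linarith
  have "2 * (norm p)^2 / nrm2 M g <= nrm2 M f + (norm p)^2 / nrm2 M g"
   using **[of "1 / nrm2 M g"] pos by (simp add: power2_eq_square)
  then have "(norm p)^2 / nrm2 M g <= nrm2 M f" by simp
  then show ?thesis using pos p_def by (simp add: field_simps)
 qed
qed

text \<open>The geometric rate replaces the passage to a subsequence: weighted by
  \<open>2 ^ n\<close>, the squared increments still have summable integrals, so the increments are
  absolutely summable almost everywhere. Fatou's lemma then turns the Cauchy bound into the same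
  bound for the limit. The form of the rate is the one that \<open>sqint_projection\<close>
  produces.\<close>

lemma sqint_complete:
 fixes s :: "nat => 'a => complex"
 assumes s: "!!n. s n \<in> sqint M"
  and cauchy: "!!n m. n <= m ==> nrm2 M (%x. s n x - s m x) <= 4 * (1/8) ^ n"
 shows "\<exists>b\<in>sqint M. \<forall>n. nrm2 M (%x. s n x - b x) <= 4 * (1/8) ^ n"
proof -
 have [measurable]: "s n \<in> bmble M" for n using s sqintD by blast
 define w where "w n x = 2 ^ n * (norm (s n x - s (Suc n) x))^2" for n x
 have [measurable]: "w n \<in> bmble M" for n unfolding w_def by measurable
 have wn: "(NN x|M. ennreal (w n x)) <= ennreal (4 * (1/4) ^ n)" for n
 proof -
  have "(NN x|M. ennreal (w n x)) = (NN x|M. ennreal (2 ^ n) * nsq (s n x - s (Suc n) x))"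
   unfolding w_def by (subst ennreal_mult[symmetric]) auto
  also have "... = ennreal (2^n) * ennreal (nrm2 M (%x. s n x - s (Suc n) x))"
   by (subst nn_integral_cmult) (auto simp: nrm2_nn_integral sqint_diff s)
  also have "... <= ennreal (2^n * (4 * (1/8)^n))"
   using cauchy[of n "Suc n"] by (subst ennreal_mult[symmetric]) (auto intro!: ennreal_leI mult_left_mono)
  also have "2^n * (4 * (1/8)^n) = 4 * (1/4::real)^n"
   by (simp add: power_mult_distrib[symmetric] field_simps)
  finally show ?thesis .
 qed
 have "(NN x|M. (\<Sum>n. ennreal (w n x))) = (\<Sum>n. NN x|M. ennreal (w n x))"
  by (rule nn_integral_suminf) measurable
 also have "... <= (\<Sum>n. ennreal (4 * (1/4) ^ n))"
  by (intro suminf_le wn) auto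
 also have "... = ennreal (\<Sum>n. 4 * (1/4) ^ n)"
  by (rule suminf_ennreal2) (auto intro!: summable_mult summable_geometric)
 also have "... < oo" by simp
 finally have "(NN x|M. (\<Sum>n. ennreal (w n x))) ~= oo" by simp
 then have "AE x in M. (\<Sum>n. ennreal (w n x)) ~= oo"
  by (intro nn_integral_PInf_AE) auto
 then have conv: "AE x in M. convergent (%n. s n x)"
 proof (eventually_elim, goal_cases)
  case fin: (1 x)
  have w0: "w n x >= 0" for n unfolding w_def by simp
  have sw: "summable (%n. w n x)"
   using fin w0 by (intro summable_suminf_not_top) auto
  have "summable (%n. (1/2)^n + w n x)"
   by (intro summable_add sw summable_geometric) auto
  then have "summable (%n. norm (s n x - s (Suc n) x))"
  proof (rule summable_comparison_test')
   fix n :: nat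
   define a where "a = norm (s n x - s (Suc n) x)"
   \<comment> \<open>The first summand is zero. The square in the second yields
     \<open>2 * a <= (1/2)^n + 2^n * a^2\<close>, which bounds an increment by two summable
     terms.\<close>
   have "0 <= ((1/2)^n - 2^n * a ^ 2 ) ^ 2 * 0 + 2^n * ((1/2)^n - a)^2" by simp
   also have "... = 2^n * ((1/2)^n)^2 - 2 * (2^n * (1/2)^n) * a + 2^n * a^2"
    by (simp add: power2_eq_square algebra_simps)
   also have "2^n * (1/2::real)^n = 1" by (simp add: power_mult_distrib[symmetric])
   also have "2^n * ((1/2::real)^n)^2 = (1/2)^n"
    by (simp add: power2_eq_square power_mult_distrib[symmetric] mult.assoc[symmetric])
   finally have "2 * a <= (1/2)^n + 2^n * a^2" by simp
   then have "2 * a <= (1/2)^n + 2^n * a^2" .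
   moreover have "a >= 0" unfolding a_def by simp
   ultimately have "a <= (1/2)^n + 2^n * a^2" by linarith
   then show "norm (norm (s n x - s (Suc n) x)) <= (1/2)^n + w n x"
    unfolding w_def a_def by simp
  qed
  moreover have "norm (s (Suc n) x - s n x) = norm (s n x - s (Suc n) x)" for n
   by (rule norm_minus_commute)
  ultimately have "summable (%n. norm (s (Suc n) x - s n x))" by simp
  then have "summable (%n. s (Suc n) x - s n x)"
   by (rule summable_norm_cancel)
  then have "convergent (%n. \<Sum>k<n. s (Suc k) x - s k x)"
   by (simp add: summable_iff_convergent)
  then have "convergent (%n. s n x - s 0 x)"
   by (simp only: sum_lessThan_telescope[of "%k. s k x"])
  then have "convergent (%n. s n x - s 0 x + s 0 x)"
   by (intro convergent_add convergent_const)
  then show ?case by simp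
 qed
 define b where "b x = lim (%n. s n x)" for x
 have bm[measurable]: "b \<in> bmble M" unfolding b_def by measurable
 have lim: "AE x in M. (%n. s n x) \<longlonglongrightarrow> b x"
  using conv by eventually_elim (simp add: b_def convergent_LIMSEQ_iff)
 have bound: "(NN x|M. nsq (s n x - b x)) <= ennreal (4 * (1/8)^n)" for n
 proof -
  have "(NN x|M. nsq (s n x - b x)) = (NN x|M. liminf (%m. nsq (s n x - s m x)))"
  proof (rule nn_integral_cong_AE, use lim in eventually_elim, goal_cases)
   case (1 x)
   then have "(%m. nsq (s n x - s m x)) \<longlonglongrightarrow> nsq (s n x - b x)"
    by (intro tendsto_intros)
   then show ?case
    using lim_imp_Liminf[OF sequentially_bot] by metis
  qed
  also have "... <= liminf (%m. NN x|M. nsq (s n x - s m x))"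
   by (rule nn_integral_liminf) measurable
  also have "... <= ennreal (4 * (1/8)^n)"
  proof (rule Liminf_le)
   show "\<forall>\<^sub>F m in sequentially. (NN x|M. nsq (s n x - s m x)) <= ennreal (4 * (1/8)^n)"
    using eventually_ge_at_top[of n]
    by eventually_elim (auto simp: nrm2_nn_integral sqint_diff s intro!: ennreal_leI cauchy)
  qed simp
  finally show ?thesis .
 qed
 have db: "(%x. s n x - b x) \<in> sqint M" for n
  unfolding sqint_def using le_less_trans[OF bound[of n]]
  by (auto intro!: integrableI_bounded)
 have "(%x. s 0 x - (s 0 x - b x)) \<in> sqint M" by (intro sqint_diff s db)
 then have "b \<in> sqint M" by simp
 moreover have "nrm2 M (%x. s n x - b x) <= 4 * (1/8) ^ n" for n
  using bound[of n] nrm2_nn_integral[OF db[of n]] by (simp add: ennreal_le_iff)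
 ultimately show ?thesis by blast
qed

text \<open>A minimising sequence within \<open>(1/8)^n\<close> of the infimum \<open>d\<close> is
  Cauchy by the parallelogram law, since midpoints stay in \<open>S\<close>; the two errors,
  doubled, add up to at most \<open>4 * (1/8)^n\<close>. \<open>S\<close> is only a linear subspace,
  so \<open>b\<close> is a limit of elements of \<open>S\<close> and keeps none of their pointwise
  properties.\<close>

lemma sqint_projection:
 assumes S: "S \<subseteq> sqint M" "S ~= {}"
  and add: "!!f g. f \<in> S ==> g \<in> S ==> (%x. f x + g x) \<in> S"
  and scale: "!!c f. f \<in> S ==> (%x. c * f x) \<in> S"
  and v: "v \<in> sqint M"
 shows "\<exists>b\<in>sqint M. (\<forall>e>0. \<exists>s\<in>S. nrm2 M (%x. b x - s x) < e) \<and> (\<forall>s\<in>S. ip M (%x. v x - b x) s = 0)"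
proof -
 define d where "d = Inf ((%s. nrm2 M (%x. v x - s x)) ` S)"
 have bdd: "bdd_below ((%s. nrm2 M (%x. v x - s x)) ` S)"
  by (intro bdd_belowI[of _ 0]) auto
 have d_le: "d <= nrm2 M (%x. v x - s x)" if "s \<in> S" for s
  unfolding d_def using bdd that by (intro cInf_lower) auto
 have "\<exists>s\<in>S. nrm2 M (%x. v x - s x) < d + (1/8)^n" for n :: nat
  using cInf_lessD[of "(%s. nrm2 M (%x. v x - s x)) ` S" "d + (1/8)^n"] S(2) unfolding d_def by auto
 then obtain s where sS: "!!n::nat. s n \<in> S" and sn: "!!n. nrm2 M (%x. v x - s n x) < d + (1/8)^n"
  by metis
 have sq: "t \<in> sqint M" if "t \<in> S" for t using that S(1) by blast
 have cauchy: "nrm2 M (%x. s n x - s m x) <= 4 * (1/8)^n" if "n <= m" for n m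
 proof -
  have 1: "nrm2 M (%x. (v x - s m x) + (v x - s n x)) + nrm2 M (%x. (v x - s m x) - (v x - s n x))
   = 2 * nrm2 M (%x. v x - s m x) + 2 * nrm2 M (%x. v x - s n x)"
   by (intro nrm2_parallelogram sqint_diff v sq sS)
  have "(%x. (1/2) * (s m x + s n x)) \<in> S" by (intro scale[OF add] sS)
  then have "d <= nrm2 M (%x. v x - (1/2) * (s m x + s n x))" by (rule d_le)
  also have "(%x. v x - (1/2) * (s m x + s n x)) = (%x. (1/2) * ((v x - s m x) + (v x - s n x)))"
   by (rule ext) (simp add: field_simps)
  also have "nrm2 M ... = (1/4) * nrm2 M (%x. (v x - s m x) + (v x - s n x))"
   by (subst nrm2_scale) (simp add: norm_divide power2_eq_square)
  finally have 2: "4 * d <= nrm2 M (%x. (v x - s m x) + (v x - s n x))" by simp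
  have "(1/8::real)^m <= (1/8)^n" using that by (intro power_decreasing) auto
  moreover have "(%x. (v x - s m x) - (v x - s n x)) = (%x. s n x - s m x)" by auto
  ultimately show ?thesis using 1 2 sn[of n] sn[of m] by (simp only:)
 qed
 obtain b where b: "b \<in> sqint M" and bn: "!!n. nrm2 M (%x. s n x - b x) <= 4 * (1/8) ^ n"
  using sqint_complete[of s M, OF sq[OF sS] cauchy] by blast
 have lim8: "(%n. C * (1/8::real)^n) \<longlonglongrightarrow> 0" for C
  by (intro tendsto_mult_right_zero LIMSEQ_power_zero) auto
 have 1: "\<exists>s\<in>S. nrm2 M (%x. b x - s x) < e" if "e > 0" for e
 proof -
  have "\<forall>\<^sub>F n in sequentially. 4 * (1/8::real)^n < e" using order_tendstoD(2)[OF lim8 that] .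
  then obtain n where "4 * (1/8::real)^n < e" by (auto simp: eventually_sequentially)
  then show ?thesis using bn[of n] sS[of n] nrm2_swap[of M b "s n"] by (intro bexI[of _ "s n"]) auto
 qed
 have 2: "ip M (%x. v x - b x) t = 0" if t: "t \<in> S" for t
 proof -
  define N where "N = nrm2 M t"
  have N0: "N >= 0" unfolding N_def by simp
  define p where "p n = ip M (%x. v x - s n x) t" for n
  have pn: "(norm (p n))^2 <= (N + 1) * (1/8)^n" for n
  proof -
   \<comment> \<open>The optimal step is \<open>p n / N\<close>; the denominator
     \<open>N + 1\<close> also serves when \<open>t\<close> is null, and costs only a
     constant.\<close>
   define c where "c = of_real (1 / (N+1)) * p n"
   have "(%x. s n x + c * t x) \<in> S" by (intro add scale sS t)
   then have "d <= nrm2 M (%x. v x - (s n x + c * t x))" by (rule d_le)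
   also have "(%x. v x - (s n x + c * t x)) = (%x. (v x - s n x) - c * t x)" by (simp add: algebra_simps)
   also have "nrm2 M ... = nrm2 M (%x. v x - s n x) - 2 * Re (cnj c * p n) + (norm c)^2 * N"
    by (subst nrm2_diff[OF sqint_diff[OF v sq[OF sS]] sqint_scale[OF sq[OF t]]]) (auto simp: ip_scale_right nrm2_scale p_def N_def)
   also have "cnj c * p n = of_real ((norm (p n))^2 / (N+1))"
    unfolding c_def by (simp add: mult_cnj_norm mult.commute)
   finally have *: "2 * ((norm (p n))^2 / (N+1)) <= (1/8)^n + (norm c)^2 * N"
    using sn[of n] by (simp del: of_real_divide)
   have "(norm c)^2 * N = (norm (p n))^2 / (N+1) * (N / (N+1))"
    unfolding c_def using N0 by (simp add: norm_mult norm_divide power_divide power2_eq_square)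
   also have "... <= (norm (p n))^2 / (N+1) * 1"
    using N0 by (intro mult_left_mono) auto
   finally have "(norm (p n))^2 / (N+1) <= (1/8)^n" using * by simp
   then show ?thesis using N0 by (simp add: field_simps)
  qed
  have diff: "(norm (p n - ip M (%x. v x - b x) t))^2 <= 4 * N * (1/8)^n" for n
  proof -
   have "p n - ip M (%x. v x - b x) t = ip M (%x. (v x - s n x) - (v x - b x)) t"
    unfolding p_def by (rule ip_diff_left[symmetric]) (rule sqint_diff[OF v sq[OF sS]] sqint_diff[OF v b] sq[OF t])+
   also have "... = ip M (%x. b x - s n x) t" by simp
   also have "(norm ...)^2 <= nrm2 M (%x. b x - s n x) * N"
    unfolding N_def by (intro cauchy_schwarz sqint_diff sq sS t b)
   also have "... <= 4 * (1/8)^n * N" using bn[of n] N0 nrm2_swap[of M b "s n"] by (intro mult_right_mono) auto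
   finally show ?thesis by (simp add: mult_ac)
  qed
  have "(norm (ip M (%x. v x - b x) t))^2 <= (2 * (N+1) + 8 * N) * (1/8)^n" for n
  proof -
   have "(norm (ip M (%x. v x - b x) t))^2 = (norm (p n + (ip M (%x. v x - b x) t - p n)))^2" by simp
   also have "... <= 2 * (norm (p n))^2 + 2 * (norm (ip M (%x. v x - b x) t - p n))^2" by (rule norm_add_sq_le)
   also have "... <= (2 * (N+1) + 8 * N) * (1/8)^n"
    using pn[of n] diff[of n] by (simp add: norm_minus_commute algebra_simps)
   finally show ?thesis .
  qed
  then have "(norm (ip M (%x. v x - b x) t))^2 <= 0"
   using lim8[of "2 * (N+1) + 8 * N"] by (intro LIMSEQ_le_const[OF lim8]) auto
  then show ?thesis by simp
 qed
 show ?thesis using b 1 2 by blast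
qed

section \<open>Uniqueness of Fourier coefficients\<close>

lemma e_fun_0[simp]: "e_fun 0 = 1" by (simp add: e_fun_def)
lemma e_fun_add: "e_fun (x + y) = e_fun x * e_fun y"
 by (simp add: e_fun_def algebra_simps flip: exp_add)
lemma e_fun_minus: "e_fun (- x) = cnj (e_fun x)"
 by (simp add: e_fun_def exp_cnj)
lemma norm_e_fun[simp]: "norm (e_fun x) = 1"
 using norm_exp_i_times[of "2 * pi * x"] by (simp add: e_fun_def mult_ac)
lemma e_fun_int[simp]: "e_fun (of_int n) = 1"
 unfolding e_fun_def using exp_integer_2pi[of "of_int n"] by (simp add: mult_ac)
lemma e_fun_add_int: "n \<in> \<int> ==> e_fun (x + n) = e_fun x"
 by (auto simp: e_fun_add elim!: Ints_cases)
lemma continuous_e_fun: "continuous_on UNIV e_fun"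
 unfolding e_fun_def by (intro continuous_intros)
lemma measurable_e_fun[measurable]: "e_fun \<in> bmble borel"
 by (intro bmble_cont continuous_e_fun)
lemma e_fun_nonzero[simp]: "e_fun x ~= 0" using norm_e_fun[of x] by (metis norm_zero zero_neq_one)
lemma e_fun_powi: "e_fun x powi k = e_fun (of_int k * x)"
 unfolding e_fun_def by (subst exp_power_int) (simp add: mult_ac)
lemma e_fun_eq_iff: "e_fun x = e_fun y \<longleftrightarrow> x - y \<in> \<int>"
proof
 assume "e_fun x = e_fun y"
 then obtain n :: int where "2 * cor pi * \<i> * cor x = 2 * cor pi * \<i> * cor y + of_int (2 * n) * cor pi * \<i>"
  unfolding e_fun_def by (auto simp: exp_eq)
 then have "cor pi * \<i> * cor (2 * (x - y - of_int n)) = 0"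
  by (simp add: algebra_simps)
 then have "cor (2 * (x - y - of_int n)) = 0" by (simp del: of_real_mult of_real_diff)
 then have "x - y = of_int n" by (simp only: of_real_eq_0_iff) simp
 then show "x - y \<in> \<int>" by simp
next
 assume "x - y \<in> \<int>"
 then show "e_fun x = e_fun y" using e_fun_add_int[of "x - y" y] by simp
qed

lemma indicator_scaleR_complex: "ind A x *\<^sub>R z = z * (ind A x :: complex)"
 by (simp add: indicator_def)

text \<open>All moments of the complex measure \<open>G dM\<close>, transported to the unit circle
  by \<open>Z\<close>, vanish. \<open>M\<close> and \<open>Z\<close> are kept general because the
  circle is reached from the interval as well as from the real line.\<close>

definition mom0 :: "'a measure => ('a => complex) => ('a => complex) => bool" where
 "mom0 M Z G \<longleftrightarrow> integrable M G \<and> (\<forall>k::int. (LINT x|M. G x * Z x powi k) = 0)"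

context
 fixes M :: "'a measure" and Z :: "'a => complex"
 assumes Z[measurable]: "Z \<in> bmble M" and Z1: "!!x. x \<in> space M ==> norm (Z x) = 1"
begin

lemma measurable_powi[measurable]: "(%x. Z x powi k) \<in> bmble M"
 unfolding power_int_def by measurable

lemma integrable_mult_powi:
 assumes "integrable M G"
 shows "integrable M (%x. G x * Z x powi k)"
proof -
 have [measurable]: "G \<in> bmble M" using assms by simp
 show ?thesis
  by (rule intble_bound[OF assms])
   (auto intro!: AE_I2 borel_measurable_times measurable_powi simp: norm_mult norm_power_int Z1)
qed

lemma mom0_add: "mom0 M Z G ==> mom0 M Z H ==> mom0 M Z (%x. G x + H x)"
 unfolding mom0_def by (auto simp: distrib_right integrable_mult_powi)

lemma mom0_scale: "mom0 M Z G ==> mom0 M Z (%x. c * G x)"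
 unfolding mom0_def by (auto simp: mult.assoc)

lemma mom0_shift:
 assumes "mom0 M Z G"
 shows "mom0 M Z (%x. G x * Z x powi j)"
proof -
 have "(LINT x|M. G x * Z x powi j * Z x powi k) = (LINT x|M. G x * Z x powi (j + k))" for k
 proof (rule lint_cong[OF refl], goal_cases)
  case (1 x)
  then have "Z x ~= 0" using Z1[of x] by auto
  then show ?case
   by (simp add: power_int_add mult.assoc)
 qed
 then show ?thesis using assms unfolding mom0_def by (auto simp: integrable_mult_powi)
qed

lemma mom0_cong: "(!!x. x \<in> space M ==> G x = H x) ==> mom0 M Z G ==> mom0 M Z H"
 unfolding mom0_def
 by (simp cong: lint_cong Bochner_Integration.integrable_cong)

lemma mom0_polynomial:
 assumes "real_polynomial_function P" "mom0 M Z G"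
 shows "mom0 M Z (%x. G x * cor (P (Z x)))"
 using assms
proof (induction arbitrary: G rule: real_polynomial_function.induct)
 case (linear f)
 \<comment> \<open>On the unit circle the inverse of \<open>Z x\<close> is its conjugate, so the two
   brackets are twice the real part and \<open>2 * \<i>\<close> times the imaginary part of
   \<open>Z x\<close>, each times \<open>G x\<close>; a real-linear \<open>f\<close> is
   \<open>f 1\<close> times the one plus \<open>f \<i>\<close> times the other.\<close>
 have "mom0 M Z (%x. of_real (f 1) / 2 * (G x * Z x powi 1 + G x * Z x powi (-1)) +
  (- \<i> / 2 * of_real (f \<i>)) * (G x * Z x powi 1 + (-1) * (G x * Z x powi (-1))))"
  by (intro mom0_add mom0_scale mom0_shift linear)
 then show ?case
 proof (rule mom0_cong[rotated])
  fix x assume "x \<in> space M"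
  then have n: "norm (Z x) = 1" by (rule Z1)
  have inv: "inverse (Z x) = cnj (Z x)"
   using n complex_norm_square[of "Z x"] by (intro inverse_unique) simp
  have "f (Z x) = f (Re (Z x) *\<^sub>R 1 + Im (Z x) *\<^sub>R \<i>)"
   by (rule arg_cong[of _ _ f]) (simp add: complex_eq_iff)
  also have "... = Re (Z x) * f 1 + Im (Z x) * f \<i>"
   using linear(1) by (simp add: linear_simps bounded_linear.linear linear_add linear_scale)
  finally have f: "f (Z x) = Re (Z x) * f 1 + Im (Z x) * f \<i>" .
  show "of_real (f 1) / 2 * (G x * Z x powi 1 + G x * Z x powi (-1)) +
  (- \<i> / 2 * of_real (f \<i>)) * (G x * Z x powi 1 + (-1) * (G x * Z x powi (-1))) = G x * cor (f (Z x))"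
   unfolding f power_int_minus power_int_1_right inv
   by (simp add: complex_eq_iff) (simp add: field_simps)
 qed
next
 case (const c)
 then show ?case using mom0_scale[of G "of_real c"] by (simp add: mult.commute)
next
 case (add f g)
 then show ?case using mom0_add[OF add(3,4)[OF add(5)]] by (simp add: algebra_simps)
next
 case (mult f g)
 then show ?case using mult(4)[OF mult(3)[OF mult(5)]] by (simp add: mult.assoc)
qed

text \<open>The indicator of a closed set is the limit of the tent functions \<open>g n\<close>;
  Stone--Weierstrass replaces each by a polynomial up to \<open>1 / Suc n\<close> on the circle, and
  polynomials on the circle are combinations of the moments.\<close>

lemma mom0_closed:
 assumes "mom0 M Z G" "closed A"
 shows "(LINT x|M. G x * ind A (Z x)) = 0"
proof (cases "A = {}")
 case False
 have [measurable]: "A \<in> sets borel" using assms by simp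
 have G[measurable]: "integrable M G" using assms by (simp add: mom0_def)
 define g where "g n z = max 0 (1 - real n * infdist z A)" for n z
 have cont: "continuous_on (sphere 0 1) (g n)" for n
  unfolding g_def by (intro continuous_intros)
 have "\<exists>P. real_polynomial_function P \<and> (\<forall>x\<in>sphere 0 1. \<bar>g n x - P x\<bar> < 1 / Suc n)" for n
  using Stone_Weierstrass_real_polynomial_function[OF _ cont, of "1 / Suc n" n] by (metis compact_sphere of_nat_0_less_iff zero_less_Suc zero_less_divide_1_iff)
 then obtain P where P: "!!n. real_polynomial_function (P n)" and Pg: "!!n x. x \<in> sphere 0 1 ==> \<bar>g n x - P n x\<bar> < 1 / Suc n"
  by metis
 have Pm[measurable]: "P n \<in> bmble borel" for n
  using continuous_real_polymonial_function[OF P[of n]]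
  by (intro bmble_cont continuous_at_imp_continuous_on) auto
 have g01: "0 <= g n z" "g n z <= 1" for n z
  unfolding g_def by (auto simp: infdist_nonneg)
 have "(%n. LINT x|M. G x * cor (P n (Z x))) \<longlonglongrightarrow> (LINT x|M. G x * ind A (Z x))"
 proof (rule integral_dominated_convergence[where w="%x. 2 * norm (G x)"])
  show "AE x in M. (%n. G x * cor (P n (Z x))) \<longlonglongrightarrow> G x * ind A (Z x)"
  proof (rule AE_I2, goal_cases)
   case x: (1 x)
   have g: "(%n. g n (Z x)) \<longlonglongrightarrow> ind A (Z x)"
   proof (cases "Z x \<in> A")
    case True then show ?thesis by (simp add: g_def)
   next
    case n: False
    then have "infdist (Z x) A > 0"
     using assms(2) False by (simp add: infdist_pos_not_in_closed)
    then obtain N where N: "real N * infdist (Z x) A > 1" using reals_Archimedean3 by blast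
    have "g n (Z x) = 0" if "n >= N" for n
    proof -
     have "real N * infdist (Z x) A <= real n * infdist (Z x) A"
      using that by (intro mult_right_mono) (auto simp: infdist_nonneg)
     then show ?thesis using N by (simp add: g_def)
    qed
    then show ?thesis using n by (intro tendsto_eventually) (auto simp: eventually_sequentially)
   qed
   have "(%n. g n (Z x) - P n (Z x)) \<longlonglongrightarrow> 0"
   proof (rule Lim_null_comparison)
    show "\<forall>\<^sub>F n in sequentially. norm (g n (Z x) - P n (Z x)) <= 1 / Suc n"
     using Pg[of "Z x"] Z1[OF x] by (auto intro!: always_eventually less_imp_le)
    show "(%n. 1 / real (Suc n)) \<longlonglongrightarrow> 0" using LIMSEQ_inverse_real_of_nat by (simp add: inverse_eq_divide)
   qed
   from tendsto_diff[OF g this] have "(%n. P n (Z x)) \<longlonglongrightarrow> ind A (Z x)" by simp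
   then have "(%n. G x * cor (P n (Z x))) \<longlonglongrightarrow> G x * cor (ind A (Z x))"
    by (intro tendsto_intros)
   then show ?case
    by (cases "Z x \<in> A") simp_all
  qed
  show "AE x in M. norm (G x * cor (P n (Z x))) <= 2 * norm (G x)" for n
  proof (rule AE_I2, goal_cases)
   case x: (1 x)
   have "\<bar>P n (Z x)\<bar> <= \<bar>g n (Z x)\<bar> + 1 / Suc n" using Pg[of "Z x" n] Z1[OF x] by simp
   also have "... <= 1 + 1" using g01[of n "Z x"] by (intro add_mono) auto
   finally show ?case
    using mult_right_mono[of "\<bar>P n (Z x)\<bar>" 2 "norm (G x)"] by (simp add: norm_mult mult.commute)
  qed
 qed (use G in auto)
 moreover have "(LINT x|M. G x * cor (P n (Z x))) = 0" for n
  using mom0_polynomial[OF P[of n] assms(1)] unfolding mom0_def by (elim conjE allE[of _ 0]) simp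
 ultimately show ?thesis by (simp add: LIMSEQ_const_iff)
qed simp

end

text \<open>The set of \<open>A\<close> for which the integral of \<open>G\<close> over the preimage vanishes is a Dynkin system.\<close>

lemma integral_indicator_dynkin:
 fixes G :: "'a => complex"
 assumes G: "integrable M G" and T[measurable]: "T \<in> measurable M N"
  and N: "sets N = sigma_sets (space N) E" "Int_stable E" "E \<subseteq> Pow (space N)"
  and E: "!!A. A \<in> E ==> (LINT x|M. G x * ind A (T x)) = 0" and tot: "(LINT x|M. G x) = 0"
  and A: "A \<in> sets N"
 shows "(LINT x|M. G x * ind A (T x)) = 0"
 using A unfolding N(1)
proof (induction rule: sigma_sets_induct_disjoint[OF N(2,3), consumes 1, case_names basic empty compl union])
 case (basic A) then show ?case by (rule E)
next
 case empty then show ?case by simp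
next
 case (compl A)
 then have [measurable]: "A \<in> sets N" using N(1) by simp
 have "(LINT x|M. G x * ind (space N - A) (T x)) = (LINT x|M. G x - G x * ind A (T x))"
  using measurable_space[OF T] by (intro lint_cong) (auto simp: indicator_def)
 also have "... = 0"
  using compl tot G by (subst Bochner_Integration.integral_diff)
   (auto intro!: intble_bound[OF G] AE_I2 simp: indicator_def)
 finally show ?case .
next
 case (union A)
 then have [measurable]: "A i \<in> sets N" for i using N(1) by auto
 have Gm[measurable]: "G \<in> bmble M" using G by simp
 have "(%n. LINT x|M. G x * ind (\<Union>i<n. A i) (T x)) \<longlonglongrightarrow> (LINT x|M. G x * ind (\<Union>i. A i) (T x))"
 proof (rule integral_dominated_convergence[where w="%x. norm (G x)"])
  show "AE x in M. (%n. G x * ind (\<Union>i<n. A i) (T x)) \<longlonglongrightarrow> G x * ind (\<Union>i. A i) (T x)"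
   by (intro AE_I2 tendsto_mult tendsto_const LIMSEQ_indicator_UN)
 qed (use G in \<open>auto simp: indicator_def\<close>)
 moreover have "(LINT x|M. G x * ind (\<Union>i<n. A i) (T x)) = 0" for n
 proof -
  have "ind (\<Union>i<n. A i) y = (\<Sum>i<n. ind (A i) y :: complex)" for y
   using union(1) by (intro indicator_UN_disjoint) (auto simp: disjoint_family_on_def)
  then have "(LINT x|M. G x * ind (\<Union>i<n. A i) (T x)) = (LINT x|M. (\<Sum>i<n. G x * ind (A i) (T x)))"
   by (simp add: sum_distrib_left)
  also have "... = (\<Sum>i<n. LINT x|M. G x * ind (A i) (T x))"
   by (intro Bochner_Integration.integral_sum) (auto intro!: intble_bound[OF G] AE_I2 simp: indicator_def)
  finally show ?thesis using union(3) by simp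
 qed
 ultimately show ?case by (simp add: LIMSEQ_const_iff)
qed

lemma Icc_generate_borel: "sets (borel :: real measure) = sigma_sets UNIV (range (%(a,b). {a..b}))"
proof -
 have "(borel :: real measure) = sigma UNIV (range (%(a,b). {a..b}))"
  by (rule borel_eq_atLeastAtMost)
 then show ?thesis by (metis Pow_UNIV sets_measure_of top_greatest)
qed

lemma Int_stable_Icc: "Int_stable (range (%(a,b). {a..b::real}))"
 by (auto simp: Int_stable_def image_iff split: prod.splits)

lemma fourier_uniqueness_unit_interval:
 fixes f :: "real => complex"
 assumes f: "set_integrable lborel {0..1} f" and 0: "!!k::int. (LINT x:{0..1}|lborel. f x * e_fun (of_int k * x)) = 0"
 shows "AE x in lborel. x \<in> {0..1} \<longrightarrow> f x = 0"
proof -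
 \<comment> \<open>On the half-open interval \<open>e_fun\<close> is injective, so membership in an
   interval can be read off on the circle.\<close>
 define U where "U = restrict_space lborel {0..<1::real}"
 have intU: "integrable U f"
 proof -
  have "set_integrable lborel {0..<1} f" by (rule set_integrable_subset[OF f]) auto
  then show ?thesis unfolding U_def set_integrable_def by (subst integrable_restrict_space) auto
 qed
 have momU: "(LINT x|U. f x * e_fun x powi k) = 0" for k :: int
 proof -
  have "(LINT x|U. f x * e_fun x powi k) = (LINT x:{0..<1}|lborel. f x * e_fun (of_int k * x))"
   unfolding U_def set_lebesgue_integral_def by (subst integral_restrict_space) (auto simp: e_fun_powi)
  also have "... = (LINT x:{0..1}|lborel. f x * e_fun (of_int k * x))"
  proof (rule set_integral_cong_set)
   have si: "set_integrable lborel {0..1} (%x. f x * e_fun (of_int k * x))"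
    unfolding set_integrable_def
   proof (rule intble_bound[OF f[unfolded set_integrable_def]])
    have "(%x. ind {0..1} x *\<^sub>R f x) \<in> bmble lborel" using f by (simp add: set_integrable_def)
    then have "(%x. (ind {0..1} x *\<^sub>R f x) * e_fun (of_int k * x)) \<in> bmble lborel"
     by (rule borel_measurable_times) measurable
    then show "(%x. ind {0..1} x *\<^sub>R (f x * e_fun (of_int k * x))) \<in> bmble lborel"
     by (simp only: mult_scaleR_left)
   qed (auto simp: norm_mult)
   have "set_integrable lborel {0..<1} (%x. f x * e_fun (of_int k * x))"
    by (rule set_integrable_subset[OF si]) auto
   with si show "set_borel_measurable lborel {0..<1} (%x. f x * e_fun (of_int k * x))" "set_borel_measurable lborel {0..1} (%x. f x * e_fun (of_int k * x))"
    unfolding set_borel_measurable_def set_integrable_def by (auto dest: borel_measurable_integrable)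
   show "AE x in lborel. (x \<in> {0..1::real}) = (x \<in> {0..<1})"
    using AE_lborel_singleton[of 1] by eventually_elim auto
  qed
  finally show ?thesis using 0 by simp
 qed
 have em: "e_fun \<in> bmble U" unfolding U_def by (intro measurable_restrict_space1) simp
 have mom: "mom0 U e_fun f" unfolding mom0_def using intU momU by auto
 have sp: "space U = {0..<1}" by (simp add: U_def space_restrict_space)
 have sb: "sigma_finite_measure U"
  unfolding U_def by (rule sigma_finite_measure_restrict_space) (auto intro: sigma_finite_lborel)
 have id: "(%x. x) \<in> measurable U borel" unfolding U_def by (intro measurable_restrict_space1) simp
 have Icc: "(LINT x|U. f x * ind {a..b} x) = 0" for a b
 proof -
  \<comment> \<open>An interval away from 1 has a closed image on the circle whose preimage is that
    interval. Intervals that reach 1 are exhausted afterwards.\<close>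
  have one: "(LINT x|U. f x * ind {a..b} x) = 0" if ab: "0 <= a" "b < 1" for a b
  proof -
   have cl: "closed (e_fun ` {a..b})"
    by (intro compact_imp_closed compact_continuous_image continuous_on_subset[OF continuous_e_fun]) auto
   have "(LINT x|U. f x * ind {a..b} x) = (LINT x|U. f x * ind (e_fun ` {a..b}) (e_fun x))"
   proof (rule lint_cong[OF refl], goal_cases)
    case (1 x)
    then have x: "0 <= x" "x < 1" by (auto simp: sp)
    have "e_fun x \<in> e_fun ` {a..b} \<longleftrightarrow> x \<in> {a..b}"
    proof
     assume "e_fun x \<in> e_fun ` {a..b}"
     then obtain t where t: "t \<in> {a..b}" "x - t \<in> \<int>" by (auto simp: e_fun_eq_iff)
     then obtain z :: int where z: "x - t = of_int z" by (auto elim!: Ints_cases)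
     have "\<bar>x - t\<bar> < 1" using x ab t by auto
     then have "z = 0" unfolding z by linarith
     then have "x = t" using z by simp
     then show "x \<in> {a..b}" using t by simp
    qed auto
    then show ?case by (simp add: indicator_def)
   qed
   also have "... = 0" by (rule mom0_closed[OF em _ mom cl]) simp
   finally show ?thesis .
  qed
  have "(%n. LINT x|U. f x * ind {max 0 a..min b (1 - 1 / Suc n)} x) \<longlonglongrightarrow> (LINT x|U. f x * ind {a..b} x)"
  proof (rule integral_dominated_convergence[where w="%x. norm (f x)"])
   show "AE x in U. (%n. f x * ind {max 0 a..min b (1 - 1 / Suc n)} x) \<longlonglongrightarrow> f x * ind {a..b} x"
   proof (rule AE_I2, goal_cases)
    case (1 x)
    then have x: "0 <= x" "x < 1" by (auto simp: sp)
    obtain N where N: "1 / real (Suc N) < 1 - x" using x by (metis diff_gt_0_iff_gt inverse_eq_divide reals_Archimedean)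
    have "ind {max 0 a..min b (1 - 1 / Suc n)} x = (ind {a..b} x :: complex)" if "n >= N" for n
    proof -
     have "1 / real (Suc n) <= 1 / real (Suc N)" using that by (intro divide_left_mono) auto
     then show ?thesis using N x by (auto simp: indicator_def)
    qed
    then show ?case
     by (intro tendsto_eventually) (auto simp: eventually_sequentially)
   qed
  qed (use intU id in \<open>auto simp: indicator_def intro!: borel_measurable_times measurable_If\<close>)
  moreover have "(LINT x|U. f x * ind {max 0 a..min b (1 - 1 / Suc n)} x) = 0" for n
  proof (rule one)
   have "1 / real (Suc n) > 0" by simp
   then show "min b (1 - 1 / Suc n) < 1" by (simp add: min_less_iff_disj)
  qed simp
  ultimately show ?thesis by (simp add: LIMSEQ_const_iff)
 qed
 have tot: "(LINT x|U. f x) = 0" using momU[of 0] by simp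
 have all: "(LINT x|U. f x * ind A x) = 0" if "A \<in> sets borel" for A
  by (rule integral_indicator_dynkin[OF intU id _ Int_stable_Icc _ _ tot that])
   (auto simp: Icc_generate_borel intro: Icc)
 have "AE x in U. f x = 0"
 proof (rule sigma_finite_measure.density_zero[OF sb intU], goal_cases)
  case A: (1 A)
  then have "A \<in> sets borel" unfolding U_def by (auto simp: sets_restrict_space)
  from all[OF this] show ?case
   by (simp add: set_lebesgue_integral_def indicator_scaleR_complex)
 qed
 then have "AE x in lborel. x \<in> {0..<1} \<longrightarrow> f x = 0"
  unfolding U_def by (subst (asm) AE_restrict_space_iff) auto
 then show ?thesis using AE_lborel_singleton[of 1] by eventually_elim auto
qed

definition I01 :: "real measure" where "I01 = density lborel (ind {0..1})"

lemma sets_I01[measurable_cong, simp]: "sets I01 = sets borel" and space_I01[simp]: "space I01 = UNIV"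
 by (auto simp: I01_def)

lemma emeasure_I01: "A \<in> sets borel ==> emeasure I01 A = emeasure lborel ({0..1} \<inter> A)"
 unfolding I01_def by (subst emeasure_density) (auto simp: indicator_inter_arith[symmetric] mult.commute Int_commute nn_integral_indicator[symmetric] simp del: nn_integral_indicator)

lemma emeasure_I01_UNIV[simp]: "emeasure I01 UNIV = 1"
 by (simp add: emeasure_I01)

lemma finite_I01: "finite_measure I01"
 by (rule finite_measureI) simp

lemma sigma_finite_I01: "sigma_finite_measure I01"
 using finite_I01 by (simp add: finite_measure_def)

lemma I01_density_real: "I01 = density lborel (%x. ennreal (ind {0..1} x))"
 unfolding I01_def by (simp add: ennreal_indicator)

lemma integral_I01:
 fixes f :: "real => complex"
 shows "f \<in> bmble borel ==> (LINT x|I01. f x) = (LINT x:{0..1}|lborel. f x)"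
 unfolding I01_density_real set_lebesgue_integral_def by (subst integral_density) auto

lemma integrable_I01:
 fixes f :: "real => complex"
 shows "f \<in> bmble borel ==> integrable I01 f \<longleftrightarrow> set_integrable lborel {0..1} f"
 unfolding I01_density_real set_integrable_def by (subst integrable_density) auto

lemma AE_I01: "(AE x in I01. P x) \<longleftrightarrow> (AE x in lborel. x \<in> {0..1} \<longrightarrow> P x)"
 unfolding I01_def by (subst AE_density) (auto simp: indicator_def)

lemma fourier_uniqueness_I01:
 assumes f: "integrable I01 f" and 0: "!!k::int. (LINT x|I01. f x * e_fun (of_int k * x)) = 0"
 shows "AE x in I01. f x = 0"
proof -
 have [measurable]: "f \<in> bmble borel" using borel_measurable_integrable[OF f] by simp
 show ?thesis unfolding AE_I01
  by (rule fourier_uniqueness_unit_interval) (use f 0 in \<open>auto simp: integrable_I01 integral_I01\<close>)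
qed

text \<open>The line is wrapped around circles of length \<open>Suc n\<close>. For a fixed point and
  a fixed interval the wrapping is harmless once \<open>n\<close> is large: two points at distance
  less than \<open>Suc n\<close> with the same image are equal. Hence the circle case gives
  intervals in the limit.\<close>

lemma mom0_real_line:
 fixes G :: "'a => complex" and T :: "'a => real"
 assumes G: "integrable M G" and T[measurable]: "T \<in> bmble M"
  and 0: "!!s. (LINT x|M. G x * e_fun (s * T x)) = 0" and A: "A \<in> sets borel"
 shows "(LINT x|M. G x * ind A (T x)) = 0"
proof (rule integral_indicator_dynkin[OF G T _ Int_stable_Icc _ _ _ A])
 show "(LINT x|M. G x) = 0" using 0[of 0] by simp
 have [measurable]: "G \<in> bmble M" using G by simp
 fix A assume "A \<in> range (%(a,b). {a..b::real})"
 then obtain a b where A: "A = {a..b}" by auto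
 define B where "B n = (%t. e_fun (t / real (Suc n))) ` {a..b}" for n
 have cl: "closed (B n)" for n
  unfolding B_def by (intro compact_imp_closed compact_continuous_image continuous_on_compose2[OF continuous_e_fun] continuous_intros) auto
 then have [measurable]: "B n \<in> sets borel" for n by simp
 have "(%n. LINT x|M. G x * ind (B n) (e_fun (T x / Suc n))) \<longlonglongrightarrow> (LINT x|M. G x * ind A (T x))"
 proof (rule integral_dominated_convergence[where w="%x. norm (G x)"])
  show "AE x in M. (%n. G x * ind (B n) (e_fun (T x / Suc n))) \<longlonglongrightarrow> G x * ind A (T x)"
  proof (rule AE_I2, goal_cases)
   case (1 x)
   obtain N where N: "real N > \<bar>T x\<bar> + \<bar>a\<bar> + \<bar>b\<bar>" using reals_Archimedean2 by blast
   have "ind (B n) (e_fun (T x / Suc n)) = (ind A (T x) :: complex)" if n: "n >= N" for n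
   proof -
    have "e_fun (T x / Suc n) \<in> B n \<longleftrightarrow> T x \<in> {a..b}"
    proof
     assume "e_fun (T x / Suc n) \<in> B n"
     then obtain t where t: "t \<in> {a..b}" "T x / Suc n - t / Suc n \<in> \<int>" by (auto simp: e_fun_eq_iff B_def)
     then obtain k :: int where "(T x - t) / Suc n = of_int k" by (auto elim!: Ints_cases simp: diff_divide_distrib)
     then have k: "T x - t = of_int k * real (Suc n)" by (simp add: field_simps)
     have "\<bar>T x - t\<bar> < real (Suc n)" using t N n by auto
     then have "\<bar>roi k\<bar> * real (Suc n) < 1 * real (Suc n)" unfolding k by (simp add: abs_mult)
     then have "\<bar>roi k\<bar> < 1" by (subst (asm) mult_less_cancel_right_pos) auto
     then have "k = 0" by linarith
     then show "T x \<in> {a..b}" using t k by simp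
    qed (auto simp: B_def)
    then show ?thesis by (simp add: indicator_def A)
   qed
   then show ?case
    by (intro tendsto_eventually) (auto simp: eventually_sequentially)
  qed
 qed (use G in \<open>auto simp: indicator_def A\<close>)
 moreover have "(LINT x|M. G x * ind (B n) (e_fun (T x / Suc n))) = 0" for n
 proof (rule mom0_closed[OF _ _ _ cl])
  show "mom0 M (%x. e_fun (T x / Suc n)) G"
   unfolding mom0_def using G 0 by (auto simp: e_fun_powi intro: 0[of "_ / Suc n", simplified])
 qed auto
 ultimately show "(LINT x|M. G x * ind A (T x)) = 0" by (simp add: LIMSEQ_const_iff)
qed (auto simp: Icc_generate_borel)

text \<open>The measure is general because the lemma is applied to \<open>lam\<close>, for which no
  density is at hand. The two coordinates are treated one after the other, the first indicator being
  absorbed into \<open>G\<close> before the second.\<close>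

lemma fourier_uniqueness_plane:
 fixes G :: "R2 => complex"
 assumes sf: "sigma_finite_measure M" and M: "sets M = sets borel" and G: "integrable M G"
  and 0: "!!s t. (LINT x|M. G x * e_fun (s * fst x + t * snd x)) = 0"
 shows "AE x in M. G x = 0"
proof -
 have [measurable_cong]: "sets M = sets borel" by fact
 have [measurable]: "G \<in> bmble M" using G by simp
 have f[measurable]: "fst \<in> bmble M" "snd \<in> bmble M"
  by (auto intro!: bmble_cont continuous_intros simp: m_cong[OF M refl])
 have int1: "integrable M (%x. G x * e_fun (h x))" if [measurable]: "h \<in> bmble M" for h
  by (rule intble_bound[OF G]) (auto simp: norm_mult)
 have 1: "(LINT x|M. G x * e_fun (t * snd x) * ind A (fst x)) = 0" if "A \<in> sets borel" for A t
 proof (rule mom0_real_line[OF int1 f(1) _ that])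
  fix s show "(LINT x|M. G x * e_fun (t * snd x) * e_fun (s * fst x)) = 0"
   using 0[of s t] by (simp add: e_fun_add mult_ac)
 qed measurable
 have 2: "(LINT x|M. G x * ind A (fst x) * ind B (snd x)) = 0" if [measurable]: "A \<in> sets borel" "B \<in> sets borel" for A B
 proof (rule mom0_real_line[OF _ f(2) _ that(2)])
  show "integrable M (%x. G x * ind A (fst x))"
   by (rule intble_bound[OF G]) (auto simp: norm_mult indicator_def)
  fix t show "(LINT x|M. G x * ind A (fst x) * e_fun (t * snd x)) = 0"
   using 1[OF that(1), of t] by (simp add: mult_ac)
 qed
 have id: "(%x. x) \<in> measurable M (borel \<otimes> borel)" by (simp add: borel_prod m_cong[OF M refl])
 have all: "(LINT x|M. G x * ind A x) = 0" if "A \<in> sets M" for A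
 proof (rule integral_indicator_dynkin[OF G id, where E="{a \<times> b | a b. a \<in> sets borel \<and> b \<in> sets borel}"])
  show "A \<in> sets (borel \<otimes> borel)" using that M by (simp only: borel_prod)
  show "(LINT x|M. G x) = 0" using 0[of 0 0] by simp
  show "Int_stable {a \<times> b |a b. a \<in> sets (borel::real measure) \<and> b \<in> sets (borel::real measure)}" by (rule Int_stable_pair_measure_generator)
  fix C :: "(R2) set" assume "C \<in> {a \<times> b |a b. a \<in> sets borel \<and> b \<in> sets borel}"
  then obtain a b where C: "C = a \<times> b" "a \<in> sets borel" "b \<in> sets borel" by auto
  then show "(LINT x|M. G x * ind C x) = 0" using 2[OF C(2,3)] by (simp add: indicator_times mult_ac)
 qed (auto simp: sets_pair_measure space_pair_measure)
 show ?thesis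
 proof (rule sigma_finite_measure.density_zero[OF sf G], goal_cases)
  case A: (1 A)
  from all[OF this] show ?case
   by (simp add: set_lebesgue_integral_def indicator_scaleR_complex)
 qed
qed

section \<open>Smooth functions of compact support in the plane\<close>

definition dd :: "real^2 => (real^2 => complex) => real^2 => complex" where
 "dd v f x = frechet_derivative f (at x) v"

definition supp_le :: "real => (real^2 => complex) => bool" where
 "supp_le R f \<longleftrightarrow> (\<forall>x. norm x > R \<longrightarrow> f x = 0)"

lemma Ck_dd: "Ck (Suc k) f ==> Ck k (dd v f)"
 unfolding dd_def by simp

lemma Ck_has_derivative: "Ck (Suc k) f ==> (f has_derivative (%v. dd v f x)) (at x)"
 unfolding dd_def by (simp add: frechet_derivative_works[symmetric] eta_contract_eq)

lemma Ck_continuous: "Ck k f ==> continuous_on UNIV f"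
 by (cases k) (auto intro!: continuous_at_imp_continuous_on differentiable_imp_continuous_within)

lemma supp_le_dd: "supp_le R f ==> supp_le R (dd v f)"
 unfolding supp_le_def dd_def
proof (intro allI impI)
 fix x :: "real^2" assume f: "\<forall>x. R < norm x \<longrightarrow> f x = 0" and x: "R < norm x"
 have "open {x::real^2. R < norm x}" by (intro open_Collect_less continuous_intros)
 then have "(f has_derivative (%x. 0)) (at x)"
  using f x by (intro has_derivative_transform_within_open[OF has_derivative_const[of 0]]) auto
 then show "frechet_derivative f (at x) v = 0" by (metis frechet_derivative_at)
qed

lemma dd_scale: "Ck (Suc k) f ==> dd (c *\<^sub>R v) f x = c *\<^sub>R dd v f x"
 using linear_scale[OF bounded_linear.linear[OF has_derivative_bounded_linear[OF Ck_has_derivative]]] by blast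

lemma supp_bounded:
 assumes "continuous_on UNIV f" "supp_le R f"
 obtains B where "B > 0" "!!x. norm (f x :: complex) <= B"
proof -
 have "compact (f ` cball 0 R)"
  by (intro compact_continuous_image continuous_on_subset[OF assms(1)]) auto
 then obtain B where B: "!!y. y \<in> f ` cball 0 R ==> norm y <= B" using compact_imp_bounded bounded_iff by metis
 have "norm (f x) <= max B 1" for x
  using assms(2) B[of "f x"] by (cases "norm x <= R") (auto simp: supp_le_def)
 then show ?thesis using that[of "max B 1"] by auto
qed

lemma supp_integrable:
 assumes "continuous_on UNIV f" "supp_le R f"
 shows "integrable lborel f"
proof -
 have "integrable lborel (%x. ind (cball 0 R) x *\<^sub>R f x)"
  using borel_integrable_compact[of "cball 0 R" f] continuous_on_subset[OF assms(1)] by auto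
 moreover have "(%x. ind (cball 0 R) x *\<^sub>R f x) = f"
  using assms(2) by (auto simp: fun_eq_iff supp_le_def indicator_def)
 ultimately show ?thesis by simp
qed

text \<open>Derivatives are taken along the sequence \<open>1 / Suc n\<close>, as required by
  dominated convergence of integrals.\<close>

lemma vector_derivative_quotient_tendsto:
 fixes f :: "real => 'a::real_normed_vector"
 assumes "(f has_vector_derivative D) (at 0)"
 shows "(%n. (f (1 / real (Suc n)) - f 0) /\<^sub>R (1 / real (Suc n))) \<longlonglongrightarrow> D"
proof -
 have "((%h. norm (f (0 + h) - f 0 - h *\<^sub>R D) / norm h) \<longlongrightarrow> 0) (at 0)"
  using assms unfolding has_vector_derivative_def has_derivative_at by blast
 moreover have lim: "filterlim (%n. 1 / real (Suc n)) (at 0) sequentially"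
  unfolding filterlim_at using LIMSEQ_inverse_real_of_nat by (auto simp: inverse_eq_divide)
 ultimately have "(%n. norm (f (0 + 1 / real (Suc n)) - f 0 - (1 / real (Suc n)) *\<^sub>R D) / norm (1 / real (Suc n))) \<longlonglongrightarrow> 0"
  by (rule filterlim_compose)
 moreover have "norm (f (0 + 1 / real (Suc n)) - f 0 - (1 / real (Suc n)) *\<^sub>R D) / norm (1 / real (Suc n))
  = norm ((f (1 / real (Suc n)) - f 0) /\<^sub>R (1 / real (Suc n)) - D)" for n
 proof -
  define t where "t = 1 / real (Suc n)"
  have t: "t > 0" unfolding t_def by simp
  have "(f t - f 0) /\<^sub>R t - D = (f t - f 0 - t *\<^sub>R D) /\<^sub>R t" using t by (simp add: algebra_simps)
  then show ?thesis unfolding t_def[symmetric] using t by (simp add: divide_inverse mult.commute)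
 qed
 ultimately have "(%n. (f (1 / real (Suc n)) - f 0) /\<^sub>R (1 / real (Suc n)) - D) \<longlonglongrightarrow> 0"
  by (simp only: tendsto_norm_zero_iff)
 then show ?thesis by (rule LIM_zero_cancel)
qed

text \<open>Frequencies are pairs of reals and points are vectors in \<open>real^2\<close>; keeping
  the types apart separates the dual plane from the plane.\<close>

definition pair_dot :: "R2 => real^2 => real" where
 "pair_dot xe v = fst xe * v $ 1 + snd xe * v $ 2"

lemma pair_dot_add: "pair_dot xe (v + w) = pair_dot xe v + pair_dot xe w"
 and pair_dot_scale: "pair_dot xe (c *\<^sub>R v) = c * pair_dot xe v"
 by (auto simp: pair_dot_def algebra_simps)

lemma continuous_pair_dot[continuous_intros]:
 "continuous_on S f ==> continuous_on S (%x. pair_dot xe (f x))"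
 unfolding pair_dot_def by (intro continuous_intros)

lemma measurable_pair_dot[measurable]: "pair_dot xe \<in> bmble borel"
 by (intro bmble_cont continuous_intros)

definition fhat :: "(real^2 => complex) => R2 => complex" where
 "fhat f xe = (LINT y|lborel. f y * e_fun (- pair_dot xe y))"

lemma fhat_integrable: "integrable lborel f ==> integrable lborel (%y. f y * e_fun (- pair_dot xe y))"
 by (rule intble_bound[of _ f]) (auto simp: norm_mult)

lemma fhat_bound:
 assumes "integrable lborel f"
 shows "norm (fhat f xe) <= (LINT y|lborel. norm (f y))"
 using integral_norm_bound[of lborel "%y. f y * e_fun (- pair_dot xe y)"] unfolding fhat_def by (simp add: norm_mult)

lemma fhat_translate:
 assumes [measurable]: "f \<in> bmble borel"
 shows "fhat (%y. f (y + s)) xe = e_fun (pair_dot xe s) * fhat f xe"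
proof -
 have "fhat f xe = (LINT y|distr lborel borel ((+) s). f y * e_fun (- pair_dot xe y))"
  unfolding fhat_def by (simp only: lborel_distr_plus)
 also have "... = (LINT y|lborel. f (s + y) * e_fun (- pair_dot xe (s + y)))"
  by (subst integral_distr) auto
 also have "... = (LINT y|lborel. cnj (e_fun (pair_dot xe s)) * (f (y + s) * e_fun (- pair_dot xe y)))"
 proof -
  have "e_fun (- pair_dot xe (s + y)) = cnj (e_fun (pair_dot xe s)) * e_fun (- pair_dot xe y)" for y
   using e_fun_add[of "- pair_dot xe s" "- pair_dot xe y"] by (simp add: pair_dot_add e_fun_minus)
  then show ?thesis by (simp add: add.commute mult.left_commute)
 qed
 also have "... = cnj (e_fun (pair_dot xe s)) * fhat (%y. f (y + s)) xe"
  unfolding fhat_def by simp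
 finally have "e_fun (pair_dot xe s) * fhat f xe = (e_fun (pair_dot xe s) * cnj (e_fun (pair_dot xe s))) * fhat (%y. f (y + s)) xe"
  by simp
 then show ?thesis by (simp add: mult_cnj_norm)
qed

text \<open>Instead of integration by parts: the transform of a difference quotient is known exactly
  from \<open>fhat_translate\<close>, and the mean value bound on the quotients, which share a
  bounded support, permits passing to the limit.\<close>

lemma fhat_dd:
 assumes f: "Ck (Suc k) f" and R: "supp_le R f"
 shows "fhat (dd v f) xe = 2 * of_real pi * \<i> * of_real (pair_dot xe v) * fhat f xe"
proof -
 have cf: "continuous_on UNIV f" by (rule Ck_continuous[OF f])
 have cd: "continuous_on UNIV (dd v f)" by (rule Ck_continuous[OF Ck_dd[OF f]])
 have [measurable]: "f \<in> bmble borel" "dd v f \<in> bmble borel"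
  using cf cd by (auto intro: bmble_cont)
 obtain B where B: "B > 0" "!!x. norm (dd v f x) <= B" using supp_bounded[OF cd supp_le_dd[OF R]] by blast
 define q where "q n y = of_nat (Suc n) * (f (y + (1 / real (Suc n)) *\<^sub>R v) - f y)" for n y
 have der: "((%t. f (y + t *\<^sub>R v)) has_vector_derivative dd v f (y + t *\<^sub>R v)) (at t within S)" for y t S
 proof -
  have "((%t. y + t *\<^sub>R v) has_derivative (%h. h *\<^sub>R v)) (at t within S)"
   by (auto intro!: derivative_eq_intros)
  from has_derivative_compose[OF this Ck_has_derivative[OF f]]
  show ?thesis unfolding has_vector_derivative_def by (simp add: dd_scale[OF f])
 qed
 have qlim: "(%n. q n y) \<longlonglongrightarrow> dd v f y" for y
 proof -
  have "((%t. f (y + t *\<^sub>R v)) has_vector_derivative dd v f y) (at 0)" using der[of y 0 UNIV] by simp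
  from vector_derivative_quotient_tendsto[OF this]
  show ?thesis unfolding q_def by (simp add: scaleR_conv_of_real)
 qed
 have qB: "norm (q n y) <= B * ind (cball 0 (R + norm v)) y" for n y
 proof (cases "norm y <= R + norm v")
  case True
  have "norm (f (y + (1 / real (Suc n)) *\<^sub>R v) - f (y + 0 *\<^sub>R v)) <= B * norm (1 / real (Suc n) - 0)"
  proof (rule differentiable_bound[of UNIV _ "%t h. h *\<^sub>R dd v f (y + t *\<^sub>R v)"])
   show "((%t. f (y + t *\<^sub>R v)) has_derivative (%h. h *\<^sub>R dd v f (y + x *\<^sub>R v))) (at x within UNIV)" for x
    using der unfolding has_vector_derivative_def by blast
   show "onorm (%h. h *\<^sub>R dd v f (y + x *\<^sub>R v)) <= B" for x
    using B by (intro onorm_le) (auto simp: mult.commute[of B] mult_left_mono)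
  qed auto
  then have "norm (q n y) <= B"
   unfolding q_def norm_mult by (simp add: field_simps norm_divide del: of_nat_Suc)
  then show ?thesis using True by simp
 next
  case False
  have "norm ((1 / real (Suc n)) *\<^sub>R v) <= 1 * norm v" unfolding norm_scaleR by (intro mult_right_mono) auto
  then have "norm (y + (1 / real (Suc n)) *\<^sub>R v) > R" using False norm_diff_ineq[of y "(1 / real (Suc n)) *\<^sub>R v"] by linarith
  moreover have "norm y > R" using False norm_ge_zero[of v] by linarith
  ultimately show ?thesis using R False unfolding q_def supp_le_def by simp
 qed
 have "(%n. LINT y|lborel. q n y * e_fun (- pair_dot xe y)) \<longlonglongrightarrow> (LINT y|lborel. dd v f y * e_fun (- pair_dot xe y))"
 proof (rule integral_dominated_convergence[where w="%y. B * ind (cball 0 (R + norm v)) y"])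
  show "(%y. q n y * e_fun (- pair_dot xe y)) \<in> bmble lborel" for n unfolding q_def by measurable
  show "integrable lborel (%y::real^2. B * ind (cball 0 (R + norm v)) y)"
   using emeasure_lborel_cball_finite[of "0::real^2"] by (intro integrable_mult_right integrable_real_indicator) (auto simp: less_top[symmetric])
  show "AE y in lborel. norm (q n y * e_fun (- pair_dot xe y)) <= B * ind (cball 0 (R + norm v)) y" for n
   using qB by (auto simp: norm_mult)
  show "AE y in lborel. (%n. q n y * e_fun (- pair_dot xe y)) \<longlonglongrightarrow> dd v f y * e_fun (- pair_dot xe y)"
   by (intro AE_I2 tendsto_intros qlim)
 qed measurable
 moreover have "(LINT y|lborel. q n y * e_fun (- pair_dot xe y)) = of_nat (Suc n) * (e_fun (pair_dot xe v / Suc n) - 1) * fhat f xe" for n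
 proof -
  have i: "integrable lborel f" by (rule supp_integrable[OF cf R])
  have cf2: "continuous_on UNIV (%y. f (y + (1 / real (Suc n)) *\<^sub>R v))"
   by (intro continuous_on_compose2[OF cf] continuous_intros) auto
  have "supp_le (R + norm v) (%y. f (y + (1 / real (Suc n)) *\<^sub>R v))"
   unfolding supp_le_def
  proof (intro allI impI)
   fix y :: "real^2" assume y: "R + norm v < norm y"
   have "norm ((1 / real (Suc n)) *\<^sub>R v) <= 1 * norm v" unfolding norm_scaleR by (intro mult_right_mono) auto
   then have "norm (y + (1 / real (Suc n)) *\<^sub>R v) > R" using y norm_diff_ineq[of y "(1 / real (Suc n)) *\<^sub>R v"] by linarith
   then show "f (y + (1 / real (Suc n)) *\<^sub>R v) = 0" using R unfolding supp_le_def by simp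
  qed
  then have i2: "integrable lborel (%y. f (y + (1 / real (Suc n)) *\<^sub>R v))"
   using supp_integrable[OF cf2] by blast
  have "(LINT y|lborel. q n y * e_fun (- pair_dot xe y)) =
   (LINT y|lborel. of_nat (Suc n) * (f (y + (1 / real (Suc n)) *\<^sub>R v) * e_fun (- pair_dot xe y) - f y * e_fun (- pair_dot xe y)))"
   unfolding q_def by (simp add: algebra_simps)
  also have "... = of_nat (Suc n) * (fhat (%y. f (y + (1 / real (Suc n)) *\<^sub>R v)) xe - fhat f xe)"
   unfolding fhat_def using fhat_integrable[OF i, of xe] fhat_integrable[OF i2, of xe]
   by (simp only: integral_mult_right_zero Bochner_Integration.integral_diff)
  also have "... = of_nat (Suc n) * (e_fun (pair_dot xe v / Suc n) - 1) * fhat f xe"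
   by (subst fhat_translate) (simp_all add: pair_dot_scale algebra_simps)
  finally show ?thesis .
 qed
 moreover have "(%n. of_nat (Suc n) * (e_fun (pair_dot xe v / Suc n) - 1) * fhat f xe) \<longlonglongrightarrow> 2 * of_real pi * \<i> * of_real (pair_dot xe v) * fhat f xe"
 proof (rule tendsto_mult[OF _ tendsto_const])
  define a where "a = 2 * of_real pi * \<i> * cor (pair_dot xe v)"
  have "((%t. exp (cor t * a)) has_vector_derivative a) (at 0)"
   by (rule has_vector_derivative_eq_rhs, rule has_vector_derivative_real_field) (auto intro!: derivative_eq_intros)
  from vector_derivative_quotient_tendsto[OF this]
  show "(%n. of_nat (Suc n) * (e_fun (pair_dot xe v / real (Suc n)) - 1)) \<longlonglongrightarrow> 2 * of_real pi * \<i> * of_real (pair_dot xe v)"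
   unfolding a_def e_fun_def by (simp add: scaleR_conv_of_real mult_ac)
 qed
 ultimately show ?thesis unfolding fhat_def[of "dd v f"] using LIMSEQ_unique by simp
qed

text \<open>Two derivatives in each of two directions give decay in both pairings at once. The
  product form is what is summable over a lattice: with \<open>a\<close> and \<open>b\<close>
  lattice generators, the pairings are the integer coordinates of a dual lattice point.\<close>

lemma fhat_decay:
 assumes f: "!!k. Ck k f" and R: "supp_le R f"
 obtains C where "C >= 0" "!!xe. norm (fhat f xe) * ((1 + (pair_dot xe a)^2) * (1 + (pair_dot xe b)^2)) <= C"
proof -
 have dd: "norm (fhat (dd v (dd v g)) xe) = 4 * pi^2 * (pair_dot xe v)^2 * norm (fhat g xe)" if "!!k. Ck k g" "supp_le R g" for v g xe
  unfolding fhat_dd[OF Ck_dd[OF that(1)[of "Suc (Suc 0)"]] supp_le_dd[OF that(2)]] fhat_dd[OF that(1)[of "Suc 0"] that(2)]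
  by (simp add: norm_mult power2_eq_square)
 define N where "N g = (LINT y|lborel. norm (g y))" for g :: "real^2 => complex"
 have bd: "norm (fhat g xe) <= N g" if "!!k. Ck k g" "supp_le R g" for g xe
  unfolding N_def by (intro fhat_bound supp_integrable[OF Ck_continuous[OF that(1)] that(2)])
 have Cdd: "Ck k (dd v g)" if "!!k. Ck k g" for v g k by (intro Ck_dd that)
 define gb where "gb = dd b (dd b f)"
 have gb: "Ck k gb" "supp_le R gb" for k unfolding gb_def by (intro Cdd f supp_le_dd R)+
 have Cf: "Ck k (dd a (dd a g))" "supp_le R (dd a (dd a g))" if "!!k. Ck k g" "supp_le R g" for k g by (intro Cdd that supp_le_dd)+
 have p1: "4 * pi^2 >= (1::real)" using pi_ge_two power_mono[of 2 pi 2] by simp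
 have up: "x * y <= 4 * pi^2 * x * y" if "x >= 0" "y >= 0" for x y :: real
  using mult_right_mono[OF p1, of "x * y"] that by (simp add: mult.assoc)
 show ?thesis
 proof (rule that)
  show "N f + N (dd a (dd a f)) + (N gb + N (dd a (dd a gb))) >= 0" unfolding N_def by (intro add_nonneg_nonneg) auto
  fix xe
  define F x y where "F = norm (fhat f xe)" and "x = (pair_dot xe a)^2" and "y = (pair_dot xe b)^2"
  have nn: "F >= 0" "x >= 0" "y >= 0" unfolding F_def x_def y_def by auto
  have 1: "F <= N f" unfolding F_def by (rule bd[OF f R])
  have 2: "x * F <= N (dd a (dd a f))"
   using bd[OF Cf[OF f R], of xe] up[OF nn(2,1)] unfolding dd[OF f R] F_def x_def by linarith
  have gF: "y * F <= norm (fhat gb xe)"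
   using up[OF nn(3,1)] unfolding gb_def dd[OF f R] F_def y_def by linarith
  have 3: "y * F <= N gb" using gF bd[OF gb, of xe] by linarith
  have "x * (y * F) <= x * norm (fhat gb xe)" using gF nn by (intro mult_left_mono) auto
  also have "... <= 4 * pi^2 * x * norm (fhat gb xe)" using nn by (intro up) auto
  also have "... = norm (fhat (dd a (dd a gb)) xe)" unfolding dd[OF gb] x_def ..
  also have "... <= N (dd a (dd a gb))" by (rule bd[OF Cf[OF gb]])
  finally have 4: "x * (y * F) <= N (dd a (dd a gb))" .
  show "F * ((1 + x) * (1 + y)) <= N f + N (dd a (dd a f)) + (N gb + N (dd a (dd a gb)))"
   using 1 2 3 4 by (simp add: algebra_simps)
 qed
qed

section \<open>Poisson summation\<close>

lemma measurable_fst_borel[measurable]: "fst \<in> measurable borel (borel :: 'a::second_countable_topology measure)"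
 and measurable_snd_borel[measurable]: "snd \<in> measurable borel (borel :: 'b::second_countable_topology measure)"
 by (auto intro!: bmble_cont continuous_intros)

section \<open>Integration in the plane and linear substitutions\<close>

lemma nn_integral_plane:
 fixes f :: "R2 => ennreal"
 assumes [measurable]: "f \<in> bmble borel"
 shows "(NN x|lborel. f x) = (NN p|lborel. NN q|lborel. f (p,q))"
  and "(NN x|lborel. f x) = (NN q|lborel. NN p|lborel. f (p,q))"
proof -
 have [measurable]: "f \<in> bmble (lborel \<otimes> lborel)" by (simp add: lborel_prod)
 show "(NN x|lborel. f x) = (NN p|lborel. NN q|lborel. f (p,q))"
  by (subst lborel.nn_integral_fst) (simp_all add: lborel_prod)
 show "(NN x|lborel. f x) = (NN q|lborel. NN p|lborel. f (p,q))"
  by (subst lborel_pair.nn_integral_snd) (simp_all add: lborel_prod)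
qed

text \<open>For \<open>a\<close> nonzero two one-dimensional substitutions suffice: the first
  rescales by \<open>a\<close>, the second by the Schur complement \<open>de / a\<close>. If
  \<open>a = 0\<close>, then \<open>c\<close> is nonzero and exchanging the two integration
  variables reduces to the first case.\<close>

lemma nn_integral_plane_linear:
 fixes f :: "R2 => ennreal"
 assumes [measurable]: "f \<in> bmble borel" and de: "a * d - b * c ~= 0"
 shows "ennreal \<bar>a * d - b * c\<bar> * (NN x|lborel. f (fst x * a + snd x * c,fst x * b + snd x * d)) = (NN x|lborel. f x)"
proof -
 have main: "ennreal \<bar>a * d - b * c\<bar> * (NN q|lborel. NN p|lborel. f (p * a + q * c,p * b + q * d)) = (NN x|lborel. f x)"
  if a: "a ~= 0" and de: "a * d - b * c ~= 0" for a b c d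
 proof -
  define de where "de = a * d - b * c"
  have 1: "ennreal \<bar>a\<bar> * (NN p|lborel. f (p * a + q * c,p * b + q * d)) = (NN x|lborel. f (x,x * b / a + q * (de / a)))" for q
  proof (subst (2) nn_integral_real_affine[where c=a and t="q * c"])
   have "(q * c + a * x) * b / a + q * (de / a) = x * b + q * d" for x
    using a by (simp add: field_simps de_def)
   then show "ennreal \<bar>a\<bar> * (NN p|lborel. f (p * a + q * c,p * b + q * d)) =
    ennreal \<bar>a\<bar> * (NN x|lborel. f (q * c + a * x,(q * c + a * x) * b / a + q * (de / a)))"
    by (simp add: add.commute mult.commute)
  qed (use a in measurable)
  have "ennreal \<bar>de\<bar> = ennreal \<bar>de / a\<bar> * ennreal \<bar>a\<bar>"
   using a by (subst ennreal_mult[symmetric]) (auto simp: abs_divide)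
  then have "ennreal \<bar>de\<bar> * (NN q|lborel. NN p|lborel. f (p * a + q * c,p * b + q * d)) =
   ennreal \<bar>de / a\<bar> * (NN q|lborel. ennreal \<bar>a\<bar> * (NN p|lborel. f (p * a + q * c,p * b + q * d)))"
   by (subst nn_integral_cmult) (auto simp: mult.assoc)
  also have "... = ennreal \<bar>de / a\<bar> * (NN q|lborel. NN x|lborel. f (x,x * b / a + q * (de / a)))"
   unfolding 1 ..
  also have "... = ennreal \<bar>de / a\<bar> * (NN x|lborel. NN q|lborel. f (x,x * b / a + q * (de / a)))"
   by (subst lborel_pair.Fubini') auto
  also have "... = (NN x|lborel. ennreal \<bar>de / a\<bar> * (NN q|lborel. f (x,x * b / a + q * (de / a))))"
   by (subst nn_integral_cmult) auto
  also have "... = (NN x|lborel. NN y|lborel. f (x,y))"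
  proof (intro nn_integral_cong)
   fix x
   show "ennreal \<bar>de / a\<bar> * (NN q|lborel. f (x,x * b / a + q * (de / a))) = (NN y|lborel. f (x,y))"
    by (subst (2) nn_integral_real_affine[where c="de / a" and t="x * b / a"])
     (use a de in \<open>auto simp: de_def mult.commute\<close>)
  qed
  also have "... = (NN x|lborel. f x)" by (rule nn_integral_plane(1)[symmetric]) simp
  finally show ?thesis unfolding de_def .
 qed
 show ?thesis
 proof (cases "a = 0")
  case False
  show ?thesis using main[OF False de] by (subst nn_integral_plane(2)) auto
 next
  case True
  then have "c ~= 0" "c * b - d * a ~= 0" using de by auto
  from main[OF this] have "ennreal \<bar>c * b - d * a\<bar> * (NN p|lborel. NN q|lborel. f (p * a + q * c,p * b + q * d)) = (NN x|lborel. f x)"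
   by (simp add: add.commute)
  moreover have "\<bar>c * b - d * a\<bar> = \<bar>a * d - b * c\<bar>" by (simp add: abs_minus_commute mult.commute)
  ultimately show ?thesis by (subst nn_integral_plane(1)) auto
 qed
qed

definition mkv :: "R2 => real^2" where
 "mkv x = fst x *\<^sub>R axis 1 1 + snd x *\<^sub>R axis 2 1"

lemma mkv_nth[simp]: "mkv x $ 1 = fst x" "mkv x $ 2 = snd x"
 by (auto simp: mkv_def axis_def)

lemma continuous_mkv: "continuous_on S mkv"
 unfolding mkv_def by (intro continuous_intros)

lemma measurable_mkv[measurable]: "mkv \<in> bmble borel"
 by (intro bmble_cont continuous_mkv)

lemma Basis_vec2: "Basis = {axis 1 1,axis 2 (1::real) :: real^2}"
proof -
 have "axis i 1 \<in> {axis 1 1,axis 2 (1::real) :: real^2}" for i :: 2 using exhaust_2[of i] by auto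
 then show ?thesis by (auto simp: Basis_vec_def)
qed

text \<open>The bridge between the two models of the plane: iterated integrals are taken over pairs
  of reals, while test functions live on \<open>real^2\<close>.\<close>

lemma lborel_mkv: "distr lborel borel mkv = (lborel :: (real^2) measure)"
proof (rule lborel_eqI[symmetric])
 fix l u :: "real^2" assume lu: "!!b. b \<in> Basis ==> l \<bullet> b <= u \<bullet> b"
 have le: "l $ 1 <= u $ 1" "l $ 2 <= u $ 2"
  using lu[of "axis 1 1"] lu[of "axis 2 1"] by (auto simp: Basis_vec2 inner_axis)
 have ne: "axis 1 1 ~= (axis 2 1 :: real^2)" by (simp add: axis_eq_axis)
 have "mkv -` box l u \<inter> space lborel = {l$1<..<u$1} \<times> {l$2<..<u$2}"
  by (auto simp: box_def Basis_vec2 inner_axis)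
 then have "emeasure (distr lborel borel mkv) (box l u) = emeasure lborel ({l$1<..<u$1} \<times> {l$2<..<u$2})"
  by (subst emeasure_distr) auto
 also have "... = emeasure (lborel \<otimes> lborel) ({l$1<..<u$1} \<times> {l$2<..<u$2})" by (simp add: lborel_prod)
 also have "... = ennreal ((u$1 - l$1) * (u$2 - l$2))"
  using le by (subst lborel.emeasure_pair_measure_Times) (auto simp: ennreal_mult)
 also have "(u$1 - l$1) * (u$2 - l$2) = (\<Prod>b\<in>Basis. (u - l) \<bullet> b)"
  unfolding Basis_vec2 using ne by (simp add: inner_axis)
 finally show "emeasure (distr lborel borel mkv) (box l u) = ennreal (\<Prod>b\<in>Basis. (u - l) \<bullet> b)" .
qed simp

lemma integral_plane_vec:
 fixes f :: "real^2 => complex"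
 assumes [measurable]: "f \<in> bmble borel" and de: "A$1 * B$2 - A$2 * B$1 ~= 0"
 shows "(LINT x|lborel. f (fst x *\<^sub>R A + snd x *\<^sub>R B + w)) = of_real (1 / \<bar>A$1 * B$2 - A$2 * B$1\<bar>) * (LINT y|lborel. f y)" (is "?L = of_real (1 / \<bar>?de\<bar>) * _")
  and "integrable lborel f ==> integrable lborel (%x. f (fst x *\<^sub>R A + snd x *\<^sub>R B + w))"
proof -
 let ?T = "%x::real\<times>real. fst x *\<^sub>R A + snd x *\<^sub>R B + w"
 have T[measurable]: "?T \<in> bmble borel"
  by (intro bmble_cont continuous_intros)
 have eq: "density (distr lborel borel ?T) (%_. ennreal \<bar>?de\<bar>) = lborel"
 proof (rule measure_eqI)
  fix X assume "X \<in> sets (density (distr lborel borel ?T) (%_. ennreal \<bar>?de\<bar>))"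
  then have [measurable]: "X \<in> sets borel" by simp
  have "emeasure (density (distr lborel borel ?T) (%_. ennreal \<bar>?de\<bar>)) X = ennreal \<bar>?de\<bar> * (NN x|lborel. ind X (?T x))"
  proof -
   have "emeasure (distr lborel borel ?T) X = (NN x|distr lborel borel ?T. ind X x)" by simp
   also have "... = (NN x|lborel. ind X (?T x))" by (subst nn_integral_distr) auto
   finally show ?thesis by (simp add: emeasure_density nn_integral_cmult)
  qed
  also have "... = ennreal \<bar>?de\<bar> * (NN x|lborel. ind X (w + mkv (fst x * A$1 + snd x * B$1,fst x * A$2 + snd x * B$2)))"
  proof -
   have "?T x = w + mkv (fst x * A$1 + snd x * B$1,fst x * A$2 + snd x * B$2)" for x
    by (simp add: vec_eq_iff forall_2)
   then show ?thesis by (simp only:)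
  qed
  also have "... = (NN x|lborel. ind X (w + mkv x))"
   using nn_integral_plane_linear[of "%x. ind X (w + mkv x)", OF _ de] by simp
  also have "... = (NN x|distr lborel borel mkv. ind X (w + x))" by (simp add: nn_integral_distr)
  also have "... = (NN x|distr lborel borel ((+) w). ind X x)" unfolding lborel_mkv by (subst nn_integral_distr) auto
  finally show "emeasure (density (distr lborel borel ?T) (%_. ennreal \<bar>?de\<bar>)) X = emeasure lborel X"
   by (simp add: lborel_distr_plus)
 qed simp
 have "(LINT y|lborel. f y) = \<bar>?de\<bar> *\<^sub>R ?L"
  by (subst eq[symmetric], subst integral_density) (auto simp: integral_distr)
 then show "?L = of_real (1 / \<bar>?de\<bar>) * (LINT y|lborel. f y)"
  using de by (simp add: scaleR_conv_of_real)
 assume "integrable lborel f"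
 then have "integrable (density (distr lborel borel ?T) (%_. ennreal \<bar>?de\<bar>)) f" by (simp only: eq)
 then have "integrable lborel (%x. \<bar>?de\<bar> *\<^sub>R f (?T x))"
  by (subst (asm) integrable_density) (auto simp: integrable_distr_eq)
 then have "integrable lborel (%x. (1 / \<bar>?de\<bar>) *\<^sub>R (\<bar>?de\<bar> *\<^sub>R f (?T x)))" by (rule integrable_scaleR_right)
 then show "integrable lborel (%x. f (?T x))" using de by simp
qed

lemma continuous_AE_I01_zero:
 fixes h :: "real => complex"
 assumes c: "continuous_on UNIV h" and ae: "AE x in I01. h x = 0" and x: "x \<in> {0..1}"
 shows "h x = 0"
proof -
 have "h x = 0" if x: "x \<in> {0<..<1}" for x
 proof (rule ccontr)
  assume nz: "h x ~= 0"
  define S where "S = {0<..<1} \<inter> {x. h x ~= 0}"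
  have "open S" unfolding S_def using c by (intro open_Int open_Collect_neq continuous_intros) auto
  moreover have "S ~= {}" using nz x by (auto simp: S_def)
  moreover have "S \<in> null_sets lborel"
  proof -
   have "AE x in lborel. x \<notin> S" using ae unfolding AE_I01 by eventually_elim (auto simp: S_def)
   then show ?thesis using \<open>open S\<close> by (subst AE_iff_null_sets) auto
  qed
  then have "negligible S" by (simp add: negligible_iff_null_sets null_sets_completionI)
  ultimately show False using open_not_negligible by blast
 qed
 then have "{0<..<1} \<subseteq> {x. h x = 0}" by auto
 moreover have "closed {x. h x = 0}" using c by (intro closed_Collect_eq continuous_intros) auto
 ultimately have "closure {0<..<1::real} \<subseteq> {x. h x = 0}" by (rule closure_minimal)
 then show ?thesis using x by (auto simp: closure_greaterThanLessThan)
qed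

section \<open>The torus, its characters and Fourier coefficients\<close>

definition TT :: "(R2) measure" where "TT = I01 \<otimes> I01"

lemma sets_TT[measurable_cong, simp]: "sets TT = sets borel" and space_TT[simp]: "space TT = UNIV"
 by (auto simp: TT_def space_pair_measure borel_prod[symmetric] cong: sets_pair_measure_cong)

lemma TT_density: "TT = density lborel (ind ({0..1} \<times> {0..1}))"
proof -
 have "TT = density (lborel \<otimes> lborel) (%(x,y). ind {0..1} x * ind {0..1} y)"
  unfolding TT_def I01_def
  by (rule pair_measure_density) (use sigma_finite_I01 in \<open>auto simp: I01_def sigma_finite_lborel\<close>)
 also have "... = density lborel (ind ({0..1} \<times> {0..1}))"
  by (auto simp: lborel_prod indicator_times intro!: arg_cong2[where f=density])
 finally show ?thesis .
qed

lemma finite_TT: "finite_measure TT" unfolding TT_def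
 by (intro finite_measure_pair_measure finite_I01)

interpretation I01: finite_measure I01 by (rule finite_I01)
interpretation TT: finite_measure TT by (rule finite_TT)
interpretation I01p: pair_sigma_finite I01 I01 ..

lemma sets_unit_square[measurable]: "{0..1} \<times> {0..1} \<in> sets (borel :: (R2) measure)"
 by (intro borel_closed closed_Times) auto

lemma AE_TT_box: "AE x in TT. fst x \<in> {0..1} \<and> snd x \<in> {0..1}"
 unfolding TT_density by (subst AE_density) (auto simp: indicator_def split: if_splits)

lemma TT_integrable_bounded:
 assumes [measurable]: "f \<in> bmble borel" and "!!x. x \<in> {0..1} \<times> {0..1} ==> norm (f x :: complex) <= B"
 shows "integrable TT f"
 by (rule TT.integrable_const_bound[of _ B]) (use AE_TT_box in eventually_elim, use assms in \<open>auto simp: mem_Times_iff\<close>)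

lemma continuous_TT_integrable:
 assumes "continuous_on UNIV f" shows "integrable TT (f :: _ => complex)"
proof -
 have "compact (f ` ({0..1} \<times> {0..1}))"
  by (intro compact_continuous_image continuous_on_subset[OF assms] compact_Times) auto
 then obtain B where "!!y. y \<in> f ` ({0..1} \<times> {0..1}) ==> norm y <= B" using compact_imp_bounded bounded_iff by metis
 then show ?thesis using assms by (intro TT_integrable_bounded[where B=B]) (auto intro: bmble_cont)
qed

definition chr :: "int \<times> int => R2 => complex" where
 "chr n s = e_fun (of_int (fst n) * fst s + of_int (snd n) * snd s)"

lemma norm_chr[simp]: "norm (chr n s) = 1" by (simp add: chr_def)
lemma continuous_chr: "continuous_on S (chr n)"
 unfolding chr_def by (intro continuous_on_compose2[OF continuous_e_fun] continuous_intros) auto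
lemma measurable_chr[measurable]: "chr n \<in> bmble borel"
 by (intro bmble_cont continuous_chr)

text \<open>One-dimensional uniqueness in each variable. Continuity upgrades almost everywhere to
  everywhere, since Poisson summation needs the value at the single point 0.\<close>

lemma fourier_uniqueness_TT:
 assumes c: "continuous_on UNIV H" and 0: "!!n. (LINT s|TT. H s * chr n s) = 0" and s: "s \<in> {0..1} \<times> {0..1}"
 shows "H s = 0"
proof -
 have [measurable]: "H \<in> bmble borel" using c by (rule bmble_cont)
 have Hp[measurable]: "H \<in> bmble (I01 \<otimes> I01)" using TT_def sets_TT by (simp add: m_cong[OF sets_TT[unfolded TT_def] refl])
 have int: "integrable (I01 \<otimes> I01) (%s. H s * chr n s)" for n
  unfolding TT_def[symmetric] by (intro continuous_TT_integrable continuous_intros c continuous_chr)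
 define F where "F r p = (LINT q|I01. H (p,q) * e_fun (of_int r * q))" for r :: int and p
 have F_int: "integrable I01 (F r)" for r
  using I01p.integrable_fst'[OF int[of "(0,r)"]] unfolding F_def by (simp add: chr_def)
 have "AE p in I01. F r p = 0" for r
 proof (rule fourier_uniqueness_I01[OF F_int])
  fix k :: int
  have "0 = (LINT s|(I01 \<otimes> I01). H s * chr (k,r) s)" using 0[of "(k,r)"] by (simp add: TT_def)
  also have "... = (LINT p|I01. (LINT q|I01. H (p,q) * chr (k,r) (p,q)))" by (rule I01p.integral_fst'[OF int, symmetric])
  also have "... = (LINT p|I01. F r p * e_fun (of_int k * p))"
  proof (rule lint_cong[OF refl], goal_cases)
   case (1 p)
   have "F r p * e_fun (of_int k * p) = (LINT q|I01. H (p,q) * e_fun (of_int r * q) * e_fun (of_int k * p))" unfolding F_def by simp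
   also have "... = (LINT q|I01. H (p,q) * chr (k,r) (p,q))" by (simp add: chr_def e_fun_add mult_ac)
   finally show ?case by simp
  qed
  finally show "(LINT p|I01. F r p * e_fun (of_int k * p)) = 0" by simp
 qed
 then have "AE p in I01. \<forall>r. F r p = 0" by (simp add: AE_all_countable)
 then have ae: "AE p in I01. \<forall>q\<in>{0..1}. H (p,q) = 0"
 proof eventually_elim
  case F0: (elim p)
  have cp: "continuous_on UNIV (%q. H (p,q))" by (intro continuous_on_compose2[OF c] continuous_intros) auto
  have "integrable TT (%s. H (p,snd s))" by (intro continuous_TT_integrable continuous_on_compose2[OF c] continuous_intros) auto
  have ip: "integrable I01 (%q. H (p,q))"
  proof -
   have "compact ((%q. H (p,q)) ` {0..1})" by (intro compact_continuous_image continuous_on_subset[OF cp]) auto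
   then obtain B where B: "!!y. y \<in> (%q. H (p,q)) ` {0..1} ==> norm y <= B" using compact_imp_bounded bounded_iff by metis
   show ?thesis
    by (rule I01.integrable_const_bound[of _ B]) (use cp B in \<open>auto simp: AE_I01 bmble_cont\<close>)
  qed
  have "AE q in I01. H (p,q) = 0"
   using F0 by (intro fourier_uniqueness_I01[OF ip]) (auto simp: F_def)
  then show ?case using continuous_AE_I01_zero[OF cp] by blast
 qed
 obtain p q where pq: "s = (p,q)" "p \<in> {0..1}" "q \<in> {0..1}" using s by auto
 have "AE p in I01. H (p,q) = 0" using ae by eventually_elim (use pq in auto)
 moreover have "continuous_on UNIV (%p. H (p,q))" by (intro continuous_on_compose2[OF c] continuous_intros) auto
 ultimately show ?thesis using continuous_AE_I01_zero[of "%p. H (p,q)" p] pq by simp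
qed

lemma chr_int: "chr n (s + (of_int j,of_int l)) = chr n s"
proof -
 have "of_int (fst n) * (fst s + of_int j) + of_int (snd n) * (snd s + of_int l) = (of_int (fst n) * fst s + of_int (snd n) * snd s) + roi (fst n * j + snd n * l)"
  by (simp add: algebra_simps)
 then show ?thesis unfolding chr_def by (simp add: e_fun_add_int del: of_int_add of_int_mult)
qed

lemma cnj_chr: "cnj (chr n s) = chr (- n) s"
 by (simp add: chr_def e_fun_minus[symmetric])

lemma chr_add: "chr (n + m) s = chr n s * chr m s"
 by (simp add: chr_def e_fun_add[symmetric] algebra_simps)

lemma I01_half_open: "I01 = density lborel (ind {0..<1})"
 unfolding I01_def
proof (rule density_cong)
 show "AE x in lborel. ind {0..1} x = (ind {0..<1::real} x :: ennreal)"
  using AE_lborel_singleton[of 1] by eventually_elim (auto simp: indicator_def)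
qed auto

lemma sets_half_open_square[measurable]: "{0..<1} \<times> {0..<1} \<in> sets (borel :: (R2) measure)"
 unfolding borel_prod[symmetric] by (intro pair_measureI) auto

lemma TT_half_open: "TT = density lborel (ind ({0..<1} \<times> {0..<1}))"
proof -
 have "TT = density (lborel \<otimes> lborel) (%(x,y). ind {0..<1} x * ind {0..<1} y)"
  unfolding TT_def I01_half_open
  by (rule pair_measure_density) (use sigma_finite_I01 in \<open>auto simp: I01_half_open sigma_finite_lborel\<close>)
 also have "... = density lborel (ind ({0..<1} \<times> {0..<1}))"
  by (auto simp: lborel_prod indicator_times intro!: arg_cong2[where f=density])
 finally show ?thesis .
qed

lemma integral_TT:
 fixes f :: "R2 => complex"
 assumes [measurable]: "f \<in> bmble borel"
 shows "(LINT s|TT. f s) = (LINT s|lborel. ind ({0..<1} \<times> {0..<1}) s *\<^sub>R f s)"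
proof -
 have "TT = density lborel (%x. ennreal (ind ({0..<1} \<times> {0..<1}) x))"
  by (simp add: TT_half_open ennreal_indicator)
 then have "(LINT s|TT. f s) = (LINT s|density lborel (%x. ennreal (ind ({0..<1} \<times> {0..<1}) x)). f s)"
  by (rule arg_cong)
 also have "... = (LINT s|lborel. ind ({0..<1} \<times> {0..<1}) s *\<^sub>R f s)"
  by (rule integral_density) auto
 finally show ?thesis .
qed

lemma integral_I01_e_fun: "(LINT x|I01. e_fun (of_int k * x)) = (if k = 0 then 1 else 0)"
proof (cases "k = 0")
 case True
 then show ?thesis using emeasure_I01_UNIV by (simp add: measure_def)
next
 case False
 define F where "F x = e_fun (of_int k * x) / (2 * of_real pi * \<i> * of_int k)" for x
 have "(LINT x|I01. e_fun (of_int k * x)) = (LINT x|lborel. ind {0..1} x *\<^sub>R e_fun (of_int k * x))"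
  by (subst integral_I01) (auto simp: set_lebesgue_integral_def)
 also have "... = F 1 - F 0"
 proof (rule integral_FTC_Icc)
  fix x :: real
  have "((%z. exp (2 * cor pi * \<i> * (of_int k * z)) / (2 * of_real pi * \<i> * of_int k)) has_field_derivative e_fun (of_int k * x)) (at (of_real x))"
   using False by (auto intro!: derivative_eq_intros simp: e_fun_def)
  from has_vector_derivative_real_field[OF this]
  show "(F has_vector_derivative e_fun (of_int k * x)) (at x within {0..1})"
   by (simp add: F_def[abs_def] e_fun_def)
 qed (auto intro!: continuous_on_compose2[OF continuous_e_fun] continuous_intros)
 also have "... = 0" using e_fun_int[of k] by (simp add: F_def)
 finally show ?thesis using False by simp
qed


lemma integral_TT_chr: "(LINT s|TT. chr n s) = (if n = 0 then 1 else 0)"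
proof -
 have "integrable TT (chr n)" by (intro continuous_TT_integrable continuous_chr)
 then have "(LINT s|TT. chr n s) = (LINT p|I01. LINT q|I01. chr n (p,q))"
  unfolding TT_def by (rule I01p.integral_fst'[symmetric])
 also have "... = (LINT p|I01. e_fun (of_int (fst n) * p) * (LINT q|I01. e_fun (of_int (snd n) * q)))"
  by (simp add: chr_def e_fun_add)
 also have "... = (LINT p|I01. e_fun (of_int (fst n) * p)) * (LINT q|I01. e_fun (of_int (snd n) * q))"
  by simp
 finally show ?thesis unfolding integral_I01_e_fun by (cases n) (auto simp: zero_prod_def)
qed

lemma sigma_finite_count_int2: "sigma_finite_measure (count_space (UNIV :: (int \<times> int) set))"
 by (rule sigma_finite_measure_count_space)

interpretation cnt: sigma_finite_measure "count_space (UNIV :: (int \<times> int) set)" by (rule sigma_finite_count_int2)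
interpretation cntTT: pair_sigma_finite "count_space (UNIV :: (int \<times> int) set)" TT ..

definition iota :: "int \<times> int => R2" where "iota n = (of_int (fst n),of_int (snd n))"

lemma chr_iota: "chr n (s + iota m) = chr n s"
 using chr_int[of n s "fst m" "snd m"] by (simp add: iota_def)

lemma chr_0[simp]: "chr 0 s = 1" "chr n 0 = 1" by (simp_all add: chr_def)

lemma floor_square: "x - iota n \<in> {0..<1} \<times> {0..<1} \<longleftrightarrow> n = (\<lfloor>fst x\<rfloor>,\<lfloor>snd x\<rfloor>)"
proof -
 have "x - iota n \<in> {0..<1} \<times> {0..<1} \<longleftrightarrow> (of_int (fst n) <= fst x \<and> fst x < of_int (fst n) + 1) \<and> (of_int (snd n) <= snd x \<and> snd x < of_int (snd n) + 1)"
  by (auto simp: mem_Times_iff iota_def)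
 also have "... \<longleftrightarrow> \<lfloor>fst x\<rfloor> = fst n \<and> \<lfloor>snd x\<rfloor> = snd n" by (simp only: floor_eq_iff)
 finally show ?thesis by (cases n) auto
qed

lemma lborel_plane_shift:
 fixes f :: "R2 => complex"
 assumes [measurable]: "f \<in> bmble borel"
 shows "(LINT s|lborel. f (s + c)) = (LINT s|lborel. f s)"
proof -
 have "(LINT s|lborel. f s) = (LINT s|distr lborel borel ((+) c). f s)" by (simp only: lborel_distr_plus)
 also have "... = (LINT s|lborel. f (c + s))" by (subst integral_distr) auto
 finally show ?thesis by (simp add: add.commute)
qed

lemma continuous_character_series:
 assumes c: "integrable (cU) c"
 shows "continuous_on UNIV (%s. LINT n|cU. c n * chr n s)"
 unfolding continuous_on_sequentially comp_def
proof (intro allI impI ballI)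
 fix X :: "nat => R2" and a assume "(\<forall>n. X n \<in> UNIV) \<and> X \<longlonglongrightarrow> a"
 then have X: "X \<longlonglongrightarrow> a" by simp
 show "(%k. LINT n|cU. c n * chr n (X k)) \<longlonglongrightarrow> (LINT n|cU. c n * chr n a)"
 proof (rule integral_dominated_convergence[where w="%n. norm (c n)"])
  show "AE n in cU. (%k. c n * chr n (X k)) \<longlonglongrightarrow> c n * chr n a"
   by (intro AE_I2 tendsto_intros continuous_on_tendsto_compose[OF continuous_chr[of UNIV] X]) auto
 qed (use c in \<open>auto simp: norm_mult\<close>)
qed

lemma coefficient_character_series:
 assumes c: "integrable (cU) c"
 shows "(LINT s|TT. (LINT n|cU. c n * chr n s) * chr (- m) s) = c m"
proof -
 have meas: "(%(n,s). c n * chr n s * chr (- m) s) \<in> bmble (cU \<otimes> TT)"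
  by (rule measurable_pair_measure_countable1) (auto simp: m_cong[OF sets_TT refl])
 have int: "integrable (cU \<otimes> TT) (%(n,s). c n * chr n s * chr (- m) s)"
 proof (rule cntTT.Fubini_integrable[OF meas])
  show "integrable (cU) (%n. LINT s|TT. norm (case (n,s) of (n,s) => c n * chr n s * chr (- m) s))"
   using c by (simp add: norm_mult)
  show "AE n in cU. integrable TT (%s. case (n,s) of (n,s) => c n * chr n s * chr (- m) s)"
   by (intro AE_I2) (auto intro!: continuous_TT_integrable continuous_intros continuous_chr)
 qed
 have "(LINT s|TT. (LINT n|cU. c n * chr n s) * chr (- m) s) = (LINT s|TT. (LINT n|cU. c n * chr n s * chr (- m) s))"
  by simp
 also have "... = (LINT n|cU. (LINT s|TT. c n * chr n s * chr (- m) s))"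
  by (rule cntTT.Fubini_integral[OF int])
 also have "... = (LINT n|cU. c n * (if n = m then 1 else 0))"
 proof (rule lint_cong[OF refl], goal_cases)
  case (1 n)
  have "(LINT s|TT. c n * chr n s * chr (- m) s) = c n * (LINT s|TT. chr (n - m) s)"
   using chr_add[of n "- m"] by (simp add: mult.assoc)
  then show ?case
   by (simp add: integral_TT_chr)
 qed
 also have "... = c m"
  by (subst lebesgue_integral_count_space_finite_support) (auto simp: if_distrib cong: if_cong)
 finally show ?thesis .
qed

text \<open>Compact support makes the periodisation \<open>P\<close> a finite sum, and summability
  of \<open>c\<close> makes the character series \<open>Q\<close> continuous. Both are continuous
  with the same coefficients, so they agree at 0.\<close>

lemma poisson_summation:
 fixes F :: "R2 => complex"
 defines "c \<equiv> %n. LINT x|lborel. F x * chr (- n) x"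
 assumes F: "continuous_on UNIV F" and R: "!!x. \<bar>fst x\<bar> > R \<or> \<bar>snd x\<bar> > R ==> F x = 0"
  and Fi: "integrable lborel F"
  and c: "integrable (cU) c"
 shows "(\<Sum>\<^sub>\<infinity>n. F (iota n)) = (LINT n|cU. c n)"
proof -
 have [measurable]: "F \<in> bmble borel" using F by (rule bmble_cont)
 \<comment> \<open>The margin ensures that every unit cell meeting the support of \<open>F\<close>
   has its lower corner in \<open>B\<close>, so that truncating to \<open>B\<close> leaves the
   coefficients over the unit square unchanged.\<close>
 obtain N :: nat where N: "real N > R + 2" using reals_Archimedean2 by blast
 define B where "B = {- int N..int N} \<times> {- int N..int N}"
 have finB: "finite B" unfolding B_def by auto
 define P where "P s = (\<Sum>n\<in>B. F (s + iota n))" for s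
 define Q where "Q s = (LINT n|cU. c n * chr n s)" for s
 have cP: "continuous_on UNIV P" unfolding P_def
  by (intro continuous_intros continuous_on_compose2[OF F]) auto
 have cQ: "continuous_on UNIV Q" unfolding Q_def by (rule continuous_character_series[OF c])
 have floorB: "(\<lfloor>fst x\<rfloor>,\<lfloor>snd x\<rfloor>) \<in> B" if "F x ~= 0" for x
 proof -
  have "\<not> (\<bar>fst x\<bar> > R \<or> \<bar>snd x\<bar> > R)" using R[of x] that by blast
  then show ?thesis using N unfolding B_def by (auto simp: le_floor_iff floor_le_iff abs_le_iff)
 qed
 have coefP: "(LINT s|TT. P s * chr (- m) s) = c m" for m
 proof -
  define G where "G x = F x * chr (- m) x" for x
  have Gm[measurable]: "G \<in> bmble borel" unfolding G_def by measurable
  have Gi: "integrable lborel G" unfolding G_def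
   by (rule intble_bound[OF Fi]) (auto simp: norm_mult)
  have Gc: "continuous_on UNIV G" unfolding G_def by (intro continuous_intros F continuous_chr)
  have "(LINT s|TT. P s * chr (- m) s) = (LINT s|TT. (\<Sum>n\<in>B. G (s + iota n)))"
   by (simp add: P_def G_def chr_iota sum_distrib_right)
  also have "... = (\<Sum>n\<in>B. LINT s|TT. G (s + iota n))"
   by (intro Bochner_Integration.integral_sum continuous_TT_integrable continuous_on_compose2[OF Gc] continuous_intros) auto
  also have "... = (\<Sum>n\<in>B. LINT s|lborel. ind ({0..<1} \<times> {0..<1}) (s - iota n) *\<^sub>R G s)"
  proof (rule sum.cong[OF refl], goal_cases)
   case (1 n)
   have "(LINT s|TT. G (s + iota n)) = (LINT s|lborel. ind ({0..<1} \<times> {0..<1}) (s + iota n - iota n) *\<^sub>R G (s + iota n))"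
    by (subst integral_TT) simp_all
   also have "... = (LINT s|lborel. ind ({0..<1} \<times> {0..<1}) (s - iota n) *\<^sub>R G s)"
    by (rule lborel_plane_shift[where f="%s. ind ({0..<1} \<times> {0..<1}) (s - iota n) *\<^sub>R G s"]) measurable
   finally show ?case .
  qed
  also have "... = (LINT s|lborel. (\<Sum>n\<in>B. ind ({0..<1} \<times> {0..<1}) (s - iota n) *\<^sub>R G s))"
   by (intro Bochner_Integration.integral_sum[symmetric] intble_bound[OF Gi]) (auto simp: indicator_def)
  also have "... = (LINT s|lborel. G s)"
  proof (rule lint_cong[OF refl], goal_cases)
   case (1 x)
   have "(\<Sum>n\<in>B. ind ({0..<1} \<times> {0..<1}) (x - iota n) *\<^sub>R G x) = (\<Sum>n\<in>B. if n = (\<lfloor>fst x\<rfloor>,\<lfloor>snd x\<rfloor>) then G x else 0)"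
    by (intro sum.cong) (auto simp only: indicator_def floor_square split: if_splits, auto)
   also have "... = G x" using finB floorB[of x] by (auto simp: G_def)
   finally show ?case .
  qed
  finally show ?thesis unfolding G_def c_def .
 qed
 have "P 0 - Q 0 = 0"
 proof (rule fourier_uniqueness_TT[where H="%s. P s - Q s"])
  show "continuous_on UNIV (%s. P s - Q s)" by (intro continuous_intros cP cQ)
  fix n
  have "(LINT s|TT. (P s - Q s) * chr n s) = (LINT s|TT. P s * chr n s) - (LINT s|TT. Q s * chr n s)"
   unfolding left_diff_distrib
   by (intro Bochner_Integration.integral_diff continuous_TT_integrable continuous_intros cP cQ continuous_chr)
  also have "... = 0" using coefP[of "- n"] coefficient_character_series[OF c, of "- n"] unfolding Q_def by simp
  finally show "(LINT s|TT. (P s - Q s) * chr n s) = 0" .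
 qed (auto simp: zero_prod_def)
 moreover have "P 0 = (\<Sum>\<^sub>\<infinity>n. F (iota n))"
 proof -
  have "F (iota n) = 0" if "n \<notin> B" for n
   using floorB[of "iota n"] that by (cases n) (auto simp: iota_def)
  then have "(\<Sum>\<^sub>\<infinity>n. F (iota n)) = (\<Sum>\<^sub>\<infinity>n\<in>B. F (iota n))" by (intro infsum_cong_neutral) auto
  then show ?thesis using finB by (simp add: P_def)
 qed
 ultimately show ?thesis by (simp add: Q_def)
qed

lemma integrable_inverse_squares_int: "integrable (count_space (UNIV :: int set)) (%m. 1 / (1 + (roi m)^2))"
proof -
 have s: "summable (%n. 1 / (1 + (real n)^2))"
 proof (rule summable_comparison_test[OF _ inverse_power_summable[of 2, where 'a=real]])
  show "\<exists>N. \<forall>n\<ge>N. norm (1 / (1 + (real n)^2)) <= inverse (real n ^ 2)"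
   by (intro exI[of _ 1]) (auto simp: divide_inverse intro!: le_imp_inverse_le)
 qed simp
 have nat: "integrable (count_space (UNIV :: nat set)) (%n. 1 / (1 + (real n)^2))"
  using s by (simp add: integrable_count_space_nat_iff)
 have "Infinite_Set_Sum.abs_summable_on (%m. 1 / (1 + (roi m)^2)) ((UNIV :: int set))"
 proof -
  have 1: "Infinite_Set_Sum.abs_summable_on (%m. 1 / (1 + (roi m)^2)) ((range int))"
   using nat by (subst abs_summable_on_reindex_iff[symmetric]) (auto simp: abs_summable_on_def)
  have 2: "Infinite_Set_Sum.abs_summable_on (%m. 1 / (1 + (roi m)^2)) ((range (%n. - int n)))"
   using nat by (subst abs_summable_on_reindex_iff[symmetric]) (auto simp: abs_summable_on_def inj_def)
  have "Infinite_Set_Sum.abs_summable_on (%m. 1 / (1 + (roi m)^2)) ((range int \<union> range (%n. - int n)))"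
   by (rule abs_summable_on_union[OF 1 2])
  moreover have "range int \<union> range (%n. - int n) = UNIV"
   by (auto simp: image_iff) (metis int_cases2)
  ultimately show ?thesis by simp
 qed
 then show ?thesis by (simp add: abs_summable_on_def)
qed

lemma integrable_inverse_squares_int2:
 "integrable (count_space (UNIV :: (int \<times> int) set)) (%n. 1 / ((1 + (roi (fst n))^2) * (1 + (roi (snd n))^2)))"
proof -
 let ?a = "%m. 1 / (1 + (roi m)^2)"
 have pos: "1 + (roi m)^2 > 0" for m by (rule add_pos_nonneg) auto
 have fin: "(NN m|cU. ennreal (?a m)) < oo"
  using integrable_inverse_squares_int pos by (subst (asm) integrable_iff_bounded) (auto simp: less_imp_le)
 have eq: "count_space (UNIV :: (int \<times> int) set) = cU \<otimes> cU"
  by (subst pair_measure_countable) auto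
 have "(NN n|count_space (UNIV :: (int \<times> int) set). ennreal (1 / ((1 + (roi (fst n))^2) * (1 + (roi (snd n))^2))))
  = (NN m|cU. NN r|cU. ennreal (?a m) * ennreal (?a r))"
  unfolding eq using pos
  by (subst sigma_finite_measure.nn_integral_fst[symmetric])
   (auto intro!: sigma_finite_measure_count_space nn_integral_cong simp: ennreal_mult[symmetric] less_imp_le pair_measure_countable)
 also have "... = (NN m|cU. ennreal (?a m)) * (NN r|cU. ennreal (?a r))"
  by (simp add: nn_integral_cmult nn_integral_multc)
 also have "... < oo" using fin by (simp add: ennreal_mult_less_top)
 finally show ?thesis using pos by (intro integrableI_bounded) (auto simp: less_imp_le)
qed

section \<open>Bump functions\<close>

text \<open>The polynomial parameter makes the family closed under differentiation: with
  \<open>u = 1 / t\<close>, the derivative in \<open>t\<close> of p(u) exp(-u) is u^2 (p - p')(u)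
  exp(-u), which is the factor in \<open>flat_exp_derivative\<close>.\<close>

definition flat_exp :: "real poly => real => real" where
 "flat_exp p t = (if t > 0 then poly p (1 / t) * exp (- (1 / t)) else 0)"

lemma poly_times_exp_minus_tendsto: "((%u::real. poly p u * exp (- u)) \<longlongrightarrow> 0) at_top"
proof -
 have "((%u::real. \<Sum>i\<le>degree p. coeff p i * (u ^ i / exp u)) \<longlongrightarrow> (\<Sum>i\<le>degree p. coeff p i * 0)) at_top"
  by (intro tendsto_intros tendsto_power_div_exp_0)
 then show ?thesis by (simp add: poly_altdef exp_minus divide_inverse sum_distrib_right mult.assoc)
qed

lemma flat_exp_tendsto_0: "((%t. flat_exp p t) \<longlongrightarrow> 0) (at 0)"
proof -
 have "((%t. flat_exp p t) \<longlongrightarrow> 0) (at_right 0)"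
 proof -
  have "((%t. poly p (inverse t) * exp (- inverse t)) \<longlongrightarrow> 0) (at_right (0::real))"
   by (rule filterlim_compose[OF poly_times_exp_minus_tendsto filterlim_inverse_at_top_right])
  then show ?thesis
   by (rule Lim_transform_eventually) (auto simp: flat_exp_def eventually_at_right_field divide_inverse intro!: exI[of _ 1])
 qed
 moreover have "((%t. flat_exp p t) \<longlongrightarrow> 0) (at_left 0)"
  by (rule Lim_transform_eventually[OF tendsto_const]) (auto simp: flat_exp_def eventually_at_left_field intro!: exI[of _ "-1"])
 ultimately show ?thesis by (simp add: filterlim_split_at)
qed

lemma flat_exp_derivative:
 "(flat_exp p has_real_derivative flat_exp ([:0,0,1:] * (p - pderiv p)) t) (at t)"
proof (cases "t > 0" "t < 0" rule: bool.exhaust[case_product bool.exhaust])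
 case True_True then show ?thesis by simp
next
 case True_False
 then have t: "t > 0" by simp
 have "((%t. poly p (1 / t) * exp (- (1 / t))) has_real_derivative flat_exp ([:0,0,1:] * (p - pderiv p)) t) (at t)"
  using t by (auto intro!: derivative_eq_intros DERIV_chain'[where g="poly p", OF _ poly_DERIV] simp: flat_exp_def field_simps power2_eq_square)
 then show ?thesis
  by (rule DERIV_cong_ev[OF refl _ refl, THEN iffD1, rotated])
   (use eventually_nhds_in_open[of "{0<..}" t] t in \<open>auto elim!: eventually_mono simp: flat_exp_def\<close>)
next
 case False_True
 then have t: "t < 0" by simp
 have "((%t. 0) has_real_derivative flat_exp ([:0,0,1:] * (p - pderiv p)) t) (at t)"
  using t by (simp add: flat_exp_def)
 then show ?thesis
  by (rule DERIV_cong_ev[OF refl _ refl, THEN iffD1, rotated])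
   (use eventually_nhds_in_open[of "{..<0}" t] t in \<open>auto elim!: eventually_mono simp: flat_exp_def\<close>)
next
 case False_False
 then have t: "t = 0" by simp
 have "flat_exp p h / h = flat_exp ([:0,1:] * p) h" for h
  by (simp add: flat_exp_def)
 then have "((%h. (flat_exp p (0 + h) - flat_exp p 0) / h) \<longlongrightarrow> 0) (at 0)"
  using flat_exp_tendsto_0[of "[:0,1:] * p"] by (simp add: flat_exp_def[of p 0])
 then show ?thesis unfolding t DERIV_def by (simp add: flat_exp_def[of _ 0])
qed

text \<open>A class containing the bump functions and stable under directional derivatives;
  \<open>Ck k\<close> for all \<open>k\<close> is then one induction, with no explicit higher
  derivatives.\<close>

inductive plane_smooth :: "(real^2 => real) => bool" where
 const: "plane_smooth (%x. c)"
| coord: "plane_smooth (%x. x $ i)"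
| flat: "plane_smooth (%x. flat_exp p (1 - r * (x $ 1 * x $ 1 + x $ 2 * x $ 2)))"
| add: "plane_smooth f ==> plane_smooth g ==> plane_smooth (%x. f x + g x)"
| mult: "plane_smooth f ==> plane_smooth g ==> plane_smooth (%x. f x * g x)"

lemma plane_smooth_derivative:
 "plane_smooth f ==> \<exists>f'. (\<forall>x. (f has_derivative f' x) (at x)) \<and> (\<forall>v. plane_smooth (%x. f' x v))"
proof (induction rule: plane_smooth.induct)
 case (const c)
 show ?case by (rule exI[of _ "%x v. 0"]) (auto intro: plane_smooth.const)
next
 case (coord i)
 show ?case by (rule exI[of _ "%x v. v $ i"])
  (auto intro!: plane_smooth.const bounded_linear.has_derivative[OF bounded_linear_vec_nth] derivative_eq_intros)
next
 case (flat p r)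
 let ?q = "[:0,0,1:] * (p - pderiv p)"
 define f' where "f' x v = flat_exp ?q (1 - r * (x $ 1 * x $ 1 + x $ 2 * x $ 2)) * ((-2 * r) * (x $ 1 * v $ 1 + x $ 2 * v $ 2))" for x v :: "real^2"
 have nth: "((%x::real^2. x $ i) has_derivative (%v. v $ i)) (at x)" for i x
  by (rule bounded_linear_imp_has_derivative) (rule bounded_linear_vec_nth)
 have "((%x::real^2. flat_exp p (1 - r * (x $ 1 * x $ 1 + x $ 2 * x $ 2))) has_derivative f' x) (at x)" for x
 proof -
  have "((%x::real^2. 1 - r * (x $ 1 * x $ 1 + x $ 2 * x $ 2)) has_derivative (%v. (-2 * r) * (x $ 1 * v $ 1 + x $ 2 * v $ 2))) (at x)"
   by (auto intro!: derivative_eq_intros nth simp: algebra_simps)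
  from has_derivative_compose[OF this flat_exp_derivative[THEN has_field_derivative_imp_has_derivative]]
  show ?thesis unfolding f'_def .
 qed
 moreover have "plane_smooth (%x. f' x v)" for v
  unfolding f'_def
  by (intro plane_smooth.mult plane_smooth.flat plane_smooth.add plane_smooth.const plane_smooth.coord)
 ultimately show ?case by blast
next
 case (add f g)
 then obtain f' g' where "!!x. (f has_derivative f' x) (at x)" "!!v. plane_smooth (%x. f' x v)"
  "!!x. (g has_derivative g' x) (at x)" "!!v. plane_smooth (%x. g' x v)" by blast
 then show ?case
  by (intro exI[of _ "%x v. f' x v + g' x v"]) (auto intro: plane_smooth.add has_derivative_add)
next
 case (mult f g)
 then obtain f' g' where "!!x. (f has_derivative f' x) (at x)" "!!v. plane_smooth (%x. f' x v)"
  "!!x. (g has_derivative g' x) (at x)" "!!v. plane_smooth (%x. g' x v)" by blast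
 with mult show ?case
  by (intro exI[of _ "%x v. f x * g' x v + f' x v * g x"] conjI allI plane_smooth.add plane_smooth.mult has_derivative_mult) auto
qed

lemma plane_smooth_Ck: "plane_smooth f ==> Ck k (%x. cor (f x))"
proof (induction k arbitrary: f)
 case 0
 then obtain f' where "!!x. (f has_derivative f' x) (at x)" using plane_smooth_derivative by blast
 then have "continuous_on UNIV f" by (intro continuous_at_imp_continuous_on ballI has_derivative_continuous)
 then show ?case by (auto intro: continuous_intros)
next
 case (Suc k)
 obtain f' where f': "!!x. (f has_derivative f' x) (at x)" "!!v. plane_smooth (%x. f' x v)"
  using plane_smooth_derivative[OF Suc(2)] by blast
 have d: "((%x. cor (f x)) has_derivative (%v. cor (f' x v))) (at x)" for x
  using f'(1) by (rule has_derivative_of_real)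
 then have "frechet_derivative (%x. cor (f x)) (at x) = (%v. cor (f' x v))" for x
  by (metis frechet_derivative_at)
 moreover have "(%x. cor (f x)) differentiable at x" for x
  unfolding differentiable_def using d by blast
 ultimately show ?case using f'(2) Suc(1) by simp
qed

definition bump :: "real => real^2 => complex" where
 "bump r x = cor (flat_exp 1 (1 - r * (x $ 1 * x $ 1 + x $ 2 * x $ 2)))"

lemma Ck_bump: "Ck k (bump r)"
 unfolding bump_def by (intro plane_smooth_Ck plane_smooth.flat)

lemma norm_vec2: "(norm (x::real^2))^2 = x $ 1 * x $ 1 + x $ 2 * x $ 2"
 by (simp add: norm_vec_def L2_set_def sum_2 power2_eq_square)

lemma supp_le_bump:
 assumes "n > 0" shows "supp_le (1 / real n) (bump ((real n)^2))"
 unfolding supp_le_def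
proof (intro allI impI)
 fix x :: "real^2" assume "1 / real n < norm x"
 then have "1 < real n * norm x" using assms by (simp add: field_simps)
 then have "1 < (real n * norm x)^2" by (simp add: one_less_power)
 then show "bump ((real n)^2) x = 0"
  by (simp add: bump_def flat_exp_def norm_vec2[symmetric] power_mult_distrib)
qed

lemma Cc_smooth0_supp:
 assumes "f \<in> Cc_smooth0"
 obtains R where "R >= 0" "supp_le R f"
proof -
 have "bounded {x. f x ~= 0}"
  using assms bounded_subset[OF compact_imp_bounded closure_subset] unfolding Cc_smooth0_def by auto
 then obtain R where R: "!!x. f x ~= 0 ==> norm x <= R" unfolding bounded_iff by blast
 have "supp_le (max R 0) f" unfolding supp_le_def using R by force
 then show ?thesis using that[of "max R 0"] by simp
qed

text \<open>Derivatives of bumps supply test functions of integral zero: the transform of a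
  derivative vanishes at frequency 0.\<close>

lemma dd_bump_Cc:
 assumes "n > 0" shows "dd v (bump ((real n)^2)) \<in> Cc_smooth0"
proof -
 have s: "supp_le (1 / real n) (dd v (bump ((real n)^2)))" by (intro supp_le_dd supp_le_bump assms)
 have "{x. dd v (bump ((real n)^2)) x ~= 0} \<subseteq> cball 0 (1 / real n)"
  using s unfolding supp_le_def by (auto simp: not_less[symmetric])
 then have "closure {x. dd v (bump ((real n)^2)) x ~= 0} \<subseteq> cball 0 (1 / real n)"
  by (rule closure_minimal) simp
 then have "compact (closure {x. dd v (bump ((real n)^2)) x ~= 0})"
  by (metis bounded_cball bounded_subset closed_closure compact_eq_bounded_closed)
 moreover have "(LINT x|lborel. dd v (bump ((real n)^2)) x) = 0"
  using fhat_dd[OF Ck_bump[of "Suc 0"] supp_le_bump[OF assms], of v "(0,0)"]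
  by (simp add: fhat_def pair_dot_def)
 moreover have "Ck k (dd v (bump ((real n)^2)))" for k by (intro Ck_dd Ck_bump)
 ultimately show ?thesis unfolding Cc_smooth0_def by simp
qed

text \<open>The bump is so narrow that the phase stays within a quarter turn of 0 on its support.
  The real part of the integrand is then nonnegative everywhere and positive near the origin; the
  factor 4 in the hypothesis is this quarter turn.\<close>

lemma fhat_bump_nonzero:
 assumes n: "real n > 4 * (\<bar>fst xe\<bar> + \<bar>snd xe\<bar>)"
 shows "fhat (bump ((real n)^2)) xe ~= 0"
proof -
 let ?b = "bump ((real n)^2)"
 have n0: "n > 0" using n abs_ge_zero[of "fst xe"] abs_ge_zero[of "snd xe"] by (cases n) auto
 have int: "integrable lborel ?b" by (rule supp_integrable[OF Ck_continuous[OF Ck_bump] supp_le_bump[OF n0]])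
 define g where "g y = Re (?b y) * cos (2 * pi * pair_dot xe y)" for y
 have Re: "Re (?b y * e_fun (- pair_dot xe y)) = g y" for y
  unfolding g_def e_fun_def by (simp add: bump_def exp_eq_polar[of "_ * _"] Re_exp Im_exp mult_ac)
 have gi: "integrable lborel g"
  using integrable_Re[OF fhat_integrable[OF int, of xe]] by (simp only: Re)
 have gpos: "g y >= 0" and gpos0: "norm y < 1 / real n ==> g y > 0" for y
 proof -
  have cpos: "cos (2 * pi * pair_dot xe y) > 0" if "norm y <= 1 / real n"
  proof -
   have "\<bar>pair_dot xe y\<bar> <= \<bar>fst xe\<bar> * \<bar>y $ 1\<bar> + \<bar>snd xe\<bar> * \<bar>y $ 2\<bar>"
    unfolding pair_dot_def by (metis abs_mult abs_triangle_ineq)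
   also have "... <= \<bar>fst xe\<bar> * (1 / real n) + \<bar>snd xe\<bar> * (1 / real n)"
    using that component_le_norm_cart[of y 1] component_le_norm_cart[of y 2] by (intro add_mono mult_left_mono) auto
   also have "... < 1 / 4" using n n0 by (simp add: field_simps)
   finally have "\<bar>2 * pi * pair_dot xe y\<bar> < pi / 2" by (simp add: abs_mult field_simps)
   then have "- (pi / 2) < 2 * pi * pair_dot xe y" "2 * pi * pair_dot xe y < pi / 2" by linarith+
   then show ?thesis by (rule cos_gt_zero_pi)
  qed
  have b0: "Re (?b y) >= 0" by (simp add: bump_def flat_exp_def)
  show "g y >= 0"
  proof (cases "norm y <= 1 / real n")
   case True then show ?thesis unfolding g_def using cpos b0 by simp
  next
   case False then show ?thesis unfolding g_def using supp_le_bump[OF n0] by (simp add: supp_le_def)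
  qed
  show "g y > 0" if "norm y < 1 / real n"
  proof -
   have "(real n * norm y) < 1" using that n0 by (simp add: field_simps)
   then have "(real n * norm y)^2 < 1" by (simp add: power_less_one_iff)
   then have "Re (?b y) > 0" by (simp add: bump_def flat_exp_def norm_vec2[symmetric] power_mult_distrib)
   then show ?thesis unfolding g_def using cpos that by simp
  qed
 qed
 have "(LINT y|lborel. g y) ~= 0"
 proof
  assume "(LINT y|lborel. g y) = 0"
  then have "AE y in lborel. g y = 0"
   using integral_nonneg_eq_0_iff_AE[OF gi] gpos by simp
  then have "AE y in lborel. y \<notin> ball (0::real^2) (1 / real n)"
  proof (rule eventually_mono, goal_cases)
   case (1 y)
   then show ?case using gpos0[of y] by auto
  qed
  then have "ball (0::real^2) (1 / real n) \<in> null_sets lborel"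
   by (subst AE_iff_null_sets) auto
  then have "negligible (ball (0::real^2) (1 / real n))" by (simp add: negligible_iff_null_sets null_sets_completionI)
  then show False using open_not_negligible[of "ball (0::real^2) (1 / real n)"] n0 by auto
 qed
 moreover have "Re (fhat ?b xe) = (LINT y|lborel. g y)"
  using integral_Re[OF fhat_integrable[OF int, of xe]] unfolding fhat_def by (simp only: Re)
 ultimately show ?thesis by auto
qed

text \<open>A countable family of test functions suffices for all nonzero frequencies, so that
  statements valid almost everywhere for each of them hold simultaneously outside one null
  set.\<close>

lemma exists_fhat_nonzero:
 assumes "xe ~= (0,0)"
 shows "\<exists>n i. fhat (dd (axis i 1) (bump ((real (Suc n))^2))) xe ~= 0"
proof -
 obtain n where n: "real n > 4 * (\<bar>fst xe\<bar> + \<bar>snd xe\<bar>)" using reals_Archimedean2 by blast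
 then have nz: "fhat (bump ((real (Suc n))^2)) xe ~= 0" by (intro fhat_bump_nonzero) simp
 have "pair_dot xe (axis 1 1) = fst xe" "pair_dot xe (axis 2 1) = snd xe"
  by (simp_all add: pair_dot_def axis_def)
 then obtain i where "pair_dot xe (axis i 1) ~= 0"
  using assms by (metis prod.collapse)
 then have "fhat (dd (axis i 1) (bump ((real (Suc n))^2))) xe ~= 0"
  using nz by (subst fhat_dd[OF Ck_bump[of "Suc 0"] supp_le_bump]) auto
 then show ?thesis by blast
qed

section \<open>Fourier expansion of Siegel--Veech transforms\<close>

text \<open>The inverse of the matrix part applied to the column \<open>n\<close>: the point of the
  dual lattice whose pairings with the two rows are the coordinates of \<open>n\<close>, see
  \<open>pair_dot_eta\<close>.\<close>

definition eta :: "int \<times> int => saff => R2" where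
 "eta n h = (of_int (fst n) * fst h $ 2 $ 2 - of_int (snd n) * fst h $ 1 $ 2,
       of_int (snd n) * fst h $ 1 $ 1 - of_int (fst n) * fst h $ 2 $ 1)"

definition th :: "(real^2 => complex) => int \<times> int => saff => complex" where
 "th f n h = fhat f (eta n h) * e_fun (pair_dot (eta n h) (snd h))"

definition smul :: "int => int \<times> int => int \<times> int" where
 "smul k n = (k * fst n,k * snd n)"

lemma pair_dot_eta:
 assumes "h \<in> SAff"
 shows "pair_dot (eta n h) (fst h $ 1) = of_int (fst n)" "pair_dot (eta n h) (fst h $ 2) = of_int (snd n)"
proof -
 have d: "fst h $ 1 $ 1 * fst h $ 2 $ 2 - fst h $ 1 $ 2 * fst h $ 2 $ 1 = 1"
  using assms by (cases h) (auto simp: SAff_def det_2)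
 have "pair_dot (eta n h) (fst h $ 1) = of_int (fst n) * (fst h $ 1 $ 1 * fst h $ 2 $ 2 - fst h $ 1 $ 2 * fst h $ 2 $ 1)"
  "pair_dot (eta n h) (fst h $ 2) = of_int (snd n) * (fst h $ 1 $ 1 * fst h $ 2 $ 2 - fst h $ 1 $ 2 * fst h $ 2 $ 1)"
  unfolding pair_dot_def eta_def by (simp_all add: algebra_simps)
 then show "pair_dot (eta n h) (fst h $ 1) = of_int (fst n)" "pair_dot (eta n h) (fst h $ 2) = of_int (snd n)"
  unfolding d by simp_all
qed

text \<open>The lattice spanned by the rows divided by \<open>M\<close> has covolume
  \<open>1 / M^2\<close>, and its dual is \<open>M\<close> times the dual of the row lattice.
  Poisson summation thus yields the factor \<open>M^2\<close> and only the frequencies divisible by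
  \<open>M\<close>.\<close>

lemma SV_expansion:
 assumes f: "!!k. Ck k f" and R: "supp_le R f" and M: "M >= 1" and h: "h \<in> SAff"
 shows "integrable (cU) (%n. th f (smul (int M) n) h)"
  and "SV_rel M f h = (of_nat M)^2 * (LINT n|cU. th f (smul (int M) n) h)"
proof -
 define A B w where "A = (1 / real M) *\<^sub>R (fst h $ 1)" and "B = (1 / real M) *\<^sub>R (fst h $ 2)" and "w = snd h"
 have d: "fst h $ 1 $ 1 * fst h $ 2 $ 2 - fst h $ 1 $ 2 * fst h $ 2 $ 1 = 1"
  using h by (cases h) (auto simp: SAff_def det_2)
 have "A$1 * B$2 - A$2 * B$1 = (1 / real M)^2 * (fst h $ 1 $ 1 * fst h $ 2 $ 2 - fst h $ 1 $ 2 * fst h $ 2 $ 1)"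
  unfolding A_def B_def by (simp add: power2_eq_square algebra_simps)
 then have de: "A$1 * B$2 - A$2 * B$1 = (1 / real M)^2" unfolding d by simp
 then have de0: "A$1 * B$2 - A$2 * B$1 ~= 0" using M by simp
 define e where "e n = eta (smul (int M) n) h" for n
 have eA: "pair_dot (e n) A = of_int (fst n)" "pair_dot (e n) B = of_int (snd n)" for n
  unfolding e_def A_def B_def using M by (simp_all add: pair_dot_scale pair_dot_eta[OF h] smul_def)
 define F where "F x = f (fst x *\<^sub>R A + snd x *\<^sub>R B + w)" for x
 have cf: "continuous_on UNIV f" by (rule Ck_continuous[OF f])
 have [measurable]: "f \<in> bmble borel" using cf by (rule bmble_cont)
 have fi: "integrable lborel f" by (rule supp_integrable[OF cf R])
 have coef: "(LINT x|lborel. F x * chr (- n) x) = (of_nat M)^2 * th f (smul (int M) n) h" for n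
 proof -
  have "(LINT x|lborel. F x * chr (- n) x) = (LINT x|lborel. (%y. f y * e_fun (- pair_dot (e n) y) * e_fun (pair_dot (e n) w)) (fst x *\<^sub>R A + snd x *\<^sub>R B + w))"
  proof (rule lint_cong[OF refl], goal_cases)
   case (1 x)
   have "chr (- n) x = e_fun (- pair_dot (e n) (fst x *\<^sub>R A + snd x *\<^sub>R B + w) + pair_dot (e n) w)"
    unfolding chr_def pair_dot_add pair_dot_scale eA by (simp add: algebra_simps)
   then show ?case
    unfolding F_def e_fun_add by (simp add: mult.assoc)
  qed
  also have "... = of_real (1 / \<bar>A$1 * B$2 - A$2 * B$1\<bar>) * (LINT y|lborel. f y * e_fun (- pair_dot (e n) y) * e_fun (pair_dot (e n) w))"
   by (rule integral_plane_vec(1)[OF _ de0]) measurable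
  also have "... = (of_nat M)^2 * th f (smul (int M) n) h"
   unfolding de th_def fhat_def e_def[symmetric] w_def[symmetric] by (simp add: power_divide)
  finally show ?thesis .
 qed
 obtain C where C: "C >= 0" "!!xe. norm (fhat f xe) * ((1 + (pair_dot xe A)^2) * (1 + (pair_dot xe B)^2)) <= C"
  using fhat_decay[OF f R] by blast
 show int: "integrable (cU) (%n. th f (smul (int M) n) h)"
 proof (rule intble_bound[OF integrable_mult_right[OF integrable_inverse_squares_int2, of C]])
  have "norm (th f (smul (int M) n) h) <= C * (1 / ((1 + (roi (fst n))^2) * (1 + (roi (snd n))^2)))" for n
  proof -
   have "(1 + (roi (fst n))^2) * (1 + (roi (snd n))^2) > 0"
    by (intro mult_pos_pos add_pos_nonneg) auto
   then show ?thesis using C(2)[of "e n"] unfolding eA th_def e_def[symmetric] by (simp add: norm_mult field_simps)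
  qed
  then show "AE n in cU. norm (th f (smul (int M) n) h) <= norm (C * (1 / ((1 + (roi (fst n))^2) * (1 + (roi (snd n))^2))))"
   by (intro AE_I2) (metis abs_ge_self order_trans real_norm_def)
 qed simp
 have bnd: "\<exists>K. \<forall>x. \<bar>fst x\<bar> > K \<or> \<bar>snd x\<bar> > K \<longrightarrow> F x = 0"
 proof -
  \<comment> \<open>Cramer's rule: the coordinates of \<open>z\<close> in the basis
    \<open>A\<close>, \<open>B\<close> are cross products divided by the determinant
    \<open>(1 / M)^2\<close>, and \<open>z\<close> lies within \<open>\<bar>R\<bar> + norm w\<close>
    of the origin.\<close>
  define K where "K = (real M)^2 * ((\<bar>R\<bar> + norm w) * (norm A + norm B) * 2)"
  have "\<bar>fst x\<bar> <= K \<and> \<bar>snd x\<bar> <= K" if Fx: "F x ~= 0" for x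
  proof -
   define z where "z = fst x *\<^sub>R A + snd x *\<^sub>R B"
   have "norm (z + w) <= R" using R Fx unfolding F_def supp_le_def z_def by (meson not_less)
   then have z: "norm z <= \<bar>R\<bar> + norm w" using norm_triangle_ineq4[of "z + w" w] by simp
   have zc: "\<bar>z $ i\<bar> <= \<bar>R\<bar> + norm w" for i using component_le_norm_cart[of z i] z by linarith
   have "z$1 * B$2 - z$2 * B$1 = fst x * (A$1 * B$2 - A$2 * B$1)" "A$1 * z$2 - A$2 * z$1 = snd x * (A$1 * B$2 - A$2 * B$1)"
    unfolding z_def by (simp_all add: algebra_simps)
   then have x: "fst x = (real M)^2 * (z$1 * B$2 - z$2 * B$1)" "snd x = (real M)^2 * (A$1 * z$2 - A$2 * z$1)"
    unfolding de using M by (simp_all add: power_divide field_simps)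
   have est: "\<bar>u * b - v * a\<bar> <= (\<bar>R\<bar> + norm w) * (norm A + norm B) * 2" if "\<bar>u\<bar> <= \<bar>R\<bar> + norm w" "\<bar>v\<bar> <= \<bar>R\<bar> + norm w" "\<bar>a\<bar> <= norm A + norm B" "\<bar>b\<bar> <= norm A + norm B" for u v a b
   proof -
    have "\<bar>u * b - v * a\<bar> <= \<bar>u\<bar> * \<bar>b\<bar> + \<bar>v\<bar> * \<bar>a\<bar>" by (metis abs_mult abs_triangle_ineq4)
    also have "... <= (\<bar>R\<bar> + norm w) * (norm A + norm B) + (\<bar>R\<bar> + norm w) * (norm A + norm B)"
     using that by (intro add_mono mult_mono) auto
    finally show ?thesis by simp
   qed
   have comp: "\<bar>A $ i\<bar> <= norm A + norm B" "\<bar>B $ i\<bar> <= norm A + norm B" for i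
    using component_le_norm_cart[of A i] component_le_norm_cart[of B i] norm_ge_zero[of A] norm_ge_zero[of B] by linarith+
   show ?thesis unfolding x K_def abs_mult
    using est[OF zc[of 1] zc[of 2] comp(2)[of 1] comp(2)[of 2]] est[OF zc[of 2] zc[of 1] comp(1)[of 2] comp(1)[of 1]]
    by (auto intro!: mult_left_mono simp: mult.commute)
  qed
  then show ?thesis by (meson not_less)
 qed
 then obtain K where K: "!!x. \<bar>fst x\<bar> > K \<or> \<bar>snd x\<bar> > K ==> F x = 0" by blast
 have "SV_rel M f h = (\<Sum>\<^sub>\<infinity>n. F (iota n))"
  unfolding SV_rel_def F_def A_def B_def w_def iota_def
  by (intro infsum_cong) (auto simp: scaleR_add_right mult.commute add.commute split: prod.splits)
 also have "... = (LINT n|cU. (LINT x|lborel. F x * chr (- n) x))"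
 proof (rule poisson_summation[OF _ K])
  show "continuous_on UNIV F" unfolding F_def by (intro continuous_on_compose2[OF cf] continuous_intros) auto
  show "integrable lborel F" unfolding F_def by (rule integral_plane_vec(2)[OF _ de0 fi]) measurable
  show "integrable (cU) (%n. LINT x|lborel. F x * chr (- n) x)"
   unfolding coef using int by simp
 qed
 finally show "SV_rel M f h = (of_nat M)^2 * (LINT n|cU. th f (smul (int M) n) h)"
  unfolding coef by simp
qed

section \<open>The affine group in coordinates\<close>

abbreviation ga :: "saff => real" where "ga h \<equiv> fst h $ 1 $ 1"
abbreviation gb :: "saff => real" where "gb h \<equiv> fst h $ 1 $ 2"
abbreviation gc :: "saff => real" where "gc h \<equiv> fst h $ 2 $ 1"
abbreviation gd :: "saff => real" where "gd h \<equiv> fst h $ 2 $ 2"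
abbreviation gp :: "saff => real" where "gp h \<equiv> snd h $ 1"
abbreviation gq :: "saff => real" where "gq h \<equiv> snd h $ 2"

definition saff_of :: "real => real => real => real => real => real => saff" where
 "saff_of a b c d p q = (\<chi> i. if i = 1 then mkv (a,b) else mkv (c,d),mkv (p,q))"

lemma saff_of_comps[simp]:
 "ga (saff_of a b c d p q) = a" "gb (saff_of a b c d p q) = b" "gc (saff_of a b c d p q) = c"
 "gd (saff_of a b c d p q) = d" "gp (saff_of a b c d p q) = p" "gq (saff_of a b c d p q) = q"
 by (auto simp: saff_of_def)

lemma saff_eqI:
 assumes "ga x = ga y" "gb x = gb y" "gc x = gc y" "gd x = gd y" "gp x = gp y" "gq x = gq y"
 shows "x = y"
 using assms by (cases x; cases y) (auto simp: vec_eq_iff forall_2)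

lemma mul_comps[simp]:
 "ga (mul x y) = ga x * ga y + gb x * gc y" "gb (mul x y) = ga x * gb y + gb x * gd y"
 "gc (mul x y) = gc x * ga y + gd x * gc y" "gd (mul x y) = gc x * gb y + gd x * gd y"
 "gp (mul x y) = gp x * ga y + gq x * gc y + gp y" "gq (mul x y) = gp x * gb y + gq x * gd y + gq y"
 by (auto simp: saff_mult_def matrix_matrix_mult_def vector_matrix_mult_def sum_2 mult.commute)

lemma saff_mult_eq: "mul x y = saff_of (ga x * ga y + gb x * gc y) (ga x * gb y + gb x * gd y)
 (gc x * ga y + gd x * gc y) (gc x * gb y + gd x * gd y) (gp x * ga y + gq x * gc y + gp y) (gp x * gb y + gq x * gd y + gq y)"
 by (rule saff_eqI) simp_all

lemma SAff_iff: "h \<in> SAff \<longleftrightarrow> ga h * gd h - gb h * gc h = 1"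
 by (cases h) (auto simp: SAff_def det_2)

lemma SAff_int_iff: "h \<in> SAff_int \<longleftrightarrow> h \<in> SAff \<and> ga h \<in> \<int> \<and> gb h \<in> \<int> \<and> gc h \<in> \<int> \<and> gd h \<in> \<int> \<and> gp h \<in> \<int> \<and> gq h \<in> \<int>"
 by (cases h) (auto simp: SAff_int_def SAff_def forall_2)

definition saff_one :: saff where "saff_one = saff_of 1 0 0 1 0 0"

definition saff_inv :: "saff => saff" where
 "saff_inv h = saff_of (gd h) (- gb h) (- gc h) (ga h) (gq h * gc h - gp h * gd h) (gp h * gb h - gq h * ga h)"

lemma saff_inv_comps[simp]:
 "ga (saff_inv h) = gd h" "gb (saff_inv h) = - gb h" "gc (saff_inv h) = - gc h" "gd (saff_inv h) = ga h"
 "gp (saff_inv h) = gq h * gc h - gp h * gd h" "gq (saff_inv h) = gp h * gb h - gq h * ga h"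
 by (simp_all add: saff_inv_def)

lemma saff_one_comps[simp]: "ga saff_one = 1" "gb saff_one = 0" "gc saff_one = 0" "gd saff_one = 1" "gp saff_one = 0" "gq saff_one = 0"
 by (simp_all add: saff_one_def)

lemma mul_assoc: "mul (mul x y) z = mul x (mul y z)"
 by (rule saff_eqI) (simp_all add: algebra_simps)

lemma mul_one[simp]: "mul saff_one x = x" "mul x saff_one = x"
 by (rule saff_eqI; simp)+

lemma saff_one_in[simp]: "saff_one \<in> SAff" "saff_one \<in> SAff_int"
 by (simp_all add: SAff_int_iff SAff_iff)

lemma mul_in[intro]:
 assumes "x \<in> SAff" "y \<in> SAff" shows "mul x y \<in> SAff"
proof -
 have "ga (mul x y) * gd (mul x y) - gb (mul x y) * gc (mul x y) = (ga x * gd x - gb x * gc x) * (ga y * gd y - gb y * gc y)"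
  by (simp add: algebra_simps)
 then show ?thesis using assms by (simp only: SAff_iff)
qed

lemma saff_inv_in[intro]: "x \<in> SAff ==> saff_inv x \<in> SAff"
 by (simp add: SAff_iff mult.commute)

lemma mul_inv:
 assumes "x \<in> SAff" shows "mul x (saff_inv x) = saff_one" "mul (saff_inv x) x = saff_one"
proof -
 have d: "ga x * gd x - gb x * gc x = 1" using assms by (simp add: SAff_iff)
 then have d1: "ga x * gd x = 1 + gb x * gc x" by simp
 show "mul x (saff_inv x) = saff_one"
  using d by (intro saff_eqI) (simp_all add: algebra_simps)
 have 1: "(gq x * gc x - gp x * gd x) * ga x + (gp x * gb x - gq x * ga x) * gc x + gp x = gp x * (1 - (ga x * gd x - gb x * gc x))"
  by (simp add: algebra_simps)
 have 2: "(gq x * gc x - gp x * gd x) * gb x + (gp x * gb x - gq x * ga x) * gd x + gq x = gq x * (1 - (ga x * gd x - gb x * gc x))"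
  by (simp add: algebra_simps)
 show "mul (saff_inv x) x = saff_one"
  using d 1 2 by (intro saff_eqI) (simp_all add: algebra_simps)
qed

lemma saff_inv_cancel: "x \<in> SAff ==> mul (saff_inv x) (mul x y) = y" "x \<in> SAff ==> mul x (mul (saff_inv x) y) = y"
 by (simp_all add: mul_assoc[symmetric] mul_inv)

lemma saff_inv_cancel_right: "x \<in> SAff ==> mul (mul y x) (saff_inv x) = y" "x \<in> SAff ==> mul (mul y (saff_inv x)) x = y"
 by (simp_all add: mul_assoc mul_inv)

lemma saff_inv_inv: "x \<in> SAff ==> saff_inv (saff_inv x) = x"
proof -
 assume x: "x \<in> SAff"
 then have "mul (saff_inv (saff_inv x)) (mul (saff_inv x) x) = x" by (intro saff_inv_cancel saff_inv_in)
 then show ?thesis using x by (simp add: mul_inv)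
qed

lemma saff_inv_mult:
 assumes "x \<in> SAff" "y \<in> SAff"
 shows "saff_inv (mul x y) = mul (saff_inv y) (saff_inv x)"
proof -
 have "mul (mul (saff_inv y) (saff_inv x)) (mul x y) = saff_one"
  using assms by (simp add: mul_assoc saff_inv_cancel mul_inv)
 then have "mul (mul (mul (saff_inv y) (saff_inv x)) (mul x y)) (saff_inv (mul x y)) = saff_inv (mul x y)" by simp
 then show ?thesis using assms by (simp add: saff_inv_cancel_right mul_in)
qed

lemma SAff_int_sub: "x \<in> SAff_int ==> x \<in> SAff" by (simp add: SAff_int_iff)

lemma SAff_int_mult[intro]: "x \<in> SAff_int ==> y \<in> SAff_int ==> mul x y \<in> SAff_int"
 by (auto simp: SAff_int_iff mul_in simp del: mul_comps) (auto intro!: Ints_add Ints_mult)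

lemma SAff_int_inv[intro]: "x \<in> SAff_int ==> saff_inv x \<in> SAff_int"
 using saff_inv_in[of x] by (auto simp: SAff_int_iff intro!: Ints_diff Ints_mult)

definition saff_of_int :: "int \<times> int \<times> int \<times> int \<times> int \<times> int => saff" where
 "saff_of_int = (%(a,b,c,d,p,q). saff_of (of_int a) (of_int b) (of_int c) (of_int d) (of_int p) (of_int q))"

lemma SAff_int_obtain:
 assumes "h \<in> SAff_int"
 obtains a b c d p q where "h = saff_of_int (a,b,c,d,p,q)" "a * d - b * c = 1"
proof -
 obtain a b c d p q where *: "ga h = of_int a" "gb h = of_int b" "gc h = of_int c" "gd h = of_int d" "gp h = of_int p" "gq h = of_int q"
  using assms unfolding SAff_int_iff by (auto elim!: Ints_cases)
 have "of_int (a * d - b * c) = (1 :: real)" using assms * by (simp add: SAff_int_iff SAff_iff)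
 then have "a * d - b * c = 1" by linarith
 moreover have "h = saff_of_int (a,b,c,d,p,q)" by (rule saff_eqI) (auto simp: * saff_of_int_def)
 ultimately show ?thesis using that by blast
qed

lemma saff_of_int_in: "a * d - b * c = 1 ==> saff_of_int (a,b,c,d,p,q) \<in> SAff_int"
 unfolding SAff_int_iff SAff_iff saff_of_int_def by simp (metis of_int_1 of_int_diff of_int_mult)

lemma countable_SAff_int: "countable SAff_int"
proof (rule countable_subset)
 show "SAff_int \<subseteq> range saff_of_int" by (auto elim!: SAff_int_obtain)
qed simp

text \<open>Bounded parts of the group are measured by entries, so that lattice points can be
  counted directly and products and inverses have explicit bounds.\<close>

definition entries_le :: "real => saff => bool" where
 "entries_le R h \<longleftrightarrow> \<bar>ga h\<bar> <= R \<and> \<bar>gb h\<bar> <= R \<and> \<bar>gc h\<bar> <= R \<and> \<bar>gd h\<bar> <= R \<and> \<bar>gp h\<bar> <= R \<and> \<bar>gq h\<bar> <= R"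

lemma finite_SAff_int_bounded: "finite {h \<in> SAff_int. entries_le R h}"
proof -
 obtain N :: int where N: "R <= of_int N" using ex_le_of_int by blast
 define I where "I = {- N..N}"
 have "{h \<in> SAff_int. entries_le R h} \<subseteq> saff_of_int ` (I \<times> I \<times> I \<times> I \<times> I \<times> I)"
 proof
  fix h assume h: "h \<in> {h \<in> SAff_int. entries_le R h}"
  then obtain a b c d p q where e: "h = saff_of_int (a,b,c,d,p,q)" by (auto elim!: SAff_int_obtain)
  have *: "x \<in> I" if "\<bar>roi x\<bar> <= R" for x
  proof -
   have "roi x <= of_int N" "- roi x <= of_int N" using that N by linarith+
   then show ?thesis unfolding I_def by simp
  qed
  have "(a,b,c,d,p,q) \<in> I \<times> I \<times> I \<times> I \<times> I \<times> I"
   using h * unfolding e entries_le_def by (simp add: saff_of_int_def)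
  then show "h \<in> saff_of_int ` (I \<times> I \<times> I \<times> I \<times> I \<times> I)" unfolding e by blast
 qed
 then show ?thesis by (rule finite_subset) (auto simp: I_def)
qed

lemma entries_le_mult:
 assumes "entries_le R x" "entries_le S y"
 shows "entries_le (2 * R * S + S) (mul x y)"
proof -
 have RS: "R >= 0" "S >= 0" using assms abs_ge_zero order_trans unfolding entries_le_def by blast+
 have *: "\<bar>u * v + u' * v'\<bar> <= 2 * R * S" if "\<bar>u\<bar> <= R" "\<bar>u'\<bar> <= R" "\<bar>v\<bar> <= S" "\<bar>v'\<bar> <= S" for u v u' v'
 proof -
  have "\<bar>u * v + u' * v'\<bar> <= \<bar>u\<bar> * \<bar>v\<bar> + \<bar>u'\<bar> * \<bar>v'\<bar>" by (metis abs_mult abs_triangle_ineq)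
  also have "... <= R * S + R * S" using that RS by (intro add_mono mult_mono) auto
  finally show ?thesis by simp
 qed
 have **: "\<bar>u * v + u' * v' + w\<bar> <= 2 * R * S + S" if "\<bar>u\<bar> <= R" "\<bar>u'\<bar> <= R" "\<bar>v\<bar> <= S" "\<bar>v'\<bar> <= S" "\<bar>w\<bar> <= S" for u v u' v' w
  using *[OF that(1-4)] that(5) by linarith
 have ***: "\<bar>u * v + u' * v'\<bar> <= 2 * R * S + S" if "\<bar>u\<bar> <= R" "\<bar>u'\<bar> <= R" "\<bar>v\<bar> <= S" "\<bar>v'\<bar> <= S" for u v u' v'
  using *[OF that(1-4)] RS by linarith
 show ?thesis using assms unfolding entries_le_def mul_comps by (auto intro!: ** ***)
qed

lemma entries_le_inv:
 assumes "entries_le R x" shows "entries_le (2 * R * R + R) (saff_inv x)"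
proof -
 have R: "R >= 0" using assms abs_ge_zero order_trans unfolding entries_le_def by blast
 have le: "R <= 2 * R * R + R" using R by simp
 have *: "\<bar>u * v - u' * v'\<bar> <= 2 * R * R + R" if "\<bar>u\<bar> <= R" "\<bar>u'\<bar> <= R" "\<bar>v\<bar> <= R" "\<bar>v'\<bar> <= R" for u v u' v'
 proof -
  have "\<bar>u * v - u' * v'\<bar> <= \<bar>u\<bar> * \<bar>v\<bar> + \<bar>u'\<bar> * \<bar>v'\<bar>" by (metis abs_mult abs_triangle_ineq4)
  also have "... <= R * R + R * R" using that R by (intro add_mono mult_mono) auto
  finally show ?thesis using R by simp
 qed
 show ?thesis using assms le unfolding entries_le_def saff_inv_comps by (auto intro!: * intro: order_trans)
qed

text \<open>A Heisenberg group: \<open>x\<close> is the shear, \<open>(p, u)\<close> the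
  translation, and by \<open>el_mult\<close> the parameter \<open>u\<close> is central. The pure
  translations \<open>tr\<close> form the torus directions.\<close>

definition el :: "real => real => real => saff" where "el x p u = saff_of 1 x 0 1 p u"

abbreviation tr :: "R2 => saff" where "tr s \<equiv> el 0 (fst s) (snd s)"

text \<open>The diagonal and rotation factors of the Iwasawa decomposition: if \<open>xe\<close> has
  radius r and angle t, this is diag(1/r, r) times the rotation by t.\<close>

definition ss :: "R2 => saff" where
 "ss xe = saff_of (fst xe / ((fst xe)^2 + (snd xe)^2)) (snd xe / ((fst xe)^2 + (snd xe)^2)) (- snd xe) (fst xe) 0 0"

text \<open>A complete invariant of left cosets of the unipotent group. The sign is chosen so that
  \<open>xi h\<close> equals \<open>eta (1,0) h\<close>, the frequency of the first
  character.\<close>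

definition xi :: "saff => R2" where "xi h = (gd h,- gc h)"

definition kap :: "(real \<times> real \<times> real) \<times> (R2) => saff" where
 "kap = (%((x,p,u),xe). mul (el x p u) (ss xe))"

abbreviation kt where "kt t v == kap ((t::real,0::real,0::real),v)"
abbreviation ks where "ks t s v == kap ((t,fst s,snd s),v)"

definition crd :: "saff => real \<times> real \<times> real" where
 "crd h = ((ga h * gc h + gb h * gd h) / ((gd h)^2 + (gc h)^2),gp h * gd h - gq h * gc h,
  (gp h * gc h + gq h * gd h) / ((gd h)^2 + (gc h)^2))"

lemma el_comps[simp]: "ga (el x p u) = 1" "gb (el x p u) = x" "gc (el x p u) = 0" "gd (el x p u) = 1" "gp (el x p u) = p" "gq (el x p u) = u"
 by (simp_all add: el_def)

lemma ss_comps[simp]: "ga (ss xe) = fst xe / ((fst xe)^2 + (snd xe)^2)" "gb (ss xe) = snd xe / ((fst xe)^2 + (snd xe)^2)"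
 "gc (ss xe) = - snd xe" "gd (ss xe) = fst xe" "gp (ss xe) = 0" "gq (ss xe) = 0"
 by (simp_all add: ss_def)

lemma el_in[simp]: "el x p u \<in> SAff" by (simp add: SAff_iff)

lemma pair_nonzero_sq: "xe ~= (0,0) ==> (fst xe)^2 + (snd xe)^2 > (0::real)"
 by (cases xe) (auto simp: sum_power2_gt_zero_iff)

lemma ss_in: "xe ~= (0,0) ==> ss xe \<in> SAff"
 using pair_nonzero_sq[of xe] by (cases xe) (auto simp: SAff_iff power2_eq_square add_divide_distrib[symmetric])

lemma el_mult: "mul (el x p u) (el x' p' u') = el (x + x') (p + p') (p * x' + u + u')"
 by (rule saff_eqI) simp_all

lemma el_inv: "saff_inv (el x p u) = el (- x) (- p) (p * x - u)"
 by (rule saff_eqI) simp_all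

lemma el_0: "el 0 0 0 = saff_one" by (rule saff_eqI) simp_all

lemma xi_nonzero: "h \<in> SAff ==> xi h ~= (0,0)"
 by (auto simp: SAff_iff xi_def)

lemma kap_in: "xe ~= (0,0) ==> kap (v,xe) \<in> SAff"
 unfolding kap_def by (cases v) (auto intro: ss_in)

lemma xi_kap[simp]: "xi (kap (v,xe)) = xe"
 by (cases v; cases xe) (simp add: xi_def kap_def)

lemma xi_el[simp]: "xi (mul (el x p u) h) = xi h"
 by (simp add: xi_def)

lemma kap_crd:
 assumes "h \<in> SAff" shows "kap (crd h,xi h) = h"
proof -
 define N where "N = (gd h)^2 + (gc h)^2"
 have N: "N ~= 0" using pair_nonzero_sq[OF xi_nonzero[OF assms]] by (auto simp: xi_def N_def)
 have d: "ga h * gd h - gb h * gc h = 1" using assms by (simp add: SAff_iff)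
 have a: "gd h + (ga h * gc h + gb h * gd h) * gc h = ga h * N" (is "?l = _")
 proof -
  have "?l = gd h * (1 - (ga h * gd h - gb h * gc h)) + ga h * N" by (simp add: N_def power2_eq_square algebra_simps)
  then show ?thesis by (simp add: d)
 qed
 have b: "- gc h + (ga h * gc h + gb h * gd h) * gd h = gb h * N" (is "?l = _")
 proof -
  have "?l = - gc h * (1 - (ga h * gd h - gb h * gc h)) + gb h * N" by (simp add: N_def power2_eq_square algebra_simps)
  then show ?thesis by (simp add: d)
 qed
 have p: "(gp h * gd h - gq h * gc h) * gd h + (gp h * gc h + gq h * gd h) * gc h = gp h * N"
  by (simp add: N_def power2_eq_square algebra_simps)
 have q: "(gp h * gd h - gq h * gc h) * (- gc h) + (gp h * gc h + gq h * gd h) * gd h = gq h * N"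
  by (simp add: N_def power2_eq_square algebra_simps)
 show ?thesis unfolding kap_def crd_def xi_def case_prod_conv
  by (rule saff_eqI) (use N a b p q in \<open>simp_all add: N_def[symmetric] add_divide_distrib[symmetric] divide_simps\<close>)
qed

lemma crd_kap:
 assumes "xe ~= (0,0)" shows "crd (kap (v,xe)) = v"
proof -
 obtain x p u where v: "v = (x,p,u)" by (cases v) auto
 define N where "N = (fst xe)^2 + (snd xe)^2"
 have N: "N ~= 0" using pair_nonzero_sq[OF assms] by (auto simp: N_def)
 show ?thesis unfolding v kap_def crd_def
  by (simp add: N_def[symmetric]) (simp add: divide_simps N, simp add: N_def power2_eq_square algebra_simps)
qed

lemma kap_el: "mul (el x' p' u') (kap ((x,p,u),xe)) = kap ((x' + x,p' + p,p' * x + u' + u),xe)"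
 by (simp add: kap_def mul_assoc[symmetric] el_mult)

text \<open>Angles are counted in full turns, so that integrals over the rotation group are
  integrals over \<open>I01\<close> and its characters are given by \<open>e_fun\<close>.\<close>

definition rot :: "real => saff" where
 "rot tt = saff_of (cos (2 * pi * tt)) (sin (2 * pi * tt)) (- sin (2 * pi * tt)) (cos (2 * pi * tt)) 0 0"

lemma rot_comps[simp]: "ga (rot tt) = cos (2 * pi * tt)" "gb (rot tt) = sin (2 * pi * tt)" "gc (rot tt) = - sin (2 * pi * tt)"
 "gd (rot tt) = cos (2 * pi * tt)" "gp (rot tt) = 0" "gq (rot tt) = 0"
 by (simp_all add: rot_def)

lemma rot_in[simp]: "rot tt \<in> SAff"
 by (simp add: SAff_iff power2_eq_square[symmetric])

lemma rot_add: "mul (rot tt) (rot tt') = rot (tt + tt')"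
 by (rule saff_eqI) (simp_all add: distrib_left cos_add sin_add algebra_simps)

lemma rot_0: "rot 0 = saff_one" by (rule saff_eqI) simp_all

lemma rot_1: "rot (tt + 1) = rot tt"
 by (rule saff_eqI) (simp_all add: distrib_left)

definition rotp :: "real => R2 => R2" where
 "rotp tt xe = (fst xe * cos (2 * pi * tt) - snd xe * sin (2 * pi * tt),fst xe * sin (2 * pi * tt) + snd xe * cos (2 * pi * tt))"

lemma rotp_norm: "(fst (rotp tt xe))^2 + (snd (rotp tt xe))^2 = (fst xe)^2 + (snd xe)^2"
proof -
 have "(a * c - b * s)^2 + (a * s + b * c)^2 = (a^2 + b^2) * (s^2 + c^2)" for a b s c :: real
  by (simp add: power2_eq_square algebra_simps)
 from this[of "fst xe" "cos (2 * pi * tt)" "snd xe" "sin (2 * pi * tt)"] show ?thesis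
  unfolding rotp_def by simp
qed

lemma ss_rot: "mul (ss xe) (rot tt) = ss (rotp tt xe)"
 unfolding saff_eqI
 by (rule saff_eqI; simp only: ss_comps rotp_norm mul_comps rot_comps; simp add: rotp_def field_simps diff_divide_distrib add_divide_distrib)

lemma kap_rot: "mul (kap (v,xe)) (rot tt) = kap (v,rotp tt xe)"
 by (cases v) (simp add: kap_def mul_assoc ss_rot)

section \<open>Measurability\<close>

lemma continuous_saff_of: "continuous_on UNIV (%(a,b,c,d,p,q). saff_of a b c d p q)"
 unfolding saff_of_def mkv_def case_prod_unfold fst_conv snd_conv
proof (intro continuous_on_Pair continuous_on_vec_lambda)
 fix i :: 2
 show "continuous_on UNIV (%x. if i = 1 then fst x *\<^sub>R axis 1 1 + fst (snd x) *\<^sub>R axis 2 1 else fst (snd (snd x)) *\<^sub>R axis 1 1 + fst (snd (snd (snd x))) *\<^sub>R axis 2 1 :: real^2)"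
  by (cases "i = 1") (auto intro!: continuous_intros)
qed (intro continuous_intros)

lemma measurable_saff_of[measurable (raw)]:
 assumes [measurable]: "a \<in> bmble M" "b \<in> bmble M" "c \<in> bmble M" "d \<in> bmble M" "p \<in> bmble M" "q \<in> bmble M"
 shows "(%x. saff_of (a x) (b x) (c x) (d x) (p x) (q x)) \<in> bmble M"
proof -
 have "(%(a,b,c,d,p,q). saff_of a b c d p q) \<in> bmble borel"
  by (rule bmble_cont[OF continuous_saff_of])
 moreover have "(%x. (a x,b x,c x,d x,p x,q x)) \<in> bmble M" by measurable
 ultimately have "(%x. (%(a,b,c,d,p,q). saff_of a b c d p q) (a x,b x,c x,d x,p x,q x)) \<in> bmble M"
  using measurable_compose by blast
 then show ?thesis by simp
qed

lemma continuous_saff_comps: "continuous_on UNIV (%h::saff. fst h $ i $ j)" "continuous_on UNIV (%h::saff. snd h $ j)"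
 by (intro continuous_intros)+

lemma measurable_saff_comps[measurable (raw)]:
 assumes "f \<in> bmble M"
 shows "(%x. fst (f x :: saff) $ i $ j) \<in> bmble M" "(%x. snd (f x :: saff) $ j) \<in> bmble M"
 using measurable_compose[OF assms bmble_cont[OF continuous_saff_comps(1)]]
  measurable_compose[OF assms bmble_cont[OF continuous_saff_comps(2)]] by auto

lemma measurable_saff_mult[measurable (raw)]:
 assumes [measurable]: "f \<in> bmble M" "g \<in> bmble M"
 shows "(%x. mul (f x) (g x)) \<in> bmble M"
 unfolding saff_mult_eq by measurable

lemma measurable_saff_inv[measurable (raw)]:
 assumes [measurable]: "f \<in> bmble M"
 shows "(%x. saff_inv (f x)) \<in> bmble M"
 unfolding saff_inv_def by measurable

lemma measurable_el[measurable (raw)]: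
 assumes [measurable]: "x \<in> bmble M" "p \<in> bmble M" "u \<in> bmble M"
 shows "(%t. el (x t) (p t) (u t)) \<in> bmble M"
 unfolding el_def by measurable

lemma measurable_ss[measurable]: "ss \<in> bmble borel"
 unfolding ss_def by measurable

lemma measurable_rot[measurable]: "rot \<in> bmble borel"
 unfolding rot_def by measurable

lemma measurable_kap[measurable]: "kap \<in> bmble borel"
 unfolding kap_def case_prod_unfold by measurable

lemma measurable_xi[measurable]: "xi \<in> bmble borel"
 unfolding xi_def by measurable

lemma measurable_crd[measurable]: "crd \<in> bmble borel"
 unfolding crd_def by measurable

lemma measurable_rotp[measurable]: "rotp tt \<in> bmble borel"
 unfolding rotp_def by measurable

lemma closed_SAff: "closed SAff"
proof -
 have "SAff = {h. ga h * gd h - gb h * gc h = 1}" by (auto simp: SAff_iff)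
 moreover have "closed {h::saff. ga h * gd h - gb h * gc h = 1}" by (intro closed_Collect_eq continuous_intros)
 ultimately show ?thesis by simp
qed

lemma sets_SAff[measurable]: "SAff \<in> sets borel" using closed_SAff by simp

lemma compact_entries_le: "compact {h \<in> SAff. entries_le R h}"
proof -
 have "bounded {h :: saff. entries_le R h}"
 proof (rule boundedI)
  fix h :: saff assume h: "h \<in> {h. entries_le R h}"
  have "norm h <= norm (fst h) + norm (snd h)" by (metis norm_Pair_le prod.collapse)
  also have "... <= (norm (fst h $ 1) + norm (fst h $ 2)) + (norm (snd h $ 1) + norm (snd h $ 2))"
   using norm_le_l1_cart[of "snd h"] L2_set_le_sum[of UNIV "%i. norm (fst h $ i)"] by (intro add_mono) (auto simp: sum_2 norm_vec_def)
  also have "norm (fst h $ 1) <= \<bar>ga h\<bar> + \<bar>gb h\<bar>" using norm_le_l1_cart[of "fst h $ 1"] by (simp add: sum_2)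
  also have "norm (fst h $ 2) <= \<bar>gc h\<bar> + \<bar>gd h\<bar>" using norm_le_l1_cart[of "fst h $ 2"] by (simp add: sum_2)
  finally show "norm h <= 6 * R" using h by (simp add: entries_le_def)
 qed
 then have "bounded {h \<in> SAff. entries_le R h}" by (rule bounded_subset) auto
 moreover have "closed {h \<in> SAff. entries_le R h}"
  unfolding entries_le_def Collect_conj_eq
  using closed_SAff by (intro closed_Int closed_Collect_le continuous_intros) auto
 ultimately show ?thesis by (simp add: compact_eq_bounded_closed)
qed

lemma measurable_entries_le[measurable]: "Measurable.pred borel (entries_le R)"
 unfolding entries_le_def[abs_def] by measurable

section \<open>Haar measure in coordinates\<close>

lemma continuous_on_saff_mult[continuous_intros]:
 assumes "continuous_on S f" "continuous_on S g"
 shows "continuous_on S (%x. mul (f x) (g x))"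
proof -
 have "continuous_on S (%x. (%(a,b,c,d,p,q). saff_of a b c d p q)
  (ga (f x) * ga (g x) + gb (f x) * gc (g x),ga (f x) * gb (g x) + gb (f x) * gd (g x),
   gc (f x) * ga (g x) + gd (f x) * gc (g x),gc (f x) * gb (g x) + gd (f x) * gd (g x),
   gp (f x) * ga (g x) + gq (f x) * gc (g x) + gp (g x),gp (f x) * gb (g x) + gq (f x) * gd (g x) + gq (g x)))"
  by (intro continuous_on_compose2[OF continuous_saff_of] continuous_intros assms) auto
 then show ?thesis by (simp add: saff_mult_eq)
qed

definition mulU :: "real \<times> real \<times> real => real \<times> real \<times> real => real \<times> real \<times> real" where
 "mulU = (%(x,p,u) (x',p',u'). (x + x',p + p',p * x' + u + u'))"

definition invU :: "real \<times> real \<times> real => real \<times> real \<times> real" where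
 "invU = (%(x,p,u). (- x,- p,p * x - u))"

definition el3 :: "real \<times> real \<times> real => saff" where
 "el3 = (%(x,p,u). el x p u)"

lemma el3_in[simp]: "el3 v \<in> SAff" by (cases v) (simp add: el3_def)

lemma measurable_el3[measurable]: "el3 \<in> bmble borel"
 unfolding el3_def case_prod_unfold by measurable

lemma measurable_fst_comp[measurable (raw)]:
 fixes f :: "_ => 'a::second_countable_topology \<times> 'b::second_countable_topology"
 shows "f \<in> bmble M ==> (%x. fst (f x)) \<in> bmble M"
 by (erule measurable_compose) (intro bmble_cont continuous_intros)

lemma measurable_snd_comp[measurable (raw)]:
 fixes f :: "_ => 'a::second_countable_topology \<times> 'b::second_countable_topology"
 shows "f \<in> bmble M ==> (%x. snd (f x)) \<in> bmble M"
 by (erule measurable_compose) (intro bmble_cont continuous_intros)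

lemma measurable_mulU[measurable (raw)]:
 assumes [measurable]: "f \<in> bmble M" "g \<in> bmble M"
 shows "(%x. mulU (f x) (g x)) \<in> bmble M"
proof -
 have "(%z. mulU (fst z) (snd z)) \<in> bmble borel"
  unfolding mulU_def case_prod_unfold by (intro bmble_cont continuous_intros)
 moreover have "(%x. (f x,g x)) \<in> bmble M" by measurable
 ultimately have "(%x. mulU (fst (f x,g x)) (snd (f x,g x))) \<in> bmble M"
  using measurable_compose by blast
 then show ?thesis by simp
qed

lemma measurable_invU[measurable]: "invU \<in> bmble borel"
 unfolding invU_def case_prod_unfold by measurable

lemma el3_kap: "mul (el3 v) (kap (v',xe)) = kap (mulU v v',xe)"
 by (cases v; cases v') (simp add: el3_def mulU_def kap_el)

lemma el3_inv: "saff_inv (el3 v) = el3 (invU v)"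
 by (cases v) (simp add: el3_def invU_def el_inv)

lemma crd_el3: "h \<in> SAff ==> crd (mul (el3 v) h) = mulU v (crd h)"
 using el3_kap[of v "crd h" "xi h"] crd_kap[OF xi_nonzero, of h "mulU v (crd h)"] by (simp add: kap_crd)

lemma xi_el3[simp]: "xi (mul (el3 v) h) = xi h"
 by (cases v) (simp add: el3_def)

lemma nn_integral_space3:
 fixes f :: "real \<times> real \<times> real => ennreal"
 assumes [measurable]: "f \<in> bmble borel"
 shows "(NN v|lborel. f v) = (NN x|lborel. NN p|lborel. NN u|lborel. f (x,p,u))"
proof -
 have [measurable]: "f \<in> bmble (lborel \<otimes> lborel)" by (simp add: lborel_prod)
 have "(NN v|lborel. f v) = (NN x|lborel. NN y|lborel. f (x,y))"
  by (subst lborel.nn_integral_fst) (simp_all add: lborel_prod)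
 also have "... = (NN x|lborel. NN p|lborel. NN u|lborel. f (x,p,u))"
  by (intro nn_integral_cong nn_integral_plane(1)) measurable
 finally show ?thesis .
qed

lemma nn_integral_shift:
 fixes f :: "real => ennreal"
 shows "f \<in> bmble borel ==> (NN x|lborel. f (x + t)) = (NN x|lborel. f x)"
 using nn_integral_real_affine[of f 1 t] by (simp add: add.commute one_ennreal_def[symmetric])

lemma nn_integral_reflect:
 fixes f :: "real => ennreal"
 shows "f \<in> bmble borel ==> (NN x|lborel. f (t - x)) = (NN x|lborel. f x)"
 using nn_integral_real_affine[of f "-1" t] by (simp add: one_ennreal_def[symmetric])

lemma nn_integral_mulU:
 fixes f :: "real \<times> real \<times> real => ennreal"
 assumes [measurable]: "f \<in> bmble borel"
 shows "(NN v|lborel. f (mulU v v')) = (NN v|lborel. f v)"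
proof -
 obtain x' p' u' where v': "v' = (x',p',u')" by (cases v')
 have "(NN v|lborel. f (mulU v v')) = (NN x|lborel. NN p|lborel. NN u|lborel. f (x + x',p + p',u + (p * x' + u')))"
 proof -
  have "(%v. f (mulU v v')) \<in> bmble borel" by measurable
  from nn_integral_space3[OF this] show ?thesis by (simp add: mulU_def v' algebra_simps)
 qed
 also have "... = (NN x|lborel. NN p|lborel. NN u|lborel. f (x + x',p + p',u))"
  by (rule nn_integral_cong, rule nn_integral_cong, rule nn_integral_shift) measurable
 also have "... = (NN x|lborel. NN p|lborel. NN u|lborel. f (x + x',p,u))"
 proof (rule nn_integral_cong, goal_cases)
  case (1 x) show ?case
   by (rule nn_integral_shift[where f="%p. NN u|lborel. f (x + x',p,u)"]) measurable
 qed
 also have "... = (NN x|lborel. NN p|lborel. NN u|lborel. f (x,p,u))"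
  by (rule nn_integral_shift[where f="%x. NN p|lborel. NN u|lborel. f (x,p,u)"]) measurable
 also have "... = (NN v|lborel. f v)" by (rule nn_integral_space3[symmetric]) simp
 finally show ?thesis .
qed

lemma nn_integral_mulU_inv:
 fixes f :: "real \<times> real \<times> real => ennreal"
 assumes [measurable]: "f \<in> bmble borel"
 shows "(NN v|lborel. f (mulU (invU v) v')) = (NN v|lborel. f v)"
proof -
 obtain x' p' u' where v': "v' = (x',p',u')" by (cases v')
 have "(NN v|lborel. f (mulU (invU v) v')) = (NN x|lborel. NN p|lborel. NN u|lborel. f (x' - x,p' - p,(p * x - p * x' + u') - u))"
 proof -
  have "(%v. f (mulU (invU v) v')) \<in> bmble borel" by measurable
  from nn_integral_space3[OF this] show ?thesis by (simp add: mulU_def invU_def v' algebra_simps)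
 qed
 also have "... = (NN x|lborel. NN p|lborel. NN u|lborel. f (x' - x,p' - p,u))"
  by (rule nn_integral_cong, rule nn_integral_cong, rule nn_integral_reflect) measurable
 also have "... = (NN x|lborel. NN p|lborel. NN u|lborel. f (x' - x,p,u))"
 proof (rule nn_integral_cong, goal_cases)
  case (1 x) show ?case
   by (rule nn_integral_reflect[where f="%p. NN u|lborel. f (x' - x,p,u)"]) measurable
 qed
 also have "... = (NN x|lborel. NN p|lborel. NN u|lborel. f (x,p,u))"
  by (rule nn_integral_reflect[where f="%x. NN p|lborel. NN u|lborel. f (x,p,u)"]) measurable
 also have "... = (NN v|lborel. f v)" by (rule nn_integral_space3[symmetric]) simp
 finally show ?thesis .
qed

definition cube :: "(real \<times> real \<times> real) set" where "cube = {0..<1} \<times> {0..<1} \<times> {0..<1}"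

lemma sets_cube[measurable]: "cube \<in> sets borel"
 unfolding cube_def borel_prod[symmetric] by (intro pair_measureI) auto

lemma nn_integral_box3:
 assumes "a >= 0" "b >= 0" "c >= 0"
 shows "(NN v|lborel. ind ({0..<a} \<times> {0..<b} \<times> {0..<c::real}) v) = ennreal (a * b * c)"
proof -
 have [measurable]: "{0..<a} \<times> {0..<b} \<times> {0..<c} \<in> sets borel"
  unfolding borel_prod[symmetric] by (intro pair_measureI) auto
 show ?thesis
  by (subst nn_integral_space3) (use assms in \<open>simp_all add: indicator_times nn_integral_cmult nn_integral_multc ennreal_mult mult_ac\<close>)
qed

lemma nn_integral_cube: "(NN v|lborel. ind cube v) = 1"
 using nn_integral_box3[of 1 1 1] by (simp add: cube_def del: nn_integral_indicator)

text \<open>The measure lives on the whole ambient type, with null complement of the group, so that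
  measurability always refers to Borel sets. Invariance is assumed on the left only;
  \<open>nn_rot\<close> derives it for right rotations.\<close>

locale haar =
 fixes nu :: "saff measure"
 assumes sets_nu[measurable_cong]: "sets nu = sets borel"
  and nu_SAff: "emeasure nu (- SAff) = 0"
  and nu_left: "!!h. h \<in> SAff ==> distr nu borel (mul h) = nu"
  and nu_finite: "!!R. emeasure nu {h \<in> SAff. entries_le R h} < oo"
  and nu_nonzero: "emeasure nu UNIV ~= 0"
begin

lemma space_nu[simp]: "space nu = UNIV"
 using sets_eq_imp_space_eq[OF sets_nu] by simp

lemma AE_SAff: "AE h in nu. h \<in> SAff"
proof (rule AE_I)
 show "- SAff \<in> sets nu" unfolding sets_nu by (rule borel_comp[OF sets_SAff])
qed (use nu_SAff in auto)

lemma nn_left: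
 assumes [measurable]: "F \<in> bmble borel" and h: "h \<in> SAff"
 shows "(NN x|nu. F (mul h x)) = (NN x|nu. F x)"
proof -
 have "(NN x|nu. F x) = (NN x|distr nu borel (mul h). F x)" by (simp only: nu_left[OF h])
 also have "... = (NN x|nu. F (mul h x))" by (rule nn_integral_distr) measurable
 finally show ?thesis ..
qed

lemma exists_entries_le: "\<exists>n::nat. entries_le (real n) h"
proof -
 obtain n :: nat where "\<bar>ga h\<bar> + \<bar>gb h\<bar> + \<bar>gc h\<bar> + \<bar>gd h\<bar> + \<bar>gp h\<bar> + \<bar>gq h\<bar> <= real n" using real_arch_simple by blast
 then have "entries_le (real n) h" unfolding entries_le_def by linarith
 then show ?thesis ..
qed

lemma sigma_finite_nu: "sigma_finite_measure nu"
proof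
 have [measurable]: "{h \<in> SAff. entries_le R h} \<in> sets borel" for R by measurable
 have [measurable]: "- SAff \<in> sets borel" by (rule borel_comp[OF sets_SAff])
 show "\<exists>A. countable A \<and> A \<subseteq> sets nu \<and> \<Union> A = space nu \<and> (\<forall>a\<in>A. emeasure nu a ~= oo)"
 proof (intro exI[of _ "insert (- SAff) (range (%n::nat. {h \<in> SAff. entries_le (real n) h}))"] conjI ballI)
  show "\<Union> (insert (- SAff) (range (%n::nat. {h \<in> SAff. entries_le (real n) h}))) = space nu"
   using exists_entries_le by auto
  fix a assume "a \<in> insert (- SAff) (range (%n::nat. {h \<in> SAff. entries_le (real n) h}))"
  then show "emeasure nu a ~= oo" using nu_SAff nu_finite less_top by auto
 qed (auto simp: sets_nu)
qed

sublocale sigma_finite_measure nu by (rule sigma_finite_nu)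

text \<open>The quotient measure on cosets of the unipotent group: every coset is met in a piece of
  unipotent volume one, the unit cube of the coordinates \<open>crd\<close>.\<close>

definition lam :: "(R2) measure" where
 "lam = distr (density nu (%h. ind cube (crd h))) borel xi"

lemma sets_lam[measurable_cong, simp]: "sets lam = sets borel" and space_lam[simp]: "space lam = UNIV"
 by (auto simp: lam_def)

lemma nn_lam:
 assumes [measurable]: "f \<in> bmble borel"
 shows "(NN xe|lam. f xe) = (NN h|nu. ind cube (crd h) * f (xi h))"
 unfolding lam_def by (subst nn_integral_distr) (auto simp: nn_integral_density)

text \<open>The unipotent group acts freely on the left with section \<^const>\<open>ss\<close>, and its Haar measure is
 Lebesgue measure in the coordinates \<^const>\<open>el\<close>. As in the uniqueness proof for Haar measure,
 multiplying by a function of total mass one and translating gives the product decomposition.\<close>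

lemma nn_chart:
 assumes [measurable]: "F \<in> bmble borel"
 shows "(NN h|nu. F h) = (NN xe|lam. NN v|lborel. F (kap (v,xe)))"
proof -
 interpret P: pair_sigma_finite lborel nu ..
 have inv_kap: "mul (el3 (invU v)) h = kap (mulU (invU v) (crd h),xi h)" if "h \<in> SAff" for v h
  using el3_kap[of "invU v" "crd h" "xi h"] kap_crd[OF that] by simp
 have "(NN h|nu. F h) = (NN h|nu. F h * (NN v|lborel. ind cube (mulU v (crd h))))"
  using nn_integral_mulU[of "ind cube"] by (simp only: nn_integral_cube sets_cube borel_measurable_indicator) simp
 also have "... = (NN h|nu. NN v|lborel. F h * ind cube (mulU v (crd h)))"
  by (intro nn_integral_cong nn_integral_cmult[symmetric]) measurable
 also have "... = (NN v|lborel. NN h|nu. F h * ind cube (mulU v (crd h)))"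
  by (rule P.Fubini') measurable
 also have "... = (NN v|lborel. NN h|nu. F h * ind cube (crd (mul (el3 v) h)))"
 proof (rule nn_integral_cong, rule nn_integral_cong_AE, goal_cases)
  case (1 v) show ?case
   using AE_SAff by eventually_elim (simp add: crd_el3)
 qed
 also have "... = (NN v|lborel. NN h|nu. F (mul (el3 (invU v)) h) * ind cube (crd h))"
 proof (rule nn_integral_cong, goal_cases)
  case (1 v)
  have "(NN h|nu. F (mul (el3 (invU v)) h) * ind cube (crd h)) =
   (NN h|nu. F (mul (el3 (invU v)) (mul (el3 v) h)) * ind cube (crd (mul (el3 v) h)))"
   by (rule nn_left[OF _ el3_in, symmetric]) measurable
  then show ?case
   by (simp add: el3_inv[symmetric] saff_inv_cancel)
 qed
 also have "... = (NN h|nu. NN v|lborel. F (mul (el3 (invU v)) h) * ind cube (crd h))"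
  by (rule P.Fubini'[symmetric]) measurable
 also have "... = (NN h|nu. ind cube (crd h) * (NN v|lborel. F (kap (v,xi h))))"
 proof (rule nn_integral_cong_AE, use AE_SAff in eventually_elim, goal_cases)
  case h: (1 h)
  have "(NN v|lborel. F (mul (el3 (invU v)) h) * ind cube (crd h)) = ind cube (crd h) * (NN v|lborel. F (kap (mulU (invU v) (crd h),xi h)))"
   unfolding inv_kap[OF h] by (subst nn_integral_cmult[symmetric]) (auto simp: mult.commute)
  then show ?case
   using nn_integral_mulU_inv[of "%v. F (kap (v,xi h))" "crd h"] by simp
 qed
 also have "... = (NN xe|lam. NN v|lborel. F (kap (v,xe)))"
  by (rule nn_lam[symmetric]) measurable
 finally show ?thesis .
qed

lemma AE_lam_nonzero: "AE xe in lam. xe ~= (0,0)"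
proof -
 have m: "{xe. xe ~= (0::real,0::real)} \<in> sets borel" by (intro borel_open open_Collect_neq continuous_intros)
 have "(NN xe|lam. ind {(0,0)} xe) = (NN h|nu. ind cube (crd h) * ind {(0,0)} (xi h))"
  by (rule nn_lam) measurable
 also have "... = (NN h|nu. 0)"
  by (rule nn_integral_cong_AE, use AE_SAff in eventually_elim) (auto dest: xi_nonzero)
 finally have "emeasure lam {(0,0)} = 0" by simp
 then show ?thesis by (intro AE_I[where N="{(0,0)}"]) auto
qed

lemma entries_le_ss:
 assumes "r > 0" "r <= (fst xe)^2 + (snd xe)^2" "\<bar>fst xe\<bar> <= R" "\<bar>snd xe\<bar> <= R"
 shows "entries_le (R / r + R) (ss xe)"
proof -
 have R: "R >= 0" using assms(3) by linarith
 have *: "\<bar>t / ((fst xe)^2 + (snd xe)^2)\<bar> <= R / r + R" if "\<bar>t\<bar> <= R" for t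
 proof -
  have "\<bar>t / ((fst xe)^2 + (snd xe)^2)\<bar> = \<bar>t\<bar> / ((fst xe)^2 + (snd xe)^2)" using assms by (simp add: abs_divide)
  also have "... <= R / r" using that assms R by (intro frac_le) auto
  finally show ?thesis using R by simp
 qed
 have "R / r >= 0" using R assms by simp
 then show ?thesis unfolding entries_le_def ss_comps using *[OF assms(3)] *[OF assms(4)] assms(3,4) R by auto
qed

lemma entries_le_kap:
 assumes "v \<in> {- S..S} \<times> {- S..S} \<times> {- S..S}" "r > 0" "r <= (fst xe)^2 + (snd xe)^2" "\<bar>fst xe\<bar> <= R" "\<bar>snd xe\<bar> <= R"
 shows "entries_le (2 * (S + 1) * (R / r + R) + (R / r + R)) (kap (v,xe))"
proof -
 obtain x p u where v: "v = (x,p,u)" by (cases v)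
 have "entries_le (S + 1) (el x p u)" using assms(1) unfolding v entries_le_def by auto
 from entries_le_mult[OF this entries_le_ss[OF assms(2-5)]] show ?thesis by (simp add: kap_def v)
qed

definition annulus :: "nat => (R2) set" where
 "annulus n = {xe. 1 / real (Suc n) <= (fst xe)^2 + (snd xe)^2 \<and> \<bar>fst xe\<bar> <= real (Suc n) \<and> \<bar>snd xe\<bar> <= real (Suc n)}"

lemma sets_annulus[measurable]: "annulus n \<in> sets borel"
 unfolding annulus_def by measurable

lemma in_annulus: "xe ~= (0,0) ==> \<exists>n. xe \<in> annulus n"
proof -
 assume "xe ~= (0,0)"
 then have pos: "(fst xe)^2 + (snd xe)^2 > 0" by (rule pair_nonzero_sq)
 obtain n :: nat where n: "real n >= \<bar>fst xe\<bar> + \<bar>snd xe\<bar> + 1 / ((fst xe)^2 + (snd xe)^2)" using real_arch_simple by blast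
 have q: "1 / ((fst xe)^2 + (snd xe)^2) > 0" using pos by simp
 have sn: "real (Suc n) = real n + 1" by simp
 from q have "real (Suc n) >= 1 / ((fst xe)^2 + (snd xe)^2)" unfolding sn using n by linarith
 then have "1 / real (Suc n) <= (fst xe)^2 + (snd xe)^2" using pos by (simp add: field_simps)
 moreover have "\<bar>fst xe\<bar> <= real (Suc n)" "\<bar>snd xe\<bar> <= real (Suc n)" unfolding sn using n q by linarith+
 ultimately show ?thesis unfolding annulus_def by blast
qed

lemma lam_annulus_finite: "emeasure lam (annulus n) < oo"
proof -
 define R where "R = 2 * (1 + 1) * (real (Suc n) / (1 / real (Suc n)) + real (Suc n)) + (real (Suc n) / (1 / real (Suc n)) + real (Suc n))"
 have [measurable]: "{h \<in> SAff. entries_le R h} \<in> sets borel" by measurable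
 have "emeasure lam (annulus n) = (NN xe|lam. ind (annulus n) xe)" by simp
 also have "... = (NN h|nu. ind cube (crd h) * ind (annulus n) (xi h))" by (rule nn_lam) measurable
 also have "... <= (NN h|nu. ind {h \<in> SAff. entries_le R h} h)"
 proof (rule nn_integral_mono_AE, use AE_SAff in eventually_elim, goal_cases)
  case h: (1 h)
  have "entries_le R h" if "crd h \<in> cube" "xi h \<in> annulus n"
  proof -
   have "entries_le R (kap (crd h,xi h))" unfolding R_def
    by (rule entries_le_kap) (use that in \<open>auto simp: cube_def annulus_def\<close>)
   then show ?thesis by (simp add: kap_crd[OF h])
  qed
  then show ?case
   using h by (auto simp: indicator_def)
 qed
 also have "... < oo" using nu_finite[of R] by simp
 finally show ?thesis .
qed

lemma sigma_finite_lam: "sigma_finite_measure lam"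
proof
 have z: "emeasure lam {(0,0)} = 0"
  using AE_lam_nonzero by (subst (asm) AE_iff_measurable[of "{(0,0)}"]) auto
 show "\<exists>A. countable A \<and> A \<subseteq> sets lam \<and> \<Union> A = space lam \<and> (\<forall>a\<in>A. emeasure lam a ~= oo)"
 proof (intro exI[of _ "insert {(0,0)} (range annulus)"] conjI ballI)
  show "\<Union> (insert {(0,0)} (range annulus)) = space lam" using in_annulus by auto
  fix a assume "a \<in> insert {(0,0)} (range annulus)"
  then show "emeasure lam a ~= oo" using z lam_annulus_finite less_top by auto
 qed auto
qed

text \<open>The diagonal element \<open>de\<close> normalises the unipotent group. It multiplies
  \<open>xi\<close> by \<open>r\<close> and pulls the unit cube of coordinates back to a box with
  sides r^2, 1/r and r, so left invariance of the Haar measure produces the factor r^2.\<close>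

lemma nn_lam_scale:
 assumes [measurable]: "f \<in> bmble borel" and r: "r > 0"
 shows "(NN xe|lam. f xe) = ennreal (r^2) * (NN xe|lam. f (r * fst xe,r * snd xe))"
proof -
 define de where "de = saff_of (1 / r) 0 0 r 0 0"
 have de: "de \<in> SAff" using r by (simp add: de_def SAff_iff)
 have xide: "xi (mul de h) = (r * fst (xi h),r * snd (xi h))" for h by (simp add: xi_def de_def)
 have dekap: "mul de (kap ((x,p,u),xe)) = kap ((x / r^2,p * r,u / r),(r * fst xe,r * snd xe))" for x p u xe
 proof -
  have "(r * fst xe)^2 + (r * snd xe)^2 = r^2 * ((fst xe)^2 + (snd xe)^2)" by (simp add: power_mult_distrib distrib_left)
  have sc: "c * t / (A + B) = c * (r * (r * t)) / (r * (r * A) + r * (r * B))" for c t A B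
  proof -
   have "c * (r * (r * t)) / (r * (r * A) + r * (r * B)) = (r * r) * (c * t) / ((r * r) * (A + B))" by (simp add: algebra_simps)
   then show ?thesis using r by simp
  qed
  have [simp]: "r ~= 0" "0 < r" using r by auto
  show ?thesis unfolding kap_def de_def case_prod_conv
   by (intro saff_eqI; simp add: power2_eq_square field_simps; (rule sc | rule sc[of 1, simplified mult_1_left])?)
 qed
 have "(NN xe|lam. f xe) = (NN h|nu. ind cube (crd h) * f (xi h))" by (rule nn_lam) simp
 also have "... = (NN h|nu. ind cube (crd (mul de h)) * f (xi (mul de h)))"
  by (rule nn_left[OF _ de, symmetric]) measurable
 also have "... = (NN xe|lam. NN v|lborel. ind cube (crd (mul de (kap (v,xe)))) * f (xi (mul de (kap (v,xe)))))"
  by (rule nn_chart) measurable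
 also have "... = (NN xe|lam. ennreal (r^2) * f (r * fst xe,r * snd xe))"
 proof (rule nn_integral_cong_AE, use AE_lam_nonzero in eventually_elim, goal_cases)
  case xe: (1 xe)
  then have rxe: "(r * fst xe,r * snd xe) ~= (0,0)" using r by (cases xe) auto
  have "ind cube (crd (mul de (kap (v,xe)))) * f (xi (mul de (kap (v,xe)))) =
   ind ({0..<r^2} \<times> {0..<1 / r} \<times> {0..<r}) v * f (r * fst xe,r * snd xe)" for v
   using r by (cases v) (auto simp: dekap crd_kap[OF rxe] cube_def indicator_def field_simps zero_le_mult_iff zero_le_divide_iff)
  then have "(NN v|lborel. ind cube (crd (mul de (kap (v,xe)))) * f (xi (mul de (kap (v,xe))))) =
   (NN v|lborel. ind ({0..<r^2} \<times> {0..<1 / r} \<times> {0..<r}) v * f (r * fst xe,r * snd xe))" by simp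
  also have "... = (NN v|lborel. ind ({0..<r^2} \<times> {0..<1 / r} \<times> {0..<r}) v) * f (r * fst xe,r * snd xe)"
   by (rule nn_integral_multc) (auto simp: borel_prod[symmetric] intro!: borel_measurable_indicator pair_measureI)
  also have "(NN v|lborel. ind ({0..<r^2} \<times> {0..<1 / r} \<times> {0..<r}) v) = ennreal (r^2)"
   using r by (subst nn_integral_box3) auto
  finally show ?case .
 qed
 also have "... = ennreal (r^2) * (NN xe|lam. f (r * fst xe,r * snd xe))"
  by (rule nn_integral_cmult) measurable
 finally show ?thesis .
qed

text \<open>A bounded neighbourhood of the identity, whose matrix has square sum 2, cut out by
  quantities that right rotations preserve.\<close>

definition kball :: "saff set" where
 "kball = {h \<in> SAff. (ga h)^2 + (gb h)^2 + (gc h)^2 + (gd h)^2 <= 4 \<and> (gp h)^2 + (gq h)^2 <= 1}"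

lemma sets_kball[measurable]: "kball \<in> sets borel" unfolding kball_def by measurable

lemma kball_entries: "h \<in> kball ==> entries_le 2 h"
proof -
 assume h: "h \<in> kball"
 have *: "\<bar>x\<bar> <= 2" if "x^2 <= 4" for x :: real using abs_le_square_iff[of x 2] that by simp
 have nn: "(ga h)^2 >= 0" "(gb h)^2 >= 0" "(gc h)^2 >= 0" "(gd h)^2 >= 0" "(gp h)^2 >= 0" "(gq h)^2 >= 0" by auto
 have "(ga h)^2 <= 4" "(gb h)^2 <= 4" "(gc h)^2 <= 4" "(gd h)^2 <= 4" "(gp h)^2 <= 4" "(gq h)^2 <= 4"
  using h nn unfolding kball_def mem_Collect_eq by linarith+
 then show ?thesis unfolding entries_le_def by (blast intro: *)
qed

lemma kball_rot: "h \<in> SAff ==> mul h (rot tt) \<in> kball \<longleftrightarrow> h \<in> kball"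
proof -
 assume h: "h \<in> SAff"
 have r: "(a * c + b * (- s))^2 + (a * s + b * c)^2 = (a^2 + b^2) * (s^2 + c^2)" for a b s c :: real
  by (simp add: power2_eq_square algebra_simps)
 have 1: "(ga (mul h (rot tt)))^2 + (gb (mul h (rot tt)))^2 = (ga h)^2 + (gb h)^2"
  and 2: "(gc (mul h (rot tt)))^2 + (gd (mul h (rot tt)))^2 = (gc h)^2 + (gd h)^2"
  and 3: "(gp (mul h (rot tt)))^2 + (gq (mul h (rot tt)))^2 = (gp h)^2 + (gq h)^2"
  unfolding mul_comps rot_comps add_0_right by (simp_all only: r sin_cos_squared_add mult_1_right)
 have "mul h (rot tt) \<in> SAff" using h by (intro mul_in) auto
 then show ?thesis using h 1 2 3 unfolding kball_def mem_Collect_eq by auto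
qed

lemma kball_right_finite: "x \<in> SAff ==> emeasure nu {t. mul t x \<in> kball \<and> t \<in> SAff} < oo"
proof -
 assume x: "x \<in> SAff"
 obtain n :: nat where n: "entries_le (real n) (saff_inv x)" using exists_entries_le by blast
 have "{t. mul t x \<in> kball \<and> t \<in> SAff} \<subseteq> {h \<in> SAff. entries_le (2 * 2 * real n + real n) h}"
 proof
  fix t assume t: "t \<in> {t. mul t x \<in> kball \<and> t \<in> SAff}"
  then have "entries_le (2 * 2 * real n + real n) (mul (mul t x) (saff_inv x))"
   using entries_le_mult[OF kball_entries n] by blast
  then show "t \<in> {h \<in> SAff. entries_le (2 * 2 * real n + real n) h}" using t x by (simp add: saff_inv_cancel_right)
 qed
 then show ?thesis
  by (rule le_less_trans[OF emeasure_mono nu_finite[unfolded]]) (simp add: sets_nu)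
qed

text \<open>Otherwise every point of the group would have a null neighbourhood, a left translate of
  a subset of the null set, and a countable subcover would make the whole measure vanish.\<close>

lemma kball_right_pos:
 assumes x: "x \<in> SAff"
 shows "emeasure nu {t. mul t x \<in> kball \<and> t \<in> SAff} ~= 0"
proof
 assume z: "emeasure nu {t. mul t x \<in> kball \<and> t \<in> SAff} = 0"
 define V :: "saff set" where "V = {h. (ga h)^2 + (gb h)^2 + (gc h)^2 + (gd h)^2 < 4 \<and> (gp h)^2 + (gq h)^2 < 1}"
 have V: "open V" unfolding V_def by (intro open_Collect_conj open_Collect_less continuous_intros)
 define U where "U y = {z. mul (mul (saff_inv (mul y x)) z) x \<in> V}" for y
 have oU: "open (U y)" for y
 proof -
  have "open ((%z. mul (mul (saff_inv (mul y x)) z) x) -` V)"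
   by (intro open_vimage V continuous_intros)
  then show ?thesis by (simp add: U_def vimage_def)
 qed
 have yU: "y \<in> U y" if "y \<in> SAff" for y
 proof -
  have "mul (mul (saff_inv (mul y x)) y) x = saff_one"
   using that x by (simp add: saff_inv_mult mul_assoc mul_inv mul_in)
  then show ?thesis unfolding U_def mem_Collect_eq by (simp only:) (simp add: V_def)
 qed
 obtain W where W: "W \<subseteq> U ` SAff" "countable W" "\<Union>W = \<Union>(U ` SAff)"
  using Lindelof[of "U ` SAff"] oU by blast
 have nullU: "emeasure nu (U y \<inter> SAff) = 0" if y: "y \<in> SAff" for y
 proof -
  define k where "k = saff_inv (mul y x)"
  have k: "k \<in> SAff" unfolding k_def using x y by blast
  have [measurable]: "{t. mul t x \<in> kball \<and> t \<in> SAff} \<in> sets borel" by measurable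
  have [measurable]: "U y \<in> sets borel" using oU by simp
  have "emeasure nu (U y \<inter> SAff) <= (NN z|nu. ind {t. mul t x \<in> kball \<and> t \<in> SAff} (mul k z))"
   unfolding nn_integral_indicator[symmetric, OF sets.Int[OF \<open>U y \<in> sets borel\<close> sets_SAff, folded sets_nu]]
   using k x by (intro nn_integral_mono) (auto simp: indicator_def U_def k_def[symmetric] V_def kball_def)
  also have "... = (NN z|nu. ind {t. mul t x \<in> kball \<and> t \<in> SAff} z)"
   by (rule nn_left[OF _ k]) measurable
  also have "... = 0" using z by (simp add: sets_nu)
  finally show ?thesis by simp
 qed
 have "\<Union>W \<inter> SAff \<in> null_sets nu"
 proof -
  have "(\<Union>A\<in>W. A \<inter> SAff) \<in> null_sets nu"
  proof (rule null_sets_UN'[OF W(2)], goal_cases)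
   case (1 A)
   then obtain y where "y \<in> SAff" "A = U y" using W(1) by blast
   then show ?case using nullU oU by (auto simp: null_sets_def sets_nu)
  qed
  then show ?thesis by (simp add: Int_commute)
 qed
 moreover have "\<Union>W \<inter> SAff = SAff" using W(3) yU by blast
 ultimately have "emeasure nu SAff = 0" by auto
 moreover have "emeasure nu UNIV <= emeasure nu SAff + emeasure nu (- SAff)"
  using emeasure_subadditive[of SAff nu "- SAff"] sets_SAff by (simp add: sets_nu)
 ultimately show False using nu_SAff nu_nonzero by simp
qed

text \<open>Uniqueness of Haar measure, applied to \<open>nu\<close> and its right translate by a rotation; the two agree on
 the rotation-invariant set \<^const>\<open>kball\<close>.\<close>

lemma nn_rot:
 assumes [measurable]: "F \<in> bmble borel"
 shows "(NN h|nu. F (mul h (rot tt))) = (NN h|nu. F h)"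
proof -
 interpret P: pair_sigma_finite nu nu ..
 define Dn where "Dn x = (NN t|nu. ind kball (mul t x))" for x
 have [measurable]: "Dn \<in> bmble borel"
  unfolding Dn_def by measurable
 have Dn: "Dn x ~= 0 \<and> Dn x ~= oo" if x: "x \<in> SAff" for x
 proof -
  have [measurable]: "{t. mul t x \<in> kball \<and> t \<in> SAff} \<in> sets nu" unfolding sets_nu by measurable
  have "Dn x = (NN t|nu. ind {t. mul t x \<in> kball \<and> t \<in> SAff} t)" unfolding Dn_def
   by (rule nn_integral_cong_AE, use AE_SAff in eventually_elim) (auto simp: indicator_def)
  then show ?thesis using kball_right_pos[OF x] kball_right_finite[OF x] by simp
 qed
 define c where "c F = (NN t|nu. F (saff_inv t) / Dn (saff_inv t))" for F
 \<comment> \<open>The right side does not contain the rotation, so the instances for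
   \<open>tt\<close> and for 0 are equal without any cancellation. \<open>Dn\<close> normalises the
   weight: it is the mass of the right translate of \<open>kball\<close>, which is positive and
   finite.\<close>
 have key: "(NN x|nu. F (mul x (rot \<phi>))) = (NN x|nu. ind kball x) * c F"
  if [measurable]: "F \<in> bmble borel" for F \<phi>
 proof -
  let ?r = "%x. mul x (rot \<phi>)"
  have rin: "?r x \<in> SAff" if "x \<in> SAff" for x by (rule mul_in[OF that rot_in])
  have "(NN x|nu. F (?r x)) = (NN x|nu. NN t|nu. F (?r x) / Dn (?r x) * ind kball (mul t (?r x)))"
  proof (rule nn_integral_cong_AE, use AE_SAff in eventually_elim, goal_cases)
   case x: (1 x)
   have "(NN t|nu. F (?r x) / Dn (?r x) * ind kball (mul t (?r x))) = F (?r x) / Dn (?r x) * Dn (?r x)"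
    unfolding Dn_def by (rule nn_integral_cmult) measurable
   also have "... = F (?r x)" using Dn[OF rin[OF x]]
    by (simp add: ennreal_divide_times ennreal_mult_divide_eq top.not_eq_extremum mult_divide_eq_ennreal)
   finally show ?case ..
  qed
  also have "... = (NN t|nu. NN x|nu. F (?r x) / Dn (?r x) * ind kball (mul t (?r x)))"
   by (rule P.Fubini'[symmetric]) measurable
  also have "... = (NN t|nu. NN x|nu. F (mul (saff_inv t) (?r x)) / Dn (mul (saff_inv t) (?r x)) * ind kball (?r x))"
  proof (rule nn_integral_cong_AE, use AE_SAff in eventually_elim)
   fix t assume t: "t \<in> SAff"
   have "(NN x|nu. F (mul (saff_inv t) (?r x)) / Dn (mul (saff_inv t) (?r x)) * ind kball (?r x)) =
    (NN x|nu. F (mul (saff_inv t) (?r (mul t x))) / Dn (mul (saff_inv t) (?r (mul t x))) * ind kball (?r (mul t x)))"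
    by (rule nn_left[OF _ t, symmetric]) measurable
   then show "(NN x|nu. F (?r x) / Dn (?r x) * ind kball (mul t (?r x))) =
    (NN x|nu. F (mul (saff_inv t) (?r x)) / Dn (mul (saff_inv t) (?r x)) * ind kball (?r x))"
    using t by (simp add: mul_assoc saff_inv_cancel)
  qed
  also have "... = (NN x|nu. NN t|nu. F (mul (saff_inv t) (?r x)) / Dn (mul (saff_inv t) (?r x)) * ind kball (?r x))"
   by (rule P.Fubini') measurable
  also have "... = (NN x|nu. ind kball x * c F)"
  proof (rule nn_integral_cong_AE, use AE_SAff in eventually_elim, goal_cases)
   case x: (1 x)
   have "(NN t|nu. F (mul (saff_inv t) (?r x)) / Dn (mul (saff_inv t) (?r x)) * ind kball (?r x)) =
    (NN t|nu. F (mul (saff_inv (mul (?r x) t)) (?r x)) / Dn (mul (saff_inv (mul (?r x) t)) (?r x)) * ind kball (?r x))"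
    by (rule nn_left[OF _ rin[OF x], symmetric]) measurable
   also have "... = (NN t|nu. F (saff_inv t) / Dn (saff_inv t) * ind kball (?r x))"
    by (rule nn_integral_cong_AE, use AE_SAff in eventually_elim)
     (simp only: saff_inv_mult[OF rin[OF x]] saff_inv_cancel_right(2)[OF rin[OF x]])
   also have "... = c F * ind kball (?r x)" unfolding c_def by (rule nn_integral_multc) measurable
   also have "... = c F * ind kball x" using kball_rot[OF x] by (simp add: indicator_def)
   also have "... = ind kball x * c F" by (rule mult.commute)
   finally show ?case .
  qed
  also have "... = (NN x|nu. ind kball x) * c F" by (rule nn_integral_multc) measurable
  finally show ?thesis .
 qed
 show ?thesis using key[of F tt] key[of F 0] by (simp add: rot_0 del: nn_integral_indicator)
qed

lemma nn_lam_rot: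
 assumes [measurable]: "f \<in> bmble borel"
 shows "(NN xe|lam. f (rotp tt xe)) = (NN xe|lam. f xe)"
proof -
 have "(NN xe|lam. f (rotp tt xe)) = (NN h|nu. ind cube (crd h) * f (rotp tt (xi h)))"
  by (rule nn_lam) measurable
 also have "... = (NN h|nu. ind cube (crd (mul h (rot tt))) * f (xi (mul h (rot tt))))"
 proof (rule nn_integral_cong_AE, use AE_SAff in eventually_elim, goal_cases)
  case h: (1 h)
  have "mul h (rot tt) = kap (crd h,rotp tt (xi h))" using kap_rot[of "crd h" "xi h" tt] by (simp add: kap_crd[OF h])
  moreover have "rotp tt (xi h) ~= (0,0)"
   using rotp_norm[of tt "xi h"] pair_nonzero_sq[OF xi_nonzero[OF h]] by (auto simp: prod_eq_iff)
  ultimately show ?case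
   by (simp add: crd_kap)
 qed
 also have "... = (NN h|nu. ind cube (crd h) * f (xi h))"
  by (rule nn_rot[where F="%h. ind cube (crd h) * f (xi h)"]) measurable
 also have "... = (NN xe|lam. f xe)" by (rule nn_lam[symmetric]) simp
 finally show ?thesis .
qed

end

section \<open>Unfolding\<close>

lemma distr_eq_of_nn_integral:
 assumes F: "F \<in> measurable M K" and G: "G \<in> measurable N K"
  and eq: "!!\<phi> :: _ => ennreal. \<phi> \<in> bmble K ==> (NN x|M. \<phi> (F x)) = (NN x|N. \<phi> (G x))"
 shows "distr M K F = distr N K G"
proof (rule measure_eqI)
 fix A assume "A \<in> sets (distr M K F)"
 then have A[measurable]: "A \<in> sets K" by simp
 have "emeasure (distr M K F) A = (NN x|distr M K F. ind A x)" by simp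
 also have "... = (NN x|M. ind A (F x))" by (rule nn_integral_distr[OF F]) simp
 also have "... = (NN x|N. ind A (G x))" by (rule eq) simp
 also have "... = (NN x|distr N K G. ind A x)" by (rule nn_integral_distr[OF G, symmetric]) simp
 finally show "emeasure (distr M K F) A = emeasure (distr N K G) A" by simp
qed simp

lemma integral_law:
 fixes F :: "'a => complex" and G :: "'b => complex"
 assumes F: "F \<in> bmble M" and G: "G \<in> bmble N"
  and eq: "!!\<phi> :: complex => ennreal. \<phi> \<in> bmble borel ==> (NN x|M. \<phi> (F x)) = (NN x|N. \<phi> (G x))"
 shows "integrable M F \<longleftrightarrow> integrable N G" "(LINT x|M. F x) = (LINT x|N. G x)"
proof -
 have d: "distr M borel F = distr N borel G" by (rule distr_eq_of_nn_integral[OF F G eq])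
 have "integrable M F \<longleftrightarrow> integrable (distr M borel F) (%z. z)" by (rule integrable_distr_eq[OF F, symmetric]) simp
 also have "... \<longleftrightarrow> integrable N G" unfolding d by (rule integrable_distr_eq[OF G]) simp
 finally show "integrable M F \<longleftrightarrow> integrable N G" .
 have "(LINT x|M. F x) = (LINT z|distr M borel F. z)" by (rule integral_distr[OF F, symmetric]) simp
 also have "... = (LINT x|N. G x)" unfolding d by (rule integral_distr[OF G]) simp
 finally show "(LINT x|M. F x) = (LINT x|N. G x)" .
qed

lemma nn_integral_count_space_single:
 assumes "a \<in> A" shows "(NN x|count_space A. (if x = a then c else 0)) = (c :: ennreal)"
proof -
 have "(NN x|count_space A. (if x = a then c else 0)) = (\<Sum>x\<in>{a}. (if x = a then c else 0))"
  using assms by (intro nn_integral_count_space') (auto split: if_splits)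
 then show ?thesis by simp
qed

lemma nn_integral_count_space_Times:
 assumes "countable A" "countable B"
 shows "(NN x|count_space (A \<times> B). f x) = (NN a|count_space A. NN b|count_space B. f (a,b))"
proof -
 interpret sigma_finite_measure "count_space B" by (rule sigma_finite_measure_count_space_countable[OF assms(2)])
 have "count_space (A \<times> B) = count_space A \<otimes> count_space B" by (rule pair_measure_countable[OF assms, symmetric])
 moreover have "f \<in> bmble (count_space A \<otimes> count_space B)" by (simp add: pair_measure_countable[OF assms])
 ultimately show ?thesis by (simp add: nn_integral_fst)
qed

lemma nn_TT: "f \<in> bmble borel ==> (NN s|TT. f s) = (NN s|lborel. ind ({0..<1} \<times> {0..<1}) s * f s)"
 unfolding TT_half_open by (rule nn_integral_density) auto

lemma nn_plane_shift:
 fixes f :: "R2 => ennreal"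
 assumes [measurable]: "f \<in> bmble borel"
 shows "(NN s|lborel. f (s + c)) = (NN s|lborel. f s)"
proof -
 have "(NN s|lborel. f s) = (NN s|distr lborel borel ((+) c). f s)" by (simp only: lborel_distr_plus)
 also have "... = (NN s|lborel. f (c + s))" by (rule nn_integral_distr) auto
 finally show ?thesis by (simp add: add.commute)
qed

lemma torus_unfold:
 fixes \<phi> :: "R2 => ennreal"
 assumes [measurable]: "\<phi> \<in> bmble borel"
 shows "(NN n|cU. NN s|TT. \<phi> (s + iota n)) = (NN s|lborel. \<phi> s)"
proof -
 let ?sq = "{0..<1::real} \<times> {0..<1::real}"
 have "(NN n|cU. NN s|TT. \<phi> (s + iota n)) = (NN n|cU. NN s|lborel. ind ?sq (s - iota n) * \<phi> s)"
 proof (rule nn_integral_cong, goal_cases)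
  case (1 n)
  have "(NN s|TT. \<phi> (s + iota n)) = (NN s|lborel. ind ?sq (s + iota n - iota n) * \<phi> (s + iota n))"
   by (subst nn_TT) auto
  also have "... = (NN s|lborel. ind ?sq (s - iota n) * \<phi> s)"
   by (rule nn_plane_shift[where f="%s. ind ?sq (s - iota n) * \<phi> s"]) measurable
  finally show ?case .
 qed
 also have "... = (NN s|lborel. NN n|cU. ind ?sq (s - iota n) * \<phi> s)"
  by (rule nn_integral_count_space_nn_integral[symmetric]) auto
 also have "... = (NN s|lborel. \<phi> s)"
 proof (rule nn_integral_cong, goal_cases)
  case (1 s)
  have "(NN n|cU. ind ?sq (s - iota n) * \<phi> s) = (NN n|cU. (if n = (\<lfloor>fst s\<rfloor>,\<lfloor>snd s\<rfloor>) then \<phi> s else 0))"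
   by (intro nn_integral_cong) (simp add: indicator_def floor_square del: mem_Times_iff SigmaI)
  then show ?case
   by (simp add: nn_integral_count_space_single)
 qed
 finally show ?thesis .
qed

lemma nn_integral_uminus_plane:
 fixes \<phi> :: "R2 => ennreal"
 assumes [measurable]: "\<phi> \<in> bmble borel"
 shows "(NN s|lborel. \<phi> (- s)) = (NN s|lborel. \<phi> s)"
 using nn_integral_plane_linear[of \<phi> "-1" "-1" 0 0] by (simp add: uminus_prod_def)

lemma bij_iota_uminus: "bij (uminus :: int \<times> int => _)" by (rule bij_uminus)

lemma iota_uminus: "iota (- n) = - iota n" by (simp add: iota_def uminus_prod_def)

lemma torus_unfold_minus:
 fixes \<phi> :: "R2 => ennreal"
 assumes [measurable]: "\<phi> \<in> bmble borel"
 shows "(NN n|cU. NN s|TT. \<phi> (iota n - s)) = (NN s|lborel. \<phi> s)"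
proof -
 have "(NN s|lborel. \<phi> s) = (NN s|lborel. \<phi> (- s))" by (rule nn_integral_uminus_plane[symmetric]) simp
 also have "... = (NN n|cU. NN s|TT. \<phi> (- (s + iota n)))"
  by (rule torus_unfold[symmetric]) measurable
 also have "... = (NN n|cU. NN s|TT. \<phi> (- (s + iota (- n))))"
  by (rule nn_integral_bij_count_space[OF bij_iota_uminus, symmetric])
 also have "... = (NN n|cU. NN s|TT. \<phi> (iota n - s))"
  by (simp add: iota_uminus)
 finally show ?thesis ..
qed

definition plane_int :: "saff => R2 => R2" where
 "plane_int gg s = (fst s * ga gg + snd s * gc gg,fst s * gb gg + snd s * gd gg)"

lemma measurable_plane_int[measurable]: "plane_int gg \<in> bmble borel"
 unfolding plane_int_def by measurable

lemma nn_plane_int: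
 fixes \<phi> :: "R2 => ennreal"
 assumes [measurable]: "\<phi> \<in> bmble borel" and "gg \<in> SAff"
 shows "(NN s|lborel. \<phi> (plane_int gg s)) = (NN s|lborel. \<phi> s)"
 using nn_integral_plane_linear[of \<phi> "ga gg" "gd gg" "gb gg" "gc gg"] assms(2) by (simp add: SAff_iff plane_int_def)

text \<open>An integral unimodular matrix followed by a shift carries the unit square to another
  fundamental domain of the integer lattice. Cutting it along integer translates, each point of the
  torus is met for exactly one \<open>n\<close>, and \<open>G\<close> is periodic.\<close>

lemma torus_automorphism:
 fixes G :: "R2 => ennreal"
 assumes [measurable]: "G \<in> bmble borel" and per: "!!s n. G (s + iota n) = G s" and gg: "gg \<in> SAff_int"
 shows "(NN s|TT. G (plane_int gg s + c)) = (NN s|TT. G s)"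
proof -
 let ?sq = "{0..<1::real} \<times> {0..<1::real}"
 define gg' where "gg' = saff_inv gg"
 have gg'in: "gg' \<in> SAff_int" "gg' \<in> SAff" using gg SAff_int_inv SAff_int_sub unfolding gg'_def by blast+
 have d: "ga gg * gd gg - gb gg * gc gg = 1" using SAff_int_sub[OF gg] by (simp add: SAff_iff)
 have inv1: "plane_int gg' (plane_int gg s) = s" for s
 proof -
  have "plane_int gg' (plane_int gg s) = ((ga gg * gd gg - gb gg * gc gg) * fst s,(ga gg * gd gg - gb gg * gc gg) * snd s)"
   by (simp add: plane_int_def gg'_def algebra_simps)
  then show ?thesis unfolding d by simp
 qed
 have inv2: "plane_int gg (plane_int gg' s) = s" for s
 proof -
  have "plane_int gg (plane_int gg' s) = ((ga gg * gd gg - gb gg * gc gg) * fst s,(ga gg * gd gg - gb gg * gc gg) * snd s)"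
   by (simp add: plane_int_def gg'_def algebra_simps)
  then show ?thesis unfolding d by simp
 qed
 have lin: "plane_int k (s + t) = plane_int k s + plane_int k t" for k s t
  by (simp add: plane_int_def plus_prod_def algebra_simps)
 have intk: "\<exists>m. plane_int k (iota n) = iota m" if k: "k \<in> SAff_int" for k n
 proof -
  obtain a b c d p q where "k = saff_of_int (a,b,c,d,p,q)" using SAff_int_obtain[OF k] by metis
  then have "plane_int k (iota n) = iota (fst n * a + snd n * c,fst n * b + snd n * d)"
   by (simp add: plane_int_def iota_def saff_of_int_def)
  then show ?thesis by blast
 qed
 have iota_inj: "iota m = iota n \<longleftrightarrow> m = n" for m n by (auto simp: iota_def prod_eq_iff)
 have "(NN s|TT. G (plane_int gg s + c)) = (NN s|lborel. ind ?sq s * G (plane_int gg s + c))"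
  by (rule nn_TT) measurable
 also have "... = (NN s|lborel. ind ?sq (plane_int gg' (plane_int gg s)) * G (plane_int gg s + c))"
  by (simp only: inv1)
 also have "... = (NN s|lborel. ind ?sq (plane_int gg' s) * G (s + c))"
  by (rule nn_plane_int[OF _ SAff_int_sub[OF gg], where \<phi>="%s. ind ?sq (plane_int gg' s) * G (s + c)"]) measurable
 also have "... = (NN s|lborel. ind ?sq (plane_int gg' (s + c - c)) * G (s + c))" by simp
 also have "... = (NN s|lborel. ind ?sq (plane_int gg' (s - c)) * G s)"
  by (rule nn_plane_shift[where f="%s. ind ?sq (plane_int gg' (s - c)) * G s"]) measurable
 also have "... = (NN n|cU. NN s|TT. ind ?sq (plane_int gg' (s + iota n - c)) * G (s + iota n))"
  by (rule torus_unfold[symmetric]) measurable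
 also have "... = (NN s|TT. NN n|cU. ind ?sq (plane_int gg' (s + iota n - c)) * G (s + iota n))"
  by (rule nn_integral_count_space_nn_integral[symmetric]) auto
 also have "... = (NN s|TT. G s)"
 proof (rule nn_integral_cong, goal_cases)
  case (1 s)
  define z where "z = plane_int gg' (s - c)"
  obtain m where m: "plane_int gg (iota (\<lfloor>fst z\<rfloor>,\<lfloor>snd z\<rfloor>)) = iota m" using intk[OF gg] by blast
  have "plane_int gg' (s + iota n - c) \<in> ?sq \<longleftrightarrow> n = - m" for n
  proof -
   obtain j where j: "plane_int gg' (iota n) = iota j" using intk[OF gg'in(1)] by blast
   have "plane_int gg' (s + iota n - c) = z - iota (- j)"
    using lin[of gg' "s - c" "iota n"] by (simp add: z_def j iota_uminus algebra_simps)
   then have "plane_int gg' (s + iota n - c) \<in> ?sq \<longleftrightarrow> - j = (\<lfloor>fst z\<rfloor>,\<lfloor>snd z\<rfloor>)" using floor_square[of z "- j"] by simp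
   also have "... \<longleftrightarrow> iota (- j) = iota (\<lfloor>fst z\<rfloor>,\<lfloor>snd z\<rfloor>)" by (simp only: iota_inj)
   also have "... \<longleftrightarrow> plane_int gg (iota (- j)) = iota m" using m inv1 by metis
   also have "plane_int gg (iota (- j)) = - plane_int gg (iota j)" by (simp add: plane_int_def iota_def)
   also have "... = iota (- n)" using j inv2[of "iota n"] by (simp add: iota_uminus)
   also have "iota (- n) = iota m \<longleftrightarrow> n = - m" unfolding iota_inj by (metis minus_minus)
   finally show ?thesis .
  qed
  then have "(NN n|cU. ind ?sq (plane_int gg' (s + iota n - c)) * G (s + iota n)) = (NN n|cU. (if n = - m then G s else 0))"
   by (intro nn_integral_cong) (simp add: indicator_def per del: mem_Times_iff SigmaI)
  then show ?case
   by (simp add: nn_integral_count_space_single)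
 qed
 finally show ?thesis .
qed

lemma integral_torus_automorphism:
 fixes G :: "R2 => complex"
 assumes [measurable]: "G \<in> bmble borel" and per: "!!s n. G (s + iota n) = G s" and gg: "gg \<in> SAff_int"
 shows "(LINT s|TT. G (plane_int gg s + c)) = (LINT s|TT. G s)"
proof (rule integral_law(2))
 fix \<phi> :: "complex => ennreal" assume [measurable]: "\<phi> \<in> bmble borel"
 show "(NN s|TT. \<phi> (G (plane_int gg s + c))) = (NN s|TT. \<phi> (G s))"
  by (rule torus_automorphism[where G="%s. \<phi> (G s)"]) (auto simp: per gg)
qed measurable

lemma tr_saff: "gg \<in> SAff ==> mul (tr s) gg = mul gg (tr (plane_int gg s))"
 by (rule saff_eqI) (simp_all add: plane_int_def)

lemma tr_add: "mul (tr s) (tr t) = tr (s + t)"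
 by (simp add: el_mult)

section \<open>The lattice as a semidirect product\<close>

definition SLZ :: "saff set" where "SLZ = {gg \<in> SAff_int. gp gg = 0 \<and> gq gg = 0}"

lemma SLZ_sub: "gg \<in> SLZ ==> gg \<in> SAff_int" by (simp add: SLZ_def)

lemma countable_SLZ: "countable SLZ"
 using countable_SAff_int by (rule countable_subset[rotated]) (auto simp: SLZ_def)

lemma tr_iota_in: "tr (iota n) \<in> SAff_int"
 by (simp add: SAff_int_iff iota_def)

text \<open>Together with \<open>bij_tr_SLZ\<close> this gives the factors in either order;
  \<open>torus_weight\<close> unfolds with one order and refolds with the other.\<close>

lemma bij_SLZ_tr: "bij_betw (%(gg,n). mul gg (tr (iota n))) (SLZ \<times> UNIV) SAff_int"
proof (rule bij_betw_imageI)
 show "inj_on (%(gg,n). mul gg (tr (iota n))) (SLZ \<times> UNIV)"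
 proof (rule inj_onI)
  fix x y :: "saff \<times> int \<times> int"
  assume xy: "x \<in> SLZ \<times> UNIV" "y \<in> SLZ \<times> UNIV" "(%(gg,n). mul gg (tr (iota n))) x = (%(gg,n). mul gg (tr (iota n))) y"
  obtain gg a b gg' a' b' where x: "x = (gg,a,b)" "y = (gg',a',b')" by (cases x, cases y) auto
  have *: "gg \<in> SLZ" "gg' \<in> SLZ" and eq: "mul gg (tr (iota (a,b))) = mul gg' (tr (iota (a',b')))"
   using xy x by auto
  have 1: "a = a'" using arg_cong[OF eq, of gp] * by (simp add: SLZ_def iota_def)
  have 2: "b = b'" using arg_cong[OF eq, of gq] * by (simp add: SLZ_def iota_def)
  have "gg = gg'"
   using arg_cong[OF eq, of ga] arg_cong[OF eq, of gb] arg_cong[OF eq, of gc] arg_cong[OF eq, of gd] *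
   by (intro saff_eqI) (simp_all add: SLZ_def)
  with 1 2 x show "x = y" by simp
 qed
 show "(%(gg,n). mul gg (tr (iota n))) ` (SLZ \<times> UNIV) = SAff_int"
 proof (intro equalityI subsetI)
  fix gg assume "gg \<in> SAff_int"
  then obtain a b c d p q where g: "gg = saff_of_int (a,b,c,d,p,q)" "a * d - b * c = 1" by (rule SAff_int_obtain)
  have "saff_of_int (a,b,c,d,0,0) \<in> SLZ" using saff_of_int_in[OF g(2)] by (simp add: SLZ_def) (simp add: saff_of_int_def)
  moreover have "gg = mul (saff_of_int (a,b,c,d,0,0)) (tr (iota (p,q)))"
   by (rule saff_eqI) (simp_all add: g saff_of_int_def iota_def)
  ultimately show "gg \<in> (%(gg,n). mul gg (tr (iota n))) ` (SLZ \<times> UNIV)" by force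
 next
  fix gg assume "gg \<in> (%(gg,n). mul gg (tr (iota n))) ` (SLZ \<times> UNIV)"
  then obtain k n where "k \<in> SLZ" "gg = mul k (tr (iota n))" by (elim imageE SigmaE) simp
  then show "gg \<in> SAff_int" using SAff_int_mult[OF SLZ_sub tr_iota_in] by simp
 qed
qed

lemma bij_tr_SLZ: "bij_betw (%(gg,n). mul (tr (iota n)) gg) (SLZ \<times> UNIV) SAff_int"
proof -
 have "bij_betw saff_inv SAff_int SAff_int"
  by (rule bij_betw_byWitness[where f'=saff_inv]) (auto simp: saff_inv_inv SAff_int_sub)
 moreover have b: "bij_betw (%(gg,n). (saff_inv gg,- n)) (SLZ \<times> (UNIV :: (int \<times> int) set)) (SLZ \<times> UNIV)"
  by (rule bij_betw_byWitness[where f'="%(gg,n). (saff_inv gg,- n)"])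
   (auto simp: saff_inv_inv SLZ_def SAff_int_sub)
 ultimately have bij: "bij_betw (saff_inv \<circ> ((%(gg,n). mul gg (tr (iota n))) \<circ> (%(gg,n). (saff_inv gg,- n)))) (SLZ \<times> UNIV) SAff_int"
  by (intro bij_betw_trans[OF bij_betw_trans[OF _ bij_SLZ_tr]])
 have eq: "(saff_inv \<circ> ((%(gg,n). mul gg (tr (iota n))) \<circ> (%(gg,n). (saff_inv gg,- n)))) x = (%(gg,n). mul (tr (iota n)) gg) x"
  if "x \<in> SLZ \<times> (UNIV :: (int \<times> int) set)" for x
 proof -
  obtain gg n where x0: "x = (gg,n)" by (cases x)
  then have x: "x = (gg,n)" "gg \<in> SLZ" using that by simp_all
  have g: "gg \<in> SAff" using x by (simp add: SLZ_def SAff_int_sub)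
  have "saff_inv (mul (saff_inv gg) (tr (iota (- n)))) = mul (saff_inv (tr (iota (- n)))) gg"
   using g by (simp add: saff_inv_mult saff_inv_in saff_inv_inv)
  also have "saff_inv (tr (iota (- n))) = tr (iota n)" by (simp add: el_inv iota_def)
  finally show ?thesis by (simp add: x)
 qed
 show ?thesis by (rule bij_betw_cong[THEN iffD1, OF eq bij])
qed

abbreviation cG :: "saff measure" where "cG \<equiv> count_space SAff_int"

definition ginv :: "(saff => 'b) => bool" where
 "ginv H \<longleftrightarrow> (\<forall>gg\<in>SAff_int. \<forall>h\<in>SAff. H (mul gg h) = H h)"

lemma ginvD: "ginv H ==> gg \<in> SAff_int ==> h \<in> SAff ==> H (mul gg h) = H h"
 by (auto simp: ginv_def)

lemma ginv_comp: "ginv H ==> ginv (%h. f (H h))" by (auto simp: ginv_def)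

section \<open>Integration over the quotient by the lattice\<close>

locale haar_fd = haar +
 fixes D :: "saff set"
 assumes D_borel[measurable]: "D \<in> sets borel" and D_sub: "D \<subseteq> SAff"
  and D_fund: "AE x in nu. \<exists>!gg. gg \<in> SAff_int \<and> mul gg x \<in> D"
begin

definition nuD :: "saff measure" where "nuD = density nu (ind D)"

lemma sets_nuD[measurable_cong, simp]: "sets nuD = sets borel" and space_nuD[simp]: "space nuD = UNIV"
 by (auto simp: nuD_def sets_nu)

lemma nn_nuD: "f \<in> bmble borel ==> (NN h|nuD. f h) = (NN h|nu. ind D h * f h)"
 unfolding nuD_def by (rule nn_integral_density) auto

lemma AE_nuD: "(AE h in nuD. Q h) \<longleftrightarrow> (AE h in nu. h \<in> D \<longrightarrow> Q h)"
 unfolding nuD_def by (subst AE_density) (auto simp: indicator_def)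

lemma AE_nuD_SAff: "AE h in nuD. h \<in> SAff"
 unfolding AE_nuD using D_sub by auto

lemma AE_nuD_I: "AE h in nu. Q h ==> AE h in nuD. Q h"
 unfolding AE_nuD by (erule eventually_mono) simp

lemma sum_D: "AE h in nu. (NN gg|cG. ind D (mul gg h)) = 1"
 using D_fund
proof eventually_elim
 case (elim h)
 then obtain gg0 where g: "gg0 \<in> SAff_int" "!!gg. gg \<in> SAff_int ==> mul gg h \<in> D \<longleftrightarrow> gg = gg0" by metis
 have "(NN gg|cG. ind D (mul gg h)) = (NN gg|cG. (if gg = gg0 then 1 else 0))"
  using g by (intro nn_integral_cong) (simp add: indicator_def)
 then show ?case
  using g by (simp add: nn_integral_count_space_single)
qed

lemma measurable_sum_cG[measurable (raw)]:
 assumes [measurable]: "!!gg. (%x. F gg x) \<in> bmble M"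
 shows "(%x. NN gg|cG. F gg x) \<in> bmble M"
proof -
 interpret c: sigma_finite_measure cG by (rule sigma_finite_measure_count_space_countable[OF countable_SAff_int])
 have "(%(x,gg). F gg x) \<in> bmble (M \<otimes> cG)"
 proof -
  have "(%(gg,x). F gg x) \<in> bmble (cG \<otimes> M)"
   by (rule measurable_pair_measure_countable1) (use countable_SAff_int in auto)
  from measurable_pair_swap[OF this] show ?thesis by simp
 qed
 then show ?thesis by (rule c.borel_measurable_nn_integral)
qed

text \<open>\<open>P\<close> generalises the indicator of a fundamental domain to any nonnegative
  weight whose sum over orbits is 1. Replacing an element by its inverse in the sum moves the orbit
  sum from \<open>F\<close> to \<open>P\<close>.\<close>

lemma nn_unfold:
 assumes [measurable]: "P \<in> bmble borel" "F \<in> bmble borel"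
  and P: "AE h in nu. (NN gg|cG. P (mul gg h)) = 1"
 shows "(NN h|nu. P h * (NN gg|cG. F (mul gg h))) = (NN h|nu. F h)"
proof -
 have bij: "bij_betw saff_inv SAff_int SAff_int"
  by (rule bij_betw_byWitness[where f'=saff_inv]) (auto simp: saff_inv_inv SAff_int_sub)
 have "(NN h|nu. P h * (NN gg|cG. F (mul gg h))) = (NN h|nu. NN gg|cG. P h * F (mul gg h))"
  by (intro nn_integral_cong nn_integral_cmult[symmetric]) auto
 also have "... = (NN gg|cG. NN h|nu. P h * F (mul gg h))"
  by (rule nn_integral_count_space_nn_integral[OF countable_SAff_int]) measurable
 also have "... = (NN gg|cG. NN h|nu. P (mul (saff_inv gg) h) * F h)"
 proof (rule nn_integral_cong, goal_cases)
  case (1 gg)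
  then have g: "gg \<in> SAff" by (simp add: SAff_int_sub)
  have "(NN h|nu. P (mul (saff_inv gg) h) * F h) = (NN h|nu. P (mul (saff_inv gg) (mul gg h)) * F (mul gg h))"
   by (rule nn_left[OF _ g, symmetric]) measurable
  then show ?case
   by (simp add: saff_inv_cancel[OF g])
 qed
 also have "... = (NN gg|cG. NN h|nu. P (mul gg h) * F h)"
  by (rule nn_integral_bij_count_space[OF bij])
 also have "... = (NN h|nu. NN gg|cG. P (mul gg h) * F h)"
  by (rule nn_integral_count_space_nn_integral[OF countable_SAff_int, symmetric]) measurable
 also have "... = (NN h|nu. (NN gg|cG. P (mul gg h)) * F h)"
  by (intro nn_integral_cong nn_integral_multc) auto
 also have "... = (NN h|nu. F h)"
  by (rule nn_integral_cong_AE, use P in eventually_elim) simp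
 finally show ?thesis .
qed

lemma nn_unfold_D:
 assumes [measurable]: "F \<in> bmble borel"
 shows "(NN h|nuD. NN gg|cG. F (mul gg h)) = (NN h|nu. F h)"
 using nn_unfold[of "ind D" F, OF _ _ sum_D] by (subst nn_nuD) auto

text \<open>Independence of the choice of fundamental domain, in the form needed for averaged and
  rotated copies of \<open>D\<close>.\<close>

lemma nn_weight:
 assumes [measurable]: "P \<in> bmble borel" "H \<in> bmble borel"
  and P: "AE h in nu. (NN gg|cG. P (mul gg h)) = 1" and H: "ginv H"
 shows "(NN h|nu. P h * H h) = (NN h|nuD. H h)"
proof -
 have "(NN h|nu. P h * H h) = (NN h|nuD. NN gg|cG. P (mul gg h) * H (mul gg h))"
  by (rule nn_unfold_D[symmetric]) measurable
 also have "... = (NN h|nuD. H h)"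
 proof (rule nn_integral_cong_AE, use AE_nuD_SAff AE_nuD_I[OF P] in eventually_elim, goal_cases)
  case (1 h) note h = 1(1) and 1 = 1(2)
  have "(NN gg|cG. P (mul gg h) * H (mul gg h)) = (NN gg|cG. P (mul gg h) * H h)"
   using ginvD[OF H _ h] by (intro nn_integral_cong) simp
  also have "... = H h" using 1 by (subst nn_integral_multc) auto
  finally show ?case .
 qed
 finally show ?thesis .
qed

lemma AE_left:
 assumes k: "k \<in> SAff" and Q: "AE h in nu. Q h" and [measurable]: "Measurable.pred borel Q"
 shows "AE h in nu. Q (mul k h)"
proof -
 have "AE h in distr nu borel (mul k). Q h" using Q by (simp only: nu_left[OF k])
 then show ?thesis by (subst (asm) AE_distr_iff) auto
qed

text \<open>The average over the torus and the sum over integer translations combine to an integral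
  over the plane. There the matrices of \<open>SLZ\<close> act preserving measure and can be moved
  past the translations; splitting the plane again leaves the average of orbit sums equal to
  1.\<close>

lemma torus_weight: "AE h in nu. (NN gg|cG. NN s|TT. ind D (mul (tr (- s)) (mul gg h))) = 1"
proof -
 interpret P: pair_sigma_finite TT nu ..
 have "AE s in TT. AE h in nu. (NN gg|cG. ind D (mul gg (mul (tr s) h))) = 1"
  by (intro AE_I2 AE_left sum_D) auto
 then have "AE h in nu. AE s in TT. (NN gg|cG. ind D (mul gg (mul (tr s) h))) = 1"
 proof (rule P.AE_commute[THEN iffD1, rotated])
  have F: "(%h. NN gg|cG. ind D (mul gg h)) \<in> bmble borel"
   by measurable
  have fs: "fst \<in> measurable (TT \<otimes> nu) borel" "snd \<in> measurable (TT \<otimes> nu) borel"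
   using measurable_fst[of TT nu] measurable_snd[of TT nu] m_cong[OF refl sets_TT] m_cong[OF refl sets_nu] by blast+
  have "(%x. mul (tr (fst x)) (snd x)) \<in> bmble (TT \<otimes> nu)"
   by (intro measurable_saff_mult measurable_el borel_measurable_const
     measurable_compose[OF fs(1) measurable_fst_borel] measurable_compose[OF fs(1) measurable_snd_borel] fs)
  from measurable_compose[OF this F]
  have "(%x. NN gg|cG. ind D (mul gg (mul (tr (fst x)) (snd x)))) \<in> bmble (TT \<otimes> nu)" .
  then have "(%x. NN gg|cG. ind D (mul gg (mul (tr (fst x)) (snd x)))) -` {1} \<inter> space (TT \<otimes> nu) \<in> sets (TT \<otimes> nu)"
   by (rule measurable_sets) simp
  moreover have "f -` {1} \<inter> S = {x \<in> S. f x = 1}" for f :: "(R2) \<times> saff => ennreal" and S by blast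
  ultimately show "{x \<in> space (TT \<otimes> nu). (NN gg|cG. ind D (mul gg (mul (tr (fst x)) (snd x)))) = 1} \<in> sets (TT \<otimes> nu)"
   by (simp only:)
 qed
 then show ?thesis using AE_SAff
 proof eventually_elim
  fix h assume h: "h \<in> SAff" and 1: "AE s in TT. (NN gg|cG. ind D (mul gg (mul (tr s) h))) = 1"
  have "(NN gg|cG. NN s|TT. ind D (mul (tr (- s)) (mul gg h))) =
   (NN x|count_space (SLZ \<times> UNIV). (%gg. NN s|TT. ind D (mul (tr (- s)) (mul gg h))) ((%(gg,n). mul (tr (iota n)) gg) x))"
   by (rule nn_integral_bij_count_space[OF bij_tr_SLZ, symmetric])
  also have "... = (NN gg|count_space SLZ. NN n|cU. NN s|TT. ind D (mul (tr (iota n - s)) (mul gg h)))"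
  proof -
   have "mul (tr (- s)) (mul (mul (tr (iota n)) gg) h) = mul (tr (iota n - s)) (mul gg h)" for gg n s
   proof -
    have "mul (tr (- s)) (mul (mul (tr (iota n)) gg) h) = mul (mul (tr (- s)) (tr (iota n))) (mul gg h)"
     by (simp only: mul_assoc)
    moreover have "- s + iota n = iota n - s" by simp
    ultimately show ?thesis by (simp only: tr_add)
   qed
   then show ?thesis by (subst nn_integral_count_space_Times[OF countable_SLZ]) simp_all
  qed
  also have "... = (NN gg|count_space SLZ. NN s|lborel. ind D (mul (tr s) (mul gg h)))"
   by (rule nn_integral_cong, rule torus_unfold_minus) measurable
  also have "... = (NN gg|count_space SLZ. NN s|lborel. ind D (mul gg (mul (tr s) h)))"
  proof (rule nn_integral_cong, goal_cases)
   case (1 gg)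
   then have g: "gg \<in> SAff" by (simp add: SLZ_def SAff_int_sub)
   have "(NN s|lborel. ind D (mul (tr s) (mul gg h))) = (NN s|lborel. ind D (mul gg (mul (tr (plane_int gg s)) h)))"
    by (simp only: mul_assoc[symmetric] tr_saff[OF g])
   also have "... = (NN s|lborel. ind D (mul gg (mul (tr s) h)))"
    by (rule nn_plane_int[OF _ g, where \<phi>="%s. ind D (mul gg (mul (tr s) h))"]) measurable
   finally show ?case .
  qed
  also have "... = (NN gg|count_space SLZ. NN n|cU. NN s|TT. ind D (mul gg (mul (tr (s + iota n)) h)))"
   by (rule nn_integral_cong, rule torus_unfold[symmetric]) measurable
  also have "... = (NN x|count_space (SLZ \<times> UNIV). NN s|TT. ind D (mul ((%(gg,n). mul gg (tr (iota n))) x) (mul (tr s) h)))"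
  proof -
   have "mul (mul gg (tr (iota n))) (mul (tr s) h) = mul gg (mul (tr (s + iota n)) h)" for gg n s
   proof -
    have "mul (mul gg (tr (iota n))) (mul (tr s) h) = mul gg (mul (mul (tr (iota n)) (tr s)) h)"
     by (simp only: mul_assoc)
    moreover have "iota n + s = s + iota n" by (rule add.commute)
    ultimately show ?thesis by (simp only: tr_add)
   qed
   then show ?thesis by (subst nn_integral_count_space_Times[OF countable_SLZ]) simp_all
  qed
  also have "... = (NN gg|cG. NN s|TT. ind D (mul gg (mul (tr s) h)))"
   by (rule nn_integral_bij_count_space[OF bij_SLZ_tr])
  also have "... = (NN s|TT. NN gg|cG. ind D (mul gg (mul (tr s) h)))"
   by (rule nn_integral_count_space_nn_integral[OF countable_SAff_int, symmetric]) measurable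
  also have "... = (NN s|TT. 1)"
   by (rule nn_integral_cong_AE, use 1 in eventually_elim) simp
  also have "... = 1"
  proof -
   have "(NN s|TT. 1) = (NN s|lborel. ind ({0..<1::real} \<times> {0..<1::real}) s * 1)" by (rule nn_TT) simp
   also have "... = emeasure lborel ({0..<1::real} \<times> {0..<1::real})"
    unfolding mult_1_right by (rule nn_integral_indicator) simp
   also have "... = emeasure (lborel \<otimes> lborel) ({0..<1::real} \<times> {0..<1::real})" by (simp only: lborel_prod)
   also have "... = 1" by (subst lborel.emeasure_pair_measure_Times) auto
   finally show ?thesis .
  qed
  finally show "(NN gg|cG. NN s|TT. ind D (mul (tr (- s)) (mul gg h))) = 1" .
 qed
qed

text \<open>A single left translation \<open>tr s\<close> does not preserve invariance under the
  lattice, only the average over the whole torus does. Hence the translation is moved onto the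
  indicator of \<open>D\<close>, and the averaged indicator is a weight by
  \<open>torus_weight\<close>.\<close>

lemma nn_torus_average:
 assumes [measurable]: "H \<in> bmble borel" and H: "ginv H"
 shows "(NN h|nuD. NN s|TT. H (mul (tr s) h)) = (NN h|nuD. H h)"
proof -
 interpret P: pair_sigma_finite TT nu ..
 have "(NN h|nuD. NN s|TT. H (mul (tr s) h)) = (NN h|nu. NN s|TT. ind D h * H (mul (tr s) h))"
  by (subst nn_nuD) (auto simp: nn_integral_cmult)
 also have "... = (NN s|TT. NN h|nu. ind D h * H (mul (tr s) h))"
  by (rule P.Fubini') measurable
 also have "... = (NN s|TT. NN h|nu. ind D (mul (tr (- s)) h) * H h)"
 proof (rule nn_integral_cong, goal_cases)
  case (1 s)
  have "(NN h|nu. ind D (mul (tr (- s)) h) * H h) = (NN h|nu. ind D (mul (tr (- s)) (mul (tr s) h)) * H (mul (tr s) h))"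
   by (rule nn_left[OF _ el_in, symmetric]) measurable
  moreover have "mul (tr (- s)) (mul (tr s) h) = h" for h
   by (simp add: mul_assoc[symmetric] el_mult el_0)
  ultimately show ?case by simp
 qed
 also have "... = (NN h|nu. NN s|TT. ind D (mul (tr (- s)) h) * H h)"
  by (rule P.Fubini'[symmetric]) measurable
 also have "... = (NN h|nu. (NN s|TT. ind D (mul (tr (- s)) h)) * H h)"
  by (intro nn_integral_cong nn_integral_multc) measurable
 also have "... = (NN h|nuD. H h)"
  by (rule nn_weight[OF _ _ torus_weight H]) measurable
 finally show ?thesis .
qed

text \<open>Right rotations commute with the lattice, so the rotated \<open>D\<close> is again a
  fundamental domain up to null sets.\<close>

lemma nn_nuD_rot:
 assumes [measurable]: "H \<in> bmble borel" and H: "ginv H"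
 shows "(NN h|nuD. H (mul h (rot tt))) = (NN h|nuD. H h)"
proof -
 have rback: "mul (mul h (rot tt)) (rot (- tt)) = h" for h tt by (simp add: mul_assoc rot_add rot_0)
 have "(NN h|nuD. H (mul h (rot tt))) = (NN h|nu. ind D (mul (mul h (rot tt)) (rot (- tt))) * H (mul h (rot tt)))"
  by (subst nn_nuD) (auto simp: rback)
 also have "... = (NN h|nu. ind D (mul h (rot (- tt))) * H h)"
  by (rule nn_rot[where F="%h. ind D (mul h (rot (- tt))) * H h"]) measurable
 also have "... = (NN h|nuD. H h)"
 proof (rule nn_weight[OF _ _ _ H])
  have d: "distr nu borel (%h. mul h (rot (- tt))) = nu"
  proof (rule measure_eqI)
   fix A assume "A \<in> sets (distr nu borel (%h. mul h (rot (- tt))))"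
   then have [measurable]: "A \<in> sets borel" by simp
   have "emeasure (distr nu borel (%h. mul h (rot (- tt)))) A = (NN h|distr nu borel (%h. mul h (rot (- tt))). ind A h)" by simp
   also have "... = (NN h|nu. ind A (mul h (rot (- tt))))" by (rule nn_integral_distr) measurable
   also have "... = (NN h|nu. ind A h)" by (rule nn_rot) measurable
   finally show "emeasure (distr nu borel (%h. mul h (rot (- tt)))) A = emeasure nu A" by simp
  qed (simp add: sets_nu)
  have "AE h in distr nu borel (%h. mul h (rot (- tt))). (NN gg|cG. ind D (mul gg h)) = 1"
   using sum_D by (simp only: d)
  then have "AE h in nu. (NN gg|cG. ind D (mul gg (mul h (rot (- tt))))) = 1"
   by (subst (asm) AE_distr_iff) auto
  then show "AE h in nu. (NN gg|cG. ind D (mul (mul gg h) (rot (- tt)))) = 1"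
   by (simp only: mul_assoc)
 qed measurable
 finally show ?thesis .
qed

text \<open>An orbit visits a bounded set boundedly often: if \<open>gg\<close> and
  \<open>gg0\<close> both bring \<open>h\<close> there, then \<open>gg\<close> times the inverse of
  \<open>gg0\<close> is a lattice element whose entries are at most \<open>S\<close>, and there are
  only \<open>N\<close> of these. Square integrability on the quotient thereby gives local
  integrability on the group.\<close>

lemma nn_local_bound:
 "\<exists>N::nat. \<forall>H::saff => ennreal. H \<in> bmble borel \<longrightarrow> ginv H \<longrightarrow> (NN h|nu. ind {h. entries_le R h} h * H h) <= of_nat N * (NN h|nuD. H h)"
proof -
 define S where "S = 2 * R * (2 * R * R + R) + (2 * R * R + R)"
 define N where "N = card {h \<in> SAff_int. entries_le S h}"
 have [measurable]: "{h. entries_le R h} \<in> sets borel" by measurable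
 have bound: "(NN gg|cG. ind {h. entries_le R h} (mul gg h)) <= of_nat N" if h: "h \<in> SAff" for h
 proof -
  define A where "A = {gg \<in> SAff_int. entries_le R (mul gg h)}"
  have A: "finite A \<and> card A <= N"
  proof (cases "A = {}")
   case False
   then obtain gg0 where g0: "gg0 \<in> SAff_int" "entries_le R (mul gg0 h)" by (auto simp: A_def)
   have inj: "inj_on (%gg. mul gg (saff_inv gg0)) A"
    by (rule inj_onI) (metis g0(1) SAff_int_sub saff_inv_cancel_right(2))
   have img: "(%gg. mul gg (saff_inv gg0)) ` A \<subseteq> {h \<in> SAff_int. entries_le S h}"
   proof (rule image_subsetI, goal_cases)
    case (1 gg)
    then have g: "gg \<in> SAff_int" "entries_le R (mul gg h)" by (auto simp: A_def)
    have s: "gg \<in> SAff" "gg0 \<in> SAff" using g g0 by (auto simp: SAff_int_sub)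
    have "entries_le S (mul (mul gg h) (saff_inv (mul gg0 h)))"
     unfolding S_def by (intro entries_le_mult entries_le_inv g g0)
    also have "mul (mul gg h) (saff_inv (mul gg0 h)) = mul gg (saff_inv gg0)"
     by (simp only: saff_inv_mult[OF s(2) h] mul_assoc saff_inv_cancel(2)[OF h])
    finally show ?case using g g0 by auto
   qed
   show ?thesis unfolding N_def
    using inj img finite_SAff_int_bounded by (meson card_inj_on_le finite_subset finite_imageD)
  qed simp
  have "(NN gg|cG. ind {h. entries_le R h} (mul gg h)) = (NN gg|cG. ind A gg)"
   by (intro nn_integral_cong) (auto simp: indicator_def A_def)
  also have "... = of_nat (card A)"
   using A by (subst nn_integral_indicator) (auto simp: A_def emeasure_count_space)
  finally show ?thesis using A by simp
 qed
 show ?thesis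
 proof (intro exI[of _ N] allI impI)
  fix H :: "saff => ennreal" assume [measurable]: "H \<in> bmble borel" and H: "ginv H"
  have "(NN h|nu. ind {h. entries_le R h} h * H h) = (NN h|nuD. NN gg|cG. ind {h. entries_le R h} (mul gg h) * H (mul gg h))"
   by (rule nn_unfold_D[symmetric]) measurable
  also have "... <= (NN h|nuD. of_nat N * H h)"
  proof (rule nn_integral_mono_AE, use AE_nuD_SAff in eventually_elim, goal_cases)
   case h: (1 h)
   have "(NN gg|cG. ind {h. entries_le R h} (mul gg h) * H (mul gg h)) = (NN gg|cG. ind {h. entries_le R h} (mul gg h) * H h)"
    using ginvD[OF H _ h] by (intro nn_integral_cong) simp
   also have "... = (NN gg|cG. ind {h. entries_le R h} (mul gg h)) * H h" by (rule nn_integral_multc) auto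
   also have "... <= of_nat N * H h" by (intro mult_right_mono bound h) auto
   finally show ?case .
  qed
  also have "... = of_nat N * (NN h|nuD. H h)" by (rule nn_integral_cmult) measurable
  finally show "(NN h|nu. ind {h. entries_le R h} h * H h) <= of_nat N * (NN h|nuD. H h)" .
 qed
qed

lemma AE_nuD_transfer:
 assumes [measurable]: "Measurable.pred borel Q" and Q: "ginv Q" and ae: "AE h in nuD. Q h"
 shows "AE h in nu. Q h"
proof -
 have "(NN h|nu. ind {h. \<not> Q h} h) = (NN h|nuD. NN gg|cG. ind {h. \<not> Q h} (mul gg h))"
  by (rule nn_unfold_D[symmetric]) measurable
 also have "... = (NN h|nuD. 0)"
 proof (rule nn_integral_cong_AE, use AE_nuD_SAff ae in eventually_elim, goal_cases)
  case h: (1 h)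
  have "(NN gg|cG. ind {h. \<not> Q h} (mul gg h)) = (NN gg|cG. 0)"
   using ginvD[OF Q _ h(1)] h(2) by (intro nn_integral_cong) (auto simp: indicator_def)
  then show ?case by simp
 qed
 finally have "(NN h|nu. ind {h. \<not> Q h} h) = 0" by simp
 then have "emeasure nu {h. \<not> Q h} = 0" by (subst (asm) nn_integral_indicator) (auto simp: sets_nu)
 then show ?thesis by (subst AE_iff_measurable[OF _ refl]) (auto simp: sets_nu)
qed

lemma sigma_finite_nuD: "sigma_finite_measure nuD"
proof -
 have "sigma_finite_measure (density nu (ind D)) \<longleftrightarrow> (AE x in nu. ind D x ~= (oo::ennreal))"
  by (rule sigma_finite_iff_density_finite) measurable
 then show ?thesis unfolding nuD_def by (auto simp: indicator_def)
qed

end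

section \<open>Fourier coefficients along the torus\<close>


lemma emeasure_TT_UNIV: "emeasure TT UNIV = 1"
proof -
 have "emeasure TT UNIV = emeasure I01 UNIV * emeasure I01 UNIV"
  unfolding TT_def using I01.emeasure_pair_measure_Times[of UNIV I01 UNIV] by simp
 then show ?thesis by simp
qed

lemma nn_integral_count_space_le:
 fixes g :: "'a => ennreal"
 assumes "countable (UNIV :: 'a set)" and le: "!!A. finite A ==> sum g A <= B"
 shows "(NN n|cU. g n) <= B"
proof (cases "finite (UNIV :: 'a set)")
 case True
 then show ?thesis using le[OF True] by (simp add: nn_integral_count_space_finite)
next
 case False
 have "(NN n|cU. g n) = (NN n|cU. g (from_nat_into UNIV n))"
  by (rule nn_integral_bij_count_space[OF bij_betw_from_nat_into[OF assms(1) False], symmetric])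
 also have "... = (\<Sum>n. g (from_nat_into UNIV n))" by (rule nn_integral_count_space_nat)
 also have "... <= B"
 proof (rule suminf_le_const)
  fix N
  have "inj_on (from_nat_into (UNIV :: 'a set)) {..<N}"
   using bij_betw_from_nat_into[OF assms(1) False] by (auto simp: bij_betw_def intro: inj_on_subset)
  then have "(\<Sum>n<N. g (from_nat_into UNIV n)) = sum g (from_nat_into UNIV ` {..<N})" by (simp add: sum.reindex)
  then show "(\<Sum>n<N. g (from_nat_into UNIV n)) <= B" using le by simp
 qed simp
 finally show ?thesis .
qed

lemma chr_sqint: "chr n \<in> sqint TT"
 unfolding sqint_def by (simp add: m_cong[OF sets_TT refl])

lemma ip_chr: "ip TT (chr n) (chr m) = (if n = m then 1 else 0)"
 unfolding ip_def using integral_TT_chr[of "n - m"] chr_add[of n "- m"] by (simp add: cnj_chr)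

lemma bessel_finite:
 assumes g: "g \<in> sqint TT" and A: "finite A"
 shows "(\<Sum>n\<in>A. (norm (LINT s|TT. g s * chr (- n) s))^2) <= nrm2 TT g"
proof -
 define c where "c n = (LINT s|TT. g s * chr (- n) s)" for n
 have cip: "ip TT g (chr n) = c n" for n by (simp add: ip_def c_def cnj_chr)
 define S where "S s = (\<Sum>n\<in>A. c n * chr n s)" for s
 have Sq: "S \<in> sqint TT" unfolding S_def[abs_def] by (intro sqint_sum chr_sqint)
 have 1: "ip TT S g = of_real (\<Sum>n\<in>A. (norm (c n))^2)"
  unfolding S_def[abs_def] by (subst ip_sum_left[OF A chr_sqint g]) (simp add: ip_cnj[of TT "chr _" g] cip mult_cnj_norm)
 have "ip TT (chr n) S = (if n \<in> A then cnj (c n) else 0)" for n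
 proof -
  have "ip TT S (chr n) = (\<Sum>m\<in>A. c m * ip TT (chr m) (chr n))"
   unfolding S_def[abs_def] by (rule ip_sum_left[OF A chr_sqint chr_sqint])
  also have "... = (if n \<in> A then c n else 0)" using A by (simp add: ip_chr if_distrib cong: if_cong)
  finally show ?thesis using ip_cnj[of TT "chr n" S] by auto
 qed
 then have "ip TT S S = of_real (\<Sum>n\<in>A. (norm (c n))^2)"
  by (subst (1) S_def[abs_def], subst ip_sum_left[OF A chr_sqint Sq]) (simp add: mult_cnj_norm)
 then have 2: "nrm2 TT S = (\<Sum>n\<in>A. (norm (c n))^2)" unfolding ip_self of_real_eq_iff .
 have "nrm2 TT (%s. S s - g s) = nrm2 TT S - 2 * Re (ip TT S g) + nrm2 TT g" by (rule nrm2_diff[OF Sq g])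
 then show ?thesis using nrm2_nonneg[of TT "%s. S s - g s"] unfolding 1 2 Re_complex_of_real c_def by linarith
qed

lemma bessel_TT:
 assumes [measurable]: "g \<in> bmble borel"
 shows "(NN n|cU. nsq (LINT s|TT. g s * chr (- n) s)) <= (NN s|TT. nsq (g s))"
proof (cases "(NN s|TT. nsq (g s)) = oo")
 case False
 have "integrable TT (%s. (norm (g s))^2)"
  using False by (intro integrableI_bounded) (auto simp: top.not_eq_extremum)
 then have g: "g \<in> sqint TT" by (simp add: sqint_def)
 show ?thesis
 proof (rule nn_integral_count_space_le)
  fix A :: "(int \<times> int) set" assume A: "finite A"
  have "(\<Sum>n\<in>A. nsq (LINT s|TT. g s * chr (- n) s)) = ennreal (\<Sum>n\<in>A. (norm (LINT s|TT. g s * chr (- n) s))^2)"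
   by (rule sum_ennreal) simp
  also have "... <= ennreal (nrm2 TT g)" by (intro ennreal_leI bessel_finite g A)
  finally show "(\<Sum>n\<in>A. nsq (LINT s|TT. g s * chr (- n) s)) <= (NN s|TT. nsq (g s))"
   by (simp add: nrm2_nn_integral[OF g])
 qed simp
qed simp

text \<open>The reindexing \<open>j\<close> is for multiplication by \<open>M\<close>, since a
  transform has only frequencies divisible by \<open>M\<close>. Summability of \<open>c\<close>
  justifies the exchange for a merely integrable \<open>g\<close>.\<close>

lemma integral_character_series:
 fixes j :: "int \<times> int => int \<times> int"
 assumes g: "integrable TT g" and c: "integrable (cU) c"
 shows "(LINT s|TT. g s * cnj (LINT n|cU. c n * chr (j n) s)) = (LINT n|cU. cnj (c n) * (LINT s|TT. g s * chr (- j n) s))"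
  and "integrable TT (%s. g s * cnj (LINT n|cU. c n * chr (j n) s))"
  and "integrable (cU) (%n. cnj (c n) * (LINT s|TT. g s * chr (- j n) s))"
proof -
 have gm[measurable]: "g \<in> bmble TT" using g by simp
 have gchr: "integrable TT (%s. g s * chr n s)" for n
  by (rule intble_bound[OF g]) (auto simp: norm_mult)
 have meas: "(%(n,s). cnj (c n) * (g s * chr (- j n) s)) \<in> bmble (cU \<otimes> TT)"
  by (rule measurable_pair_measure_countable1) auto
 have int: "integrable (cU \<otimes> TT) (%(n,s). cnj (c n) * (g s * chr (- j n) s))"
 proof (rule cntTT.Fubini_integrable[OF meas])
  show "integrable (cU) (%n. LINT s|TT. norm (case (n,s) of (n,s) => cnj (c n) * (g s * chr (- j n) s)))"
   using c by (simp add: norm_mult)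
  show "AE n in cU. integrable TT (%s. case (n,s) of (n,s) => cnj (c n) * (g s * chr (- j n) s))"
   by (intro AE_I2) (auto intro!: gchr)
 qed
 have eq: "g s * cnj (LINT n|cU. c n * chr (j n) s) = (LINT n|cU. cnj (c n) * (g s * chr (- j n) s))" for s
 proof -
  have "cnj (LINT n|cU. c n * chr (j n) s) = (LINT n|cU. cnj (c n * chr (j n) s))"
   by (rule Bochner_Integration.integral_cnj[symmetric])
  then have "g s * cnj (LINT n|cU. c n * chr (j n) s) = (LINT n|cU. g s * cnj (c n * chr (j n) s))"
   by (simp only: integral_mult_right_zero)
  also have "... = (LINT n|cU. cnj (c n) * (g s * chr (- j n) s))"
   by (intro lint_cong) (auto simp: cnj_chr)
  finally show ?thesis .
 qed
 have "(LINT s|TT. g s * cnj (LINT n|cU. c n * chr (j n) s)) = (LINT s|TT. LINT n|cU. cnj (c n) * (g s * chr (- j n) s))"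
  by (simp only: eq)
 also have "... = (LINT n|cU. LINT s|TT. cnj (c n) * (g s * chr (- j n) s))"
  by (rule cntTT.Fubini_integral[OF int])
 finally show "(LINT s|TT. g s * cnj (LINT n|cU. c n * chr (j n) s)) = (LINT n|cU. cnj (c n) * (LINT s|TT. g s * chr (- j n) s))"
  by simp
 show "integrable TT (%s. g s * cnj (LINT n|cU. c n * chr (j n) s))"
  unfolding eq using cntTT.integrable_snd[OF int] by simp
 show "integrable (cU) (%n. cnj (c n) * (LINT s|TT. g s * chr (- j n) s))"
  using cntTT.integrable_fst'[OF int] by simp
qed

definition psih :: "(saff => complex) => int \<times> int => saff => complex" where
 "psih psi n h = (LINT s|TT. psi (mul (tr s) h) * chr (- n) s)"

lemma measurable_psih[measurable]:
 assumes [measurable]: "psi \<in> bmble borel"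
 shows "psih psi n \<in> bmble borel"
 unfolding psih_def by measurable

text \<open>The integer form of \<open>xi\<close>; on lattice elements the floor only changes the
  type, see \<open>vec_real\<close>.\<close>

definition vec :: "saff => int \<times> int" where
 "vec gg = (\<lfloor>gd gg\<rfloor>,- \<lfloor>gc gg\<rfloor>)"

lemma vec_real:
 assumes "gg \<in> SAff_int" shows "roi (fst (vec gg)) = gd gg" "roi (snd (vec gg)) = - gc gg"
 using assms by (auto simp: vec_def SAff_int_iff)

lemma iota_in: "mul (tr (s + iota n)) h = mul (tr (iota n)) (mul (tr s) h)"
proof -
 have "mul (tr (iota n)) (mul (tr s) h) = mul (mul (tr (iota n)) (tr s)) h" by (simp only: mul_assoc)
 moreover have "iota n + s = s + iota n" by (rule add.commute)
 ultimately show ?thesis by (simp only: tr_add)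
qed

text \<open>The linear substitution by \<open>gg\<close> on the torus turns the character
  \<open>(k,0)\<close> into \<open>k\<close> times the primitive vector \<open>vec gg\<close>. Every
  nonzero frequency is thus reduced to one of the form \<open>(k,0)\<close>, at a translated
  point.\<close>

lemma psih_gamma:
 assumes m[measurable]: "psi \<in> bmble borel" and inv: "ginv psi" and gg: "gg \<in> SAff_int" and h: "h \<in> SAff"
 shows "psih psi (k,0) (mul gg h) = psih psi (smul k (vec gg)) h"
proof -
 define G where "G s = psi (mul (tr s) h) * chr (- smul k (vec gg)) s" for s
 have d: "ga gg * gd gg - gb gg * gc gg = 1" using SAff_int_sub[OF gg] by (simp add: SAff_iff)
 have "psi (mul (tr s) (mul gg h)) * chr (- (k,0)) s = G (plane_int gg s + 0)" for s
 proof -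
  have "mul (tr s) (mul gg h) = mul gg (mul (tr (plane_int gg s)) h)"
   by (simp only: mul_assoc[symmetric] tr_saff[OF SAff_int_sub[OF gg]])
  then have 1: "psi (mul (tr s) (mul gg h)) = psi (mul (tr (plane_int gg s)) h)"
   using ginvD[OF inv gg, of "mul (tr (plane_int gg s)) h"] h by (simp add: mul_in del: mul_comps)
  have "roi k * fst s = roi k * (ga gg * gd gg - gb gg * gc gg) * fst s" by (simp add: d)
  also have "... = roi (fst (smul k (vec gg))) * fst (plane_int gg s) + roi (snd (smul k (vec gg))) * snd (plane_int gg s)"
   unfolding smul_def plane_int_def by (simp add: vec_real[OF gg] algebra_simps)
  finally have "chr (- (k,0)) s = chr (- smul k (vec gg)) (plane_int gg s)"
   unfolding chr_def by (simp add: algebra_simps)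
  then show ?thesis unfolding G_def 1 by simp
 qed
 then have "psih psi (k,0) (mul gg h) = (LINT s|TT. G (plane_int gg s + 0))" unfolding psih_def by simp
 also have "... = (LINT s|TT. G s)"
 proof (rule integral_torus_automorphism[OF _ _ gg])
  show "G (s + iota n) = G s" for s n
   unfolding G_def iota_in chr_iota using ginvD[OF inv tr_iota_in mul_in[OF el_in h]] by simp
 qed (simp add: G_def[abs_def])
 finally show ?thesis unfolding G_def psih_def .
qed

lemma plane_int_one: "plane_int saff_one s = s" by (simp add: plane_int_def)

lemma psih_tr:
 assumes m[measurable]: "psi \<in> bmble borel" and inv: "ginv psi" and h: "h \<in> SAff"
 shows "psih psi n (mul (tr c) h) = chr n c * psih psi n h"
proof -
 define G where "G s = psi (mul (tr s) h) * chr (- n) s" for s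
 have shift: "chr n c * chr (- n) (s + c) = chr (- n) s" for s
  by (simp add: chr_def e_fun_add[symmetric] algebra_simps)
 have "psi (mul (tr s) (mul (tr c) h)) * chr (- n) s = chr n c * G (plane_int saff_one s + c)" for s
 proof -
  have "mul (tr s) (mul (tr c) h) = mul (tr (s + c)) h"
   by (simp only: mul_assoc[symmetric] tr_add)
  then show ?thesis unfolding G_def plane_int_one using shift[of s] by (simp add: mult_ac)
 qed
 then have "psih psi n (mul (tr c) h) = chr n c * (LINT s|TT. G (plane_int saff_one s + c))" unfolding psih_def by simp
 also have "(LINT s|TT. G (plane_int saff_one s + c)) = (LINT s|TT. G s)"
 proof (rule integral_torus_automorphism)
  show "G (s + iota n) = G s" for s n
   unfolding G_def iota_in chr_iota using ginvD[OF inv tr_iota_in mul_in[OF el_in h]] by simp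
 qed (simp_all add: G_def[abs_def])
 finally show ?thesis unfolding G_def psih_def .
qed

lemma eta_gamma:
 assumes "gg \<in> SAff_int" shows "eta (k,0) (mul gg h) = eta (smul k (vec gg)) h"
 unfolding eta_def smul_def by (simp add: vec_real[OF assms] algebra_simps)

lemma pair_dot_vec2: "pair_dot xe (snd (mul x h)) = gp x * pair_dot xe (fst h $ 1) + gq x * pair_dot xe (fst h $ 2) + pair_dot xe (snd h)"
 unfolding pair_dot_def by (simp add: algebra_simps)

text \<open>The matrix part permutes the dual frequencies as in \<open>psih_gamma\<close>, and the
  integral translation part changes the phase by an integer.\<close>

lemma th_gamma:
 assumes gg: "gg \<in> SAff_int" and h: "h \<in> SAff"
 shows "th f (k,0) (mul gg h) = th f (smul k (vec gg)) h"
proof -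
 have "pair_dot (eta (smul k (vec gg)) h) (snd (mul gg h)) = pair_dot (eta (smul k (vec gg)) h) (snd h) + (gp gg * of_int (fst (smul k (vec gg))) + gq gg * of_int (snd (smul k (vec gg))))"
  unfolding pair_dot_vec2 pair_dot_eta[OF h] by simp
 moreover have "gp gg * of_int (fst (smul k (vec gg))) + gq gg * of_int (snd (smul k (vec gg))) \<in> \<int>"
  using gg by (intro Ints_add Ints_mult) (auto simp: SAff_int_iff)
 ultimately show ?thesis unfolding th_def eta_gamma[OF gg] by (simp only: e_fun_add_int)
qed

lemma eta_tr: "eta n (mul (tr c) h) = eta n h"
 by (simp add: eta_def)

lemma th_tr:
 assumes h: "h \<in> SAff" shows "th f n (mul (tr c) h) = chr n c * th f n h"
 unfolding th_def eta_tr pair_dot_vec2 pair_dot_eta[OF h] chr_def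
 by (simp add: e_fun_add mult_ac)

lemma measurable_fhat[measurable]:
 assumes [measurable]: "f \<in> bmble borel"
 shows "fhat f \<in> bmble borel"
proof -
 have "(%z. pair_dot (fst z) (snd z)) \<in> bmble borel"
  unfolding pair_dot_def by (intro bmble_cont continuous_intros)
 then have "(%z. f (snd z) * e_fun (- pair_dot (fst z) (snd z))) \<in> bmble borel"
  by (rule borel_measurable_times[OF measurable_compose[OF measurable_snd_borel assms]
    measurable_compose[OF borel_measurable_uminus measurable_e_fun]])
 moreover have "sets (borel \<otimes> lborel) = sets (borel :: ((R2) \<times> (real^2)) measure)"
  unfolding borel_prod[symmetric] by (rule sets_pair_measure_cong) auto
 ultimately have "(%(xe,y). f y * e_fun (- pair_dot xe y)) \<in> bmble (borel \<otimes> lborel)"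
  unfolding case_prod_unfold using m_cong by blast
 then show ?thesis unfolding fhat_def[abs_def] by (rule lborel.borel_measurable_lebesgue_integral)
qed

lemma measurable_eta[measurable]: "eta n \<in> bmble borel"
 unfolding eta_def by measurable

lemma measurable_th[measurable]:
 assumes [measurable]: "f \<in> bmble borel"
 shows "th f n \<in> bmble borel"
 unfolding th_def pair_dot_def by measurable

lemma smul_gcd: "a * d - b * c = 1 ==> k >= 0 ==> gcd (fst (smul k (d,- c))) (snd (smul k (d,- c))) = (k :: int)"
proof -
 assume det: "a * d - b * c = 1" and k: "k >= 0"
 have "gcd d c dvd a * d - b * c" by (intro dvd_diff dvd_mult) auto
 then have "gcd d c = 1" unfolding det by simp
 then show ?thesis using k by (simp add: smul_def gcd_mult_left)
qed

text \<open>Every nonzero \<open>n\<close> is uniquely \<open>sig k v\<close> with \<open>k \<ge> 1\<close> and \<open>v\<close> primitive, and the primitive vectors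
 are the cosets of the unipotent integral subgroup, for which the set of \<open>h\<close> with
 \<open>crd h \<in> cube\<close> is a fundamental domain.\<close>

definition orbit_set :: "saff => (int \<times> saff) set" where
 "orbit_set h = {(k,gg). k >= 1 \<and> gg \<in> SAff_int \<and> crd (mul gg h) \<in> cube}"

text \<open>The coordinates are forced to vanish one after the other: the last is twisted by
  \<open>p\<close>, so \<open>p = 0\<close> must be known before \<open>q\<close>.\<close>

lemma crd_cube_unique:
 assumes h: "h \<in> SAff" and u: "u = el x p q" "x \<in> \<int>" "p \<in> \<int>" "q \<in> \<int>"
  and c: "crd h \<in> cube" "crd (mul u h) \<in> cube"
 shows "u = saff_one"
proof -
 obtain X P Q where v: "crd h = (X,P,Q)" by (cases "crd h")
 have "crd (mul u h) = mulU (x,p,q) (crd h)"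
  using crd_el3[OF h, of "(x,p,q)"] by (simp add: u el3_def)
 then have *: "0 <= X" "X < 1" "0 <= P" "P < 1" "0 <= Q" "Q < 1" "0 <= x + X" "x + X < 1" "0 <= p + P" "p + P < 1" "0 <= p * X + q + Q" "p * X + q + Q < 1"
  using c by (auto simp: v mulU_def cube_def)
 have Z: "r = 0" if "r \<in> \<int>" "\<bar>r\<bar> < 1" for r :: real using that by (auto elim!: Ints_cases)
 have x: "x = 0" using * u by (intro Z) auto
 have p: "p = 0" using * u by (intro Z) auto
 have q: "q = 0" using * u p by (intro Z) auto
 show ?thesis unfolding u x p q by (rule el_0)
qed

text \<open>Primitive vectors are closed under negation, so either value of \<open>sig\<close> lists
  all nonzero frequencies. This freedom later isolates the coefficients with positive and with
  negative index separately.\<close>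

lemma bij_orbit_set:
 assumes h: "h \<in> SAff" and sig: "sig = 1 \<or> sig = (-1::int)"
 shows "bij_betw (%(k,gg). smul (sig * k) (vec gg)) (orbit_set h) (UNIV - {0})"
proof (rule bij_betw_imageI)
 have sig2: "sig * (sig * t) = t" for t using sig by auto
 show "inj_on (%(k,gg). smul (sig * k) (vec gg)) (orbit_set h)"
 proof (rule inj_onI)
  fix y z assume y: "y \<in> orbit_set h" and z: "z \<in> orbit_set h" and eq: "(%(k,gg). smul (sig * k) (vec gg)) y = (%(k,gg). smul (sig * k) (vec gg)) z"
  obtain k gg k' gg' where yz: "y = (k,gg)" "z = (k',gg')" by (metis surj_pair)
  have 1: "k >= 1" "gg \<in> SAff_int" "crd (mul gg h) \<in> cube" "k' >= 1" "gg' \<in> SAff_int" "crd (mul gg' h) \<in> cube"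
   using y z by (auto simp: yz orbit_set_def)
  obtain a b c d p q where g: "gg = saff_of_int (a,b,c,d,p,q)" "a * d - b * c = 1" using 1(2) by (rule SAff_int_obtain)
  obtain a' b' c' d' p' q' where g': "gg' = saff_of_int (a',b',c',d',p',q')" "a' * d' - b' * c' = 1" using 1(5) by (rule SAff_int_obtain)
  have v: "vec gg = (d,- c)" "vec gg' = (d',- c')" by (simp_all add: vec_def g g' saff_of_int_def)
  have "smul sig (smul (sig * k) (vec gg)) = smul sig (smul (sig * k') (vec gg'))" using eq by (simp add: yz)
  then have eq': "smul k (d,- c) = smul k' (d',- c')" by (simp add: smul_def v sig2 mult.assoc)
  have "k = k'" using smul_gcd[OF g(2), of k] smul_gcd[OF g'(2), of k'] eq' 1 by simp
  with eq' 1 have cd: "d = d'" "c = c'" by (auto simp: smul_def)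
  \<comment> \<open>Equal bottom rows make \<open>u\<close> an integral unipotent element, and it
    joins two points with coordinates in the unit cube.\<close>
  define u where "u = mul gg' (saff_inv gg)"
  have ui: "u \<in> SAff_int" unfolding u_def using 1 by blast
  have "roi a * roi d - roi b * roi c = 1"
   by (metis g(2) of_int_1 of_int_diff of_int_mult)
  moreover have "roi a' * roi d - roi b' * roi c = 1"
   by (metis g'(2) cd of_int_1 of_int_diff of_int_mult)
  ultimately have "gc u = 0" "gd u = 1" "ga u = 1"
   unfolding u_def g g' by (simp_all add: saff_of_int_def algebra_simps flip: cd)
  then have uel: "u = el (gb u) (gp u) (gq u)" by (intro saff_eqI) simp_all
  have ugg: "mul u gg = gg'" unfolding u_def using 1 by (simp add: saff_inv_cancel_right SAff_int_sub)
  have "u = saff_one"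
  proof (rule crd_cube_unique[OF _ uel])
   show "mul gg h \<in> SAff" using 1 h SAff_int_sub by blast
   show "crd (mul u (mul gg h)) \<in> cube" using 1 by (simp only: mul_assoc[symmetric] ugg)
  qed (use ui 1 in \<open>auto simp: SAff_int_iff\<close>)
  then have "gg = gg'" using ugg by simp
  then show "y = z" using \<open>k = k'\<close> by (simp add: yz)
 qed
 show "(%(k,gg). smul (sig * k) (vec gg)) ` orbit_set h = UNIV - {0}"
 proof (intro equalityI subsetI)
  fix n assume "n \<in> (%(k,gg). smul (sig * k) (vec gg)) ` orbit_set h"
  then obtain k gg where n: "n = smul (sig * k) (vec gg)" "k >= 1" "gg \<in> SAff_int" by (auto simp: orbit_set_def)
  obtain a b c d p q where g: "gg = saff_of_int (a,b,c,d,p,q)" "a * d - b * c = 1" using n(3) by (rule SAff_int_obtain)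
  have "vec gg = (d,- c)" by (simp add: vec_def g saff_of_int_def)
  then have "vec gg ~= 0" using g(2) by (auto simp: zero_prod_def)
  then have "n ~= 0" using n sig by (cases "vec gg") (auto simp: smul_def zero_prod_def)
  then show "n \<in> UNIV - {0}" by simp
 next
  fix n :: "int \<times> int" assume "n \<in> UNIV - {0}"
  then have n: "n ~= 0" by simp
  define k where "k = gcd (fst n) (snd n)"
  have k: "k >= 1"
  proof -
   have "k ~= 0" using n unfolding k_def by (cases n) (auto simp: zero_prod_def)
   then show ?thesis using gcd_ge_0_int[of "fst n" "snd n"] unfolding k_def by linarith
  qed
  obtain d e where de: "fst n = k * d" "snd n = k * e" unfolding k_def by (metis dvdE gcd_dvd1 gcd_dvd2)
  have "gcd (k * d) (k * e) = k" unfolding de[symmetric] by (rule k_def[symmetric])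
  then have "k * gcd d e = k" using k by (simp add: gcd_mult_left)
  then have "gcd (sig * d) (sig * e) = 1" using k sig by auto
  \<comment> \<open>Bezout coefficients complete the primitive vector to an integral matrix of
    determinant 1.\<close>
  then obtain r t where rt: "r * (sig * d) + t * (sig * e) = 1" using bezout_int[of "sig * d" "sig * e"] by auto
  define gg1 where "gg1 = saff_of_int (r,t,- (sig * e),sig * d,0,0)"
  have g1: "gg1 \<in> SAff_int" unfolding gg1_def by (rule saff_of_int_in) (use rt in simp)
  obtain X P Q where v: "crd (mul gg1 h) = (X,P,Q)" by (cases "crd (mul gg1 h)")
  \<comment> \<open>An integral unipotent element moves the coordinates into the cube. The last one
    is reduced only after adding the twist \<open>j * X\<close> caused by moving the second.\<close>
  define i j l where "i = - roi \<lfloor>X\<rfloor>" and "j = - roi \<lfloor>P\<rfloor>" and "l = - roi \<lfloor>j * X + Q\<rfloor>"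
  define gg where "gg = mul (el i j l) gg1"
  have "el i j l \<in> SAff_int" by (simp add: SAff_int_iff i_def j_def l_def)
  then have g: "gg \<in> SAff_int" unfolding gg_def using g1 by blast
  have "crd (mul gg h) = mulU (i,j,l) (crd (mul gg1 h))"
   using crd_el3[OF mul_in[OF SAff_int_sub[OF g1] h], of "(i,j,l)"] by (simp add: gg_def el3_def mul_assoc)
  also have "... \<in> cube" unfolding v mulU_def cube_def
   by (auto simp: i_def j_def l_def) (linarith+)?
  finally have "crd (mul gg h) \<in> cube" .
  then have in_orb: "(k,gg) \<in> orbit_set h" using k g by (simp add: orbit_set_def)
  have "gc gg = roi (- (sig * e))" "gd gg = roi (sig * d)"
   by (simp_all add: gg_def gg1_def saff_of_int_def)
  then have "vec gg = (sig * d,sig * e)" unfolding vec_def by (simp only: floor_of_int minus_minus)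
  then have "smul (sig * k) (vec gg) = n" using de sig by (auto simp: smul_def prod_eq_iff)
  then show "n \<in> (%(k,gg). smul (sig * k) (vec gg)) ` orbit_set h" using in_orb by force
 qed
qed

abbreviation cK :: "int measure" where "cK \<equiv> count_space {1..}"
abbreviation cT :: "(int \<times> saff) measure" where "cT \<equiv> count_space ({1..} \<times> SAff_int)"

lemma orbit_set_sub: "orbit_set h \<subseteq> {1..} \<times> SAff_int"
 by (auto simp: orbit_set_def)

lemma nn_orbit_sum:
 assumes "h \<in> SAff" "sig = 1 \<or> sig = (-1::int)"
 shows "(NN n|count_space (UNIV - {0}). g n) = (NN x|cT. ind cube (crd (mul (snd x) h)) * g (smul (sig * fst x) (vec (snd x))))"
proof -
 have "(NN n|count_space (UNIV - {0}). g n) = (NN x|count_space (orbit_set h). g ((%(k,gg). smul (sig * k) (vec gg)) x))"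
  by (rule nn_integral_bij_count_space[OF bij_orbit_set[OF assms], symmetric])
 also have "... = (NN x|cT. g ((%(k,gg). smul (sig * k) (vec gg)) x) * ind (orbit_set h) x)"
  using orbit_set_sub[of h]
  by (subst restrict_count_space_subset[OF orbit_set_sub, symmetric], subst nn_integral_restrict_space) auto
 also have "... = (NN x|cT. ind cube (crd (mul (snd x) h)) * g (smul (sig * fst x) (vec (snd x))))"
  by (intro nn_integral_cong) (auto simp: indicator_def orbit_set_def)
 finally show ?thesis .
qed

lemma integral_orbit_sum:
 fixes g :: "int \<times> int => complex"
 assumes "h \<in> SAff" "sig = 1 \<or> sig = (-1::int)"
 shows "(LINT n|count_space (UNIV - {0}). g n) = (LINT x|cT. ind cube (crd (mul (snd x) h)) * g (smul (sig * fst x) (vec (snd x))))"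
proof -
 have "(LINT n|count_space (UNIV - {0}). g n) = (LINT x|count_space (orbit_set h). g ((%(k,gg). smul (sig * k) (vec gg)) x))"
  by (rule integral_bij_count_space[OF bij_orbit_set[OF assms], symmetric])
 also have "... = (LINT x|cT. ind (orbit_set h) x *\<^sub>R g ((%(k,gg). smul (sig * k) (vec gg)) x))"
  using orbit_set_sub[of h]
  by (subst restrict_count_space_subset[OF orbit_set_sub, symmetric], subst integral_restrict_space) auto
 also have "... = (LINT x|cT. ind cube (crd (mul (snd x) h)) * g (smul (sig * fst x) (vec (snd x))))"
  by (intro lint_cong) (auto simp: indicator_def orbit_set_def)
 finally show ?thesis .
qed

section \<open>The scalar product with a Siegel--Veech transform\<close>

lemma kap_tr: "kap ((x,p,u),xe) = mul (tr (p,u - p * x)) (kt x xe)"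
 unfolding kap_def case_prod_conv mul_assoc[symmetric] by (simp add: el_mult)

lemma nn_I01_half_open: "f \<in> bmble borel ==> (NN x|I01. f x) = (NN x|lborel. ind {0..<1} x * f x)"
 unfolding I01_half_open by (rule nn_integral_density) auto

lemma eta_kap: "eta (m,0) (kap (v,xe)) = (of_int m * fst xe,of_int m * snd xe)"
proof -
 have "gd (kap (v,xe)) = fst xe" "gc (kap (v,xe)) = - snd xe"
  using xi_kap[of v xe] by (auto simp: xi_def prod_eq_iff)
 then show ?thesis by (simp add: eta_def)
qed

lemma snd_kap_0: "pair_dot \<eta> (snd (kt x xe)) = 0"
 by (simp add: pair_dot_def kap_def)

lemma th_kap: "th f (m,0) (kt x xe) = fhat f (of_int m * fst xe,of_int m * snd xe)"
 unfolding th_def eta_kap snd_kap_0 by simp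

lemma cnj_chr_mult: "chr n c * cnj (chr n c) = 1"
 using mult_cnj_norm[of "chr n c"] by simp

lemma four_power_ge: "1 + (real n)^2 <= 4 ^ n"
proof (induction n)
 case (Suc n)
 have "1 + (real (Suc n))^2 = 2 + 2 * real n + (real n)^2" by (simp add: power2_eq_square algebra_simps)
 also have "2 * real n <= 1 + (real n)^2" using sum_squares_bound[of 1 "real n"] by simp
 finally have "1 + (real (Suc n))^2 <= 3 + 2 * (real n)^2" by linarith
 also have "... <= 4 * (1 + (real n)^2)" by simp
 also have "... <= 4 * 4 ^ n" using Suc by (intro mult_left_mono) auto
 finally show ?case by simp
qed simp

lemma smul_smul: "smul a (smul b n) = smul (a * b) n"
 by (simp add: smul_def mult.assoc)

lemma inj_smul: "k ~= 0 ==> inj (smul k)"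
 by (auto simp: inj_def smul_def prod_eq_iff)

text \<open>The transform is set to 0 outside the group, where \<open>SV_expansion\<close> gives no
  information; Borel measurability on the ambient type then follows from the expansion.\<close>

definition svr :: "nat => (real^2 => complex) => saff => complex" where
 "svr M f h = (if h \<in> SAff then SV_rel M f h else 0)"

lemma ginv_SV_rel:
 assumes "gg \<in> SAff_int" and M: "M >= 1"
 shows "SV_rel M f (mul gg h) = SV_rel M f h"
proof -
 obtain a b c d p q where g: "gg = saff_of_int (a,b,c,d,p,q)" "a * d - b * c = 1" using assms(1) by (rule SAff_int_obtain)
 \<comment> \<open>The action on indices: the matrix part acts unimodularly, and the integral
   translation \<open>(p, q)\<close>, expressed in the lattice divided by \<open>M\<close>, shifts
   them by \<open>M\<close> times \<open>(p, q)\<close>.\<close>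
 define r where "r = (%(j,l). (j * a + l * c + int M * p,j * b + l * d + int M * q))"
 have bij: "bij_betw r UNIV UNIV"
 proof (rule bij_betw_byWitness[where f'="%(j,l). ((j - int M * p) * d - (l - int M * q) * c,(l - int M * q) * a - (j - int M * p) * b)"])
  have e1: "(j * a + l * c) * d - (j * b + l * d) * c = (a * d - b * c) * j" "(j * b + l * d) * a - (j * a + l * c) * b = (a * d - b * c) * l" for j l
   by (simp_all add: algebra_simps)
  show "\<forall>x\<in>UNIV. (%(j,l). ((j - int M * p) * d - (l - int M * q) * c,(l - int M * q) * a - (j - int M * p) * b)) (r x) = x"
   unfolding r_def by (auto simp: e1 g(2))
  have e2: "(x * d - y * c) * a + (y * a - x * b) * c = (a * d - b * c) * x" "(x * d - y * c) * b + (y * a - x * b) * d = (a * d - b * c) * y" for x y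
   by (simp_all add: algebra_simps)
  show "\<forall>x\<in>UNIV. r ((%(j,l). ((j - int M * p) * d - (l - int M * q) * c,(l - int M * q) * a - (j - int M * p) * b)) x) = x"
   unfolding r_def by (auto simp: e2 g(2))
 qed auto
 define F where "F = (%(j,l). f (snd h + (1 / real M) *\<^sub>R (of_int j *\<^sub>R (fst h $ 1) + of_int l *\<^sub>R (fst h $ 2))))"
 have "SV_rel M f (mul gg h) = (\<Sum>\<^sub>\<infinity>x\<in>UNIV. F (r x))"
  unfolding SV_rel_def
 proof (rule infsum_cong, goal_cases)
  case (1 x)
  obtain j l where x: "x = (j,l)" by (cases x)
  have "snd (mul gg h) + (1 / real M) *\<^sub>R (of_int j *\<^sub>R (fst (mul gg h) $ 1) + of_int l *\<^sub>R (fst (mul gg h) $ 2))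
   = snd h + (1 / real M) *\<^sub>R (of_int (fst (r x)) *\<^sub>R (fst h $ 1) + of_int (snd (r x)) *\<^sub>R (fst h $ 2))"
   using M unfolding x r_def g by (simp add: vec_eq_iff forall_2 saff_of_int_def field_simps)
  then show ?case
   unfolding F_def x by (simp add: case_prod_unfold)
 qed
 also have "... = (\<Sum>\<^sub>\<infinity>x\<in>UNIV. F x)" by (rule infsum_reindex_bij_betw[OF bij])
 finally show ?thesis unfolding SV_rel_def F_def .
qed

lemma ginv_svr: "M >= 1 ==> ginv (svr M f)"
 unfolding ginv_def svr_def using ginv_SV_rel by (auto simp: SAff_int_sub mul_in)

lemma svr_tr:
 assumes f: "!!k. Ck k f" and R: "supp_le R f" and M: "M >= 1" and h: "h \<in> SAff"
 shows "svr M f (mul (tr s) h) = (of_nat M)^2 * (LINT n|cU. th f (smul (int M) n) h * chr (smul (int M) n) s)"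
proof -
 have "mul (tr s) h \<in> SAff" using h by (intro mul_in) simp_all
 then have "svr M f (mul (tr s) h) = (of_nat M)^2 * (LINT n|cU. th f (smul (int M) n) (mul (tr s) h))"
  using SV_expansion(2)[OF f R M] by (simp add: svr_def del: mul_comps)
 then show ?thesis by (simp only: th_tr[OF h] mult.commute[of "chr _ _"])
qed

lemma measurable_svr:
 assumes f: "!!k. Ck k f" and R: "supp_le R f" and M: "M >= 1"
 shows "svr M f \<in> bmble borel"
proof -
 have [measurable]: "f \<in> bmble borel" using Ck_continuous[OF f[of 0]] by (rule bmble_cont)
 have "(%(n,h). th f (smul (int M) n) h) \<in> bmble (cU \<otimes> borel)"
  by (rule measurable_pair_measure_countable1) auto
 from measurable_pair_swap[OF this]
 have "(%(h,n). th f (smul (int M) n) h) \<in> bmble (borel \<otimes> cU)" by simp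
 then have "(%h. LINT n|cU. th f (smul (int M) n) h) \<in> bmble borel"
  by (rule cnt.borel_measurable_lebesgue_integral)
 then have "(%h. ind SAff h * ((of_nat M)^2 * (LINT n|cU. th f (smul (int M) n) h))) \<in> bmble borel"
  by measurable
 also have "(%h. ind SAff h * ((of_nat M)^2 * (LINT n|cU. th f (smul (int M) n) h))) = svr M f"
  using SV_expansion(2)[OF f R M] by (auto simp: svr_def fun_eq_iff indicator_def)
 finally show ?thesis .
qed

lemma parseval_series:
 fixes c :: "int \<times> int => complex" and j :: "int \<times> int => int \<times> int"
 assumes c: "integrable (cU) c" and j: "inj j"
 defines "Q \<equiv> %s. LINT n|cU. c n * chr (j n) s"
 shows "(NN s|TT. nsq (Q s)) = (NN n|cU. nsq (c n))"
  and "Q \<in> bmble TT"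
proof -
 have "(%(n,h). c n * chr (j n) h) \<in> bmble (cU \<otimes> TT)"
  by (rule measurable_pair_measure_countable1) auto
 from measurable_pair_swap[OF this]
 show Qm[measurable]: "Q \<in> bmble TT" unfolding Q_def
  by (intro cnt.borel_measurable_lebesgue_integral) simp
 have Qb: "norm (Q s) <= (LINT n|cU. norm (c n))" for s
  unfolding Q_def using integral_norm_bound[of "cU" "%n. c n * chr (j n) s"] by (simp add: norm_mult)
 have Qs: "(LINT n|cU. c n * chr (j n) s) = Q s" for s by (simp only: Q_def)
 have Qi: "integrable TT Q" by (rule TT.integrable_const_bound[of _ "LINT n|cU. norm (c n)"]) (use Qb in auto)
 have chri: "integrable TT (chr n)" for n by (intro continuous_TT_integrable continuous_chr)
 have coef: "(LINT s|TT. Q s * chr (- j m) s) = c m" for m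
 proof -
  have "(LINT s|TT. chr (j m) s * cnj (Q s)) = (LINT n|cU. cnj (c n) * (LINT s|TT. chr (j m) s * chr (- j n) s))"
   unfolding Q_def by (rule integral_character_series(1)[OF chri c])
  also have "... = (LINT n|cU. cnj (c n) * (if n = m then 1 else 0))"
  proof (rule lint_cong[OF refl], goal_cases)
   case (1 n)
   have "(LINT s|TT. chr (j m) s * chr (- j n) s) = (LINT s|TT. chr (j m - j n) s)"
    using chr_add[of "j m" "- j n"] by simp
   then show ?case
    using injD[OF j, of m n] by (auto simp: integral_TT_chr)
  qed
  also have "... = cnj (c m)"
   by (subst lebesgue_integral_count_space_finite_support) (auto simp: if_distrib cong: if_cong)
  finally have 1: "(LINT s|TT. chr (j m) s * cnj (Q s)) = cnj (c m)" .
  have "(LINT s|TT. Q s * chr (- j m) s) = (LINT s|TT. cnj (chr (j m) s * cnj (Q s)))"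
   by (intro lint_cong) (auto simp: cnj_chr)
  also have "... = cnj (LINT s|TT. chr (j m) s * cnj (Q s))" by (rule Bochner_Integration.integral_cnj)
  finally show ?thesis unfolding 1 by simp
 qed
 have 1: "(LINT s|TT. Q s * cnj (Q s)) = (LINT n|cU. cnj (c n) * c n)"
  using integral_character_series(1)[OF Qi c, of j] unfolding Qs coef .
 have 2: "integrable (cU) (%n. cnj (c n) * c n)"
  using integral_character_series(3)[OF Qi c, of j] unfolding coef .
 have 3: "integrable TT (%s. Q s * cnj (Q s))"
  using integral_character_series(2)[OF Qi c, of j] unfolding Qs .
 have i1: "integrable TT (%s. (norm (Q s))^2)"
  using integrable_norm[OF 3] by (simp add: norm_mult power2_eq_square)
 have i2: "integrable (cU) (%n. (norm (c n))^2)"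
  using integrable_norm[OF 2] by (simp add: norm_mult power2_eq_square)
 have "cor (LINT s|TT. (norm (Q s))^2) = (LINT s|TT. Q s * cnj (Q s))"
  unfolding integral_complex_of_real[symmetric] by (intro lint_cong) (auto simp: mult_cnj_norm)
 also have "... = cor (LINT n|cU. (norm (c n))^2)"
  unfolding 1 integral_complex_of_real[symmetric] by (intro lint_cong) (auto simp: mult_cnj_norm mult.commute[of "cnj _"])
 finally have "(LINT s|TT. (norm (Q s))^2) = (LINT n|cU. (norm (c n))^2)" by (simp only: of_real_eq_iff)
 then show "(NN s|TT. nsq (Q s)) = (NN n|cU. nsq (c n))"
  by (subst (1 2) nn_integral_eq_integral) (auto intro: i1 i2)
qed

context haar_fd
begin

text \<open>A function that ignores the two translation coordinates sees only the shear; integrating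
  the other two over the cube contributes 1.\<close>

lemma nn_cube_chart:
 assumes [measurable]: "G \<in> bmble borel"
  and inv: "!!x p u xe. xe ~= (0,0) ==> G (kap ((x,p,u),xe)) = G (kt x xe)"
 shows "(NN h|nu. ind cube (crd h) * G h) = (NN xe|lam. NN t|I01. G (kt t xe))"
proof -
 have "(NN h|nu. ind cube (crd h) * G h) = (NN xe|lam. NN v|lborel. ind cube (crd (kap (v,xe))) * G (kap (v,xe)))"
  by (rule nn_chart) measurable
 also have "... = (NN xe|lam. NN t|I01. G (kt t xe))"
 proof (rule nn_integral_cong_AE, use AE_lam_nonzero in eventually_elim, goal_cases)
  case xe: (1 xe)
  define F where "F t = G (kt t xe)" for t
  have [measurable]: "F \<in> bmble borel" unfolding F_def by measurable
  have m: "(%v. ind cube v * F (fst v)) \<in> bmble borel" by measurable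
  have "(NN v|lborel. ind cube (crd (kap (v,xe))) * G (kap (v,xe))) = (NN v|lborel. ind cube v * F (fst v))"
  proof (rule nn_integral_cong, goal_cases)
   case (1 v)
   obtain a b c where v: "v = (a,b,c)" by (cases v)
   show ?case
    unfolding crd_kap[OF xe] unfolding v inv[OF xe, of a b c] F_def by simp
  qed
  also have "... = (NN x|lborel. NN p|lborel. NN u|lborel. ind {0..<1} x * F x * (ind {0..<1::real} p * ind {0..<1::real} u))"
  proof -
   have "ind cube (x,p,u) * F (fst (x,p,u)) = ind {0..<1} x * F x * (ind {0..<1} p * ind {0..<1} u)" for x p u
    by (auto simp: cube_def indicator_def)
   then show ?thesis unfolding nn_integral_space3[OF m] by simp
  qed
  also have "... = (NN x|lborel. ind {0..<1} x * F x)"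
   by (simp add: nn_integral_cmult nn_integral_multc)
  also have "... = (NN t|I01. F t)" by (rule nn_I01_half_open[symmetric]) simp
  finally show ?case
   unfolding F_def .
 qed
 finally show ?thesis .
qed

lemma nn_core:
 assumes m[measurable]: "!!k. \<Phi> k \<in> bmble borel"
  and inv: "!!k x p u xe. xe ~= (0,0) ==> \<Phi> k (kap ((x,p,u),xe)) = \<Phi> k (kt x xe)"
 shows "(NN h|nuD. NN x|cT. ind cube (crd (mul (snd x) h)) * \<Phi> (fst x) (mul (snd x) h)) =
  (NN k|cK. NN xe|lam. NN t|I01. \<Phi> k (kt t xe))"
proof -
 have "(NN h|nuD. NN x|cT. ind cube (crd (mul (snd x) h)) * \<Phi> (fst x) (mul (snd x) h)) =
  (NN h|nuD. NN k|cK. NN gg|cG. ind cube (crd (mul gg h)) * \<Phi> k (mul gg h))"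
  by (subst nn_integral_count_space_Times[OF _ countable_SAff_int]) simp_all
 also have "... = (NN k|cK. NN h|nuD. NN gg|cG. ind cube (crd (mul gg h)) * \<Phi> k (mul gg h))"
  by (rule nn_integral_count_space_nn_integral) (simp, measurable)
 also have "... = (NN k|cK. NN h|nu. ind cube (crd h) * \<Phi> k h)"
  by (rule nn_integral_cong, rule nn_unfold_D[where F="%h. ind cube (crd h) * \<Phi> _ h"]) measurable
 also have "... = (NN k|cK. NN xe|lam. NN t|I01. \<Phi> k (kt t xe))"
  by (rule nn_integral_cong, rule nn_cube_chart) (auto intro: inv)
 finally show ?thesis .
qed

text \<open>Unfolding in the manner of Rankin and Selberg. By \<open>eq\<close> the terms with fixed
  \<open>k\<close> form a sum over the cosets of the integral unipotent group, which together with
  the integral over the quotient becomes an integral over that group's quotient, the plane of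
  \<open>xi\<close> times a circle of shears.\<close>

lemma nn_orbit:
 assumes m[measurable]: "!!n. g n \<in> bmble borel" and sig: "sig = 1 \<or> sig = (-1::int)"
  and eq: "!!k gg h. gg \<in> SAff_int ==> h \<in> SAff ==> g (sig * k,0) (mul gg h) = g (smul (sig * k) (vec gg)) h"
  and inv: "!!n s h. h \<in> SAff ==> g n (mul (tr s) h) = g n h"
 shows "(NN h|nuD. NN n|count_space (UNIV - {0}). g n h) = (NN k|cK. NN xe|lam. NN t|I01. g (sig * k,0) (kt t xe))"
proof -
 have "(NN h|nuD. NN n|count_space (UNIV - {0}). g n h) = (NN h|nuD. NN x|cT. ind cube (crd (mul (snd x) h)) * g (sig * fst x,0) (mul (snd x) h))"
 proof (rule nn_integral_cong_AE, use AE_nuD_SAff in eventually_elim, goal_cases)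
  case h: (1 h)
  show ?case
   unfolding nn_orbit_sum[OF h sig] using eq[OF _ h] by (intro nn_integral_cong) auto
 qed
 also have "... = (NN k|cK. NN xe|lam. NN t|I01. g (sig * k,0) (kt t xe))"
 proof (rule nn_core[where \<Phi>="%k. g (sig * k,0)"])
  fix k :: int and x p u and xe :: "R2" assume "xe ~= (0,0)"
  then show "g (sig * k,0) (kap ((x,p,u),xe)) = g (sig * k,0) (kt x xe)"
   unfolding kap_tr[of x p u xe] by (intro inv kap_in)
 qed simp
 finally show ?thesis .
qed

text \<open>Bessel's inequality on each torus fibre, integrated over the quotient and
  unfolded.\<close>

lemma nn_psih_bound:
 assumes m[measurable]: "psi \<in> bmble borel" and inv: "ginv psi" and sig: "sig = 1 \<or> sig = (-1::int)"
 shows "(NN k|cK. NN xe|lam. NN t|I01. nsq (psih psi (sig * k,0) (kt t xe))) <= (NN h|nuD. nsq (psi h))"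
proof -
 have "(NN k|cK. NN xe|lam. NN t|I01. nsq (psih psi (sig * k,0) (kt t xe)))
  = (NN h|nuD. NN n|count_space (UNIV - {0}). nsq (psih psi n h))"
  by (rule nn_orbit[OF _ sig, symmetric, where g="%n h. nsq (psih psi n h)"])
   (auto simp: psih_gamma[OF m inv] psih_tr[OF m inv] norm_mult)
 also have "... <= (NN h|nuD. NN s|TT. nsq (psi (mul (tr s) h)))"
 proof (rule nn_integral_mono, goal_cases)
  case (1 h)
  have "(NN n|count_space (UNIV - {0}). nsq (psih psi n h)) <= (NN n|cU. nsq (psih psi n h))"
  proof -
   have "(NN n|count_space (UNIV - {0}). nsq (psih psi n h)) = (NN n|cU. nsq (psih psi n h) * ind (UNIV - {0}) n)"
    by (subst restrict_count_space_subset[OF subset_UNIV, symmetric], subst nn_integral_restrict_space) auto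
   also have "... <= (NN n|cU. nsq (psih psi n h))"
    by (intro nn_integral_mono) (auto simp: indicator_def)
   finally show ?thesis .
  qed
  also have "... <= (NN s|TT. nsq (psi (mul (tr s) h)))"
   unfolding psih_def by (rule bessel_TT) measurable
  finally show ?case .
 qed
 also have "... = (NN h|nuD. nsq (psi h))"
  by (rule nn_torus_average[where H="%h. nsq (psi h)"]) (auto intro: ginv_comp[OF inv])
 finally show ?thesis .
qed

section \<open>Integrability of decaying functions for the quotient measure\<close>

definition shell :: "(R2) set" where
 "shell = {xe. 1 <= (fst xe)^2 + (snd xe)^2 \<and> (fst xe)^2 + (snd xe)^2 < 4}"

lemma sets_shell[measurable]: "shell \<in> sets borel" unfolding shell_def by measurable

lemma lam_shell_finite: "emeasure lam shell < oo"
proof -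
 have "shell \<subseteq> annulus 1"
 proof
  fix xe :: "R2" assume s: "xe \<in> shell"
  have "(fst xe)^2 <= 2^2" "(snd xe)^2 <= 2^2" using s zero_le_power2[of "fst xe"] zero_le_power2[of "snd xe"] unfolding shell_def by (simp_all, linarith+)
  then have "\<bar>fst xe\<bar> <= 2" "\<bar>snd xe\<bar> <= 2" using abs_le_square_iff[of _ "2::real"] by fastforce+
  then show "xe \<in> annulus 1" using s by (simp add: shell_def annulus_def)
 qed
 then have "emeasure lam shell <= emeasure lam (annulus 1)" by (rule emeasure_mono) simp
 then show ?thesis using lam_annulus_finite[of 1] by (rule le_less_trans)
qed

text \<open>Only homogeneity and finiteness on one dyadic shell are used. The shell number j has
  mass 4^j times that of \<open>shell\<close>, and the integrand there is at most (1 + 4^j)^(-2);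
  the resulting term is at most 4^(-|j|), hence at most 1 / (1 + j^2).\<close>

lemma nn_lam_decay_finite: "(NN xe|lam. ennreal (1 / (1 + ((fst xe)^2 + (snd xe)^2))^2)) < oo"
proof -
 define N where "N xe = (fst xe)^2 + (snd xe)^2" for xe :: "R2"
 have [measurable]: "N \<in> bmble borel" unfolding N_def by measurable
 define F where "F xe = ennreal (1 / (1 + N xe)^2)" for xe
 have [measurable]: "F \<in> bmble borel" unfolding F_def by measurable
 define S where "S j xe = (ind shell (2 powi (- j) * fst xe,2 powi (- j) * snd xe) :: ennreal)" for j :: int and xe :: "R2"
 have [measurable]: "S j \<in> bmble borel" for j unfolding S_def by measurable
 have sh: "S j xe = ind {xe. 4 powi j <= N xe \<and> N xe < 4 powi (j + 1)} xe" for j xe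
 proof -
  have "(2 powi (- j) * fst xe)^2 + (2 powi (- j) * snd xe)^2 = N xe / 4 powi j"
  proof -
   have "(2 powi (- j) :: real)^2 = (2^2) powi (- j)" by (metis power_int_mult power_int_numeral mult.commute power_int_power')
   then have "(2 powi (- j) :: real)^2 = 1 / 4 powi j" by (simp add: power_int_minus divide_inverse)
   then show ?thesis by (simp add: power_mult_distrib N_def add_divide_distrib)
  qed
  moreover have "(4 powi j :: real) > 0" by simp
  moreover have "(4 powi (j + 1) :: real) = 4 * 4 powi j" by (simp add: power_int_add)
  ultimately show ?thesis unfolding S_def shell_def indicator_def mem_Collect_eq fst_conv snd_conv
   by (simp only:) (simp add: field_simps)
 qed
 have cover: "1 <= (NN j|cU. S j xe)" if "xe ~= (0,0)" for xe
 proof -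
  have N0: "N xe > 0" unfolding N_def by (rule pair_nonzero_sq[OF that])
  define j where "j = \<lfloor>log 4 (N xe)\<rfloor>"
  have "4 powr roi j <= N xe" "N xe < 4 powr roi (j + 1)"
   using N0 unfolding j_def by (auto simp: le_log_iff[symmetric] log_less_iff[symmetric])
  then have "4 powi j <= N xe" "N xe < 4 powi (j + 1)" using powr_real_of_int'[of "4::real" j] powr_real_of_int'[of "4::real" "j + 1"] by simp_all
  then have "S j xe = 1" unfolding sh indicator_def by simp
  then have "1 = (NN i|cU. (if i = j then 1 else 0))" by (simp add: nn_integral_count_space_single)
  also have "... <= (NN j|cU. S j xe)" using \<open>S j xe = 1\<close> by (intro nn_integral_mono) auto
  finally show ?thesis .
 qed
 have tm: "(NN xe|lam. S j xe * F xe) <= ennreal (1 / (1 + (roi j)^2)) * emeasure lam shell" for j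
 proof -
  have p: "(2 powi j :: real) > 0" "(4 powi j :: real) > 0" by simp_all
  have "(NN xe|lam. S j xe * F xe) <= (NN xe|lam. ennreal (1 / (1 + 4 powi j)^2) * S j xe)"
  proof (rule nn_integral_mono, goal_cases)
   case (1 xe)
   show ?case
   proof (cases "4 powi j <= N xe")
    case True
    then have "(1 + 4 powi j)^2 <= (1 + N xe)^2" using p by (intro power_mono) auto
    moreover have "0 < (1 + 4 powi j :: real)^2" using p by (intro zero_less_power) linarith
    ultimately have "F xe <= ennreal (1 / (1 + 4 powi j)^2)" unfolding F_def by (intro ennreal_leI divide_left_mono mult_pos_pos) linarith+
    then show ?thesis by (subst mult.commute) (rule mult_right_mono, simp_all)
   next
    case False then show ?thesis by (simp add: sh)
   qed
  qed
  also have "... = ennreal (1 / (1 + 4 powi j)^2) * (NN xe|lam. S j xe)" by (rule nn_integral_cmult) measurable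
  also have "(NN xe|lam. S j xe) = ennreal ((2 powi j)^2) * (NN xe|lam. S j (2 powi j * fst xe,2 powi j * snd xe))"
   by (rule nn_lam_scale[OF _ p(1)]) measurable
  also have "(%xe. S j (2 powi j * fst xe,2 powi j * snd xe)) = ind shell"
  proof -
   have "2 powi (- j) * (2 powi j * t) = t" for t :: real by (simp add: mult.assoc[symmetric] power_int_add[symmetric])
   then show ?thesis unfolding S_def by (simp only: fst_conv snd_conv prod.collapse)
  qed
  also have "(2 powi j :: real)^2 = 4 powi j"
   using power_int_mult_distrib[of "2::real" 2 j] by (simp add: power2_eq_square)
  also have "(NN xe|lam. ind shell xe) = emeasure lam shell" by simp
  also have "ennreal (1 / (1 + 4 powi j)^2) * (ennreal (4 powi j) * emeasure lam shell) = ennreal (4 powi j / (1 + 4 powi j)^2) * emeasure lam shell"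
   unfolding mult.assoc[symmetric] by (subst ennreal_mult[symmetric]) (use p in simp_all)
  also have "... <= ennreal (1 / (1 + (roi j)^2)) * emeasure lam shell"
  proof (intro mult_right_mono ennreal_leI)
   define n where "n = nat \<bar>j\<bar>"
   define y where "y = (4 powi j :: real)"
   have y: "y = 4 ^ n \<or> y = 1 / 4 ^ n"
   proof (cases "j >= 0")
    case True
    then have "j = int n" unfolding n_def by linarith
    then show ?thesis unfolding y_def by (simp only: power_int_of_nat simp_thms)
   next
    case False
    then have "j = - int n" unfolding n_def by linarith
    then show ?thesis unfolding y_def by (simp only: power_int_minus power_int_of_nat inverse_eq_divide simp_thms)
   qed
   have q: "(4::real) ^ n > 0" by simp
   have "y / (1 + y)^2 <= 1 / 4 ^ n"
   proof -
    have "4 ^ n * y <= (1 + y)^2"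
     using y
    proof
     assume "y = 4 ^ n"
     then have "4 ^ n * y = y * y" by simp
     also have "... <= (1 + y)^2" using p y_def by (simp add: power2_eq_square algebra_simps)
     finally show ?thesis .
    next
     assume "y = 1 / 4 ^ n"
     then have "4 ^ n * y = 1" using q by simp
     also have "... <= (1 + y)^2" using p y_def by (simp add: power2_eq_square algebra_simps)
     finally show ?thesis .
    qed
    moreover have "(1 + y)^2 > 0" using p y_def by (intro zero_less_power) linarith
    ultimately show ?thesis using q by (simp add: pos_divide_le_eq pos_le_divide_eq mult.commute)
   qed
   also have "... <= 1 / (1 + (real n)^2)"
    using four_power_ge[of n] by (intro divide_left_mono) (auto intro!: mult_pos_pos add_pos_nonneg)
   also have "(real n)^2 = (roi j)^2" unfolding n_def by simp
   finally show "4 powi j / (1 + 4 powi j)^2 <= 1 / (1 + (roi j)^2)" unfolding y_def .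
  qed simp
  finally show ?thesis .
 qed
 have "(NN xe|lam. F xe) <= (NN xe|lam. NN j|cU. S j xe * F xe)"
 proof (rule nn_integral_mono_AE, use AE_lam_nonzero in eventually_elim, goal_cases)
  case (1 xe)
  from cover[OF this] have "1 * F xe <= (NN j|cU. S j xe) * F xe" by (rule mult_right_mono) simp
  then show ?case by (simp add: nn_integral_multc)
 qed
 also have "... = (NN j|cU. NN xe|lam. S j xe * F xe)"
  by (rule nn_integral_count_space_nn_integral) (simp, measurable)
 also have "... <= (NN j|cU. ennreal (1 / (1 + (roi j)^2)) * emeasure lam shell)"
  by (intro nn_integral_mono tm)
 also have "... = (NN j|cU. ennreal (1 / (1 + (roi j)^2))) * emeasure lam shell"
  by (rule nn_integral_multc) simp
 also have "... < oo"
 proof -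
  have "(NN j|cU. ennreal (1 / (1 + (roi j)^2))) < oo"
   using integrable_inverse_squares_int by (subst (asm) integrable_iff_bounded) simp
  then show ?thesis using lam_shell_finite by (simp add: ennreal_mult_less_top)
 qed
 finally show ?thesis unfolding F_def N_def .
qed

end

lemma nn_integral_cK_mult_le:
 fixes g :: "int => ennreal"
 assumes "M >= 1"
 shows "(NN k|cK. g (M * k)) <= (NN k|cK. g k)"
proof -
 have "bij_betw ((*) M) {1..} ((*) M ` {1..})" using assms by (intro inj_on_imp_bij_betw) (auto simp: inj_on_def)
 then have "(NN k|cK. g (M * k)) = (NN k|count_space ((*) M ` {1..}). g k)"
  by (rule nn_integral_bij_count_space)
 also have "... = (NN k|cK. ind ((*) M ` {1..}) k * g k)"
 proof -
  have "1 <= M * k" if "1 <= k" for k using assms that mult_mono[of 1 M 1 k] by simp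
  then have "(*) M ` {1..} \<subseteq> {1..}" by auto
  then show ?thesis by (subst nn_integral_count_space_eq[where B="(*) M ` {1..}"]) (auto intro!: nn_integral_cong simp: indicator_def)
 qed
 also have "... <= (NN k|cK. g k)" by (intro nn_integral_mono) (auto simp: indicator_def)
 finally show ?thesis .
qed

lemma sigma_finite_cK: "sigma_finite_measure cK"
 by (rule sigma_finite_measure_count_space_countable) simp

lemma sigma_finite_cT: "sigma_finite_measure cT"
 by (rule sigma_finite_measure_count_space_countable) (simp add: countable_SAff_int)

interpretation cK: sigma_finite_measure cK by (rule sigma_finite_cK)
interpretation cT: sigma_finite_measure cT by (rule sigma_finite_cT)

lemma measurable_cK_pair:
 assumes "!!k. (%x. F k x) \<in> bmble N"
 shows "(%(k,x). F k x) \<in> bmble (cK \<otimes> N)"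
 by (rule measurable_pair_measure_countable1) (use assms in auto)

text \<open>The shear variable is integrated as well, so this is the coefficient for a character of
  the Heisenberg group that depends on the coordinate \<open>p\<close> alone;
  \<open>omg_unfold\<close> brings it to that form.\<close>

definition omg :: "(saff => complex) => int => R2 => complex" where
 "omg psi m xe = (LINT t|I01. psih psi (m,0) (kt t xe))"

lemma measurable_kap_t[measurable]: "(%(xe,t). kap ((t,0,0),xe)) \<in> bmble (borel \<otimes> borel)"
 by measurable

lemma measurable_omg[measurable]:
 assumes [measurable]: "psi \<in> bmble borel"
 shows "omg psi m \<in> bmble borel"
proof -
 have "(%x. psih psi (m,0) ((%(xe,t). kap ((t,0,0),xe)) x)) \<in> bmble (borel \<otimes> borel)"
  by (rule measurable_compose[OF measurable_kap_t measurable_psih[OF assms]])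
 then have "(%(xe,t). psih psi (m,0) (kt t xe)) \<in> bmble (borel \<otimes> I01)"
  by (simp add: case_prod_unfold cong: m_cong)
 then show ?thesis unfolding omg_def[abs_def] by (rule I01.borel_measurable_lebesgue_integral)
qed

context haar_fd
begin

sublocale nuD: sigma_finite_measure nuD by (rule sigma_finite_nuD)
sublocale lam: sigma_finite_measure lam by (rule sigma_finite_lam)
sublocale lamI: pair_sigma_finite lam I01 ..
sublocale cKlam: pair_sigma_finite cK lam ..
sublocale cKlamI: pair_sigma_finite cK "lam \<otimes> I01" ..
sublocale nuDcT: pair_sigma_finite nuD cT ..
sublocale nuDTT: pair_sigma_finite nuD TT ..

text \<open>The complex companion of \<open>nn_core\<close>, without a second unfolding: by
  \<open>nn_core\<close>, \<open>F\<close> under \<open>M'\<close> and \<open>G\<close> under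
  \<open>N\<close> have the same law, so \<open>integral_law\<close> applies. The cube indicator
  enters as the density of \<open>M'\<close>.\<close>

lemma integral_core:
 fixes \<Phi> :: "int => saff => complex"
 assumes m[measurable]: "!!k. \<Phi> k \<in> bmble borel"
  and inv: "!!k x p u xe. xe ~= (0,0) ==> \<Phi> k (kap ((x,p,u),xe)) = \<Phi> k (kt x xe)"
  and fin: "(NN k|cK. NN xe|lam. NN t|I01. ennreal (norm (\<Phi> k (kt t xe)))) < oo"
 shows "(LINT h|nuD. LINT x|cT. ind cube (crd (mul (snd x) h)) * \<Phi> (fst x) (mul (snd x) h)) =
  (LINT k|cK. LINT xe|lam. LINT t|I01. \<Phi> k (kt t xe))"
proof -
 define F where "F z = \<Phi> (fst (snd z)) (mul (snd (snd z)) (fst z))" for z :: "saff \<times> int \<times> saff"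
 define w where "w z = (ind cube (crd (mul (snd (snd z)) (fst z))) :: real)" for z :: "saff \<times> int \<times> saff"
 define G where "G z = \<Phi> (fst z) (kap ((snd (snd z),0,0),fst (snd z)))" for z :: "int \<times> (R2) \<times> real"
 define M' where "M' = density (nuD \<otimes> cT) (%z. ennreal (w z))"
 define N where "N = cK \<otimes> (lam \<otimes> I01)"
 have wpos: "w z >= 0" for z by (simp add: w_def)
 have cm: "(%z. f (fst z) (snd z)) \<in> measurable (nuD \<otimes> cT) K" if "!!x. (%h. f h x) \<in> measurable borel K" for f and K :: "'b measure"
 proof -
  have "(%(x,h). f h x) \<in> measurable (cT \<otimes> nuD) K"
   by (rule measurable_pair_measure_countable1) (use that countable_SAff_int in auto)
  from measurable_pair_swap[OF this] show ?thesis by (simp add: case_prod_unfold)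
 qed
 have Fm[measurable]: "F \<in> bmble (nuD \<otimes> cT)" unfolding F_def by (rule cm) measurable
 have wm[measurable]: "w \<in> bmble (nuD \<otimes> cT)" unfolding w_def by (rule cm) measurable
 have "(%(k,y). \<Phi> k ((%(xe,t). kap ((t,0,0),xe)) y)) \<in> bmble (cK \<otimes> (lam \<otimes> I01))"
 proof (rule measurable_cK_pair, goal_cases)
  case (1 k)
  have "(%(xe,t). kap ((t,0,0),xe)) \<in> bmble (lam \<otimes> I01)"
   using measurable_kap_t by (simp cong: m_cong)
  then show ?case
   by (rule measurable_compose[OF _ m])
 qed
 then have Gm[measurable]: "G \<in> bmble N" unfolding N_def G_def[abs_def] by (simp add: case_prod_unfold)
 have nnN: "(NN z|N. f z) = (NN k|cK. NN xe|lam. NN t|I01. f (k,(xe,t)))" if fm: "f \<in> bmble N" for f :: "_ => ennreal"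
 proof -
  have "(NN z|N. f z) = (NN k|cK. NN y|(lam \<otimes> I01). f (k,y))"
   using fm unfolding N_def by (rule lamI.P.nn_integral_fst[symmetric])
  also have "... = (NN k|cK. NN xe|lam. NN t|I01. f (k,(xe,t)))"
  proof (rule nn_integral_cong, goal_cases)
   case (1 k)
   then have "(%y. f (k,y)) \<in> bmble (lam \<otimes> I01)"
    using measurable_compose[OF measurable_Pair1' fm[unfolded N_def]] by simp
   then show ?case
    by (rule I01.nn_integral_fst[symmetric])
  qed
  finally show ?thesis .
 qed
 have law: "(NN x|M'. \<phi> (F x)) = (NN x|N. \<phi> (G x))" if [measurable]: "\<phi> \<in> bmble borel" for \<phi> :: "complex => ennreal"
 proof -
  have "(NN x|M'. \<phi> (F x)) = (NN z|(nuD \<otimes> cT). ennreal (w z) * \<phi> (F z))"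
   unfolding M'_def by (rule nn_integral_density) measurable
  also have "... = (NN h|nuD. NN x|cT. ennreal (w (h,x)) * \<phi> (F (h,x)))"
   by (rule cT.nn_integral_fst[symmetric]) measurable
  also have "... = (NN h|nuD. NN x|cT. ind cube (crd (mul (snd x) h)) * \<phi> (\<Phi> (fst x) (mul (snd x) h)))"
   by (intro nn_integral_cong) (simp add: w_def F_def ennreal_indicator)
  also have "... = (NN k|cK. NN xe|lam. NN t|I01. \<phi> (\<Phi> k (kt t xe)))"
   by (rule nn_core[where \<Phi>="%k h. \<phi> (\<Phi> k h)"]) (measurable, rule arg_cong[where f=\<phi>], rule inv)
  also have "... = (NN z|N. \<phi> (G z))" by (subst nnN) (measurable, simp add: G_def)
  finally show ?thesis .
 qed
 have GI: "integrable N G"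
  by (rule integrableI_bounded[OF Gm], subst nnN) (measurable, use fin in \<open>simp only: G_def fst_conv snd_conv\<close>)
 have "integrable M' F" and eq: "(LINT z|M'. F z) = (LINT z|N. G z)"
  using integral_law[of F M' G N] law GI Gm Fm unfolding M'_def by simp_all
 then have wF: "integrable (nuD \<otimes> cT) (%z. w z *\<^sub>R F z)"
  unfolding M'_def by (subst (asm) integrable_density) (use wpos in auto)
 have "(LINT h|nuD. LINT x|cT. ind cube (crd (mul (snd x) h)) * \<Phi> (fst x) (mul (snd x) h)) = (LINT h|nuD. LINT x|cT. w (h,x) *\<^sub>R F (h,x))"
  by (intro lint_cong) (auto simp: w_def F_def indicator_def)
 also have "... = (LINT z|(nuD \<otimes> cT). w z *\<^sub>R F z)" by (rule nuDcT.integral_fst'[OF wF])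
 also have "... = (LINT z|M'. F z)" unfolding M'_def by (rule integral_density[symmetric]) (use wpos in auto)
 also have "... = (LINT z|N. G z)" by (rule eq)
 also have "... = (LINT k|cK. LINT y|(lam \<otimes> I01). G (k,y))"
  using GI unfolding N_def by (rule cKlamI.integral_fst'[symmetric])
 also have "... = (LINT k|cK. LINT xe|lam. LINT t|I01. G (k,(xe,t)))"
 proof (rule integral_cong_AE)
  show "(%k. LINT y|(lam \<otimes> I01). G (k,y)) \<in> bmble cK" "(%k. LINT xe|lam. LINT t|I01. G (k,(xe,t))) \<in> bmble cK" by simp_all
  have "AE k in cK. integrable (lam \<otimes> I01) (%y. G (k,y))"
   using GI unfolding N_def by (rule cKlamI.AE_integrable_fst')
  then show "AE k in cK. (LINT y|(lam \<otimes> I01). G (k,y)) = (LINT xe|lam. LINT t|I01. G (k,(xe,t)))"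
   by eventually_elim (rule lamI.integral_fst'[symmetric])
 qed
 finally show ?thesis unfolding G_def by simp
qed

lemma fhat_sq_finite:
 assumes f: "!!k. Ck k f" and R: "supp_le R f" and c: "c = 1 \<or> c = -1"
 shows "(NN xe|lam. nsq (fhat f (c * fst xe,c * snd xe))) < oo"
proof -
 obtain C where C: "C >= 0" "!!xe. norm (fhat f xe) * ((1 + (pair_dot xe (axis 1 1))^2) * (1 + (pair_dot xe (axis 2 1))^2)) <= C"
  using fhat_decay[OF f R] by blast
 have "(norm (fhat f (c * fst xe,c * snd xe)))^2 <= C^2 * (1 / (1 + ((fst xe)^2 + (snd xe)^2))^2)" for xe :: "R2"
 proof -
  define P where "P = 1 + ((fst xe)^2 + (snd xe)^2)"
  have P: "P > 0" unfolding P_def by (intro add_pos_nonneg) auto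
  have "pair_dot (c * fst xe,c * snd xe) (axis 1 1) = c * fst xe" "pair_dot (c * fst xe,c * snd xe) (axis 2 1) = c * snd xe"
   by (simp_all add: pair_dot_def axis_def)
  moreover have "(c * t)^2 = t^2" for t using c by auto
  ultimately have 1: "norm (fhat f (c * fst xe,c * snd xe)) * ((1 + (fst xe)^2) * (1 + (snd xe)^2)) <= C"
   using C(2)[of "(c * fst xe,c * snd xe)"] by simp
  have "P <= (1 + (fst xe)^2) * (1 + (snd xe)^2)" unfolding P_def by (simp add: algebra_simps)
  then have "norm (fhat f (c * fst xe,c * snd xe)) * P <= C" by (rule order_trans[OF mult_left_mono 1]) simp
  then have "norm (fhat f (c * fst xe,c * snd xe)) <= C / P" using P by (simp add: pos_le_divide_eq)
  then have "(norm (fhat f (c * fst xe,c * snd xe)))^2 <= (C / P)^2" by (intro power_mono) auto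
  then show ?thesis unfolding P_def[symmetric] by (simp add: power_divide)
 qed
 then have "(NN xe|lam. nsq (fhat f (c * fst xe,c * snd xe))) <= (NN xe|lam. ennreal (C^2) * ennreal (1 / (1 + ((fst xe)^2 + (snd xe)^2))^2))"
  by (intro nn_integral_mono) (auto simp: ennreal_mult[symmetric] intro!: ennreal_leI simp del: mult_1_right)
 also have "... = ennreal (C^2) * (NN xe|lam. ennreal (1 / (1 + ((fst xe)^2 + (snd xe)^2))^2))"
  by (rule nn_integral_cmult) measurable
 also have "... < oo" using nn_lam_decay_finite by (simp add: ennreal_mult_less_top)
 finally show ?thesis .
qed

text \<open>Rescaling the frequency by M k divides the integral by (M k)^2, which is summable over
  k. The bound \<open>2 / (1 + k^2)\<close> for \<open>1 / k^2\<close> uses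
  \<open>k >= 1\<close>.\<close>

lemma fhat_sum_finite:
 assumes f: "!!k. Ck k f" and R: "supp_le R f" and M: "M >= (1::int)" and sig: "sig = 1 \<or> sig = (-1::int)"
 shows "(NN k|cK. NN xe|lam. nsq (fhat f (of_int (sig * (M * k)) * fst xe,of_int (sig * (M * k)) * snd xe))) < oo"
proof -
 have [measurable]: "f \<in> bmble borel" using Ck_continuous[OF f[of 0]] by (rule bmble_cont)
 define F where "F xe = nsq (fhat f (of_int sig * fst xe,of_int sig * snd xe))" for xe
 have [measurable]: "F \<in> bmble borel" unfolding F_def by measurable
 define W where "W = (NN xe|lam. F xe)"
 have W: "W < oo" unfolding W_def F_def by (rule fhat_sq_finite[OF f R]) (use sig in auto)
 have "(NN k|cK. NN xe|lam. nsq (fhat f (of_int (sig * (M * k)) * fst xe,of_int (sig * (M * k)) * snd xe)))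
  <= (NN k|cK. ennreal (2 * (1 / (1 + (roi k)^2))) * W)"
 proof (rule nn_integral_mono)
  fix k assume "k \<in> space cK"
  then have k: "k >= 1" by simp
  define r where "r = roi (M * k)"
  have "1 * roi k <= roi M * roi k" using M k by (intro mult_right_mono) auto
  then have "r >= roi k" unfolding r_def by simp
  then have r: "r > 0" "r >= roi k" using k by linarith+
  have W': "W = ennreal (r^2) * (NN xe|lam. F (r * fst xe,r * snd xe))" unfolding W_def by (rule nn_lam_scale[OF _ r(1)]) measurable
  have "(NN xe|lam. F (r * fst xe,r * snd xe)) = ennreal (1 / r^2) * W"
   unfolding W' mult.assoc[symmetric] using r by (subst ennreal_mult[symmetric]) simp_all
  also have "... <= ennreal (2 * (1 / (1 + (roi k)^2))) * W"
  proof (intro mult_right_mono ennreal_leI)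
   have "(roi k)^2 <= r^2" using r k by (intro power_mono) auto
   moreover have "(1::real)^2 <= (roi k)^2" using k by (intro power_mono) auto
   ultimately have "1 + (roi k)^2 <= 2 * r^2" by simp
   moreover have "1 + (roi k)^2 > 0" by (intro add_pos_nonneg) auto
   ultimately show "1 / r^2 <= 2 * (1 / (1 + (roi k)^2))" using r by (simp add: divide_simps)
  qed simp
  finally have le: "(NN xe|lam. F (r * fst xe,r * snd xe)) <= ennreal (2 * (1 / (1 + (roi k)^2))) * W" .
  have "F (r * fst xe,r * snd xe) = nsq (fhat f (of_int (sig * (M * k)) * fst xe,of_int (sig * (M * k)) * snd xe))" for xe
   unfolding F_def r_def by (simp add: mult.assoc)
  with le show "(NN xe|lam. nsq (fhat f (of_int (sig * (M * k)) * fst xe,of_int (sig * (M * k)) * snd xe)))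
   <= ennreal (2 * (1 / (1 + (roi k)^2))) * W" by simp
 qed
 also have "... = (NN k|cK. ennreal (2 * (1 / (1 + (roi k)^2)))) * W" by (rule nn_integral_multc) simp
 also have "... < oo"
 proof -
  have "(NN k|cK. ennreal (2 * (1 / (1 + (roi k)^2)))) <= (NN k|cU. ennreal (2 * (1 / (1 + (roi k)^2))))"
  proof -
   have "(NN k|cK. ennreal (2 * (1 / (1 + (roi k)^2)))) = (NN k|cU. ennreal (2 * (1 / (1 + (roi k)^2))) * ind {1..} k)"
    by (rule nn_integral_count_space_indicator) simp
   also have "... <= (NN k|cU. ennreal (2 * (1 / (1 + (roi k)^2))))"
    by (intro nn_integral_mono) (auto simp: indicator_def)
   finally show ?thesis .
  qed
  also have "... < oo"
   using integrable_mult_right[OF integrable_inverse_squares_int, of 2] by (subst (asm) integrable_iff_bounded) simp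
  finally show ?thesis using W by (simp add: ennreal_mult_less_top)
 qed
 finally show ?thesis .
qed

lemma th_zero: "(LINT x|lborel. f x) = 0 ==> th f (0,0) h = 0"
 by (simp add: th_def eta_def fhat_def pair_dot_def)

text \<open>Integral zero removes the frequency 0, which unfolding does not reach. On every fibre
  the norm is computed by Parseval; unfolding then leaves norms of rescaled Fourier
  transforms.\<close>

lemma svr_sqint:
 assumes f: "f \<in> Cc_smooth0" and M: "M >= 1"
 shows "svr M f \<in> sqint nuD"
proof -
 have fk: "!!k. Ck k f" using f by (auto simp: Cc_smooth0_def)
 obtain R where R: "supp_le R f" using Cc_smooth0_supp[OF f] by blast
 have [measurable]: "f \<in> bmble borel" using Ck_continuous[OF fk[of 0]] by (rule bmble_cont)
 note [measurable] = measurable_svr[OF fk R M]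
 have inv: "ginv (svr M f)" by (rule ginv_svr[OF M])
 define g where "g n h = nsq (th f (smul (int M) n) h)" for n h
 have "(NN h|nuD. nsq (svr M f h)) = (NN h|nuD. NN s|TT. nsq (svr M f (mul (tr s) h)))"
  by (rule nn_torus_average[where H="%h. nsq (svr M f h)", symmetric]) (auto intro: ginv_comp[OF inv])
 also have "... = (NN h|nuD. ennreal ((real M)^4) * (NN n|count_space (UNIV - {0}). g n h))"
 proof (rule nn_integral_cong_AE, use AE_nuD_SAff in eventually_elim, goal_cases)
  case h: (1 h)
  define Q where "Q s = (LINT n|cU. th f (smul (int M) n) h * chr (smul (int M) n) s)" for s
  have ps: "(NN s|TT. nsq (Q s)) = (NN n|cU. g n h)" "Q \<in> bmble TT"
   unfolding Q_def[abs_def] g_def using parseval_series[OF SV_expansion(1)[OF fk R M h] inj_smul[of "int M"]] M by auto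
  note [measurable] = ps(2)
  have "(NN s|TT. nsq (svr M f (mul (tr s) h))) = (NN s|TT. ennreal ((real M)^4) * nsq (Q s))"
   unfolding svr_tr[OF fk R M h] Q_def[symmetric]
   by (intro nn_integral_cong) (simp add: norm_mult norm_power power_mult_distrib ennreal_mult[symmetric] flip: power_mult)
  also have "... = ennreal ((real M)^4) * (NN s|TT. nsq (Q s))" by (rule nn_integral_cmult) measurable
  also have "(NN s|TT. nsq (Q s)) = (NN n|count_space (UNIV - {0}). g n h)"
   unfolding ps(1) using f by (intro nn_integral_count_space_eq) (auto simp: g_def smul_def th_zero Cc_smooth0_def)
  finally show ?case .
 qed
 also have "... = ennreal ((real M)^4) * (NN h|nuD. NN n|count_space (UNIV - {0}). g n h)"
 proof (rule nn_integral_cmult)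
  interpret c: sigma_finite_measure "count_space (UNIV - {0 :: int \<times> int})" by (rule sigma_finite_measure_count_space_countable) simp
  have "(%(n,h). g n h) \<in> bmble (count_space (UNIV - {0}) \<otimes> nuD)"
   by (rule measurable_pair_measure_countable1) (auto simp: g_def)
  from measurable_pair_swap[OF this] show "(%h. NN n|count_space (UNIV - {0}). g n h) \<in> bmble nuD"
   by (intro c.borel_measurable_nn_integral) simp
 qed
 also have "(NN h|nuD. NN n|count_space (UNIV - {0}). g n h) = (NN k|cK. NN xe|lam. NN t|I01. g (1 * k,0) (kt t xe))"
 proof (rule nn_orbit)
  show "g n \<in> bmble borel" for n unfolding g_def by measurable
  show "g (1 * k,0) (mul gg h) = g (smul (1 * k) (vec gg)) h" if "gg \<in> SAff_int" "h \<in> SAff" for k gg h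
   using th_gamma[OF that, of f "int M * k"] by (simp add: g_def smul_smul) (simp add: smul_def)
  show "g n (mul (tr s) h) = g n h" if "h \<in> SAff" for n s h
   unfolding g_def th_tr[OF that] by (simp add: norm_mult)
 qed simp
 also have "... = (NN k|cK. NN xe|lam. nsq (fhat f (of_int (1 * (int M * k)) * fst xe,of_int (1 * (int M * k)) * snd xe)))"
 proof -
  have "g (1 * k,0) (kt t xe) = nsq (fhat f (of_int (1 * (int M * k)) * fst xe,of_int (1 * (int M * k)) * snd xe))" for k t xe
   using th_kap[of f "int M * k" t xe] by (simp add: g_def smul_def)
  then show ?thesis by simp
 qed
 finally have "(NN h|nuD. nsq (svr M f h)) = ennreal ((real M)^4) *
  (NN k|cK. NN xe|lam. nsq (fhat f (of_int (1 * (int M * k)) * fst xe,of_int (1 * (int M * k)) * snd xe)))" .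
 moreover have "... < oo" using fhat_sum_finite[OF fk R, of "int M" 1] M by (simp add: ennreal_mult_less_top)
 ultimately have "(NN h|nuD. nsq (svr M f h)) < oo" by simp
 then have "integrable nuD (%h. (norm (svr M f h))^2)" by (intro integrableI_bounded) auto
 then show ?thesis by (simp add: sqint_def)
qed

end

section \<open>A sieve\<close>

text \<open>Sieving by one prime \<open>p\<close> at a time keeps all the sums zero, because the
  part removed is again such a sum with \<open>M * p\<close> in place of \<open>M\<close>. After
  sieving by enough primes only 1 and a tail of small absolute sum remain, so \<open>a 1\<close> is
  arbitrarily small.\<close>

lemma sieve_one:
 fixes a :: "int => complex"
 assumes s: "a summable_on {1..}" and sn: "(%k. norm (a k)) summable_on {1..}"
  and z: "!!M. M >= 1 ==> (\<Sum>\<^sub>\<infinity>k\<in>{1..}. a (M * k)) = 0"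
 shows "a 1 = 0"
proof -
 define Sv where "Sv P = {k::int. k >= 1 \<and> (\<forall>p\<in>P. \<not> p dvd k)}" for P
 have sub: "(%k. a (M * k)) summable_on A" if M: "M >= 1" and A: "A \<subseteq> {1..}" for M A
 proof -
  have "1 <= M * k" if "1 <= k" for k using M that mult_mono[of 1 M 1 k] by simp
  then have "(*) M ` A \<subseteq> {1..}" using A by auto
  then have "a summable_on (*) M ` A" by (rule summable_on_subset_banach[OF s])
  moreover have "inj_on ((*) M) A" using M by (auto simp: inj_on_def)
  ultimately show ?thesis by (simp add: summable_on_reindex o_def)
 qed
 have sieve: "\<forall>M\<ge>1. (\<Sum>\<^sub>\<infinity>k\<in>Sv P. a (M * k)) = 0" if "finite P" "\<forall>p\<in>P. prime p" for P
  using that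
 proof (induction P rule: finite_induct)
  case empty
  have "Sv {} = {1..}" by (auto simp: Sv_def)
  then show ?case using z by simp
 next
  case (insert p P)
  have pp: "prime p" and P: "\<forall>q\<in>P. prime q" and IH: "\<forall>M\<ge>1. (\<Sum>\<^sub>\<infinity>k\<in>Sv P. a (M * k)) = 0" using insert by auto
  have p1: "p >= 1" using prime_gt_0_int[OF pp] by linarith
  have dv: "q dvd p * k \<longleftrightarrow> q dvd k" if "q \<in> P" for q k
  proof -
   have "prime q" using P that by blast
   then have "\<not> q dvd p" using insert(2) that pp primes_dvd_imp_eq by blast
   then show ?thesis using \<open>prime q\<close> by (auto simp: prime_dvd_mult_iff)
  qed
  \<comment> \<open>\<open>p\<close> is a prime outside \<open>P\<close>, so divisibility by the
    primes of \<open>P\<close> is unaffected by a factor \<open>p\<close>.\<close>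
  have split: "Sv P = Sv (insert p P) \<union> (*) p ` Sv P"
  proof (intro equalityI subsetI)
   fix k assume k: "k \<in> Sv P"
   show "k \<in> Sv (insert p P) \<union> (*) p ` Sv P"
   proof (cases "p dvd k")
    case True
    then obtain j where j: "k = p * j" by auto
    have "j >= 1"
    proof (rule ccontr)
     assume "\<not> j >= 1"
     then have "p * j <= 0" using p1 by (intro mult_nonneg_nonpos) auto
     then show False using k j by (simp add: Sv_def)
    qed
    then have "j \<in> Sv P" using k dv unfolding j by (auto simp: Sv_def)
    then show ?thesis unfolding j by blast
   qed (use k in \<open>auto simp: Sv_def\<close>)
  next
   fix k assume "k \<in> Sv (insert p P) \<union> (*) p ` Sv P"
   then show "k \<in> Sv P"
   proof
    assume "k \<in> (*) p ` Sv P"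
    then obtain j where j: "k = p * j" "j \<in> Sv P" by auto
    then have "1 <= p * j" using p1 mult_mono[of 1 p 1 j] by (simp add: Sv_def)
    then show ?thesis using j dv by (auto simp: Sv_def)
   qed (auto simp: Sv_def)
  qed
  have disj: "Sv (insert p P) \<inter> (*) p ` Sv P = {}" by (auto simp: Sv_def)
  show ?case
  proof (intro allI impI)
   fix M :: int assume M: "M >= 1"
   have Mp: "M * p >= 1" using M p1 mult_mono[of 1 M 1 p] by simp
   have i: "inj_on ((*) p) (Sv P)" using p1 by (auto simp: inj_on_def)
   have SP: "Sv P \<subseteq> {1..}" "Sv (insert p P) \<subseteq> {1..}" "(*) p ` Sv P \<subseteq> {1..}" using split by (auto simp: Sv_def)
   have "0 = (\<Sum>\<^sub>\<infinity>k\<in>Sv P. a (M * k))" using IH M by simp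
   also have "... = (\<Sum>\<^sub>\<infinity>k\<in>Sv (insert p P) \<union> (*) p ` Sv P. a (M * k))" using split by simp
   also have "... = (\<Sum>\<^sub>\<infinity>k\<in>Sv (insert p P). a (M * k)) + (\<Sum>\<^sub>\<infinity>k\<in>(*) p ` Sv P. a (M * k))"
    by (rule infsum_Un_disjoint[OF sub[OF M SP(2)] sub[OF M SP(3)] disj])
   also have "(\<Sum>\<^sub>\<infinity>k\<in>(*) p ` Sv P. a (M * k)) = (\<Sum>\<^sub>\<infinity>k\<in>Sv P. a ((M * p) * k))"
    by (subst infsum_reindex[OF i]) (simp add: o_def mult.assoc)
   also have "... = 0" using IH Mp by blast
   finally show "(\<Sum>\<^sub>\<infinity>k\<in>Sv (insert p P). a (M * k)) = 0" by simp
  qed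
 qed
 have "norm (a 1) <= e" if e: "e > 0" for e
 proof -
  obtain F where F: "finite F" "F \<subseteq> {1..}" "dist (\<Sum>k\<in>F. norm (a k)) (\<Sum>\<^sub>\<infinity>k\<in>{1..}. norm (a k)) <= e"
   using infsum_finite_approximation[OF sn e] by blast
  \<comment> \<open>The set \<open>F\<close> carries all but \<open>e\<close> of the absolute sum.
    Every member of \<open>F\<close> other than 1 has a prime factor in \<open>P\<close> and is
    removed by the sieve.\<close>
  define P where "P = {p::int. prime p \<and> (\<exists>k\<in>F. p dvd k)}"
  have "P \<subseteq> (\<Union>k\<in>F. {p. p dvd k})" by (auto simp: P_def)
  moreover have "finite (\<Union>k\<in>F. {p. p dvd k})" using F by (intro finite_UN_I finite_divisors_int) auto
  ultimately have "finite P" by (rule finite_subset)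
  then have "\<forall>M\<ge>1. (\<Sum>\<^sub>\<infinity>k\<in>Sv P. a (M * k)) = 0" by (rule sieve) (simp add: P_def)
  from this[rule_format, of 1] have 0: "(\<Sum>\<^sub>\<infinity>k\<in>Sv P. a k) = 0" by simp
  have "F \<inter> Sv P \<subseteq> {1}"
  proof
   fix k assume k: "k \<in> F \<inter> Sv P"
   show "k \<in> {1}"
   proof (rule ccontr)
    assume "k \<notin> {1}"
    then have "\<bar>k\<bar> ~= 1" using k by (auto simp: Sv_def)
    then obtain p where "prime p" "p dvd k" using prime_divisor_exists[of k] k by (auto simp: Sv_def)
    then have "p \<in> P" using k by (auto simp: P_def)
    then show False using k \<open>p dvd k\<close> by (auto simp: Sv_def)
   qed
  qed
  then have tail: "Sv P - {1} \<subseteq> {1..} - F" by (auto simp: Sv_def)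
  have "\<not> p dvd 1" if "prime p" for p :: int using that not_prime_unit by blast
  then have "1 \<in> Sv P" unfolding Sv_def P_def by blast
  have sS: "a summable_on (Sv P - {1})" by (rule summable_on_subset_banach[OF s]) (auto simp: Sv_def)
  have nS: "(%k. norm (a k)) summable_on (Sv P - {1})" by (rule summable_on_subset_banach[OF sn]) (auto simp: Sv_def)
  have nT: "(%k. norm (a k)) summable_on ({1..} - F)" by (rule summable_on_subset_banach[OF sn]) auto
  have "(\<Sum>\<^sub>\<infinity>k\<in>Sv P. a k) = (\<Sum>\<^sub>\<infinity>k\<in>{1} \<union> (Sv P - {1}). a k)" using \<open>1 \<in> Sv P\<close> by (simp add: insert_absorb)
  also have "... = a 1 + (\<Sum>\<^sub>\<infinity>k\<in>Sv P - {1}. a k)" by (subst infsum_Un_disjoint) (auto intro: sS)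
  finally have "a 1 = - (\<Sum>\<^sub>\<infinity>k\<in>Sv P - {1}. a k)" using 0 by (simp add: eq_neg_iff_add_eq_0)
  then have "norm (a 1) = norm (\<Sum>\<^sub>\<infinity>k\<in>Sv P - {1}. a k)" by simp
  also have "... <= (\<Sum>\<^sub>\<infinity>k\<in>Sv P - {1}. norm (a k))" by (rule norm_infsum_bound[OF nS])
  also have "... <= (\<Sum>\<^sub>\<infinity>k\<in>{1..} - F. norm (a k))" by (rule infsum_mono2[OF nS nT tail]) auto
  also have "... = (\<Sum>\<^sub>\<infinity>k\<in>{1..}. norm (a k)) - (\<Sum>k\<in>F. norm (a k))"
   using infsum_Diff[OF sn _ F(2)] F(1) by simp
  also have "... <= e" using F(3) by (simp add: dist_real_def)
  finally show ?thesis .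
 qed
 then have "norm (a 1) <= 0" by (rule field_le_epsilon[of _ 0, simplified])
 then show ?thesis by simp
qed

lemma integrable_cK_mult:
 fixes a :: "int => complex"
 assumes "integrable cK a" "M >= 1"
 shows "integrable cK (%k. a (M * k))"
proof (rule integrableI_bounded)
 have "(NN k|cK. ennreal (norm (a (M * k)))) <= (NN k|cK. ennreal (norm (a k)))" by (rule nn_integral_cK_mult_le[OF assms(2)])
 also have "... < oo" using assms(1) by (simp add: integrable_iff_bounded)
 finally show "(NN k|cK. ennreal (norm (a (M * k)))) < oo" .
qed simp

lemma sieve_zero:
 fixes a :: "int => complex"
 assumes i: "integrable cK a" and z: "!!M. M >= 1 ==> (LINT k|cK. a (M * k)) = 0" and m: "m >= 1"
 shows "a m = 0"
proof -
 have i': "integrable cK (%k. a (m * k))" by (rule integrable_cK_mult[OF i m])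
 have ab: "Infinite_Set_Sum.abs_summable_on b {1..}" if "integrable cK b" for b :: "int => complex"
  using that by (simp add: Infinite_Set_Sum.abs_summable_on_def)
 have sn: "(%k. norm (a (m * k))) summable_on {1..}" using ab[OF i'] by (simp add: abs_summable_equivalent)
 have "(\<Sum>\<^sub>\<infinity>k\<in>{1..}. a (m * (M * k))) = 0" if M: "M >= 1" for M
 proof -
  have mM: "m * M >= 1" using m M mult_mono[of 1 m 1 M] by simp
  have "(\<Sum>\<^sub>\<infinity>k\<in>{1..}. a (m * M * k)) = (LINT k|cK. a (m * M * k))"
   using infsetsum_infsum[OF ab[OF integrable_cK_mult[OF i mM]]] by (simp add: infsetsum_def)
  then show ?thesis using z[OF mM] by (simp add: mult.assoc)
 qed
 then show ?thesis using sieve_one[of "%k. a (m * k)"] abs_summable_summable[OF sn] sn by simp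
qed

section \<open>Pairing with Siegel--Veech transforms\<close>

lemma Ck_translate: "Ck k f ==> Ck k (%y. f (y + s))"
proof (induction k arbitrary: f)
 case 0
 then show ?case by (auto intro!: continuous_on_compose2[of UNIV f] continuous_intros)
next
 case (Suc k)
 have d: "((%y. f (y + s)) has_derivative frechet_derivative f (at (x + s))) (at x)" for x
 proof -
  have "(f has_derivative frechet_derivative f (at (x + s))) (at (x + s))"
   using Suc.prems frechet_derivative_works by auto
  moreover have "((%y. y + s) has_derivative (%v. v)) (at x)" by (auto intro!: derivative_eq_intros)
  ultimately show ?thesis using diff_chain_at[of "%y. y + s" "%v. v" x f] by (simp add: o_def)
 qed
 then have "frechet_derivative (%y. f (y + s)) (at x) = frechet_derivative f (at (x + s))" for x
  by (metis frechet_derivative_at)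
 moreover have "Ck k (%x. frechet_derivative f (at (x + s)) v)" for v
  using Suc.IH[of "%x. frechet_derivative f (at x) v"] Suc.prems by simp
 ultimately show ?case using d by (auto simp: differentiable_def)
qed

lemma translate_Cc_smooth0:
 assumes f: "f \<in> Cc_smooth0" shows "(%y. f (y + s)) \<in> Cc_smooth0"
proof -
 obtain R where R: "supp_le R f" using Cc_smooth0_supp[OF f] by blast
 have "{x. f (x + s) ~= 0} \<subseteq> cball 0 (R + norm s)"
 proof
  fix x assume "x \<in> {x. f (x + s) ~= 0}"
  then have "norm (x + s) <= R" using R by (auto simp: supp_le_def not_less[symmetric])
  then show "x \<in> cball 0 (R + norm s)" using norm_triangle_ineq4[of "x + s" s] by simp
 qed
 then have "closure {x. f (x + s) ~= 0} \<subseteq> cball 0 (R + norm s)" by (rule closure_minimal) simp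
 then have "compact (closure {x. f (x + s) ~= 0})" by (meson bounded_cball bounded_subset closed_closure compact_eq_bounded_closed)
 moreover have "(LINT x|lborel. f (x + s)) = 0"
 proof -
  have [measurable]: "f \<in> bmble borel" using f Ck_continuous[of 0 f] by (auto simp: Cc_smooth0_def intro!: bmble_cont)
  have "fhat (%y. f (y + s)) (0,0) = e_fun (pair_dot (0,0) s) * fhat f (0,0)" by (rule fhat_translate) simp
  then show ?thesis using f by (simp add: fhat_def pair_dot_def Cc_smooth0_def)
 qed
 ultimately show ?thesis using f Ck_translate[of _ f s] by (simp add: Cc_smooth0_def)
qed

lemma measurable_pair_cT:
 assumes "!!x. (%h. f h x) \<in> measurable N K"
 shows "(%z. f (fst z) (snd z)) \<in> measurable (N \<otimes> cT) K"
proof -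
 have "(%(x,h). f h x) \<in> measurable (cT \<otimes> N) K"
  by (rule measurable_pair_measure_countable1) (use assms countable_SAff_int in auto)
 from measurable_pair_swap[OF this] show ?thesis by (simp add: case_prod_unfold)
qed

context haar_fd
begin


lemma sqint_borel: "psi \<in> sqint nuD ==> psi \<in> bmble borel"
 using sqintD(1)[of psi nuD] by (simp cong: m_cong)

lemma sqint_nn_finite: "psi \<in> sqint nuD ==> (NN h|nuD. nsq (psi h)) < oo"
 by (simp add: nrm2_nn_integral)

lemma torus_nn:
 assumes "psi \<in> sqint nuD" and inv: "ginv psi"
 shows "AE h in nuD. (%s. psi (mul (tr s) h)) \<in> sqint TT"
proof -
 note [measurable] = sqint_borel[OF assms(1)]
 have "(NN h|nuD. NN s|TT. nsq (psi (mul (tr s) h))) = (NN h|nuD. nsq (psi h))"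
  by (rule nn_torus_average[where H="%h. nsq (psi h)"]) (auto intro: ginv_comp[OF inv])
 moreover have "(%(h,s). nsq (psi (mul (tr s) h))) \<in> bmble (nuD \<otimes> TT)" by measurable
 then have "(%h. NN s|TT. nsq (psi (mul (tr s) h))) \<in> bmble nuD"
  by (rule TT.borel_measurable_nn_integral)
 ultimately have "AE h in nuD. (NN s|TT. nsq (psi (mul (tr s) h))) ~= oo"
  using sqint_nn_finite[OF assms(1)] by (intro nn_integral_PInf_AE) simp_all
 then show ?thesis
 proof eventually_elim
  case (elim h)
  then have "integrable TT (%s. (norm (psi (mul (tr s) h)))^2)"
   by (intro integrableI_bounded) (auto simp: top.not_eq_extremum)
  then show ?case by (simp add: sqint_def)
 qed
qed

lemma sqint_TT_integrable: "g \<in> sqint TT ==> integrable TT g"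
 using sqint_prod_integrable(1)[of g TT "%_. 1"] by (simp add: sqint_def)

lemma integral_torus_average:
 fixes F :: "saff => complex"
 assumes F: "integrable nuD F" and inv: "ginv F"
 shows "(LINT h|nuD. F h) = (LINT h|nuD. LINT s|TT. F (mul (tr s) h))"
  and "(%h. LINT s|TT. F (mul (tr s) h)) \<in> bmble nuD"
proof -
 have [measurable]: "F \<in> bmble borel" using borel_measurable_integrable[OF F] by (simp cong: m_cong)
 define G where "G z = F (mul (tr (snd z)) (fst z))" for z
 have Gm[measurable]: "G \<in> bmble (nuD \<otimes> TT)" unfolding G_def by measurable
 have law: "(NN z|(nuD \<otimes> TT). \<phi> (G z)) = (NN h|nuD. \<phi> (F h))" if [measurable]: "\<phi> \<in> bmble borel" for \<phi> :: "complex => ennreal"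
 proof -
  have "(NN z|(nuD \<otimes> TT). \<phi> (G z)) = (NN h|nuD. NN s|TT. \<phi> (G (h,s)))"
   by (rule TT.nn_integral_fst[symmetric]) measurable
  also have "... = (NN h|nuD. \<phi> (F h))" unfolding G_def fst_conv snd_conv
   by (rule nn_torus_average[where H="%h. \<phi> (F h)"]) (auto intro: ginv_comp[OF inv])
  finally show ?thesis .
 qed
 have GI: "integrable (nuD \<otimes> TT) G" and eq: "(LINT z|(nuD \<otimes> TT). G z) = (LINT h|nuD. F h)"
  using integral_law[of G "nuD \<otimes> TT" F nuD] law F by simp_all
 show "(LINT h|nuD. F h) = (LINT h|nuD. LINT s|TT. F (mul (tr s) h))"
  using nuDTT.integral_fst'[OF GI] unfolding eq unfolding G_def by simp
 show "(%h. LINT s|TT. F (mul (tr s) h)) \<in> bmble nuD"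
  using borel_measurable_integrable[OF nuDTT.integrable_fst'[OF GI]] unfolding G_def by simp
qed

text \<open>All exchanges are licensed by one absolute bound: a product is at most the sum of the
  squares of its factors, the squares of the coefficients of \<open>psi\<close> are controlled by
  \<open>nn_psih_bound\<close>, and those of the transform of \<open>f\<close> by
  \<open>fhat_sum_finite\<close>. Either sign alone accounts for the whole pairing.\<close>

lemma key_formula:
 fixes psi :: "saff => complex"
 assumes psi: "psi \<in> sqint nuD" and inv: "ginv psi" and f: "f \<in> Cc_smooth0" and M: "M >= 1" and sig: "sig = 1 \<or> sig = (-1::int)"
 defines "T \<equiv> %k xe. cnj (fhat f (of_int (sig * (int M * k)) * fst xe,of_int (sig * (int M * k)) * snd xe)) * omg psi (sig * (int M * k)) xe"
 shows "ip nuD psi (svr M f) = (of_nat M)^2 * (LINT k|cK. LINT xe|lam. T k xe)"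
  and "(NN k|cK. NN xe|lam. ennreal (norm (T k xe))) < oo"
proof -
 have fk: "!!k. Ck k f" using f by (auto simp: Cc_smooth0_def)
 obtain R where R: "supp_le R f" using Cc_smooth0_supp[OF f] by blast
 have [measurable]: "f \<in> bmble borel" using Ck_continuous[OF fk[of 0]] by (rule bmble_cont)
 note psim[measurable] = sqint_borel[OF psi]
 have sv: "svr M f \<in> sqint nuD" by (rule svr_sqint[OF f M])
 note [measurable] = sqint_borel[OF sv]
 define n where "n k = (sig * (int M * k),0 :: int)" for k
 define fh where "fh k xe = fhat f (of_int (sig * (int M * k)) * fst xe,of_int (sig * (int M * k)) * snd xe)" for k and xe :: "R2"
 have [measurable]: "fh k \<in> bmble borel" for k unfolding fh_def by measurable
 define \<Phi> where "\<Phi> k h = psih psi (n k) h * cnj (th f (n k) h)" for k h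
 have \<Phi>m[measurable]: "\<Phi> k \<in> bmble borel" for k unfolding \<Phi>_def by measurable
 have \<Phi>inv: "\<Phi> k (kap ((x,p,u),xe)) = \<Phi> k (kt x xe)" if "xe ~= (0,0)" for k x p u xe
  unfolding kap_tr[of x p u xe] \<Phi>_def psih_tr[OF psim inv kap_in[OF that]] th_tr[OF kap_in[OF that]]
  using cnj_chr_mult[of "n k" "(p,u - p * x)"] by (simp add: mult_ac)
 have \<Phi>kap: "\<Phi> k (kt t xe) = psih psi (n k) (kt t xe) * cnj (fh k xe)" for k t xe
  unfolding \<Phi>_def n_def th_kap fh_def ..
 have T: "T k xe = (LINT t|I01. \<Phi> k (kt t xe))" for k xe
  unfolding T_def \<Phi>kap omg_def fh_def[symmetric] n_def[symmetric] by (simp add: mult.commute)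
 have fin: "(NN k|cK. NN xe|lam. NN t|I01. ennreal (norm (\<Phi> k (kt t xe)))) < oo"
 proof -
  have half: "(x + y) / 2 <= x + y" if "x >= 0" "y >= 0" for x y :: real using that by (simp add: field_simps)
  define A where "A k t xe = nsq (psih psi (n k) (kt t xe))" for k t xe
  define B where "B k xe = nsq (fh k xe)" for k xe
  have [measurable]: "B k \<in> bmble borel" for k unfolding B_def by measurable
  have Am: "(%x. A k (snd x) (fst x)) \<in> bmble (lam \<otimes> I01)" for k
  proof -
   have "(%x. nsq (psih psi (n k) ((%(xe,t). kap ((t,0,0),xe)) x))) \<in> bmble (borel \<otimes> borel)"
    using measurable_compose[OF measurable_kap_t measurable_psih[OF psim]] by measurable
   then show ?thesis unfolding A_def by (simp add: case_prod_unfold cong: m_cong)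
  qed
  have At[measurable]: "(%t. A k t xe) \<in> bmble I01" for k xe
   using measurable_compose[OF measurable_Pair1' Am, of xe k] by simp
  have Axe[measurable]: "(%xe. NN t|I01. A k t xe) \<in> bmble lam" for k
   using I01.borel_measurable_nn_integral_fst[OF Am] by simp
  have "(NN k|cK. NN xe|lam. NN t|I01. ennreal (norm (\<Phi> k (kt t xe)))) <= (NN k|cK. NN xe|lam. NN t|I01. A k t xe + B k xe)"
  proof (rule nn_integral_mono, rule nn_integral_mono, rule nn_integral_mono, goal_cases)
   case (1 k xe t)
   have "norm (\<Phi> k (kt t xe)) <= (norm (psih psi (n k) (kt t xe)))^2 + (norm (fh k xe))^2"
    unfolding \<Phi>kap norm_mult complex_mod_cnj
    by (rule order_trans[OF norm_mult_le_half half]) simp_all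
   then show ?case
    unfolding A_def B_def by (subst ennreal_plus[symmetric]) (auto intro: ennreal_leI simp del: ennreal_plus)
  qed
  also have "... = (NN k|cK. (NN xe|lam. NN t|I01. A k t xe) + (NN xe|lam. B k xe))"
  proof (rule nn_integral_cong, goal_cases)
   case (1 k)
   have "(NN xe|lam. NN t|I01. A k t xe + B k xe) = (NN xe|lam. (NN t|I01. A k t xe) + B k xe)"
    by (rule nn_integral_cong) (subst nn_integral_add, simp_all)
   also have "... = (NN xe|lam. NN t|I01. A k t xe) + (NN xe|lam. B k xe)"
    by (rule nn_integral_add) measurable
   finally show ?case .
  qed
  also have "... = (NN k|cK. NN xe|lam. NN t|I01. A k t xe) + (NN k|cK. NN xe|lam. B k xe)"
   by (rule nn_integral_add) simp_all
  also have "... < oo"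
  proof -
   have "(NN k|cK. NN xe|lam. NN t|I01. A k t xe) <= (NN k|cK. NN xe|lam. NN t|I01. nsq (psih psi (sig * k,0) (kt t xe)))"
    unfolding A_def n_def
    by (rule nn_integral_cK_mult_le[where g="%k. NN xe|lam. NN t|I01. nsq (psih psi (sig * k,0) (kt t xe))"]) (use M in simp)
   also have "... <= (NN h|nuD. nsq (psi h))" by (rule nn_psih_bound[OF psim inv sig])
   also have "... < oo" by (rule sqint_nn_finite[OF psi])
   finally have 1: "(NN k|cK. NN xe|lam. NN t|I01. A k t xe) < oo" .
   have "(NN k|cK. NN xe|lam. B k xe) < oo"
    unfolding B_def fh_def by (rule fhat_sum_finite[OF fk R _ sig]) (use M in simp)
   with 1 show ?thesis by simp
  qed
  finally show ?thesis .
 qed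
 have "ennreal (norm (T k xe)) <= (NN t|I01. ennreal (norm (\<Phi> k (kt t xe))))" for k xe
  unfolding T by (cases "integrable I01 (%t. \<Phi> k (kt t xe))") (auto intro: integral_norm_bound_ennreal simp: not_integrable_integral_eq)
 then have "(NN k|cK. NN xe|lam. ennreal (norm (T k xe))) <= (NN k|cK. NN xe|lam. NN t|I01. ennreal (norm (\<Phi> k (kt t xe))))"
  by (intro nn_integral_mono)
 also note fin
 finally show "(NN k|cK. NN xe|lam. ennreal (norm (T k xe))) < oo" .
 define F where "F h = psi h * cnj (svr M f h)" for h
 have FI: "integrable nuD F" unfolding F_def by (rule sqint_prod_integrable(1)[OF psi sv])
 have Finv: "ginv F" unfolding F_def ginv_def using inv ginv_svr[OF M, of f] by (simp add: ginv_def)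
 define W where "W h = (LINT x|cT. ind cube (crd (mul (snd x) h)) * \<Phi> (fst x) (mul (snd x) h))" for h
 have Wm: "W \<in> bmble nuD"
 proof -
  have "(%z. ind cube (crd (mul (snd (snd z)) (fst z))) * \<Phi> (fst (snd z)) (mul (snd (snd z)) (fst z))) \<in> bmble (nuD \<otimes> cT)"
   by (rule measurable_pair_cT) measurable
  then show ?thesis unfolding W_def[abs_def] by (intro cT.borel_measurable_lebesgue_integral) (simp add: case_prod_unfold)
 qed
 have "ip nuD psi (svr M f) = (LINT h|nuD. LINT s|TT. F (mul (tr s) h))"
  unfolding ip_def F_def[symmetric] by (rule integral_torus_average(1)[OF FI Finv])
 also have "... = (LINT h|nuD. (of_nat M)^2 * W h)"
 proof (rule integral_cong_AE)
  show "(%h. LINT s|TT. F (mul (tr s) h)) \<in> bmble nuD" by (rule integral_torus_average(2)[OF FI Finv])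
  show "(%h. (of_nat M)^2 * W h) \<in> bmble nuD" using Wm by simp
  show "AE h in nuD. (LINT s|TT. F (mul (tr s) h)) = (of_nat M)^2 * W h"
   using AE_nuD_SAff torus_nn[OF psi inv]
  proof eventually_elim
   fix h assume h: "h \<in> SAff" and "(%s. psi (mul (tr s) h)) \<in> sqint TT"
   then have gi: "integrable TT (%s. psi (mul (tr s) h))" by (intro sqint_TT_integrable)
   define Q where "Q s = (LINT n|cU. th f (smul (int M) n) h * chr (smul (int M) n) s)" for s
   define Y where "Y n = cnj (th f (smul (int M) n) h) * psih psi (smul (int M) n) h" for n
   have "(LINT s|TT. F (mul (tr s) h)) = (LINT s|TT. (of_nat M)^2 * (psi (mul (tr s) h) * cnj (Q s)))"
    unfolding F_def svr_tr[OF fk R M h] Q_def[symmetric] by (intro lint_cong) simp_all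
   also have "... = (of_nat M)^2 * (LINT s|TT. psi (mul (tr s) h) * cnj (Q s))" by simp
   also have "(LINT s|TT. psi (mul (tr s) h) * cnj (Q s)) = (LINT n|cU. Y n)"
    unfolding Q_def Y_def psih_def by (rule integral_character_series(1)[OF gi SV_expansion(1)[OF fk R M h]])
   also have "(LINT n|cU. Y n) = (LINT n|count_space (UNIV - {0}). Y n)"
   proof -
    \<comment> \<open>The zero frequency drops out because \<open>f\<close> has integral zero, so
      the sum runs over the frequencies enumerated by \<open>orbit_set\<close>.\<close>
    have "Y 0 = 0" using f by (simp add: Y_def smul_def th_zero Cc_smooth0_def)
    then have "(LINT n|cU. Y n) = (LINT n|cU. ind (UNIV - {0}) n *\<^sub>R Y n)"
     by (intro lint_cong) (auto simp: indicator_def)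
    also have "... = (LINT n|count_space (UNIV - {0}). Y n)"
     by (subst restrict_count_space_subset[OF subset_UNIV, symmetric], subst integral_restrict_space) auto
    finally show ?thesis .
   qed
   also have "... = (LINT x|cT. ind cube (crd (mul (snd x) h)) * Y (smul (sig * fst x) (vec (snd x))))"
    by (rule integral_orbit_sum[OF h sig])
   also have "... = W h" unfolding W_def
   proof (rule lint_cong[OF refl], goal_cases)
    case (1 x)
    then have g: "snd x \<in> SAff_int" by auto
    have "smul (int M) (smul (sig * fst x) (vec (snd x))) = smul (sig * (int M * fst x)) (vec (snd x))"
     by (simp add: smul_smul mult_ac)
    then have "Y (smul (sig * fst x) (vec (snd x))) = \<Phi> (fst x) (mul (snd x) h)"
     unfolding Y_def \<Phi>_def n_def psih_gamma[OF psim inv g h] th_gamma[OF g h] by (simp only: mult.commute)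
    then show ?case
     by (simp only:)
   qed
   finally show "(LINT s|TT. F (mul (tr s) h)) = (of_nat M)^2 * W h" .
  qed
 qed
 also have "... = (of_nat M)^2 * (LINT h|nuD. W h)" by simp
 also have "(LINT h|nuD. W h) = (LINT k|cK. LINT xe|lam. LINT t|I01. \<Phi> k (kt t xe))"
  unfolding W_def by (rule integral_core[OF \<Phi>m \<Phi>inv fin])
 finally show "ip nuD psi (svr M f) = (of_nat M)^2 * (LINT k|cK. LINT xe|lam. T k xe)"
  unfolding T[abs_def] .
qed

lemma ip_svr_zero:
 assumes psi: "psi \<in> sqint nuD" and inv: "ginv psi" and f: "f \<in> Cc_smooth0" and M: "M >= 1"
  and 0: "!!m. m ~= 0 ==> AE xe in lam. omg psi m xe = 0"
 shows "ip nuD psi (svr M f) = 0"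
proof -
 define T where "T k xe = cnj (fhat f (of_int (1 * (int M * k)) * fst xe,of_int (1 * (int M * k)) * snd xe)) * omg psi (1 * (int M * k)) xe" for k xe
 have "(LINT k|cK. LINT xe|lam. T k xe) = (LINT k|cK. 0)"
 proof (rule lint_cong[OF refl], goal_cases)
  case (1 k)
  then have "AE xe in lam. omg psi (1 * (int M * k)) xe = 0" using M by (intro 0) simp
  then have "AE xe in lam. T k xe = 0" by eventually_elim (simp add: T_def)
  then show ?case by (rule integral_eq_zero_AE)
 qed
 then show ?thesis using key_formula(1)[OF psi inv f M, of 1] unfolding T_def by simp
qed

end

context haar_fd
begin


lemma integral_lam_scale:
 fixes f :: "R2 => complex"
 assumes [measurable]: "f \<in> bmble borel" and r: "r > 0"
 shows "(LINT xe|lam. f xe) = of_real (r^2) * (LINT xe|lam. f (r * fst xe,r * snd xe))"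
proof -
 define M where "M = density lam (%_. ennreal (r^2))"
 have "(LINT xe|lam. f xe) = (LINT xe|M. f (r * fst xe,r * snd xe))"
 proof (rule integral_law(2))
  show "(%xe. f (r * fst xe,r * snd xe)) \<in> bmble M" unfolding M_def by measurable
  fix \<phi> :: "complex => ennreal" assume [measurable]: "\<phi> \<in> bmble borel"
  have "(NN xe|lam. \<phi> (f xe)) = ennreal (r^2) * (NN xe|lam. \<phi> (f (r * fst xe,r * snd xe)))"
   by (rule nn_lam_scale[OF _ r]) measurable
  also have "... = (NN xe|M. \<phi> (f (r * fst xe,r * snd xe)))"
   unfolding M_def by (subst nn_integral_density) (auto simp: nn_integral_cmult)
  finally show "(NN xe|lam. \<phi> (f xe)) = (NN xe|M. \<phi> (f (r * fst xe,r * snd xe)))" .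
 qed measurable
 also have "... = (LINT xe|lam. r^2 *\<^sub>R f (r * fst xe,r * snd xe))"
  unfolding M_def by (rule integral_density) auto
 finally show ?thesis by (simp add: scaleR_conv_of_real)
qed

text \<open>Translating \<open>f\<close> multiplies its Fourier transform by all characters, so the vanishing of the
 pairings forces \<open>\<Sum>k. a (M k) xe = 0\<close> for almost every \<open>xe\<close>, and the sieve applies.\<close>

lemma omg_zero_pm:
 fixes psi :: "saff => complex"
 assumes psi: "psi \<in> sqint nuD" and inv: "ginv psi" and sig: "sig = 1 \<or> sig = (-1::int)"
  and orth: "!!M f. M >= 1 ==> f \<in> Cc_smooth0 ==> ip nuD psi (svr M f) = 0" and m: "m >= 1"
 shows "AE xe in lam. omg psi (sig * m) xe = 0"
proof -
 note psim[measurable] = sqint_borel[OF psi]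
 \<comment> \<open>The substitution of \<open>xe / (M k)\<close> for \<open>xe\<close> makes the
   argument of the Fourier transform of \<open>f\<close> independent of \<open>k\<close>. The
   Jacobian and the dilation are put into \<open>a\<close>, leaving one function of
   \<open>xe\<close> times a sum over \<open>k\<close>.\<close>
 define a where "a k xe = of_real (1 / (roi k)^2) * omg psi (sig * k) (1 / roi k * fst xe,1 / roi k * snd xe)" for k xe
 have am[measurable]: "a k \<in> bmble borel" for k unfolding a_def by measurable
 define fs where "fs f xe = cnj (fhat f (of_int sig * fst xe,of_int sig * snd xe))" for f and xe :: "R2"
 have fb[measurable]: "f \<in> bmble borel" if "f \<in> Cc_smooth0" for f
  using that Ck_continuous[of 0 f] by (auto simp: Cc_smooth0_def intro!: bmble_cont)
 have fsm[measurable]: "fs f \<in> bmble borel" if "f \<in> Cc_smooth0" for f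
  using fb[OF that] unfolding fs_def by measurable
 define U where "U M f k xe = fs f xe * a (int M * k) xe" for M f k xe
 have Um[measurable]: "U M f k \<in> bmble borel" if "f \<in> Cc_smooth0" for M f k
  using fsm[OF that] unfolding U_def by measurable
 define T where "T M f k xe = cnj (fhat f (of_int (sig * (int M * k)) * fst xe,of_int (sig * (int M * k)) * snd xe)) * omg psi (sig * (int M * k)) xe" for M f k xe
 have Tm[measurable]: "T M f k \<in> bmble borel" if "f \<in> Cc_smooth0" for M f k
  using fb[OF that] unfolding T_def by measurable
 have TU: "of_real ((1 / roi (int M * k))^2) * T M f k (1 / roi (int M * k) * fst xe,1 / roi (int M * k) * snd xe) = U M f k xe"
  if "M >= 1" "k >= 1" for M f k xe
 proof -
  have nz: "roi (int M * k) ~= 0" using that by simp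
  have c: "of_int (sig * (int M * k)) * (1 / roi (int M * k) * t) = of_int sig * t" for t
   using nz by (simp del: of_int_mult add: of_int_mult[of sig])
  show ?thesis unfolding T_def U_def a_def fs_def fst_conv snd_conv c by (simp add: power_divide mult_ac)
 qed
 have pos: "1 / roi (int M * k) > 0" if "M >= 1" "k >= 1" for M k using that by simp
 have intTU: "(LINT xe|lam. T M f k xe) = (LINT xe|lam. U M f k xe)" if M: "M >= 1" "k >= 1" and f: "f \<in> Cc_smooth0" for M f k
  unfolding integral_lam_scale[OF Tm[OF f] pos[OF M]] TU[OF M, symmetric] by simp
 have nnTU: "(NN xe|lam. ennreal (norm (T M f k xe))) = (NN xe|lam. ennreal (norm (U M f k xe)))" if M: "M >= 1" "k >= 1" and f: "f \<in> Cc_smooth0" for M f k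
 proof -
  define r where "r = 1 / roi (int M * k)"
  have [measurable]: "T M f k \<in> bmble borel" by (rule Tm[OF f])
  have "(NN xe|lam. ennreal (norm (T M f k xe))) = ennreal (r^2) * (NN xe|lam. ennreal (norm (T M f k (r * fst xe,r * snd xe))))"
   unfolding r_def by (rule nn_lam_scale[OF _ pos[OF M]]) measurable
  also have "... = (NN xe|lam. ennreal (r^2) * ennreal (norm (T M f k (r * fst xe,r * snd xe))))"
   by (rule nn_integral_cmult[symmetric]) measurable
  also have "... = (NN xe|lam. ennreal (norm (U M f k xe)))"
   unfolding TU[OF M, symmetric] r_def[symmetric] by (simp add: norm_mult ennreal_mult[symmetric] norm_power)
  finally show ?thesis .
 qed
 have UI: "integrable (cK \<otimes> lam) (%(k,xe). U M f k xe)" if M: "M >= 1" and f: "f \<in> Cc_smooth0" for M f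
 proof (rule integrableI_bounded)
  show m: "(%(k,xe). U M f k xe) \<in> bmble (cK \<otimes> lam)"
   using Um[OF f] by (intro measurable_cK_pair) simp
  have "(NN x|(cK \<otimes> lam). ennreal (norm (case x of (k,xe) => U M f k xe))) = (NN k|cK. NN xe|lam. ennreal (norm (U M f k xe)))"
   by (subst lam.nn_integral_fst[symmetric]) (use m in auto)
  also have "... = (NN k|cK. NN xe|lam. ennreal (norm (T M f k xe)))"
   by (rule nn_integral_cong) (use nnTU[OF M _ f] in simp)
  also have "... < oo" unfolding T_def by (rule key_formula(2)[OF psi inv f M sig])
  finally show "(NN x|(cK \<otimes> lam). ennreal (norm (case x of (k,xe) => U M f k xe))) < oo" .
 qed
 define B where "B M xe = (LINT k|cK. a (int M * k) xe)" for M xe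
 have zero: "(LINT xe|lam. fs f xe * B M xe) = 0" if M: "M >= 1" and f: "f \<in> Cc_smooth0" for M f
 proof -
  have "(LINT xe|lam. fs f xe * B M xe) = (LINT xe|lam. LINT k|cK. U M f k xe)"
   unfolding B_def U_def by simp
  also have "... = (LINT k|cK. LINT xe|lam. U M f k xe)" by (rule cKlam.Fubini_integral[OF UI[OF M f]])
  also have "... = (LINT k|cK. LINT xe|lam. T M f k xe)"
   by (rule lint_cong[OF refl]) (use intTU[OF M _ f] in simp)
  also have "... = 0"
   using key_formula(1)[OF psi inv f M sig] orth[OF M f] M unfolding T_def[symmetric] by simp
  finally show ?thesis .
 qed
 have AE1: "AE xe in lam. fs f xe * B M xe = 0" if M: "M >= 1" and f: "f \<in> Cc_smooth0" for M f
 proof (rule fourier_uniqueness_plane[OF sigma_finite_lam sets_lam])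
  have "integrable lam (%xe. LINT k|cK. U M f k xe)" using cKlam.integrable_snd[OF UI[OF M f]] .
  then show "integrable lam (%xe. fs f xe * B M xe)" unfolding B_def U_def by simp
  fix s t
  \<comment> \<open>Translation of \<open>f\<close> by this vector multiplies \<open>fs f\<close> by
    the character with parameters \<open>s\<close> and \<open>t\<close>; the sign compensates for
    the conjugation and for \<open>sig\<close>.\<close>
  define v where "v = mkv (- of_int sig * s,- of_int sig * t)"
  have v: "v $ 1 = - of_int sig * s" "v $ 2 = - of_int sig * t" unfolding v_def by simp_all
  have "fs (%y. f (y + v)) xe = fs f xe * e_fun (s * fst xe + t * snd xe)" for xe
  proof -
   have "pair_dot (of_int sig * fst xe,of_int sig * snd xe) v = - (s * fst xe + t * snd xe)"
    unfolding pair_dot_def v fst_conv snd_conv using sig by (auto simp: algebra_simps)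
   then show ?thesis unfolding fs_def fhat_translate[OF fb[OF f]] by (simp only: e_fun_minus complex_cnj_mult complex_cnj_cnj mult.commute)
  qed
  then have "(LINT xe|lam. fs f xe * B M xe * e_fun (s * fst xe + t * snd xe)) = (LINT xe|lam. fs (%y. f (y + v)) xe * B M xe)"
   by (simp add: mult_ac)
  also have "... = 0" by (rule zero[OF M translate_Cc_smooth0[OF f]])
  finally show "(LINT xe|lam. fs f xe * B M xe * e_fun (s * fst xe + t * snd xe)) = 0" .
 qed
 define b where "b n i = dd (axis i 1) (bump ((real (Suc n))^2))" for n and i :: 2
 have b: "b n i \<in> Cc_smooth0" for n i unfolding b_def by (rule dd_bump_Cc) simp
 \<comment> \<open>One null set serves all \<open>M\<close> and the countable family of bumps. At a
   good \<open>xe\<close> some bump has nonzero transform, which can be divided out.\<close>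
 have "AE xe in lam. \<forall>M n i. fs (b n i) xe * B (Suc M) xe = 0"
  unfolding AE_all_countable using AE1 b by simp
 moreover have "AE xe in lam. \<forall>n i. integrable cK (%k. U 1 (b n i) k xe)"
  unfolding AE_all_countable
 proof (intro allI)
  fix n i
  show "AE xe in lam. integrable cK (%k. U 1 (b n i) k xe)" using cKlam.AE_integrable_snd[OF UI[OF _ b, of 1 n i]] by simp
 qed
 ultimately have "AE xe in lam. a m xe = 0"
  using AE_lam_nonzero
 proof eventually_elim
  fix xe :: "R2" assume B0: "\<forall>M n i. fs (b n i) xe * B (Suc M) xe = 0" and I: "\<forall>n i. integrable cK (%k. U 1 (b n i) k xe)" and "xe ~= (0,0)"
  then have "(of_int sig * fst xe,of_int sig * snd xe) ~= (0,0)" using sig by (cases xe) auto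
  from exists_fhat_nonzero[OF this] obtain n i where ni: "fs (b n i) xe ~= 0" unfolding fs_def b_def by auto
  have "integrable cK (%k. inverse (fs (b n i) xe) * U 1 (b n i) k xe)" using I by simp
  then have ai: "integrable cK (%k. a k xe)" unfolding U_def using ni by (simp add: mult.assoc[symmetric])
  show "a m xe = 0"
  proof (rule sieve_zero[OF ai _ m], goal_cases)
   case (1 M)
   then have M: "M = int (Suc (nat (M - 1)))" by simp
   have "B (Suc (nat (M - 1))) xe = 0" using B0 ni by (metis mult_eq_0_iff)
   then show ?case unfolding B_def M[symmetric] .
  qed
 qed
 then have "(NN xe|lam. ennreal (norm (a m xe))) = 0" by (subst nn_integral_0_iff_AE) auto
 \<comment> \<open>Homogeneity of \<open>lam\<close> undoes the dilation contained in
   \<open>a m\<close>.\<close>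
 moreover have "(NN xe|lam. ennreal (norm (omg psi (sig * m) xe))) = (NN xe|lam. ennreal (norm (a m xe)))"
 proof -
  define r where "r = 1 / roi m"
  have r: "r > 0" using m by (simp add: r_def)
  have "(NN xe|lam. ennreal (norm (omg psi (sig * m) xe))) = ennreal (r^2) * (NN xe|lam. ennreal (norm (omg psi (sig * m) (r * fst xe,r * snd xe))))"
   by (rule nn_lam_scale[OF _ r]) measurable
  also have "... = (NN xe|lam. ennreal (r^2) * ennreal (norm (omg psi (sig * m) (r * fst xe,r * snd xe))))"
   by (rule nn_integral_cmult[symmetric]) measurable
  also have "... = (NN xe|lam. ennreal (norm (a m xe)))"
   unfolding a_def r_def by (simp add: norm_mult ennreal_mult[symmetric] norm_power power_divide norm_divide)
  finally show ?thesis .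
 qed
 ultimately have "(NN xe|lam. ennreal (norm (omg psi (sig * m) xe))) = 0" by (simp only:)
 then show ?thesis by (subst (asm) nn_integral_0_iff_AE) auto
qed

text \<open>Left translations act on each fibre over the matrix part transitively, so on the group
  this says that \<open>p\<close> depends on the matrix alone, see \<open>tinv_obtain_F\<close>. In
  this form the property passes easily to rotated functions.\<close>

definition tinv :: "(saff => complex) => bool" where
 "tinv p \<longleftrightarrow> (\<forall>s. \<forall>h\<in>SAff. p (mul (tr s) h) = p h)"

definition gen :: "(saff => complex) => bool" where
 "gen psi \<longleftrightarrow> (\<forall>p\<in>sqint nuD. ginv p \<longrightarrow> tinv p \<longrightarrow> ip nuD psi p = 0)"

text \<open>The zeroth torus coefficient \<open>p\<close> of \<open>psi\<close> is itself a
  pullback, hence an admissible test function for genuineness. Averaging over fibres identifies the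
  pairing of \<open>psi\<close> with \<open>p\<close> as the squared norm of
  \<open>p\<close>.\<close>

lemma omg_zero_0:
 assumes psi: "psi \<in> sqint nuD" and inv: "ginv psi" and gen: "gen psi"
 shows "AE xe in lam. omg psi 0 xe = 0"
proof -
 note psim[measurable] = sqint_borel[OF psi]
 define p where "p = psih psi (0,0)"
 have pm[measurable]: "p \<in> bmble borel" unfolding p_def by measurable
 have ginvp: "ginv p" unfolding ginv_def p_def
  by (simp add: psih_gamma[OF psim inv] smul_def)
 have tinvp: "tinv p" unfolding tinv_def p_def
  by (simp add: psih_tr[OF psim inv] chr_def)
 have "(NN h|nuD. nsq (p h)) <= (NN h|nuD. NN s|TT. nsq (psi (mul (tr s) h)))"
 proof (rule nn_integral_mono, goal_cases)
  case (1 h)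
  have "nsq (p h) <= (NN n|cU. nsq (psih psi n h))"
   unfolding p_def by (rule nn_integral_ge_point[where p="%n. nsq (psih psi n h)"]) simp
  also have "... <= (NN s|TT. nsq (psi (mul (tr s) h)))"
   unfolding psih_def by (rule bessel_TT) measurable
  finally show ?case .
 qed
 also have "... = (NN h|nuD. nsq (psi h))"
  by (rule nn_torus_average[where H="%h. nsq (psi h)"]) (auto intro: ginv_comp[OF inv])
 also have "... < oo" by (rule sqint_nn_finite[OF psi])
 finally have "integrable nuD (%h. (norm (p h))^2)" by (intro integrableI_bounded) auto
 then have ps: "p \<in> sqint nuD" by (simp add: sqint_def)
 define F where "F h = psi h * cnj (p h)" for h
 have FI: "integrable nuD F" unfolding F_def by (rule sqint_prod_integrable(1)[OF psi ps])
 have Finv: "ginv F" unfolding F_def ginv_def using inv ginvp by (simp add: ginv_def)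
 have "0 = ip nuD psi p" using gen ps ginvp tinvp by (simp add: gen_def)
 also have "... = (LINT h|nuD. LINT s|TT. F (mul (tr s) h))"
  unfolding ip_def F_def[symmetric] by (rule integral_torus_average(1)[OF FI Finv])
 also have "... = ip nuD p p" unfolding ip_def
 proof (rule integral_cong_AE)
  show "(%h. LINT s|TT. F (mul (tr s) h)) \<in> bmble nuD" by (rule integral_torus_average(2)[OF FI Finv])
  show "(%h. p h * cnj (p h)) \<in> bmble nuD" by measurable
  show "AE h in nuD. (LINT s|TT. F (mul (tr s) h)) = p h * cnj (p h)"
   using AE_nuD_SAff
  proof eventually_elim
   case h: (elim h)
   have "p (mul (tr s) h) = p h" for s using tinvp h by (auto simp: tinv_def)
   then have "(LINT s|TT. F (mul (tr s) h)) = (LINT s|TT. psi (mul (tr s) h)) * cnj (p h)"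
    unfolding F_def by simp
   also have "(LINT s|TT. psi (mul (tr s) h)) = p h" by (simp add: p_def psih_def chr_def)
   finally show ?case .
  qed
 qed
 finally have "nrm2 nuD p = 0" by (simp add: ip_self)
 then have "AE h in nuD. p h = 0" using nrm2_eq_0[OF ps] by simp
 then have p0: "AE h in nu. p h = 0"
  by (rule AE_nuD_transfer[rotated 2]) (auto intro: ginv_comp[OF ginvp])
 define G where "G h = ennreal (norm (p h))" for h
 have Gm[measurable]: "G \<in> bmble borel" unfolding G_def by measurable
 have "(NN xe|lam. NN t|I01. G (kt t xe)) = (NN h|nu. ind cube (crd h) * G h)"
 proof (rule nn_cube_chart[symmetric])
  fix x q u and xe :: "R2" assume "xe ~= (0,0)"
  then have "p (kap ((x,q,u),xe)) = p (kt x xe)"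
   unfolding kap_tr[of x q u xe] using tinvp kap_in[of xe "(x,0,0)"] unfolding tinv_def by blast
  then show "G (kap ((x,q,u),xe)) = G (kt x xe)" unfolding G_def by (rule arg_cong)
 qed simp
 also have "... = (NN h|nu. 0)" by (rule nn_integral_cong_AE, use p0 in eventually_elim) (simp add: G_def)
 finally have z: "(NN xe|lam. NN t|I01. G (kt t xe)) = 0" by simp
 have le: "ennreal (norm (omg psi 0 xe)) <= (NN t|I01. G (kt t xe))" for xe
  unfolding omg_def G_def p_def by (cases "integrable I01 (%t. psih psi (0,0) (kt t xe))")
   (auto intro: integral_norm_bound_ennreal simp: not_integrable_integral_eq)
 have "(NN xe|lam. ennreal (norm (omg psi 0 xe))) <= (NN xe|lam. NN t|I01. G (kt t xe))"
  by (rule nn_integral_mono) (rule le)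
 then have "(NN xe|lam. ennreal (norm (omg psi 0 xe))) = 0" using z by simp
 then show ?thesis by (subst (asm) nn_integral_0_iff_AE) auto
qed

lemma omg_zero:
 assumes psi: "psi \<in> sqint nuD" and inv: "ginv psi" and gen: "gen psi"
  and orth: "!!M f. M >= 1 ==> f \<in> Cc_smooth0 ==> ip nuD psi (svr M f) = 0"
 shows "AE xe in lam. omg psi m xe = 0"
proof -
 consider "m = 0" | "m >= 1" | "- m >= 1" by linarith
 then show ?thesis
 proof cases
  case 1 then show ?thesis using omg_zero_0[OF psi inv gen] by simp
 next
  case 2 then show ?thesis using omg_zero_pm[OF psi inv _ orth, of 1 m] by simp
 next
  case 3 then show ?thesis using omg_zero_pm[OF psi inv _ orth, of "-1" "- m"] by simp
 qed
qed

end

section \<open>Decomposition into \<open>K\<close>-types\<close>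

definition rotv :: "real => real^2 => real^2" where
 "rotv tt y = mkv (rotp tt (y $ 1,y $ 2))"

lemma rotv_comps[simp]:
 "rotv tt y $ 1 = y $ 1 * cos (2 * pi * tt) - y $ 2 * sin (2 * pi * tt)"
 "rotv tt y $ 2 = y $ 1 * sin (2 * pi * tt) + y $ 2 * cos (2 * pi * tt)"
 by (simp_all add: rotv_def rotp_def)

lemma bounded_linear_rotv: "bounded_linear (rotv tt)"
 by (rule linear_conv_bounded_linear[THEN iffD1], rule linearI) (simp_all add: vec_eq_iff forall_2 algebra_simps)

lemma norm_rotv: "norm (rotv tt y) = norm y"
proof -
 have "(norm (rotv tt y))^2 = (norm y)^2"
  using rotp_norm[of tt "(y $ 1,y $ 2)"] unfolding norm_vec2 rotv_def by (simp add: power2_eq_square)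
 then show ?thesis by (simp add: power2_eq_iff_nonneg)
qed

lemma Ck_linear: "bounded_linear L ==> Ck k f ==> Ck k (%y. f (L y))"
proof (induction k arbitrary: f)
 case 0
 then show ?case using continuous_on_compose2[OF _ linear_continuous_on[OF 0(1)], of UNIV f UNIV] by simp
next
 case (Suc k)
 have d: "((%y. f (L y)) has_derivative (%v. frechet_derivative f (at (L x)) (L v))) (at x)" for x
 proof -
  have "(f has_derivative frechet_derivative f (at (L x))) (at (L x))"
   using Suc.prems frechet_derivative_works by auto
  then show ?thesis using diff_chain_at[OF bounded_linear_imp_has_derivative[OF Suc.prems(1)], of f _ x] by (simp add: o_def)
 qed
 then have "frechet_derivative (%y. f (L y)) (at x) = (%v. frechet_derivative f (at (L x)) (L v))" for x
  by (metis frechet_derivative_at)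
 moreover have "Ck k (%x. frechet_derivative f (at (L x)) (L v))" for v
  using Suc.IH[of "%x. frechet_derivative f (at x) (L v)"] Suc.prems by simp
 ultimately show ?case using d by (auto simp: differentiable_def)
qed

lemma rotv_Cc_smooth0:
 assumes f: "f \<in> Cc_smooth0" shows "(%y. f (rotv tt y)) \<in> Cc_smooth0"
proof -
 obtain R where R: "supp_le R f" using Cc_smooth0_supp[OF f] by blast
 have "{x. f (rotv tt x) ~= 0} \<subseteq> cball 0 R"
  using R by (auto simp: supp_le_def not_less[symmetric] norm_rotv[of tt] simp del: not_less)
 then have "closure {x. f (rotv tt x) ~= 0} \<subseteq> cball 0 R" by (rule closure_minimal) simp
 then have c: "compact (closure {x. f (rotv tt x) ~= 0})" by (meson bounded_cball bounded_subset closed_closure compact_eq_bounded_closed)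
 have [measurable]: "f \<in> bmble borel" using f Ck_continuous[of 0 f] by (auto simp: Cc_smooth0_def intro!: bmble_cont)
 have [measurable]: "rotv tt \<in> bmble borel"
  by (intro bmble_cont linear_continuous_on bounded_linear_rotv)
 define A B where "A = mkv (cos (2 * pi * tt),sin (2 * pi * tt))" and "B = mkv (- sin (2 * pi * tt),cos (2 * pi * tt))"
 have d: "A $ 1 * B $ 2 - A $ 2 * B $ 1 ~= 0" unfolding A_def B_def by (simp add: power2_eq_square[symmetric])
 have "rotv tt (fst x *\<^sub>R axis 1 1 + snd x *\<^sub>R axis 2 1 + 0) = fst x *\<^sub>R A + snd x *\<^sub>R B + 0" for x :: "R2"
  by (simp add: vec_eq_iff forall_2 A_def B_def axis_def)
 then have "(LINT x|lborel. f (rotv tt (fst x *\<^sub>R axis 1 1 + snd x *\<^sub>R axis 2 1 + 0))) = (LINT x|lborel. f (fst x *\<^sub>R A + snd x *\<^sub>R B + 0))"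
  by (simp only:)
 also have "... = 0" using f unfolding integral_plane_vec(1)[OF \<open>f \<in> bmble borel\<close> d, of 0] by (simp add: Cc_smooth0_def)
 also have "(LINT x|lborel. f (rotv tt (fst x *\<^sub>R axis 1 1 + snd x *\<^sub>R axis 2 1 + 0))) = (LINT y|lborel. f (rotv tt y))"
  by (subst integral_plane_vec(1)) (simp_all add: axis_def)
 finally have "(LINT y|lborel. f (rotv tt y)) = 0" .
 then show ?thesis using c f Ck_linear[OF bounded_linear_rotv, of _ f tt] by (simp add: Cc_smooth0_def)
qed

text \<open>Right rotations act linearly on the vectors summed over, so the transforms form a
  rotation-stable family and orthogonality to them passes to K-types.\<close>

lemma svr_rot: "svr M f (mul h (rot tt)) = svr M (%y. f (rotv tt y)) h"
proof (cases "h \<in> SAff")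
 case True
 have "snd (mul h (rot tt)) + (1 / real M) *\<^sub>R (of_int j *\<^sub>R (fst (mul h (rot tt)) $ 1) + of_int l *\<^sub>R (fst (mul h (rot tt)) $ 2))
   = rotv tt (snd h + (1 / real M) *\<^sub>R (of_int j *\<^sub>R (fst h $ 1) + of_int l *\<^sub>R (fst h $ 2)))" for j l
  by (simp add: vec_eq_iff forall_2 algebra_simps add_divide_distrib diff_divide_distrib)
 then have "SV_rel M f (mul h (rot tt)) = SV_rel M (%y. f (rotv tt y)) h" unfolding SV_rel_def by (simp only:)
 then show ?thesis using True by (simp add: svr_def mul_in del: mul_comps)
next
 case False
 have "mul h (rot tt) \<notin> SAff"
 proof
  assume "mul h (rot tt) \<in> SAff"
  then have "mul (mul h (rot tt)) (saff_inv (rot tt)) \<in> SAff" by (rule mul_in[OF _ saff_inv_in[OF rot_in]])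
  then show False using False by (simp only: saff_inv_cancel_right(1)[OF rot_in])
 qed
 then show ?thesis using False by (simp add: svr_def)
qed

lemma nn_I01_shift:
 fixes F :: "real => ennreal"
 assumes [measurable]: "F \<in> bmble borel" and per: "!!x. F (x + 1) = F x"
 shows "(NN x|I01. F (x + c)) = (NN x|I01. F x)"
proof -
 have pern: "F (x + of_nat n) = F x" for x n
 proof (induction n)
  case (Suc n) then show ?case using per[of "x + of_nat n"] by (simp add: add.assoc add.commute[of 1])
 qed simp
 have peri: "F (x + of_int n) = F x" for x n
 proof (cases n)
  case (nonneg k) then show ?thesis using pern by simp
 next
  case (neg k) then show ?thesis using pern[of "x + of_int n" "Suc k"] by simp
 qed
 have red: "(NN s|TT. g (fst s)) = (NN x|I01. g x)" if g: "g \<in> bmble borel" for g :: "real => ennreal"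
 proof -
  have "(%s. g (fst s)) \<in> bmble (I01 \<otimes> I01)" using g by measurable
  then show ?thesis unfolding TT_def by (subst I01.nn_integral_fst[symmetric]) simp_all
 qed
 \<comment> \<open>The circle is viewed as the first factor of the torus, where translation by
   \<open>(c,0)\<close> with the identity matrix is an instance of
   \<open>torus_automorphism\<close>.\<close>
 have "(NN x|I01. F (x + c)) = (NN s|TT. F (fst (plane_int saff_one s + (c,0))))"
  by (subst red[symmetric]) (simp_all add: plane_int_one)
 also have "... = (NN s|TT. F (fst s))"
  by (rule torus_automorphism[where G="%s. F (fst s)"]) (simp_all add: iota_def peri)
 also have "... = (NN x|I01. F x)" by (rule red) simp
 finally show ?thesis .
qed

lemma integral_I01_shift:
 fixes F :: "real => complex"
 assumes [measurable]: "F \<in> bmble borel" and per: "!!x. F (x + 1) = F x"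
 shows "(LINT x|I01. F (x + c)) = (LINT x|I01. F x)"
proof (rule integral_law(2))
 fix \<phi> :: "complex => ennreal" assume [measurable]: "\<phi> \<in> bmble borel"
 show "(NN x|I01. \<phi> (F (x + c))) = (NN x|I01. \<phi> (F x))"
  by (rule nn_I01_shift[where F="%x. \<phi> (F x)"]) (simp_all add: per)
qed measurable

text \<open>The projection to one K-type, as an explicit average over rotations. By
  \<open>psl_rot\<close> its equivariance holds at every point and not only almost everywhere, which
  is needed to read off a form from it.\<close>

definition psl :: "(saff => complex) => int => saff => complex" where
 "psl psi l h = (LINT tt|I01. psi (mul h (rot tt)) * e_fun (- of_int l * tt))"

lemma measurable_rot_pair:
 assumes "psi \<in> bmble borel"
 shows "(%z. psi (mul (fst z) (rot (snd z)))) \<in> bmble (borel \<otimes> I01)"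
proof -
 have "(%z. mul (fst z) (rot (snd z))) \<in> bmble (borel \<otimes> I01)" by measurable
 from measurable_compose[OF this assms] show ?thesis .
qed

lemma measurable_rot_section:
 assumes "psi \<in> bmble borel"
 shows "(%tt. psi (mul h (rot tt))) \<in> bmble I01" "(%h. psi (mul h (rot tt))) \<in> bmble borel"
proof -
 have "(%tt. mul h (rot tt)) \<in> bmble I01" "(%h. mul h (rot tt)) \<in> bmble borel" by measurable
 then show "(%tt. psi (mul h (rot tt))) \<in> bmble I01" "(%h. psi (mul h (rot tt))) \<in> bmble borel"
  using measurable_compose[OF _ assms] by blast+
qed

lemma measurable_psl[measurable]:
 assumes "psi \<in> bmble borel"
 shows "psl psi l \<in> bmble borel"
proof -
 have "(%z. psi (mul (fst z) (rot (snd z))) * e_fun (- of_int l * snd z)) \<in> bmble (borel \<otimes> I01)"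
  by (intro borel_measurable_times measurable_rot_pair assms) measurable
 then show ?thesis unfolding psl_def[abs_def] by (intro I01.borel_measurable_lebesgue_integral) (simp add: case_prod_unfold)
qed

lemma psl_rot:
 assumes m: "psi \<in> bmble borel"
 shows "psl psi l (mul h (rot al)) = e_fun (of_int l * al) * psl psi l h"
proof -
 define F where "F tt = psi (mul h (rot tt)) * e_fun (- of_int l * tt)" for tt
 have "(%tt. psi (mul h (rot tt))) \<in> bmble borel"
  using measurable_rot_section(1)[OF m, of h] by (simp cong: m_cong)
 then have Fm: "F \<in> bmble borel" unfolding F_def by measurable
 have e1: "e_fun (of_int l * al) * e_fun (- (of_int l * (tt + al))) = e_fun (- (of_int l * tt))" for tt
  by (simp add: e_fun_add[symmetric] algebra_simps)
 have "psi (mul (mul h (rot al)) (rot tt)) * e_fun (- of_int l * tt) = e_fun (of_int l * al) * F (tt + al)" for tt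
  unfolding F_def mul_assoc rot_add add.commute[of al] using e1[of tt] by (simp add: mult_ac)
 then have "psl psi l (mul h (rot al)) = e_fun (of_int l * al) * (LINT tt|I01. F (tt + al))" unfolding psl_def by simp
 also have "(LINT tt|I01. F (tt + al)) = (LINT tt|I01. F tt)"
 proof (rule integral_I01_shift[OF Fm])
  fix x
  have "e_fun (- of_int l * x + of_int (- l)) = e_fun (- of_int l * x)" by (rule e_fun_add_int) simp
  then show "F (x + 1) = F x" unfolding F_def rot_1 by (simp add: algebra_simps)
 qed
 finally show ?thesis unfolding F_def psl_def .
qed

lemma ginv_rot: "ginv psi ==> ginv (%h. psi (mul h (rot tt)))"
 unfolding ginv_def mul_assoc by (simp add: mul_in del: mul_comps)

lemma ginv_psl: "ginv psi ==> ginv (psl psi l)"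
 unfolding ginv_def psl_def mul_assoc by (simp add: mul_in del: mul_comps)

lemma norm_sq_integral_le:
 fixes g :: "'a => complex"
 assumes P: "emeasure P (space P) = 1" and g: "g \<in> bmble P" and e: "e \<in> bmble P" "!!x. norm (e x) = 1"
 shows "nsq (LINT x|P. g x * e x) <= (NN x|P. nsq (g x))"
proof (cases "(NN x|P. nsq (g x)) = oo")
 case False
 interpret finite_measure P by (rule finite_measureI) (simp add: P)
 have "integrable P (%x. (norm (g x))^2)" using False g by (intro integrableI_bounded) (auto simp: top.not_eq_extremum)
 then have gs: "g \<in> sqint P" using g by (simp add: sqint_def)
 have es: "(%x. cnj (e x)) \<in> sqint P" using e by (simp add: sqint_def)
 have "(norm (ip P g (%x. cnj (e x))))^2 <= nrm2 P g * nrm2 P (%x. cnj (e x))" by (rule cauchy_schwarz[OF gs es])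
 also have "nrm2 P (%x. cnj (e x)) = 1" unfolding nrm2_def using e(2) P by (simp add: measure_def)
 finally show ?thesis unfolding nrm2_nn_integral[OF gs] by (intro ennreal_leI) (simp add: ip_def)
qed simp

context haar_fd
begin

sublocale nuDI: pair_sigma_finite nuD I01 ..

lemma measurable_rot_nuD:
 assumes "psi \<in> bmble borel"
 shows "(%z. psi (mul (fst z) (rot (snd z)))) \<in> bmble (nuD \<otimes> I01)"
 using measurable_rot_pair[OF assms] by (simp cong: m_cong sets_pair_measure_cong)

lemma nn_rot_average:
 assumes H: "H \<in> bmble borel" and inv: "ginv H"
 shows "(NN h|nuD. NN tt|I01. H (mul h (rot tt))) = (NN h|nuD. H h)"
proof -
 have m: "(%z. H (mul (fst z) (rot (snd z)))) \<in> bmble (nuD \<otimes> I01)"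
  using measurable_compose[OF _ H, of "%z. mul (fst z) (rot (snd z))" "nuD \<otimes> I01"] by measurable
 interpret InuD: pair_sigma_finite I01 nuD ..
 have "(%(tt,h). H (mul h (rot tt))) \<in> bmble (I01 \<otimes> nuD)"
  using measurable_pair_swap[OF m] by (simp add: case_prod_unfold)
 then have "(NN h|nuD. NN tt|I01. H (mul h (rot tt))) = (NN tt|I01. NN h|nuD. H (mul h (rot tt)))"
  by (rule InuD.Fubini')
 also have "... = (NN tt|I01. (NN h|nuD. H h))" by (intro nn_integral_cong nn_nuD_rot H inv)
 finally show ?thesis by simp
qed

lemma integral_nuD_rot:
 fixes F :: "saff => complex"
 assumes F: "F \<in> bmble borel" and inv: "ginv F"
 shows "(LINT h|nuD. F (mul h (rot tt))) = (LINT h|nuD. F h)"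
  and "integrable nuD (%h. F (mul h (rot tt))) \<longleftrightarrow> integrable nuD F"
proof -
 have m: "(%h. F (mul h (rot tt))) \<in> bmble nuD" "F \<in> bmble nuD"
  using measurable_rot_section(2)[OF F, of tt] F by (simp_all cong: m_cong)
 have law: "(NN h|nuD. \<phi> (F (mul h (rot tt)))) = (NN h|nuD. \<phi> (F h))" if p: "\<phi> \<in> bmble borel" for \<phi> :: "complex => ennreal"
  by (rule nn_nuD_rot[where H="%h. \<phi> (F h)"]) (use measurable_compose[OF F p] ginv_comp[OF inv] in auto)
 show "(LINT h|nuD. F (mul h (rot tt))) = (LINT h|nuD. F h)" "integrable nuD (%h. F (mul h (rot tt))) \<longleftrightarrow> integrable nuD F"
  using integral_law[OF m law] by auto
qed

lemma sqint_rot: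
 assumes q: "q \<in> sqint nuD" and inv: "ginv q"
 shows "(%h. q (mul h (rot tt))) \<in> sqint nuD"
proof -
 have qm: "q \<in> bmble borel" by (rule sqint_borel[OF q])
 have "(NN h|nuD. nsq (q (mul h (rot tt)))) = (NN h|nuD. nsq (q h))"
  by (rule nn_nuD_rot[where H="%h. nsq (q h)"]) (use qm ginv_comp[OF inv] in auto)
 also have "... < oo" by (rule sqint_nn_finite[OF q])
 finally show ?thesis using measurable_rot_section(2)[OF qm, of tt]
  by (auto simp: sqint_def intro!: integrableI_bounded cong: m_cong)
qed

lemma psl_sqint:
 assumes psi: "psi \<in> sqint nuD" and inv: "ginv psi"
 shows "psl psi l \<in> sqint nuD"
proof -
 note m = sqint_borel[OF psi]
 have "(NN h|nuD. nsq (psl psi l h)) <= (NN h|nuD. NN tt|I01. nsq (psi (mul h (rot tt))))"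
  unfolding psl_def by (rule nn_integral_mono, rule norm_sq_integral_le) (simp_all add: measurable_rot_section(1)[OF m])
 also have "... = (NN h|nuD. nsq (psi h))"
  by (rule nn_rot_average[where H="%h. nsq (psi h)"]) (use m ginv_comp[OF inv] in auto)
 also have "... < oo" by (rule sqint_nn_finite[OF psi])
 finally show ?thesis using measurable_psl[OF m, of l]
  by (auto simp: sqint_def intro!: integrableI_bounded cong: m_cong)
qed

text \<open>Rotation invariance of the quotient integral shifts the rotation from \<open>psi\<close>
  to \<open>q\<close>. Consequently a K-type of \<open>psi\<close> remains orthogonal to whatever
  \<open>psi\<close> and all rotations of \<open>q\<close> are orthogonal to each other against, see
  \<open>psl_orthogonal\<close>.\<close>

lemma ip_psl:
 assumes psi: "psi \<in> sqint nuD" and inv: "ginv psi" and q: "q \<in> sqint nuD" and qinv: "ginv q"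
 shows "ip nuD (psl psi l) q = (LINT tt|I01. e_fun (- of_int l * tt) * ip nuD psi (%h. q (mul h (rot (- tt)))))"
proof -
 note m = sqint_borel[OF psi] and qm = sqint_borel[OF q]
 define G where "G h tt = psi (mul h (rot tt)) * e_fun (- of_int l * tt) * cnj (q h)" for h tt
 have Gm: "(%(h,tt). G h tt) \<in> bmble (nuD \<otimes> I01)"
 proof -
  have [measurable]: "(%z. psi (mul (fst z) (rot (snd z)))) \<in> bmble (nuD \<otimes> I01)" by (rule measurable_rot_nuD[OF m])
  have [measurable]: "q \<in> bmble nuD" by (rule sqintD(1)[OF q])
  show ?thesis unfolding G_def case_prod_unfold by measurable
 qed
 have GI: "integrable (nuD \<otimes> I01) (%(h,tt). G h tt)"
 proof (rule integrableI_bounded[OF Gm])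
  have "(NN z|(nuD \<otimes> I01). ennreal (norm (case z of (h,tt) => G h tt))) = (NN h|nuD. NN tt|I01. ennreal (norm (G h tt)))"
   by (subst I01.nn_integral_fst[symmetric]) (use Gm in auto)
  also have "... <= (NN h|nuD. (NN tt|I01. nsq (psi (mul h (rot tt)))) + nsq (q h))"
  proof (rule nn_integral_mono, goal_cases)
   case (1 h)
   have half: "(x + y) / 2 <= x + y" if "x >= 0" "y >= 0" for x y :: real using that by (simp add: field_simps)
   have "(NN tt|I01. ennreal (norm (G h tt))) <= (NN tt|I01. nsq (psi (mul h (rot tt))) + nsq (q h))"
   proof (rule nn_integral_mono, goal_cases)
    case (1 tt)
    have "norm (G h tt) = norm (psi (mul h (rot tt))) * norm (q h)" by (simp add: G_def norm_mult)
    also have "... <= (norm (psi (mul h (rot tt))))^2 + (norm (q h))^2" by (rule order_trans[OF norm_mult_le_half half]) simp_all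
    finally show ?case
     by (subst ennreal_plus[symmetric]) (auto intro: ennreal_leI simp del: ennreal_plus)
   qed
   also have "... = (NN tt|I01. nsq (psi (mul h (rot tt)))) + nsq (q h)"
    by (subst nn_integral_add) (use measurable_rot_section(1)[OF m, of h] in auto)
   finally show ?case .
  qed
  also have "... = (NN h|nuD. NN tt|I01. nsq (psi (mul h (rot tt)))) + (NN h|nuD. nsq (q h))"
  proof (rule nn_integral_add)
   have "(%z. nsq (psi (mul (fst z) (rot (snd z))))) \<in> bmble (nuD \<otimes> I01)"
    using measurable_rot_nuD[OF m] by measurable
   from I01.borel_measurable_nn_integral_fst[OF this] show "(%h. NN tt|I01. nsq (psi (mul h (rot tt)))) \<in> bmble nuD" by simp
   show "(%h. nsq (q h)) \<in> bmble nuD" using sqintD(1)[OF q] by measurable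
  qed
  also have "(NN h|nuD. NN tt|I01. nsq (psi (mul h (rot tt)))) = (NN h|nuD. nsq (psi h))"
   by (rule nn_rot_average[where H="%h. nsq (psi h)"]) (use m ginv_comp[OF inv] in auto)
  also have "... + (NN h|nuD. nsq (q h)) < oo"
   using sqint_nn_finite[OF psi] sqint_nn_finite[OF q] by simp
  finally show "(NN z|(nuD \<otimes> I01). ennreal (norm (case z of (h,tt) => G h tt))) < oo" .
 qed
 have "ip nuD (psl psi l) q = (LINT h|nuD. LINT tt|I01. G h tt)"
  unfolding ip_def psl_def G_def by simp
 also have "... = (LINT tt|I01. LINT h|nuD. G h tt)" by (rule nuDI.Fubini_integral[OF GI, symmetric])
 also have "... = (LINT tt|I01. e_fun (- of_int l * tt) * ip nuD psi (%h. q (mul h (rot (- tt)))))"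
 proof (rule lint_cong[OF refl], goal_cases)
  case (1 tt)
  define K where "K h = psi h * cnj (q (mul h (rot (- tt))))" for h
  have Km: "K \<in> bmble borel" unfolding K_def using m measurable_rot_section(2)[OF qm] by measurable
  have Kinv: "ginv K" unfolding K_def using inv ginv_rot[OF qinv, of "- tt"] by (auto simp: ginv_def simp del: mul_comps)
  have "G h tt = e_fun (- of_int l * tt) * K (mul h (rot tt))" for h
   unfolding G_def K_def by (simp add: mul_assoc rot_add rot_0 mult_ac del: mul_comps)
  then have "(LINT h|nuD. G h tt) = e_fun (- of_int l * tt) * (LINT h|nuD. K (mul h (rot tt)))" by simp
  also have "(LINT h|nuD. K (mul h (rot tt))) = ip nuD psi (%h. q (mul h (rot (- tt))))"
   unfolding integral_nuD_rot(1)[OF Km Kinv] unfolding ip_def K_def ..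
  finally show ?case .
 qed
 finally show ?thesis .
qed

lemma psl_orthogonal:
 assumes "psi \<in> sqint nuD" "ginv psi" "q \<in> sqint nuD" "ginv q"
  and "!!tt. ip nuD psi (%h. q (mul h (rot tt))) = 0"
 shows "ip nuD (psl psi l) q = 0"
 unfolding ip_psl[OF assms(1-4)] assms(5) by simp

lemma gen_psl:
 assumes psi: "psi \<in> sqint nuD" and inv: "ginv psi" and g: "gen psi"
 shows "gen (psl psi l)"
 unfolding gen_def
proof (intro ballI impI)
 fix p assume p: "p \<in> sqint nuD" "ginv p" "tinv p"
 show "ip nuD (psl psi l) p = 0"
 proof (rule psl_orthogonal[OF psi inv p(1,2)], goal_cases)
  case (1 tt)
  have "tinv (%h. p (mul h (rot tt)))"
   using p(3) unfolding tinv_def mul_assoc by (simp add: mul_in del: mul_comps)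
  then show ?case
   using g sqint_rot[OF p(1,2)] ginv_rot[OF p(2)] unfolding gen_def by blast
 qed
qed

lemma omg_psl_zero:
 assumes psi: "psi \<in> sqint nuD" and inv: "ginv psi" and g: "gen psi"
  and orth: "!!M f. M >= 1 ==> f \<in> Cc_smooth0 ==> ip nuD psi (svr M f) = 0"
 shows "AE xe in lam. omg (psl psi l) m xe = 0"
proof (rule omg_zero[OF psl_sqint[OF psi inv] ginv_psl[OF inv] gen_psl[OF psi inv g]], goal_cases)
 case (1 M f) note M = 1(1) and f = 1(2)
 show ?case
  by (rule psl_orthogonal[OF psi inv svr_sqint[OF f M] ginv_svr[OF M]]) (simp add: svr_rot orth[OF M] rotv_Cc_smooth0[OF f])
qed

text \<open>The projection to a K-type is self-adjoint and idempotent. This is how orthogonality of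
  \<open>psi\<close> to its own K-type will force that K-type to vanish.\<close>

lemma ip_psl_self:
 assumes psi: "psi \<in> sqint nuD" and inv: "ginv psi"
 shows "ip nuD psi (psl psi l) = of_real (nrm2 nuD (psl psi l))"
proof -
 define p where "p = psl psi l"
 have m: "psi \<in> bmble borel" by (rule sqint_borel[OF psi])
 have ps: "p \<in> sqint nuD" "ginv p" unfolding p_def by (rule psl_sqint[OF psi inv], rule ginv_psl[OF inv])
 have "ip nuD psi (%h. p (mul h (rot (- tt)))) = e_fun (of_int l * tt) * ip nuD psi p" for tt
 proof -
  have "(%h. p (mul h (rot (- tt)))) = (%h. e_fun (- (of_int l * tt)) * p h)"
   unfolding p_def psl_rot[OF m] by simp
  then show ?thesis by (simp only: ip_scale_right e_fun_minus complex_cnj_cnj)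
 qed
 moreover have "e_fun (- of_int l * tt) * (e_fun (of_int l * tt) * c) = c" for tt c
  by (simp add: mult.assoc[symmetric] e_fun_add[symmetric])
 ultimately have "ip nuD p p = (LINT tt|I01. ip nuD psi p)"
  unfolding ip_psl[OF psi inv ps, of l, folded p_def] by (simp only:)
 also have "... = ip nuD psi p" by (simp add: measure_def)
 finally show ?thesis unfolding p_def ip_self by simp
qed

text \<open>For almost every \<open>h\<close> the restriction to the rotation orbit of
  \<open>h\<close> is square integrable with all Fourier coefficients zero, hence zero almost
  everywhere on the orbit; averaging over orbits recovers the norm of \<open>psi\<close>.\<close>

lemma psl_complete:
 assumes psi: "psi \<in> sqint nuD" and inv: "ginv psi" and z: "!!l. AE h in nuD. psl psi l h = 0"
 shows "AE h in nuD. psi h = 0"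
proof -
 have m: "psi \<in> bmble borel" by (rule sqint_borel[OF psi])
 define S where "S h = (NN tt|I01. nsq (psi (mul h (rot tt))))" for h
 have Sm: "S \<in> bmble nuD"
 proof -
  have "(%z. nsq (psi (mul (fst z) (rot (snd z))))) \<in> bmble (nuD \<otimes> I01)"
   using measurable_rot_nuD[OF m] by measurable
  from I01.borel_measurable_nn_integral_fst[OF this] show ?thesis by (simp add: S_def[abs_def])
 qed
 have Sint: "(NN h|nuD. S h) = (NN h|nuD. nsq (psi h))"
  unfolding S_def by (rule nn_rot_average[where H="%h. nsq (psi h)"]) (use m ginv_comp[OF inv] in auto)
 have "AE h in nuD. S h ~= oo"
  using sqint_nn_finite[OF psi] Sint by (intro nn_integral_PInf_AE[OF Sm]) simp
 moreover have "AE h in nuD. \<forall>l. psl psi l h = 0" unfolding AE_all_countable using z by blast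
 ultimately have "AE h in nuD. S h = 0"
 proof eventually_elim
  fix h assume S: "S h ~= oo" and l: "\<forall>l. psl psi l h = 0"
  define g where "g tt = psi (mul h (rot tt))" for tt
  have gm: "g \<in> bmble I01" unfolding g_def by (rule measurable_rot_section(1)[OF m])
  have "integrable I01 (%tt. (norm (g tt))^2)"
   using S gm unfolding S_def g_def[symmetric] by (intro integrableI_bounded) (auto simp: top.not_eq_extremum)
  then have "g \<in> sqint I01" using gm by (simp add: sqint_def)
  then have gi: "integrable I01 g" using sqint_prod_integrable(1)[of g I01 "%_. 1"] by (simp add: sqint_def)
  have "AE tt in I01. g tt = 0"
  proof (rule fourier_uniqueness_I01[OF gi], goal_cases)
   case (1 k)
   show ?case
    using spec[OF l, of "- k"] unfolding psl_def g_def by simp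
  qed
  then have "AE tt in I01. nsq (g tt) = 0" by eventually_elim simp
  then show "S h = 0" unfolding S_def g_def[symmetric] using gm by (subst nn_integral_0_iff_AE) auto
 qed
 then have "(NN h|nuD. S h) = 0" using Sm by (subst nn_integral_0_iff_AE) auto
 then have "(NN h|nuD. nsq (psi h)) = 0" unfolding Sint .
 then show ?thesis using sqintD(1)[OF psi] by (subst (asm) nn_integral_0_iff_AE) auto
qed

end

section \<open>Lifts of affine modular-invariant functions\<close>

definition jac :: "saff => complex" where
 "jac h = cor (gc h) * \<i> + cor (gd h)"

definition rho :: "R2 => real" where
 "rho xe = sqrt ((fst xe)^2 + (snd xe)^2)"

lemma measurable_rho[measurable]: "rho \<in> bmble borel"
 unfolding rho_def by measurable

lemma rho_rotp[simp]: "rho (rotp tt xe) = rho xe"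
 unfolding rho_def rotp_norm ..

lemma rho_pos: "xe ~= (0,0) ==> rho xe > 0"
 unfolding rho_def using pair_nonzero_sq[of xe] by simp

lemma rho_axis: "r > 0 ==> rho (r,0) = r"
 by (simp add: rho_def)

lemma rho_polar: "xe ~= (0,0) ==> \<exists>al. xe = rotp al (rho xe,0)"
proof -
 assume xe: "xe ~= (0,0)"
 note r = rho_pos[OF xe]
 have "(rho xe)^2 = (fst xe)^2 + (snd xe)^2" by (simp add: rho_def)
 then have "(fst xe / rho xe)^2 + (snd xe / rho xe)^2 = (rho xe)^2 / (rho xe)^2"
  by (simp only: power_divide add_divide_distrib)
 also have "... = 1" using r by simp
 finally have "(fst xe / rho xe)^2 + (snd xe / rho xe)^2 = 1" .
 then obtain t where "fst xe / rho xe = cos t" "snd xe / rho xe = sin t" by (rule sincos_total_2pi)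
 then have "xe = rotp (t / (2 * pi)) (rho xe,0)" using r by (simp add: rotp_def prod_eq_iff field_simps)
 then show ?thesis ..
qed

lemma kap_comps:
 "gc (kap (v,xe)) = - snd xe" "gd (kap (v,xe)) = fst xe"
 using xi_kap[of v xe] by (auto simp: xi_def prod_eq_iff)

lemma jac_nonzero: "h \<in> SAff ==> jac h ~= 0"
 by (auto simp: jac_def SAff_iff complex_eq_iff)

lemma e_fun_cis: "e_fun x = Complex (cos (2 * pi * x)) (sin (2 * pi * x))"
proof -
 have "e_fun x = cis (2 * pi * x)" unfolding e_fun_def cis_conv_exp by (simp add: mult_ac)
 then show ?thesis by (simp add: cis.ctr)
qed

lemma jac_rot: "jac (mul h (rot tt)) = jac h * e_fun (- tt)"
 unfolding e_fun_cis by (simp add: jac_def complex_eq_iff algebra_simps)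

lemma crd_rot: "h \<in> SAff ==> crd (mul h (rot tt)) = crd h"
proof -
 assume h: "h \<in> SAff"
 have "mul h (rot tt) = kap (crd h,rotp tt (xi h))" using kap_rot[of "crd h" "xi h" tt] kap_crd[OF h] by simp
 moreover have "rotp tt (xi h) ~= (0,0)"
  using rho_pos[OF xi_nonzero[OF h]] rho_rotp[of tt "xi h"] by (auto simp: rho_def)
 ultimately show ?thesis by (simp add: crd_kap)
qed

lemma xi_rot: "h \<in> SAff ==> xi (mul h (rot tt)) = rotp tt (xi h)"
 using kap_rot[of "crd h" "xi h" tt] xi_kap[of "crd h" "rotp tt (xi h)"] by (simp add: kap_crd)

lemma act_coords:
 assumes h: "h \<in> SAff" and c: "crd h = (x,p,u)"
 shows "(cor (ga h) * \<i> + cor (gb h)) / jac h = Complex x (1 / (rho (xi h))^2)"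
  and "(cor (gp h) * \<i> + cor (gq h)) / jac h = Complex u (p / (rho (xi h))^2)"
proof -
 define N where "N = (gd h)^2 + (gc h)^2"
 have N: "(rho (xi h))^2 = N" by (simp add: N_def rho_def xi_def)
 have k: "mul (el x p u) (ss (gd h,- gc h)) = h" using kap_crd[OF h] by (simp add: c kap_def xi_def del: mul_comps)
 have *: "ga h = gd h / N + x * gc h" "gb h = - gc h / N + x * gd h"
  "gp h = p * (gd h / N) + u * gc h" "gq h = p * (- gc h / N) + u * gd h"
  by (subst k[symmetric], simp add: N_def)+
 show "(cor (ga h) * \<i> + cor (gb h)) / jac h = Complex x (1 / (rho (xi h))^2)"
  unfolding nonzero_divide_eq_eq[OF jac_nonzero[OF h]] N
  by (simp add: complex_eq_iff jac_def *(1,2))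
 show "(cor (gp h) * \<i> + cor (gq h)) / jac h = Complex u (p / (rho (xi h))^2)"
  unfolding nonzero_divide_eq_eq[OF jac_nonzero[OF h]] N
  by (simp add: complex_eq_iff jac_def *(3,4))
qed

lemma group_lift_coords:
 assumes "h \<in> SAff" "crd h = (x,p,u)"
 shows "group_lift k \<phi> h = jac h powi (- k) * \<phi> (Complex x (1 / (rho (xi h))^2)) (Complex u (p / (rho (xi h))^2))"
 unfolding group_lift_def slash_def Let_def act_coords[OF assms, symmetric] by (simp add: jac_def)

lemma group_lift_rot:
 assumes h: "h \<in> SAff"
 shows "group_lift k \<phi> (mul h (rot al)) = e_fun (of_int k * al) * group_lift k \<phi> h"
proof -
 obtain x p u where c: "crd h = (x,p,u)" by (cases "crd h")
 have c': "crd (mul h (rot al)) = (x,p,u)" using c crd_rot[OF h] by simp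
 have "(jac h * e_fun (- al)) powi (- k) = jac h powi (- k) * e_fun (of_int k * al)"
  by (simp add: power_int_mult_distrib e_fun_powi)
 then show ?thesis
  unfolding group_lift_coords[OF h c] group_lift_coords[OF mul_in[OF h rot_in] c'] xi_rot[OF h] rho_rotp jac_rot
  by (simp add: mult_ac)
qed

lemma group_lift_kap:
 assumes r: "r > 0"
 shows "group_lift k \<phi> (kap ((x,p,u),(r,0))) = of_real r powi (- k) * \<phi> (Complex x (1 / r^2)) (Complex u (p / r^2))"
proof -
 have nz: "(r,0) ~= (0,0 :: real)" using r by simp
 have "jac (kap ((x,p,u),(r,0))) = of_real r" unfolding jac_def kap_comps by simp
 then show ?thesis
  unfolding group_lift_coords[OF kap_in[OF nz] crd_kap[OF nz]] xi_kap rho_axis[OF r] by simp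
qed

lemma Im_moebius:
 fixes \<tau> :: complex
 assumes "a * d - b * c = 1" "Im \<tau> > 0"
 shows "cor c * \<tau> + cor d ~= 0"
  and "Im ((cor a * \<tau> + cor b) / (cor c * \<tau> + cor d)) > 0"
proof -
 show nz: "cor c * \<tau> + cor d ~= 0"
  using assms by (auto simp: complex_eq_iff)
 define n where "n = (Re (cor c * \<tau> + cor d))^2 + (Im (cor c * \<tau> + cor d))^2"
 have n: "n > 0" unfolding n_def using nz by (auto simp: complex_eq_iff sum_power2_gt_zero_iff)
 have "Im ((cor a * \<tau> + cor b) / (cor c * \<tau> + cor d)) = (a * d - b * c) * Im \<tau> / n"
  unfolding Im_divide n_def by (simp add: algebra_simps)
 then show "Im ((cor a * \<tau> + cor b) / (cor c * \<tau> + cor d)) > 0"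
  using assms n by simp
qed

lemma slash_mult:
 assumes g: "g \<in> SAff" and h: "h \<in> SAff" and \<tau>: "Im \<tau> > 0"
 shows "slash k \<phi> (mul g h) \<tau> z = slash k (slash k \<phi> g) h \<tau> z"
proof -
 define J where "J = cor (gc h) * \<tau> + cor (gd h)"
 define T where "T = (cor (ga h) * \<tau> + cor (gb h)) / J"
 define Z where "Z = (z + cor (gp h) * \<tau> + cor (gq h)) / J"
 define L where "L = cor (gc g) * T + cor (gd g)"
 have J: "J ~= 0" and T: "Im T > 0"
  using Im_moebius[of "ga h" "gd h" "gb h" "gc h" \<tau>] h \<tau> unfolding J_def T_def SAff_iff by auto
 have L: "L ~= 0" using Im_moebius(1)[of "ga g" "gd g" "gb g" "gc g" T] g T unfolding L_def SAff_iff by auto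
 have TJ: "T * J = cor (ga h) * \<tau> + cor (gb h)" unfolding T_def using J by simp
 have ZJ: "Z * J = z + cor (gp h) * \<tau> + cor (gq h)" unfolding Z_def using J by simp
 have 1: "cor (gc (mul g h)) * \<tau> + cor (gd (mul g h)) = L * J"
  unfolding L_def distrib_right mult.assoc TJ by (simp add: J_def algebra_simps)
 have 2: "cor (ga (mul g h)) * \<tau> + cor (gb (mul g h)) = (cor (ga g) * T + cor (gb g)) * J"
  unfolding distrib_right mult.assoc TJ by (simp add: J_def algebra_simps)
 have 3: "z + cor (gp (mul g h)) * \<tau> + cor (gq (mul g h)) = (Z + cor (gp g) * T + cor (gq g)) * J"
  unfolding distrib_right mult.assoc TJ ZJ by (simp add: J_def algebra_simps)
 show ?thesis
  unfolding slash_def[of k \<phi> "mul g h"] Let_def 1 2 3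
  unfolding slash_def[of k "slash k \<phi> g"] Let_def J_def[symmetric] T_def[symmetric] Z_def[symmetric]
  unfolding slash_def[of k \<phi> g] Let_def L_def[symmetric]
  using J L by (simp add: power_int_mult_distrib)
qed

lemma invariant_of_lift:
 assumes inv: "ginv (group_lift k \<phi>)"
 shows "affine_modular_invariant k \<phi>"
 unfolding affine_modular_invariant_def
proof (intro ballI allI impI)
 fix gg \<tau> z assume gg: "gg \<in> SAff_int" and \<tau>: "0 < Im \<tau>"
 define r where "r = 1 / sqrt (Im \<tau>)"
 have r: "r > 0" and r2: "1 / r^2 = Im \<tau>" using \<tau> by (simp_all add: r_def power_divide)
 \<comment> \<open>This element carries \<open>(\<i>, 0)\<close> to \<open>(\<tau>, z)\<close>, so
   invariance of the lift at \<open>h\<close> is invariance of the form at that point.\<close>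
 define h where "h = kap ((Re \<tau>,Im z / Im \<tau>,Re z),(r,0))"
 have h: "h \<in> SAff" unfolding h_def using r by (intro kap_in) simp
 have lift: "group_lift k f h = of_real r powi (- k) * f \<tau> z" for f
 proof -
  have "Im z / Im \<tau> / r^2 = Im z" using r2 \<tau> by (metis divide_inverse inverse_eq_divide mult.assoc mult.commute mult.right_neutral nonzero_mult_div_cancel_left order_less_irrefl times_divide_eq_right)
  then show ?thesis unfolding h_def group_lift_kap[OF r] r2 by simp
 qed
 have "group_lift k (slash k \<phi> gg) h = group_lift k \<phi> (mul gg h)"
  unfolding group_lift_def by (rule slash_mult[OF SAff_int_sub[OF gg] h, symmetric]) simp
 also have "... = group_lift k \<phi> h" by (rule ginvD[OF inv gg h])
 finally show "slash k \<phi> gg \<tau> z = \<phi> \<tau> z" unfolding lift using r by simp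
qed

text \<open>The integrals of \<open>c_H0\<close> in group coordinates and in the same nesting, so
  that \<open>c_H0_cusp_int\<close> is a matter of substitution and requires no absolute
  convergence. Comparison with \<open>omg\<close>, which integrates in another order, is left to
  \<open>omg_cusp_int\<close>.\<close>

definition cusp_int :: "int => (saff => complex) => real => complex" where
 "cusp_int m F r = (LINT p|I01. (LINT u|I01. LINT x|I01. F (kap ((x,p,u),(r,0)))) * e_fun (- of_int m * p))"

lemma c_H0_cusp_int:
 assumes Fm[measurable]: "F \<in> bmble borel" and F: "!!h. h \<in> SAff ==> F h = group_lift k \<phi> h"
  and r: "r > 0"
 shows "c_H0 \<phi> 0 m (1 / r^2) = of_real r powi k * cusp_int m F r"
proof -
 define y where "y = 1 / r^2"
 have y: "y > 0" using r by (simp add: y_def)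
 define c where "c = (of_real r :: complex) powi k"
 have val: "\<phi> (Complex x y) (Complex u (q * y)) = c * F (kap ((x,q,u),(r,0)))" for x u q
 proof -
  have "F (kap ((x,q,u),(r,0))) = of_real r powi (- k) * \<phi> (Complex x (1 / r^2)) (Complex u (q / r^2))"
   using group_lift_kap[OF r, of k \<phi> x q u] F[OF kap_in] r by simp
  moreover have "c * of_real r powi (- k) = 1" unfolding c_def using r by (simp add: power_int_minus)
  ultimately show ?thesis by (simp add: y_def mult.assoc[symmetric])
 qed
 have km: "(%z. F (kap ((fst z,q,snd z),(r,0)))) \<in> bmble (borel \<otimes> borel)" for q by measurable
 define C where "C q = (LINT u|I01. LINT x|I01. F (kap ((x,q,u),(r,0))))" for q
 have cH: "c_H \<phi> 0 0 y q = c * C q" for q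
 proof -
  have 1: "(LINT x:{0..1}|lborel. \<phi> (Complex x y) (Complex u (q * y)) * e_fun (- of_int 0 * x - of_int 0 * u)) = c * (LINT x|I01. F (kap ((x,q,u),(r,0))))" for u
  proof -
   have "(LINT x|I01. F (kap ((x,q,u),(r,0)))) = (LINT x:{0..1}|lborel. F (kap ((x,q,u),(r,0))))"
    by (rule integral_I01) measurable
   then show ?thesis unfolding val by simp
  qed
  have "(LINT u|I01. LINT x|I01. F (kap ((x,q,u),(r,0)))) = (LINT u:{0..1}|lborel. LINT x|I01. F (kap ((x,q,u),(r,0))))"
  proof (rule integral_I01)
   have "(%(u,x). F (kap ((x,q,u),(r,0)))) \<in> bmble (borel \<otimes> I01)"
    using measurable_pair_swap[OF km[of q]] by (simp add: case_prod_unfold cong: m_cong)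
   then show "(%u. LINT x|I01. F (kap ((x,q,u),(r,0)))) \<in> bmble borel"
    by (rule I01.borel_measurable_lebesgue_integral)
  qed
  then show ?thesis unfolding c_H_def 1 C_def by simp
 qed
 have Cm: "C \<in> bmble borel"
 proof -
  have "(%z. F (kap ((snd z,fst (fst z),snd (fst z)),(r,0)))) \<in> bmble ((borel \<otimes> borel) \<otimes> borel)" by measurable
  then have "(%(w,x). F (kap ((x,fst w,snd w),(r,0)))) \<in> bmble ((borel \<otimes> borel) \<otimes> I01)"
   by (simp add: case_prod_unfold cong: m_cong)
  then have "(%w. LINT x|I01. F (kap ((x,fst w,snd w),(r,0)))) \<in> bmble (borel \<otimes> borel)"
   by (rule I01.borel_measurable_lebesgue_integral)
  then have "(%(q,u). LINT x|I01. F (kap ((x,q,u),(r,0)))) \<in> bmble (borel \<otimes> I01)"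
   by (simp add: case_prod_unfold cong: m_cong)
  then show ?thesis unfolding C_def[abs_def] by (rule I01.borel_measurable_lebesgue_integral)
 qed
 have "(LINT v:{0..y}|lborel. c_H \<phi> 0 0 y (v / y) * e_fun (- of_int m * v / y)) = y *\<^sub>R (LINT p:{0..1}|lborel. c * (C p * e_fun (- of_int m * p)))"
 proof -
  have "(LINT v:{0..y}|lborel. c_H \<phi> 0 0 y (v / y) * e_fun (- of_int m * v / y))
    = \<bar>y\<bar> *\<^sub>R (LINT p|lborel. ind {0..y} (0 + y * p) *\<^sub>R (c_H \<phi> 0 0 y ((0 + y * p) / y) * e_fun (- of_int m * (0 + y * p) / y)))"
   unfolding set_lebesgue_integral_def by (rule lborel_integral_real_affine) (use y in simp)
  also have "... = y *\<^sub>R (LINT p:{0..1}|lborel. c * (C p * e_fun (- of_int m * p)))"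
  proof -
   have "ind {0..y} (0 + y * p) = (ind {0..1} p :: real)" for p
    using y by (auto simp: indicator_def zero_le_mult_iff)
   moreover have "(0 + y * p) / y = p" "- of_int m * (0 + y * p) / y = - of_int m * p" for p using y by simp_all
   ultimately show ?thesis unfolding set_lebesgue_integral_def cH using y by (simp add: mult.assoc)
  qed
  finally show ?thesis .
 qed
 also have "(LINT p:{0..1}|lborel. c * (C p * e_fun (- of_int m * p))) = c * (LINT p|I01. C p * e_fun (- of_int m * p))"
 proof -
  have "(%p. C p * e_fun (- of_int m * p)) \<in> bmble borel" using Cm by measurable
  from integral_I01[OF this] show ?thesis by simp
 qed
 finally have "c_H0 \<phi> 0 m y = c * (LINT p|I01. C p * e_fun (- of_int m * p))"
  unfolding c_H0_def using y by (simp add: scaleR_conv_of_real)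
 then show ?thesis unfolding y_def c_def cusp_int_def C_def .
qed

text \<open>A translation applied before the shear moves the central coordinate by
  \<open>fst s * t\<close>. The integrand is 1-periodic in that coordinate, so the displacement
  disappears after integration.\<close>

lemma omg_unfold:
 assumes Fm[measurable]: "F \<in> bmble borel" and inv: "ginv F" and xe: "xe ~= (0,0)"
 shows "omg F m xe = (LINT t|I01. LINT s|TT. F (ks t s xe) * e_fun (- of_int m * fst s))"
 unfolding omg_def psih_def
proof (rule lint_cong[OF refl], goal_cases)
 case (1 t)
 define K where "K s = F (ks t s xe) * e_fun (- of_int m * fst s)" for s
 have Km[measurable]: "K \<in> bmble borel" unfolding K_def by measurable
 have trk: "mul (tr s) (kt t xe) = kap ((t,fst s,snd s + fst s * t),xe)" for s
  unfolding kap_el by (simp add: add.commute)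
 have per: "K (p,u + 1) = K (p,u)" for p u
 proof -
  have "kap ((t,p,u + 1),xe) = mul (el 0 0 1) (kap ((t,p,u),xe))" unfolding kap_el by (simp add: add.commute)
  moreover have "el 0 0 1 \<in> SAff_int" by (simp add: SAff_int_iff)
  ultimately show ?thesis unfolding K_def using ginvD[OF inv _ kap_in[OF xe]] by simp
 qed
 have "(LINT s|TT. F (mul (tr s) (kt t xe)) * chr (- (m,0)) s) = (LINT s|TT. K (fst s,snd s + fst s * t))"
  unfolding trk by (simp add: K_def chr_def)
 also have "... = (LINT s|TT. K s)"
 proof (rule integral_law(2))
  show "(%s. K (fst s,snd s + fst s * t)) \<in> bmble TT" by measurable
  fix \<phi> :: "complex => ennreal" assume p[measurable]: "\<phi> \<in> bmble borel"
  have "(%s. \<phi> (K (fst s,snd s + fst s * t))) \<in> bmble (I01 \<otimes> I01)" "(%s. \<phi> (K s)) \<in> bmble (I01 \<otimes> I01)"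
   unfolding TT_def[symmetric] by measurable
  then have e: "(NN s|TT. \<phi> (K (fst s,snd s + fst s * t))) = (NN p|I01. NN u|I01. \<phi> (K (p,u + p * t)))"
   "(NN s|TT. \<phi> (K s)) = (NN p|I01. NN u|I01. \<phi> (K (p,u)))"
   unfolding TT_def by (simp_all add: I01.nn_integral_fst[symmetric])
  show "(NN s|TT. \<phi> (K (fst s,snd s + fst s * t))) = (NN s|TT. \<phi> (K s))"
   unfolding e
  proof (rule nn_integral_cong, goal_cases)
   case (1 p)
   show ?case
    by (rule nn_I01_shift[where F="%u. \<phi> (K (p,u))"]) (measurable, simp add: per)
  qed
 qed measurable
 finally show ?case
  unfolding K_def .
qed

interpretation I01TT: pair_sigma_finite I01 TT ..

lemma measurable_kap3[measurable]: "(%z. kap ((fst z,fst (snd z),snd (snd z)),xe)) \<in> bmble (I01 \<otimes> TT)"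
 by measurable

text \<open>The hypothesis \<open>fin\<close> is the absolute convergence that permits exchanging
  the shear integral with those over the torus.\<close>

lemma omg_cusp_int:
 assumes Fm[measurable]: "F \<in> bmble borel" and inv: "ginv F" and r: "r > 0"
  and fin: "(NN t|I01. NN s|TT. ennreal (norm (F (ks t s (r,0))))) < oo"
 shows "omg F m (r,0) = cusp_int m F r"
proof -
 define K where "K t s = F (ks t s (r,0)) * e_fun (- of_int m * fst s)" for t s
 have Km: "(%(t,s). K t s) \<in> bmble (I01 \<otimes> TT)"
  unfolding K_def case_prod_unfold by (intro borel_measurable_times measurable_compose[OF measurable_kap3 Fm]) measurable
 have KI: "integrable (I01 \<otimes> TT) (%(t,s). K t s)"
 proof (rule integrableI_bounded[OF Km])
  have "(NN z|(I01 \<otimes> TT). ennreal (norm (case z of (t,s) => K t s))) = (NN t|I01. NN s|TT. ennreal (norm (K t s)))"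
   by (subst TT.nn_integral_fst[symmetric]) (use Km in auto)
  also have "... < oo" using fin by (simp add: K_def norm_mult)
  finally show "(NN z|(I01 \<otimes> TT). ennreal (norm (case z of (t,s) => K t s))) < oo" .
 qed
 have "omg F m (r,0) = (LINT t|I01. LINT s|TT. K t s)"
  unfolding K_def by (rule omg_unfold[OF Fm inv]) (use r in simp)
 also have "... = (LINT s|TT. LINT t|I01. K t s)" by (rule I01TT.Fubini_integral[OF KI, symmetric])
 also have "... = (LINT p|I01. LINT u|I01. LINT t|I01. K t (p,u))"
 proof -
  have "integrable (I01 \<otimes> I01) (%s. LINT t|I01. K t s)" using I01TT.integrable_snd[OF KI] unfolding TT_def .
  then show ?thesis unfolding TT_def by (rule I01p.integral_fst'[symmetric])
 qed
 also have "... = cusp_int m F r" unfolding cusp_int_def K_def by simp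
 finally show ?thesis .
qed

text \<open>The union of all lattice orbits that meet a radius in \<open>E\<close>. It is invariant
  under the lattice and under rotations, so setting a function to 0 on it preserves invariance and
  K-type.\<close>

definition sat :: "real set => saff set" where
 "sat E = {h. \<exists>gg\<in>SAff_int. rho (xi (mul gg h)) \<in> E}"

lemma sets_sat[measurable]:
 assumes [measurable]: "E \<in> sets borel" shows "sat E \<in> sets borel"
proof -
 have "sat E = (\<Union>gg\<in>SAff_int. {h \<in> space borel. rho (xi (mul gg h)) \<in> E})" by (auto simp: sat_def)
 moreover have "{h \<in> space borel. rho (xi (mul gg h)) \<in> E} \<in> sets borel" for gg by measurable
 ultimately show ?thesis using countable_SAff_int by (auto intro!: sets.countable_UN')
qed

lemma sat_gamma:
 assumes gg: "gg \<in> SAff_int" shows "mul gg h \<in> sat E \<longleftrightarrow> h \<in> sat E"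
proof
 assume "mul gg h \<in> sat E"
 then obtain de where "de \<in> SAff_int" "rho (xi (mul (mul de gg) h)) \<in> E" unfolding sat_def mul_assoc by blast
 then show "h \<in> sat E" using gg unfolding sat_def by blast
next
 assume "h \<in> sat E"
 then obtain de where d: "de \<in> SAff_int" "rho (xi (mul de h)) \<in> E" unfolding sat_def by blast
 have "mul (mul de (saff_inv gg)) (mul gg h) = mul de h"
  unfolding mul_assoc saff_inv_cancel(1)[OF SAff_int_sub[OF gg]] ..
 then show "mul gg h \<in> sat E" using d gg unfolding sat_def by (metis (mono_tags, lifting) SAff_int_inv SAff_int_mult mem_Collect_eq)
qed

lemma sat_rot:
 assumes h: "h \<in> SAff" shows "mul h (rot al) \<in> sat E \<longleftrightarrow> h \<in> sat E"
proof -
 have "rho (xi (mul gg (mul h (rot al)))) = rho (xi (mul gg h))" if "gg \<in> SAff_int" for gg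
  unfolding mul_assoc[symmetric] xi_rot[OF mul_in[OF SAff_int_sub[OF that] h]] rho_rotp ..
 then show ?thesis by (auto simp: sat_def)
qed

lemma sat_kap:
 assumes "r > 0" "r \<in> E" shows "kap (v,(r,0)) \<in> sat E"
proof -
 have "rho (xi (mul saff_one (kap (v,(r,0))))) \<in> E" unfolding mul_one xi_kap rho_axis[OF assms(1)] by fact
 then show ?thesis unfolding sat_def using saff_one_in(2) by blast
qed

lemma sat_UN: "sat (\<Union>n. E n) = (\<Union>n. sat (E n))" by (auto simp: sat_def)

text \<open>The mean over the compact quotient of the unipotent fibre above \<open>xe\<close>, for
  nonnegative functions; it tests both integrability and nullity on a single fibre.\<close>

definition av :: "(saff => ennreal) => R2 => ennreal" where
 "av G xe = (NN t|I01. NN s|TT. G (ks t s xe))"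

lemma measurable_av[measurable]:
 assumes G: "G \<in> bmble borel" shows "av G \<in> bmble borel"
proof -
 have "(%z. kap ((snd (fst z),fst (snd z),snd (snd z)),fst (fst z))) \<in> bmble ((borel \<otimes> borel) \<otimes> borel)" by measurable
 from measurable_compose[OF this G]
 have "(%(x,s). G (kap ((snd x,fst s,snd s),fst x))) \<in> bmble ((borel \<otimes> borel) \<otimes> TT)"
  by (simp add: case_prod_unfold cong: m_cong)
 then have "(%x. NN s|TT. G (kap ((snd x,fst s,snd s),fst x))) \<in> bmble (borel \<otimes> borel)"
  by (rule TT.borel_measurable_nn_integral)
 then have "(%(xe,t). NN s|TT. G (ks t s xe)) \<in> bmble (borel \<otimes> I01)"
  by (simp add: case_prod_unfold cong: m_cong)
 then show ?thesis unfolding av_def[abs_def] by (rule I01.borel_measurable_nn_integral)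
qed

lemma nn_cube_av:
 fixes f :: "real \<times> real \<times> real => ennreal"
 assumes [measurable]: "f \<in> bmble borel"
 shows "(NN v|lborel. ind cube v * f v) = (NN t|I01. NN s|TT. f (t,s))"
proof -
 have fp: "(%(t,s). f (t,s)) \<in> bmble (borel \<otimes> TT)"
 proof -
  have "f \<in> bmble (borel \<otimes> borel)" unfolding borel_prod by fact
  then show ?thesis by (simp cong: m_cong sets_pair_measure_cong)
 qed
 have in1: "(NN s|lborel. ind cube (t,s) * f (t,s)) = ind {0..<1} t * (NN s|TT. f (t,s))" for t
 proof -
  have m: "(%s. f (t,s)) \<in> bmble borel" by measurable
  have [measurable]: "{0..<1::real} \<times> {0..<1::real} \<in> sets borel" unfolding borel_prod[symmetric] by (intro pair_measureI) auto
  have "(NN s|lborel. ind cube (t,s) * f (t,s)) = (NN s|lborel. ind {0..<1} t * (ind ({0..<1} \<times> {0..<1}) s * f (t,s)))"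
   by (intro nn_integral_cong) (auto simp: cube_def indicator_def)
  also have "... = ind {0..<1} t * (NN s|lborel. ind ({0..<1} \<times> {0..<1}) s * f (t,s))"
   by (rule nn_integral_cmult) measurable
  finally show ?thesis unfolding nn_TT[OF m] .
 qed
 have "(%v. ind cube v * f v) \<in> bmble (lborel \<otimes> lborel)" by (simp add: lborel_prod)
 then have "(NN v|lborel. ind cube v * f v) = (NN t|lborel. NN s|lborel. ind cube (t,s) * f (t,s))"
  by (subst lborel.nn_integral_fst) (simp_all add: lborel_prod)
 also have "... = (NN t|lborel. ind {0..<1} t * (NN s|TT. f (t,s)))" unfolding in1 ..
 also have "... = (NN t|I01. NN s|TT. f (t,s))"
  by (rule nn_I01_half_open[symmetric]) (rule TT.borel_measurable_nn_integral[OF fp])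
 finally show ?thesis .
qed

lemma le_one_plus_square: "x <= 1 + (x::real)^2"
proof (cases "x >= 1")
 case True
 then have "x * 1 <= x * x" by (intro mult_left_mono) auto
 then show ?thesis by (simp add: power2_eq_square)
next
 case False
 then have "x <= 1 + 0" by simp
 also have "... <= 1 + x^2" by (intro add_left_mono) simp
 finally show ?thesis .
qed

context haar_fd
begin

lemma nn_chart_av:
 assumes [measurable]: "G \<in> bmble borel"
 shows "(NN xe|lam. av G xe) <= (NN h|nu. G h)"
proof -
 have "av G xe <= (NN v|lborel. G (kap (v,xe)))" for xe
 proof -
  have m: "(%v. G (kap (v,xe))) \<in> bmble borel" by measurable
  have "av G xe = (NN v|lborel. ind cube v * G (kap (v,xe)))" unfolding nn_cube_av[OF m] av_def by simp
  also have "... <= (NN v|lborel. G (kap (v,xe)))" by (intro nn_integral_mono) (auto simp: indicator_def)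
  finally show ?thesis .
 qed
 then show ?thesis unfolding nn_chart[OF assms] by (intro nn_integral_mono)
qed

text \<open>Fibres over an annulus, with coordinates in the cube, stay in a bounded part of the
  group, where \<open>nn_local_bound\<close> controls the square. The fibre has mass one, so
  finiteness of the square gives finiteness of the absolute value.\<close>

lemma av_finite:
 assumes psi: "psi \<in> sqint nuD" and inv: "ginv psi"
 shows "AE xe in lam. av (%h. ennreal (norm (psi h))) xe < oo"
proof -
 note m[measurable] = sqint_borel[OF psi]
 have ae: "AE xe in lam. xe \<in> annulus n \<longrightarrow> av (%h. nsq (psi h)) xe ~= oo" for n
 proof -
  define S where "S = (1::real)"
  define R where "R = 2 * (S + 1) * (real (Suc n) / (1 / real (Suc n)) + real (Suc n)) + (real (Suc n) / (1 / real (Suc n)) + real (Suc n))"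
  have [measurable]: "{h. entries_le R h} \<in> sets borel" unfolding entries_le_def by measurable
  define G where "G h = ind {h. entries_le R h} h * nsq (psi h)" for h
  have [measurable]: "G \<in> bmble borel" unfolding G_def by measurable
  obtain N :: nat where N: "!!H::saff => ennreal. H \<in> bmble borel ==> ginv H ==> (NN h|nu. ind {h. entries_le R h} h * H h) <= of_nat N * (NN h|nuD. H h)"
   using nn_local_bound[of R] by blast
  have "(NN xe|lam. av G xe) <= (NN h|nu. G h)" by (rule nn_chart_av) measurable
  also have "... <= of_nat N * (NN h|nuD. nsq (psi h))"
   unfolding G_def by (rule N) (measurable, rule ginv_comp[OF inv])
  also have "... < oo" using sqint_nn_finite[OF psi] by (simp add: ennreal_mult_less_top of_nat_less_top)
  finally have "AE xe in lam. av G xe ~= oo" by (intro nn_integral_PInf_AE) auto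
  then show ?thesis
  proof eventually_elim
   case fin: (elim xe)
   show ?case
   proof
    assume "xe \<in> annulus n"
    then have b: "1 / real (Suc n) > 0" "1 / real (Suc n) <= (fst xe)^2 + (snd xe)^2" "\<bar>fst xe\<bar> <= real (Suc n)" "\<bar>snd xe\<bar> <= real (Suc n)"
     unfolding annulus_def by auto
    have m2: "(%v. G (kap (v,xe))) \<in> bmble borel" "(%v. nsq (psi (kap (v,xe)))) \<in> bmble borel" by measurable
    have "av (%h. nsq (psi h)) xe = (NN v|lborel. ind cube v * nsq (psi (kap (v,xe))))"
     unfolding nn_cube_av[OF m2(2)] av_def by simp
    also have "... = (NN v|lborel. ind cube v * G (kap (v,xe)))"
    proof (rule nn_integral_cong, goal_cases)
     case (1 v)
     have "entries_le R (kap (v,xe))" if "v \<in> cube"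
      unfolding R_def by (rule entries_le_kap[OF _ b]) (use that in \<open>auto simp: cube_def S_def\<close>)
     then show ?case
      by (auto simp: G_def indicator_def)
    qed
    also have "... = av G xe" unfolding nn_cube_av[OF m2(1)] av_def by simp
    finally show "av (%h. nsq (psi h)) xe ~= oo" using fin by simp
   qed
  qed
 qed
 have "AE xe in lam. \<forall>n. xe \<in> annulus n \<longrightarrow> av (%h. nsq (psi h)) xe ~= oo"
  unfolding AE_all_countable using ae by blast
 then show ?thesis
  using AE_lam_nonzero
 proof eventually_elim
  case (elim xe)
  then have fin: "av (%h. nsq (psi h)) xe ~= oo" using in_annulus by blast
  have "av (%h. ennreal (norm (psi h))) xe <= av (%h. 1 + nsq (psi h)) xe"
   unfolding av_def
  proof (rule nn_integral_mono, rule nn_integral_mono, goal_cases)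
   case (1 t s)
   have "ennreal (norm (psi (ks t s xe))) <= ennreal (1 + (norm (psi (ks t s xe)))^2)" by (intro ennreal_leI le_one_plus_square)
   then show ?case by simp
  qed
  also have "... = 1 + av (%h. nsq (psi h)) xe"
  proof -
   have mm: "(%z. nsq (psi (kap ((fst z,fst (snd z),snd (snd z)),xe)))) \<in> bmble (I01 \<otimes> TT)"
    using measurable_compose[OF measurable_kap3 m] by measurable
   have m1: "(%s. nsq (psi (ks t s xe))) \<in> bmble TT" for t
    using measurable_compose[OF measurable_Pair1' mm, of t] by simp
   have m3: "(%t. NN s|TT. nsq (psi (ks t s xe))) \<in> bmble I01"
    using TT.borel_measurable_nn_integral_fst[OF mm] by simp
   show ?thesis unfolding av_def
    by (simp add: nn_integral_add m1 m3 emeasure_TT_UNIV)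
  qed
  also have "... < oo" using fin by (simp add: top.not_eq_extremum)
  finally show ?case .
 qed
qed

section \<open>K-types, correction on null sets and lifts\<close>

definition ktype :: "int => (saff => complex) => bool" where
 "ktype l F \<longleftrightarrow> (\<forall>h\<in>SAff. \<forall>al. F (mul h (rot al)) = e_fun (of_int l * al) * F h)"

lemma av_rot:
 assumes "!!h al. h \<in> SAff ==> G (mul h (rot al)) = G h" and xe: "xe ~= (0,0)"
 shows "av G (rotp al xe) = av G xe"
 unfolding av_def kap_rot[symmetric] using assms(1)[OF kap_in[OF xe]] by simp

lemma omg_rot:
 assumes k: "ktype l F" and xe: "xe ~= (0,0)"
 shows "omg F m (rotp al xe) = e_fun (of_int l * al) * omg F m xe"
proof -
 have "psih F n (mul h (rot al)) = e_fun (of_int l * al) * psih F n h" if h: "h \<in> SAff" for n h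
 proof -
  have "F (mul (tr s) (mul h (rot al))) = e_fun (of_int l * al) * F (mul (tr s) h)" for s
   using k mul_in[OF el_in h] unfolding ktype_def mul_assoc[symmetric] by blast
  then show ?thesis unfolding psih_def by (simp add: mult.assoc)
 qed
 then show ?thesis unfolding omg_def kap_rot[symmetric] by (simp add: kap_in[OF xe])
qed

text \<open>If \<open>F\<close> has a \<open>K\<close>-type and its integrals over the unipotent quotient vanish for almost every
 radius, then removing the orbits through the exceptional radii makes them vanish for all radii. Orbits
 through further radii may be removed by this, so the exceptional set is enlarged repeatedly.\<close>

lemma cusp_modification:
 assumes F: "F \<in> sqint nuD" and inv: "ginv F" and k: "ktype l F"
  and 0: "!!m. AE xe in lam. omg F m xe = 0"
 shows "\<exists>F'. F' \<in> bmble borel \<and> ginv F' \<and> ktype l F' \<and> (AE h in nuD. F' h = F h) \<and> (\<forall>m. \<forall>r>0. cusp_int m F' r = 0)"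
proof -
 note m[measurable] = sqint_borel[OF F]
 define nF where "nF h = ennreal (norm (F h))" for h
 have nFm[measurable]: "nF \<in> bmble borel" unfolding nF_def by measurable
 define E0 where "E0 = {r. r > 0 \<and> (av nF (r,0) = oo \<or> (\<exists>m. omg F m (r,0) ~= 0))}"
 \<comment> \<open>The radii whose fibre meets the orbits through \<open>E\<close> in positive
   measure. Deleting these orbits could change the integrals at such a radius, so it has to be added
   to the exceptional set.\<close>
 define Bd where "Bd E = {r. r > 0 \<and> av (ind (sat E)) (r,0) ~= 0}" for E
 define En where "En = rec_nat E0 (%_ E. E \<union> Bd E)"
 have En: "En 0 = E0" "En (Suc n) = En n \<union> Bd (En n)" for n by (simp_all add: En_def)
 define Ei where "Ei = (\<Union>n. En n)"
 have p0: "(%r. (r,0::real)) \<in> bmble (borel :: real measure)" by measurable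
 have avm: "(%r. av G (r,0)) \<in> bmble borel" if "G \<in> bmble borel" for G
  by (rule measurable_compose[OF p0 measurable_av[OF that]])
 have E0m: "E0 \<in> sets borel"
 proof -
  have [measurable]: "(%r. omg F m (r,0)) \<in> bmble borel" for m
   by (rule measurable_compose[OF p0 measurable_omg[OF m]])
  note avm[OF nFm, measurable]
  have "{r \<in> space borel. r > 0 \<and> (av nF (r,0) = oo \<or> (\<exists>m. omg F m (r,0) ~= 0))} \<in> sets borel" by measurable
  then show ?thesis by (simp add: E0_def)
 qed
 have Bdm: "Bd E \<in> sets borel" if [measurable]: "E \<in> sets borel" for E
 proof -
  have [measurable]: "(%r. av (ind (sat E)) (r,0)) \<in> bmble borel" by (rule avm) measurable
  have "{r \<in> space borel. r > 0 \<and> av (ind (sat E)) (r,0) ~= 0} \<in> sets borel" by measurable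
  then show ?thesis by (simp add: Bd_def)
 qed
 have Enm: "En n \<in> sets borel" for n by (induction n) (auto simp: En intro!: E0m Bdm sets.Un)
 have Eim[measurable]: "Ei \<in> sets borel" unfolding Ei_def using Enm by auto
 \<comment> \<open>Everything tested is rotation covariant, so a condition that holds for almost
   every \<open>xe\<close> excludes exceptional radii for almost every \<open>xe\<close>.\<close>
 have radial: "AE xe in lam. rho xe \<notin> E" if P: "AE xe in lam. Q xe" and E: "!!xe al. xe ~= (0,0) ==> xe = rotp al (rho xe,0) ==> Q xe ==> rho xe \<notin> E" for Q E
  using P AE_lam_nonzero
 proof eventually_elim
  fix xe :: "R2" assume "Q xe" "xe ~= (0,0)"
  then show "rho xe \<notin> E" using rho_polar[of xe] E[of xe] by blast
 qed
 have nax: "(rho xe,0) ~= (0,0 :: real)" if "xe ~= (0,0)" for xe using rho_pos[OF that] by simp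
 have E0n: "AE xe in lam. rho xe \<notin> E0"
 proof (rule radial)
  have "AE xe in lam. \<forall>m. omg F m xe = 0" unfolding AE_all_countable using 0 by blast
  with av_finite[OF F inv] show "AE xe in lam. av nF xe < oo \<and> (\<forall>m. omg F m xe = 0)"
   unfolding nF_def by eventually_elim simp
  fix xe :: "R2" and al assume xe: "xe ~= (0,0)" and p: "xe = rotp al (rho xe,0)" and Q: "av nF xe < oo \<and> (\<forall>m. omg F m xe = 0)"
  have "av nF (rotp al (rho xe,0)) = av nF (rho xe,0)"
   by (rule av_rot[OF _ nax[OF xe]]) (use k in \<open>simp add: ktype_def nF_def norm_mult\<close>)
  moreover have "omg F m (rotp al (rho xe,0)) = e_fun (of_int l * al) * omg F m (rho xe,0)" for m
   by (rule omg_rot[OF k nax[OF xe]])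
  ultimately show "rho xe \<notin> E0" using Q p by (auto simp: E0_def)
 qed
 \<comment> \<open>In the chart the coset measure of the exceptional radii is zero. Left translates
   of a null set are null and the lattice is countable, so the saturation is null too.\<close>
 have satn: "AE h in nu. h \<notin> sat E" if [measurable]: "E \<in> sets borel" and n: "AE xe in lam. rho xe \<notin> E" for E
 proof -
  have "(NN h|nu. ind E (rho (xi h))) = (NN xe|lam. NN v|lborel. ind E (rho (xi (kap (v,xe)))))"
   by (rule nn_chart) measurable
  also have "... = (NN xe|lam. 0)"
   unfolding xi_kap by (rule nn_integral_cong_AE, use n in eventually_elim) simp
  finally have "(NN h|nu. ind E (rho (xi h))) = 0" by simp
  then have "AE h in nu. (ind E (rho (xi h)) :: ennreal) = 0" by (subst (asm) nn_integral_0_iff_AE) auto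
  then have a: "AE h in nu. rho (xi h) \<notin> E" by eventually_elim (simp add: indicator_def split: if_splits)
  have "AE h in nu. \<forall>gg\<in>SAff_int. rho (xi (mul gg h)) \<notin> E"
   using AE_ball_countable[OF countable_SAff_int, of "%h gg. rho (xi (mul gg h)) \<notin> E" nu]
    AE_left[OF SAff_int_sub a] by simp
  then show ?thesis by eventually_elim (auto simp: sat_def)
 qed
 have Enn: "AE xe in lam. rho xe \<notin> En n" for n
 proof (induction n)
  case 0 show ?case unfolding En by (rule E0n)
 next
  case (Suc n)
  have [measurable]: "En n \<in> sets borel" by (rule Enm)
  have "(NN xe|lam. av (ind (sat (En n))) xe) <= (NN h|nu. ind (sat (En n)) h)" by (rule nn_chart_av) measurable
  also have "... = (NN h|nu. 0)"
   by (rule nn_integral_cong_AE, use satn[OF Enm Suc] in eventually_elim) (simp add: indicator_def)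
  finally have "(NN xe|lam. av (ind (sat (En n))) xe) = 0" by simp
  then have z: "AE xe in lam. av (ind (sat (En n))) xe = 0" by (subst (asm) nn_integral_0_iff_AE) auto
  have "AE xe in lam. rho xe \<notin> Bd (En n)"
  proof (rule radial[OF z], goal_cases)
   case (1 xe al) note xe = 1(1) and p = 1(2) and Q = 1(3)
   have "av (ind (sat (En n))) (rotp al (rho xe,0)) = av (ind (sat (En n))) (rho xe,0)"
    by (rule av_rot[OF _ nax[OF xe]]) (simp add: indicator_def sat_rot)
   then show ?case using Q p by (simp add: Bd_def)
  qed
  with Suc show ?case unfolding En by eventually_elim auto
 qed
 define F' where "F' h = (if h \<in> SAff \<and> h \<notin> sat Ei then F h else 0)" for h
 have F'm[measurable]: "F' \<in> bmble borel" unfolding F'_def by measurable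
 have F'inv: "ginv F'"
  unfolding ginv_def F'_def using sat_gamma[of _ _ Ei] ginvD[OF inv] by (auto simp: mul_in SAff_int_sub simp del: mul_comps)
 have F'k: "ktype l F'"
  unfolding ktype_def F'_def using sat_rot[of _ _ Ei] k by (auto simp: ktype_def mul_in simp del: mul_comps)
 have "AE h in nu. \<forall>n. h \<notin> sat (En n)" unfolding AE_all_countable using satn[OF Enm Enn] by blast
 then have "AE h in nu. F' h = F h"
  using AE_SAff by eventually_elim (auto simp: F'_def Ei_def sat_UN)
 then have ae: "AE h in nuD. F' h = F h" by (rule AE_nuD_I)
 have "cusp_int m F' r = 0" if r: "r > 0" for m r
 proof (cases "r \<in> Ei")
  case True
  have "F' (kap (v,(r,0))) = 0" for v unfolding F'_def using sat_kap[OF r True] by simp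
  then show ?thesis by (simp add: cusp_int_def)
 next
  case False
  have nz: "(r,0) ~= (0,0 :: real)" using r by simp
  have r0: "av nF (r,0) ~= oo" "!!m. omg F m (r,0) = 0" using False En(1) r unfolding Ei_def E0_def by blast+
  have mm: "(%z. ind (sat (En n)) (kap ((fst z,fst (snd z),snd (snd z)),(r,0))) :: ennreal) \<in> bmble (I01 \<otimes> TT)" for n
   by (rule measurable_compose[OF measurable_kap3]) (use Enm[of n] in measurable)
  have m1: "(%s. ind (sat (En n)) (ks t s (r,0)) :: ennreal) \<in> bmble TT" for t n
   using measurable_compose[OF measurable_Pair1' mm, of t n] by simp
  have m3: "(%t. NN s|TT. ind (sat (En n)) (ks t s (r,0))) \<in> bmble I01" for n
   using TT.borel_measurable_nn_integral_fst[OF mm] by simp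
  \<comment> \<open>A radius outside \<open>Ei\<close> lies in no \<open>Bd (En n)\<close>. The
    deleted set is the countable union of the \<open>sat (En n)\<close>, so it is null in this fibre
    and \<open>F'\<close> has the same integrals there as \<open>F\<close>.\<close>
  have "av (ind (sat (En n))) (r,0) = 0" for n
  proof -
   have "r \<notin> En (Suc n)" using False unfolding Ei_def by blast
   then show ?thesis using r unfolding En Bd_def by blast
  qed
  then have "AE t in I01. (NN s|TT. ind (sat (En n)) (ks t s (r,0))) = 0" for n
   unfolding av_def using m3 by (subst (asm) nn_integral_0_iff_AE) auto
  then have "AE t in I01. \<forall>n. (NN s|TT. ind (sat (En n)) (ks t s (r,0))) = 0"
   unfolding AE_all_countable by blast
  then have AEt: "AE t in I01. AE s in TT. F' (ks t s (r,0)) = F (ks t s (r,0))"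
  proof eventually_elim
   case z: (elim t)
   have "AE s in TT. \<forall>n. (ind (sat (En n)) (ks t s (r,0)) :: ennreal) = 0"
    unfolding AE_all_countable
   proof
    fix n show "AE s in TT. (ind (sat (En n)) (ks t s (r,0)) :: ennreal) = 0"
     using spec[OF z, of n] m1[of n t] by (subst (asm) nn_integral_0_iff_AE) auto
   qed
   then show ?case
   proof eventually_elim
    case (elim s)
    then have "kap ((t,fst s,snd s),(r,0)) \<notin> sat Ei" unfolding Ei_def sat_UN by (auto simp: indicator_def)
    then show ?case
     unfolding F'_def using kap_in[OF nz] by simp
   qed
  qed
  have Kms: "(%s. G (ks t s (r,0)) * e_fun (- of_int m * fst s)) \<in> bmble TT"
   "(%t. LINT s|TT. G (ks t s (r,0)) * e_fun (- of_int m * fst s)) \<in> bmble I01"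
   if G: "G \<in> bmble borel" for G and t
  proof -
   have gm: "(%z. G (kap ((fst z,fst (snd z),snd (snd z)),(r,0))) * e_fun (- of_int m * fst (snd z))) \<in> bmble (I01 \<otimes> TT)"
    by (intro borel_measurable_times measurable_compose[OF measurable_kap3 G]) measurable
   show "(%s. G (ks t s (r,0)) * e_fun (- of_int m * fst s)) \<in> bmble TT"
    using measurable_compose[OF measurable_Pair1' gm, of t] by simp
   show "(%t. LINT s|TT. G (ks t s (r,0)) * e_fun (- of_int m * fst s)) \<in> bmble I01"
    using gm by (intro TT.borel_measurable_lebesgue_integral) (simp add: case_prod_unfold)
  qed
  have "omg F' m (r,0) = omg F m (r,0)"
   unfolding omg_unfold[OF F'm F'inv nz] omg_unfold[OF m inv nz]
  proof (rule integral_cong_AE[OF Kms(2)[OF F'm] Kms(2)[OF m]], use AEt in eventually_elim, goal_cases)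
   case (1 t)
   then have "AE s in TT. F' (ks t s (r,0)) * e_fun (- of_int m * fst s) = F (ks t s (r,0)) * e_fun (- of_int m * fst s)"
    by eventually_elim simp
   then show ?case
    by (rule integral_cong_AE[OF Kms(1)[OF F'm] Kms(1)[OF m]])
  qed
  moreover have "omg F' m (r,0) = cusp_int m F' r"
  proof (rule omg_cusp_int[OF F'm F'inv r])
   have "(NN t|I01. NN s|TT. ennreal (norm (F' (ks t s (r,0))))) <= av nF (r,0)"
    unfolding av_def nF_def F'_def by (intro nn_integral_mono) auto
   also have "... < oo" using r0(1) by (simp add: top.not_eq_extremum)
   finally show "(NN t|I01. NN s|TT. ennreal (norm (F' (ks t s (r,0))))) < oo" .
  qed
  ultimately show ?thesis using r0(2) by simp
 qed
 then show ?thesis using F'm F'inv F'k ae by blast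
qed

text \<open>The converse passage, from forms back to coefficients: on almost every fibre the
  integrals converge absolutely, and the K-type reduces a general \<open>xe\<close> to the positive
  axis.\<close>

lemma omg_zero_of_cusp_int:
 assumes F: "F \<in> sqint nuD" and inv: "ginv F" and k: "ktype l F"
  and 0: "!!r. r > 0 ==> cusp_int m F r = 0"
 shows "AE xe in lam. omg F m xe = 0"
 using av_finite[OF F inv] AE_lam_nonzero
proof eventually_elim
 fix xe :: "R2" assume fin: "av (%h. ennreal (norm (F h))) xe < oo" and xe: "xe ~= (0,0)"
 obtain al where p: "xe = rotp al (rho xe,0)" using rho_polar[OF xe] by blast
 have r: "rho xe > 0" by (rule rho_pos[OF xe])
 then have nz: "(rho xe,0) ~= (0,0 :: real)" by simp
 have "av (%h. ennreal (norm (F h))) (rotp al (rho xe,0)) = av (%h. ennreal (norm (F h))) (rho xe,0)"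
  by (rule av_rot[OF _ nz]) (use k in \<open>simp add: ktype_def norm_mult\<close>)
 then have "av (%h. ennreal (norm (F h))) (rho xe,0) < oo" using fin p by simp
 then have "omg F m (rho xe,0) = cusp_int m F (rho xe)"
  unfolding av_def by (rule omg_cusp_int[OF sqint_borel[OF F] inv r])
 moreover have "omg F m xe = e_fun (of_int l * al) * omg F m (rho xe,0)"
  using omg_rot[OF k nz, of m al] p by simp
 ultimately show "omg F m xe = 0" using 0[OF r] by simp
qed

lemma lift_of_ktype:
 assumes k: "ktype l F"
 shows "\<exists>\<phi>. \<forall>h\<in>SAff. group_lift l \<phi> h = F h"
proof -
 \<comment> \<open>The values on the slice of elements with \<open>xi\<close> on the positive axis
   determine a function of given K-type. The power of \<open>1 / sqrt (Im \<tau>)\<close> cancels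
   the automorphy factor there.\<close>
 define \<phi> where "\<phi> \<tau> z = cor (1 / sqrt (Im \<tau>)) powi l * F (kap ((Re \<tau>,Im z / Im \<tau>,Re z),(1 / sqrt (Im \<tau>),0)))" for \<tau> z
 have "group_lift l \<phi> h = F h" if h: "h \<in> SAff" for h
 proof -
  obtain x p u where c: "crd h = (x,p,u)" by (cases "crd h")
  define r where "r = rho (xi h)"
  have r: "r > 0" unfolding r_def by (rule rho_pos[OF xi_nonzero[OF h]])
  have nz: "(r,0) ~= (0,0 :: real)" using r by simp
  obtain al where al: "xi h = rotp al (r,0)" unfolding r_def using rho_polar[OF xi_nonzero[OF h]] by blast
  define h0 where "h0 = kap ((x,p,u),(r,0))"
  have h0: "h0 \<in> SAff" unfolding h0_def by (rule kap_in[OF nz])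
  have hh: "h = mul h0 (rot al)" unfolding h0_def kap_rot al[symmetric] c[symmetric] kap_crd[OF h] ..
  have s: "1 / sqrt (1 / r^2) = r" using r by (simp add: real_sqrt_divide)
  have "group_lift l \<phi> h0 = of_real r powi (- l) * \<phi> (Complex x (1 / r^2)) (Complex u (p / r^2))"
   unfolding h0_def by (rule group_lift_kap[OF r])
  also have "\<phi> (Complex x (1 / r^2)) (Complex u (p / r^2)) = of_real r powi l * F h0"
   unfolding \<phi>_def complex.sel s h0_def using r by simp
  also have "of_real r powi (- l) * (of_real r powi l * F h0) = F h0"
   using r by (simp add: power_int_minus)
  finally have "group_lift l \<phi> h0 = F h0" .
  then show ?thesis unfolding hh group_lift_rot[OF h0] using k h0 by (simp add: ktype_def del: mul_comps)
 qed
 then show ?thesis by blast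
qed

end

section \<open>The orthogonal decomposition\<close>

lemma fun_span_I: "p \<in> X ==> p \<in> fun_span X"
 unfolding fun_span_def by (intro CollectI exI[of _ "{p}"] exI[of _ "%_. 1"]) auto

lemma fun_span_scale: "f \<in> fun_span X ==> (%x. c * f x) \<in> fun_span X"
proof -
 assume "f \<in> fun_span X"
 then obtain T d where T: "finite T" "T \<subseteq> X" and f: "f = (%x. \<Sum>p\<in>T. d p * p x)" unfolding fun_span_def by blast
 have eq: "(%x. c * f x) = (%x. \<Sum>p\<in>T. (c * d p) * p x)" by (simp add: f sum_distrib_left mult.assoc)
 show ?thesis unfolding fun_span_def by (intro CollectI exI[of _ T] exI[of _ "%p. c * d p"] conjI eq T)
qed

lemma fun_span_add: "f \<in> fun_span X ==> g \<in> fun_span X ==> (%x. f x + g x) \<in> fun_span X"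
proof -
 assume "f \<in> fun_span X" "g \<in> fun_span X"
 then obtain T c U d where T: "finite T" "T \<subseteq> X" and f: "f = (%x. \<Sum>p\<in>T. c p * p x)"
  and U: "finite U" "U \<subseteq> X" and g: "g = (%x. \<Sum>p\<in>U. d p * p x)" unfolding fun_span_def by blast
 define e where "e p = (if p \<in> T then c p else 0) + (if p \<in> U then d p else 0)" for p
 have "(\<Sum>p\<in>T. c p * p x) = (\<Sum>p\<in>T \<union> U. (if p \<in> T then c p else 0) * p x)" for x
  using T U by (intro sum.mono_neutral_cong_left) auto
 moreover have "(\<Sum>p\<in>U. d p * p x) = (\<Sum>p\<in>T \<union> U. (if p \<in> U then d p else 0) * p x)" for x
  using T U by (intro sum.mono_neutral_cong_left) auto
 ultimately have "(%x. f x + g x) = (%x. \<Sum>p\<in>T \<union> U. e p * p x)"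
  unfolding f g e_def by (simp add: sum.distrib distrib_right)
 moreover have "finite (T \<union> U)" "T \<union> U \<subseteq> X" using T U by auto
 ultimately show ?thesis unfolding fun_span_def by blast
qed

context haar_fd
begin

text \<open>Projections produce functions that are only defined almost everywhere; they are made invariant
 by transporting their values on the fundamental domain.\<close>

lemma periodization:
 assumes b0: "b0 \<in> sqint nuD"
 shows "\<exists>b\<in>sqint nuD. ginv b \<and> (AE h in nuD. b h = b0 h)"
proof -
 interpret cG: sigma_finite_measure cG by (rule sigma_finite_measure_count_space_countable[OF countable_SAff_int])
 have b0m[measurable]: "b0 \<in> bmble borel" by (rule sqint_borel[OF b0])
 define G where "G h = ind D h * b0 h" for h
 have Gm[measurable]: "G \<in> bmble borel" unfolding G_def by measurable
 define b where "b h = (LINT gg|cG. G (mul gg h))" for h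
 have bm: "b \<in> bmble borel"
 proof -
  have "(%(gg,h). G (mul gg h)) \<in> bmble (cG \<otimes> borel)"
   by (rule measurable_pair_measure_countable1) (use countable_SAff_int in auto)
  from measurable_pair_swap[OF this] have "(%(h,gg). G (mul gg h)) \<in> bmble (borel \<otimes> cG)"
   by (simp add: case_prod_unfold)
  then show ?thesis unfolding b_def[abs_def] by (rule cG.borel_measurable_lebesgue_integral)
 qed
 have binv: "ginv b"
  unfolding ginv_def
 proof (intro ballI)
  fix de h assume d: "de \<in> SAff_int"
  have "bij_betw (%gg. mul gg de) SAff_int SAff_int"
   by (rule bij_betw_byWitness[where f'="%gg. mul gg (saff_inv de)"])
    (use d in \<open>simp_all add: saff_inv_cancel_right SAff_int_sub image_subset_iff SAff_int_mult SAff_int_inv del: mul_comps\<close>)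
  from integral_bij_count_space[OF this, of "%gg. G (mul gg h)"]
  show "b (mul de h) = b h" unfolding b_def mul_assoc .
 qed
 have ae: "AE h in nuD. b h = b0 h"
  unfolding AE_nuD using D_fund AE_SAff
 proof eventually_elim
  fix h assume u: "\<exists>!gg. gg \<in> SAff_int \<and> mul gg h \<in> D" and h: "h \<in> SAff"
  show "h \<in> D \<longrightarrow> b h = b0 h"
  proof
   assume hD: "h \<in> D"
   have one: "gg = saff_one" if "gg \<in> SAff_int" "mul gg h \<in> D" for gg
   proof -
    have "saff_one \<in> SAff_int \<and> mul saff_one h \<in> D" using hD by (simp del: mul_comps)
    with u that show ?thesis by blast
   qed
   have "b h = (LINT gg|cG. (if gg = saff_one then b0 h else 0))"
    unfolding b_def
   proof (rule lint_cong[OF refl], goal_cases)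
    case (1 gg)
    then have "gg \<in> SAff_int" by simp
    then show ?case
     using one[of gg] hD by (auto simp: G_def indicator_def simp del: mul_comps)
   qed
   also have "... = (\<Sum>gg | gg \<in> SAff_int \<and> (if gg = saff_one then b0 h else 0) ~= 0. (if gg = saff_one then b0 h else 0))"
    by (rule lebesgue_integral_count_space_finite_support) (rule finite_subset[of _ "{saff_one}"], auto)
   also have "... = b0 h"
   proof (cases "b0 h = 0")
    case False
    then have "{gg. gg \<in> SAff_int \<and> (if gg = saff_one then b0 h else 0) ~= 0} = {saff_one}" by auto
    then show ?thesis by simp
   qed simp
   finally show "b h = b0 h" .
  qed
 qed
 have "(NN h|nuD. nsq (b h)) = (NN h|nuD. nsq (b0 h))"
  by (rule nn_integral_cong_AE, use ae in eventually_elim) simp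
 then have "b \<in> sqint nuD" using bm sqint_nn_finite[OF b0]
  by (auto simp: sqint_def intro!: integrableI_bounded cong: m_cong)
 then show ?thesis using binv ae by blast
qed

text \<open>A pullback is constant along the torus, so its coefficients with nonzero index vanish
  and the pairing formula gives 0. This shows that the transforms are genuine.\<close>

lemma ip_tinv_svr:
 assumes q: "q \<in> sqint nuD" "ginv q" "tinv q" and f: "f \<in> Cc_smooth0" and M: "M >= 1"
 shows "ip nuD q (svr M f) = 0"
proof (rule ip_svr_zero[OF q(1,2) f M], goal_cases)
 case m: (1 m)
 show ?case
  using AE_lam_nonzero
 proof eventually_elim
  fix xe :: "R2" assume xe: "xe ~= (0,0)"
  have "psih q (m,0) (kt t xe) = 0" for t
  proof -
   have "q (mul (tr s) (kt t xe)) = q (kt t xe)" for s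
    using q(3) kap_in[OF xe] unfolding tinv_def by blast
   then have "psih q (m,0) (kt t xe) = q (kt t xe) * (LINT s|TT. chr (- (m,0)) s)"
    unfolding psih_def by simp
   also have "(LINT s|TT. chr (- (m,0)) s) = 0" using m by (subst integral_TT_chr) (auto simp: zero_prod_def)
   finally show ?thesis by simp
  qed
  then show "omg q m xe = 0" unfolding omg_def by simp
 qed
qed

end

section \<open>Transfer to the given measure and function spaces\<close>

definition ext :: "(saff => complex) => saff => complex" where
 "ext f h = ind SAff h *\<^sub>R f h"

lemma ext_in[simp]: "h \<in> SAff ==> ext f h = f h" and ext_out[simp]: "h \<notin> SAff ==> ext f h = 0"
 by (simp_all add: ext_def)

lemma ext_svr: "ext (SV_rel M f) = svr M f"
 by (auto simp: fun_eq_iff svr_def ext_def indicator_def)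

lemma ginv_ext[simp]: "ginv (ext f) \<longleftrightarrow> ginv f"
 by (auto simp: ginv_def mul_in SAff_int_sub simp del: mul_comps)

text \<open>\<open>\<mu>\<close> lives on the subspace \<open>SAff\<close>, while the locale
  \<open>haar_fd\<close> speaks of measures on the whole type. \<open>nu\<close> is the image of
  \<open>\<mu>\<close> under the inclusion, and \<open>ext\<close> carries functions along by
  zero.\<close>

locale haar_quotient =
 fixes \<mu> :: "saff measure" and D :: "saff set"
 assumes haar_mu: "haar_measure \<mu>" and fd: "fundamental_domain \<mu> D"
begin

lemma sets_mu: "sets \<mu> = sets (restrict_space borel SAff)" using haar_mu by (simp add: haar_measure_def)

lemma space_mu: "space \<mu> = SAff"
 using sets_eq_imp_space_eq[OF sets_mu] by (simp add: space_restrict_space)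

lemma sets_mu_iff: "A \<in> sets \<mu> \<longleftrightarrow> A \<in> sets borel \<and> A \<subseteq> SAff"
 unfolding sets_mu by (subst sets_restrict_space_iff) auto

definition nu :: "saff measure" where "nu = distr \<mu> borel (%x. x)"

lemma measurable_mu_id: "(%x. x) \<in> measurable \<mu> borel"
proof (rule measurableI)
 fix A :: "saff set" assume "A \<in> sets borel"
 then show "(%x. x) -` A \<inter> space \<mu> \<in> sets \<mu>" unfolding sets_mu_iff space_mu by auto
qed simp

lemma emeasure_nu: "A \<in> sets borel ==> emeasure nu A = emeasure \<mu> (A \<inter> SAff)"
 unfolding nu_def by (subst emeasure_distr[OF measurable_mu_id]) (simp_all add: space_mu)

sublocale haar_fd nu D
proof
 show "sets nu = sets borel" by (simp add: nu_def)
 have "- SAff \<in> sets borel" by (rule borel_comp[OF sets_SAff])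
 then show z: "emeasure nu (- SAff) = 0" by (simp add: emeasure_nu)
 show "distr nu borel (mul h) = nu" if h: "h \<in> SAff" for h
 proof (rule measure_eqI)
  fix A assume "A \<in> sets (distr nu borel (mul h))"
  then have A[measurable]: "A \<in> sets borel" by simp
  define B where "B = (mul h -` A \<inter> space borel) \<inter> SAff"
  have hm: "mul h \<in> bmble borel" by measurable
  have vs: "mul h -` A \<inter> space borel \<in> sets borel" by (rule measurable_sets[OF hm A])
  then have B: "B \<in> sets \<mu>" unfolding sets_mu_iff B_def by auto
  have im: "mul h ` B = A \<inter> SAff"
  proof (intro equalityI subsetI)
   fix y assume "y \<in> A \<inter> SAff"
   then have "y = mul h (mul (saff_inv h) y)" "mul (saff_inv h) y \<in> B"
    using h saff_inv_cancel(2)[OF h, of y] by (auto simp: B_def mul_in saff_inv_in simp del: mul_comps)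
   then show "y \<in> mul h ` B" by blast
  next
   fix y assume "y \<in> mul h ` B"
   then obtain x where "y = mul h x" "mul h x \<in> A" "x \<in> SAff" unfolding B_def by blast
   then show "y \<in> A \<inter> SAff" using mul_in[OF h, of x] by simp
  qed
  have "emeasure (distr nu borel (mul h)) A = emeasure nu (mul h -` A \<inter> space borel)"
   by (subst emeasure_distr) (simp_all add: nu_def)
  also have "... = emeasure \<mu> B" unfolding B_def by (rule emeasure_nu[OF vs])
  also have "... = emeasure \<mu> (mul h ` B)" using haar_mu h B by (simp add: haar_measure_def)
  also have "... = emeasure nu A" unfolding im by (rule emeasure_nu[OF A, symmetric])
  finally show "emeasure (distr nu borel (mul h)) A = emeasure nu A" .
 qed (simp add: nu_def)
 show "emeasure nu {h \<in> SAff. entries_le R h} < oo" for R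
 proof -
  have c: "compact {h \<in> SAff. entries_le R h}" by (rule compact_entries_le)
  have "emeasure nu {h \<in> SAff. entries_le R h} = emeasure \<mu> ({h \<in> SAff. entries_le R h} \<inter> SAff)"
   by (rule emeasure_nu[OF borel_compact[OF c]])
  also have "{h \<in> SAff. entries_le R h} \<inter> SAff = {h \<in> SAff. entries_le R h}" by auto
  finally show ?thesis using haar_mu c unfolding haar_measure_def by auto
 qed
 show "emeasure nu UNIV ~= 0" using haar_mu by (simp add: emeasure_nu haar_measure_def)
 have D: "D \<in> sets \<mu>" using fd by (simp add: fundamental_domain_def)
 then show "D \<in> sets borel" "D \<subseteq> SAff" unfolding sets_mu_iff by auto
 have "AE x in \<mu>. \<exists>!gg. gg \<in> SAff_int \<and> mul gg x \<in> D" using fd by (simp add: fundamental_domain_def)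
 then obtain N where N: "{x \<in> space \<mu>. \<not> (\<exists>!gg. gg \<in> SAff_int \<and> mul gg x \<in> D)} \<subseteq> N" "emeasure \<mu> N = 0" "N \<in> sets \<mu>" by (rule AE_E)
 have Nb: "N \<in> sets borel" "N \<inter> SAff = N" using N(3) unfolding sets_mu_iff by auto
 have "N \<in> null_sets nu" using emeasure_nu[OF Nb(1)] Nb N(2) by (auto simp: nu_def null_sets_def)
 moreover have "- SAff \<in> null_sets nu" using z \<open>- SAff \<in> sets borel\<close> by (auto simp: nu_def null_sets_def)
 ultimately have "N \<union> - SAff \<in> null_sets nu" by (rule null_sets.Un)
 then show "AE x in nu. \<exists>!gg. gg \<in> SAff_int \<and> mul gg x \<in> D"
  by (rule AE_I') (use N(1) in \<open>auto simp: space_mu\<close>)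
qed

lemma integral_mu_D:
 fixes H :: "saff => 'b :: {banach,second_countable_topology}"
 assumes H: "H \<in> bmble borel" and eq: "!!h. h \<in> SAff ==> G h = H h"
 shows "set_integrable \<mu> D G \<longleftrightarrow> integrable nuD H" "(LINT x:D|\<mu>. G x) = (LINT x|nuD. H x)"
proof -
 have n: "nuD = density nu (%x. ennreal (ind D x))" unfolding nuD_def by (simp add: ennreal_indicator)
 have Hn: "H \<in> bmble nu" using H by (simp add: nu_def)
 have Dn: "D \<in> sets nu" using D_borel by (simp add: nu_def)
 have DH: "(%x. ind D x *\<^sub>R H x) \<in> bmble borel" using H by measurable
 have "integrable nuD H \<longleftrightarrow> integrable nu (%x. ind D x *\<^sub>R H x)"
  unfolding n by (rule integrable_density) (use Hn Dn in auto)
 also have "... \<longleftrightarrow> integrable \<mu> (%x. ind D x *\<^sub>R H x)"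
  unfolding nu_def by (rule integrable_distr_eq[OF measurable_mu_id DH])
 also have "... \<longleftrightarrow> set_integrable \<mu> D G"
  unfolding set_integrable_def by (rule Bochner_Integration.integrable_cong) (auto simp: space_mu eq)
 finally show "set_integrable \<mu> D G \<longleftrightarrow> integrable nuD H" ..
 have "(LINT x|nuD. H x) = (LINT x|nu. ind D x *\<^sub>R H x)"
  unfolding n by (rule integral_density) (use Hn Dn in auto)
 also have "... = (LINT x|\<mu>. ind D x *\<^sub>R H x)"
  unfolding nu_def by (rule integral_distr[OF measurable_mu_id DH])
 also have "... = (LINT x:D|\<mu>. G x)"
  unfolding set_lebesgue_integral_def by (rule lint_cong) (auto simp: space_mu eq)
 finally show "(LINT x:D|\<mu>. G x) = (LINT x|nuD. H x)" ..
qed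

lemma measurable_ext: "f \<in> bmble \<mu> \<longleftrightarrow> ext f \<in> bmble borel"
 unfolding m_cong[OF sets_mu refl] ext_def[abs_def]
 by (rule borel_measurable_restrict_space_iff) simp

lemma L2_iff: "f \<in> L2 \<mu> D \<longleftrightarrow> ext f \<in> sqint nuD \<and> ginv f"
proof -
 have "set_integrable \<mu> D (%x. (norm (f x))^2) \<longleftrightarrow> integrable nuD (%x. (norm (ext f x))^2)" if "ext f \<in> bmble borel"
  by (rule integral_mu_D(1)) (use that in auto)
 then show ?thesis unfolding L2_def sqint_def ginv_def[symmetric] measurable_ext
  by (auto simp: ginv_def cong: m_cong)
qed

lemma L2D: "f \<in> L2 \<mu> D ==> ext f \<in> sqint nuD" "f \<in> L2 \<mu> D ==> ginv f"
 by (auto simp: L2_iff)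

lemma L2_inner_ip: "f \<in> L2 \<mu> D ==> g \<in> L2 \<mu> D ==> L2_inner \<mu> D f g = ip nuD (ext f) (ext g)"
proof -
 assume "f \<in> L2 \<mu> D" "g \<in> L2 \<mu> D"
 then have [measurable]: "ext f \<in> bmble borel" "ext g \<in> bmble borel" by (auto dest!: L2D(1) sqint_borel)
 show ?thesis unfolding L2_inner_def ip_def by (rule integral_mu_D(2)) auto
qed

lemma L2_norm_nrm2: "f \<in> L2 \<mu> D ==> L2_norm \<mu> D f = sqrt (nrm2 nuD (ext f))"
proof -
 assume "f \<in> L2 \<mu> D"
 then have [measurable]: "ext f \<in> bmble borel" by (auto dest!: L2D(1) sqint_borel)
 show ?thesis unfolding L2_norm_def nrm2_def by (subst integral_mu_D(2)[where H="%x. (norm (ext f x))^2"]) auto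
qed

lemma ext_add: "ext (%x. f x + g x) = (%x. ext f x + ext g x)"
 and ext_diff: "ext (%x. f x - g x) = (%x. ext f x - ext g x)"
 and ext_scale: "ext (%x. c * f x) = (%x. c * ext f x)"
 and ext_sum: "ext (%x. \<Sum>p\<in>T. d p * p x) = (%x. \<Sum>p\<in>T. d p * ext p x)"
 by (auto simp: fun_eq_iff ext_def indicator_def)

lemma ext_ext[simp]: "ext (ext f) = ext f" by (auto simp: fun_eq_iff ext_def indicator_def)

lemma L2_add: "f \<in> L2 \<mu> D ==> g \<in> L2 \<mu> D ==> (%x. f x + g x) \<in> L2 \<mu> D"
 and L2_diff: "f \<in> L2 \<mu> D ==> g \<in> L2 \<mu> D ==> (%x. f x - g x) \<in> L2 \<mu> D"
 and L2_scale: "f \<in> L2 \<mu> D ==> (%x. c * f x) \<in> L2 \<mu> D"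
 by (auto simp: L2_iff ext_add ext_diff ext_scale ginv_def intro: sqint_add sqint_diff sqint_scale)

lemma ext_AE: "AE h in nuD. ext q h = q h"
 using AE_nuD_SAff by eventually_elim simp

lemma ip_cong_right:
 assumes "f \<in> sqint nuD" "p \<in> sqint nuD" "q \<in> sqint nuD" "AE h in nuD. p h = q h"
 shows "ip nuD f p = ip nuD f q"
 using ip_cong_AE[OF sqintD(1)[OF assms(2)] sqintD(1)[OF assms(3)] sqintD(1)[OF assms(1)] assms(4)] ip_cnj[of nuD f p] ip_cnj[of nuD f q]
 by simp

lemma sqint_ext: "q \<in> sqint nuD ==> ext q \<in> sqint nuD"
proof -
 assume q: "q \<in> sqint nuD"
 have [measurable]: "q \<in> bmble borel" by (rule sqint_borel[OF q])
 have "ext q \<in> bmble borel" unfolding ext_def[abs_def] by measurable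
 then show ?thesis
  by (intro sqint_bound[OF _ sqintD(2)[OF q]]) (auto simp: ext_def indicator_def cong: m_cong)
qed

lemma tinv_obtain_F: "tinv q ==> \<exists>F. \<forall>(g,w)\<in>SAff. q (g,w) = F g"
proof (intro exI ballI, clarify)
 fix g w assume q: "tinv q" and h: "(g,w) \<in> SAff"
 have d: "g $ 1 $ 1 * g $ 2 $ 2 - g $ 1 $ 2 * g $ 2 $ 1 = 1" using h by (simp add: SAff_iff)
 have h0: "(g,0) \<in> SAff" using h by (simp add: SAff_iff)
 \<comment> \<open>The row vector \<open>w\<close> times the inverse of \<open>g\<close>;
   translating \<open>(g, 0)\<close> by it on the left produces \<open>(g, w)\<close>.\<close>
 define s where "s = (w $ 1 * g $ 2 $ 2 - w $ 2 * g $ 2 $ 1,w $ 2 * g $ 1 $ 1 - w $ 1 * g $ 1 $ 2)"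
 have 1: "fst s * g $ 1 $ 1 + snd s * g $ 2 $ 1 = w $ 1 * (g $ 1 $ 1 * g $ 2 $ 2 - g $ 1 $ 2 * g $ 2 $ 1)"
  and 2: "fst s * g $ 1 $ 2 + snd s * g $ 2 $ 2 = w $ 2 * (g $ 1 $ 1 * g $ 2 $ 2 - g $ 1 $ 2 * g $ 2 $ 1)"
  by (simp_all add: s_def algebra_simps)
 have "mul (tr s) (g,0) = (g,w)" by (rule saff_eqI) (simp_all add: 1 2 d)
 then show "q (g,w) = q (g,0)" using q h0 unfolding tinv_def by metis
qed

lemma L2_gen_iff: "f \<in> L2_gen \<mu> D \<longleftrightarrow> f \<in> L2 \<mu> D \<and> gen (ext f)"
proof (intro iffI conjI)
 assume f: "f \<in> L2_gen \<mu> D"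
 then show fL: "f \<in> L2 \<mu> D" by (simp add: L2_gen_def)
 show "gen (ext f)" unfolding gen_def
 proof (intro ballI impI)
  fix q assume q: "q \<in> sqint nuD" "ginv q" "tinv q"
  have qL: "q \<in> L2 \<mu> D" unfolding L2_iff using sqint_ext[OF q(1)] q(2) by simp
  have "L2_inner \<mu> D f q = 0" using f qL tinv_obtain_F[OF q(3)] by (simp add: L2_gen_def)
  then have "ip nuD (ext f) (ext q) = 0" unfolding L2_inner_ip[OF fL qL] .
  then show "ip nuD (ext f) q = 0" using ip_cong_right[OF L2D(1)[OF fL] sqint_ext[OF q(1)] q(1) ext_AE] by simp
 qed
next
 assume "f \<in> L2 \<mu> D \<and> gen (ext f)"
 then have fL: "f \<in> L2 \<mu> D" and g: "gen (ext f)" by auto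
 show "f \<in> L2_gen \<mu> D" unfolding L2_gen_def
 proof (intro CollectI conjI ballI impI fL)
  fix p assume p: "p \<in> L2 \<mu> D" and "\<exists>F. \<forall>(g,w)\<in>SAff. p (g,w) = F g"
  then obtain F where F: "!!h. h \<in> SAff ==> p h = F (fst h)" by force
  have "tinv (ext p)" unfolding tinv_def
  proof (intro allI ballI)
   fix s h assume h: "h \<in> SAff"
   have "fst (mul (tr s) h) = fst h" by (simp add: vec_eq_iff forall_2)
   then show "ext p (mul (tr s) h) = ext p h" using h F mul_in[OF el_in h] by (simp del: mul_comps)
  qed
  then show "L2_inner \<mu> D f p = 0"
   unfolding L2_inner_ip[OF fL p] using g L2D[OF p] by (simp add: gen_def)
 qed
qed

lemma closure_iff: "f \<in> L2_closure \<mu> D S \<longleftrightarrow> f \<in> L2 \<mu> D \<and> (\<forall>e>0. \<exists>s\<in>S \<inter> L2 \<mu> D. nrm2 nuD (%x. ext f x - ext s x) < e)"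
proof -
 have n: "L2_norm \<mu> D (%x. f x - s x) = sqrt (nrm2 nuD (%x. ext f x - ext s x))" if "f \<in> L2 \<mu> D" "s \<in> L2 \<mu> D" for s
  using L2_norm_nrm2[OF L2_diff[OF that]] by (simp add: ext_diff)
 show ?thesis
 proof (intro iffI conjI allI impI)
  assume f: "f \<in> L2_closure \<mu> D S"
  then show fL: "f \<in> L2 \<mu> D" by (simp add: L2_closure_def)
  fix e :: real assume "e > 0"
  then have "sqrt e > 0" by simp
  then obtain s where s: "s \<in> S \<inter> L2 \<mu> D" "L2_norm \<mu> D (%x. f x - s x) < sqrt e" using f unfolding L2_closure_def by blast
  then have "sqrt (nrm2 nuD (%x. ext f x - ext s x)) < sqrt e" using n[OF fL, of s] by simp
  then show "\<exists>s\<in>S \<inter> L2 \<mu> D. nrm2 nuD (%x. ext f x - ext s x) < e" using s(1) by auto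
 next
  assume f: "f \<in> L2 \<mu> D \<and> (\<forall>e>0. \<exists>s\<in>S \<inter> L2 \<mu> D. nrm2 nuD (%x. ext f x - ext s x) < e)"
  show "f \<in> L2_closure \<mu> D S" unfolding L2_closure_def
  proof (intro CollectI conjI allI impI)
   fix e :: real assume e: "e > 0"
   then have "e^2 > 0" by simp
   then obtain s where s: "s \<in> S \<inter> L2 \<mu> D" "nrm2 nuD (%x. ext f x - ext s x) < e^2" using f by blast
   have "sqrt (nrm2 nuD (%x. ext f x - ext s x)) < sqrt (e^2)" using s(2) by (simp only: real_sqrt_less_iff)
   then have "L2_norm \<mu> D (%x. f x - s x) < e" using n[of s] f s(1) e by simp
   then show "\<exists>s\<in>S \<inter> L2 \<mu> D. L2_norm \<mu> D (%x. f x - s x) < e" using s(1) by blast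
  qed (use f in blast)
 qed
qed

lemma span_orthogonal:
 assumes X: "X \<subseteq> L2 \<mu> D" and w: "w \<in> sqint nuD" and 0: "!!p. p \<in> X ==> ip nuD (ext p) w = 0"
  and f: "f \<in> L2_closure \<mu> D (fun_span X)"
 shows "ip nuD (ext f) w = 0"
proof -
 have sp: "ip nuD (ext s) w = 0" if s: "s \<in> fun_span X" for s
 proof -
  obtain T c where T: "finite T" "T \<subseteq> X" and s: "s = (%x. \<Sum>p\<in>T. c p * p x)" using s unfolding fun_span_def by blast
  have "ip nuD (ext s) w = (\<Sum>p\<in>T. c p * ip nuD (ext p) w)"
   unfolding s ext_sum by (rule ip_sum_left[OF T(1) _ w]) (use T X L2D(1) in blast)
  also have "... = 0" using 0 T by (intro sum.neutral) auto
  finally show ?thesis .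
 qed
 have fL: "f \<in> L2 \<mu> D" and ap: "!!e. e > 0 ==> \<exists>s\<in>fun_span X \<inter> L2 \<mu> D. nrm2 nuD (%x. ext f x - ext s x) < e"
  using f unfolding closure_iff by blast+
 have "(norm (ip nuD (ext f) w))^2 <= e" if e: "e > 0" for e
 proof -
  define K where "K = nrm2 nuD w + 1"
  have K: "K > 0" unfolding K_def using nrm2_nonneg[of nuD w] by linarith
  obtain s where s: "s \<in> fun_span X" "s \<in> L2 \<mu> D" "nrm2 nuD (%x. ext f x - ext s x) < e / K"
   using ap[of "e / K"] e K by auto
  have "ip nuD (ext f) w = ip nuD (%x. ext f x - ext s x) w"
   unfolding ip_diff_left[OF L2D(1)[OF fL] L2D(1)[OF s(2)] w] sp[OF s(1)] by simp
  then have "(norm (ip nuD (ext f) w))^2 <= nrm2 nuD (%x. ext f x - ext s x) * nrm2 nuD w"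
   using cauchy_schwarz[OF sqint_diff[OF L2D(1)[OF fL] L2D(1)[OF s(2)]] w] by simp
  also have "... <= (e / K) * K" using e K by (intro mult_mono[OF less_imp_le[OF s(3)]]) (simp_all add: K_def)
  also have "... = e" using K by simp
  finally show ?thesis .
 qed
 then have "(norm (ip nuD (ext f) w))^2 <= 0" by (rule field_le_epsilon[of _ 0, simplified])
 then show ?thesis by simp
qed

lemma closure_projection:
 assumes v: "v \<in> L2 \<mu> D"
 shows "\<exists>b\<in>L2_closure \<mu> D (fun_span X). \<forall>s\<in>fun_span X \<inter> L2 \<mu> D. ip nuD (%x. ext v x - ext b x) (ext s) = 0"
proof -
 define S where "S = ext ` (fun_span X \<inter> L2 \<mu> D)"
 have zero: "(%x. 0) \<in> fun_span X \<inter> L2 \<mu> D"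
 proof
  show "(%x. 0) \<in> fun_span X" unfolding fun_span_def by (intro CollectI exI[of _ "{}"]) simp
  show "(%x. 0) \<in> L2 \<mu> D" unfolding L2_iff by (simp add: ext_def[abs_def] sqint_zero ginv_def)
 qed
 have "\<exists>b\<in>sqint nuD. (\<forall>e>0. \<exists>s\<in>S. nrm2 nuD (%x. b x - s x) < e) \<and> (\<forall>s\<in>S. ip nuD (%x. ext v x - b x) s = 0)"
 proof (rule sqint_projection)
  show "S \<subseteq> sqint nuD" unfolding S_def using L2D(1) by blast
  show "S ~= {}" unfolding S_def using zero by blast
  show "(%x. f x + g x) \<in> S" if "f \<in> S" "g \<in> S" for f g
  proof -
   obtain f' g' where fg: "f = ext f'" "g = ext g'" "f' \<in> fun_span X \<inter> L2 \<mu> D" "g' \<in> fun_span X \<inter> L2 \<mu> D" using \<open>f \<in> S\<close> \<open>g \<in> S\<close> unfolding S_def by blast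
   then have "(%x. f' x + g' x) \<in> fun_span X \<inter> L2 \<mu> D" by (auto intro: fun_span_add L2_add)
   then show ?thesis unfolding S_def fg(1,2) ext_add[symmetric] by blast
  qed
  show "(%x. c * f x) \<in> S" if "f \<in> S" for f c
  proof -
   obtain f' where f': "f = ext f'" "f' \<in> fun_span X \<inter> L2 \<mu> D" using \<open>f \<in> S\<close> unfolding S_def by blast
   then have "(%x. c * f' x) \<in> fun_span X \<inter> L2 \<mu> D" by (auto intro: fun_span_scale L2_scale)
   then show ?thesis unfolding S_def f'(1) ext_scale[symmetric] by blast
  qed
  show "ext v \<in> sqint nuD" by (rule L2D(1)[OF v])
 qed
 then obtain b0 where b0: "b0 \<in> sqint nuD" and ap: "!!e. e > 0 ==> \<exists>s\<in>S. nrm2 nuD (%x. b0 x - s x) < e"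
  and orth: "!!s. s \<in> S ==> ip nuD (%x. ext v x - b0 x) s = 0" by blast
 obtain b where b: "b \<in> sqint nuD" "ginv b" and ae: "AE h in nuD. b h = b0 h" using periodization[OF b0] by blast
 have bL: "b \<in> L2 \<mu> D" unfolding L2_iff using sqint_ext[OF b(1)] b(2) by simp
 have ae': "AE h in nuD. ext b h = b0 h" using ae ext_AE[of b] by eventually_elim simp
 have Sm: "s \<in> sqint nuD" if "s \<in> S" for s using that L2D(1) unfolding S_def by blast
 show ?thesis
 proof (intro bexI[of _ b] ballI)
  show "b \<in> L2_closure \<mu> D (fun_span X)" unfolding closure_iff
  proof (intro conjI bL allI impI)
   fix e :: real assume "e > 0"
   then obtain s where s: "s \<in> fun_span X \<inter> L2 \<mu> D" "nrm2 nuD (%x. b0 x - ext s x) < e" using ap unfolding S_def by blast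
   have "ext s \<in> sqint nuD" using s L2D(1) by blast
   then have "nrm2 nuD (%x. ext b x - ext s x) = nrm2 nuD (%x. b0 x - ext s x)"
    unfolding nrm2_def using sqintD(1)[OF b0] sqintD(1)[OF sqint_ext[OF b(1)]]
    by (intro integral_cong_AE) (auto dest: sqintD(1) intro: eventually_mono[OF ae'])
   then show "\<exists>s\<in>fun_span X \<inter> L2 \<mu> D. nrm2 nuD (%x. ext b x - ext s x) < e" using s by (intro bexI[of _ s]) simp_all
  qed
  fix s assume s: "s \<in> fun_span X \<inter> L2 \<mu> D"
  then have sS: "ext s \<in> S" unfolding S_def by blast
  have "ip nuD (%x. ext v x - ext b x) (ext s) = ip nuD (%x. ext v x - b0 x) (ext s)"
   by (rule ip_cong_AE) (use sqintD(1)[OF b0] sqintD(1)[OF sqint_ext[OF b(1)]] sqintD(1)[OF L2D(1)[OF v]] sqintD(1)[OF Sm[OF sS]] in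
    \<open>auto intro: eventually_mono[OF ae']\<close>)
  then show "ip nuD (%x. ext v x - ext b x) (ext s) = 0" using orth[OF sS] by simp
 qed
qed

lemma gen_cong:
 assumes "p \<in> sqint nuD" "q \<in> sqint nuD" "AE h in nuD. p h = q h" "gen q"
 shows "gen p"
 unfolding gen_def
proof (intro ballI impI)
 fix r assume r: "r \<in> sqint nuD" "ginv r" "tinv r"
 have "ip nuD p r = ip nuD q r"
  by (rule ip_cong_AE[OF sqintD(1)[OF assms(1)] sqintD(1)[OF assms(2)] sqintD(1)[OF r(1)] assms(3)])
 then show "ip nuD p r = 0" using assms(4) r by (simp add: gen_def)
qed

lemma ktype_psl: "psi \<in> sqint nuD ==> ktype l (psl psi l)"
 unfolding ktype_def using psl_rot[OF sqint_borel] by blast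

text \<open>Each K-type of \<open>psi\<close> has vanishing coefficients, and off a null set it is
  the lift of a genuine cusp form by \<open>cusp_modification\<close> and
  \<open>lift_of_ktype\<close>. As \<open>psi\<close> is orthogonal to that lift,
  \<open>ip_psl_self\<close> makes the K-type null; \<open>psl_complete\<close> concludes.\<close>

lemma complement_trivial:
 assumes psi: "psi \<in> sqint nuD" and inv: "ginv psi" and g: "gen psi"
  and sv: "!!M f. M >= 1 ==> f \<in> Cc_smooth0 ==> ip nuD psi (svr M f) = 0"
  and cusp: "!!k \<phi>. genuine_cusp_form \<mu> D k \<phi> ==> ip nuD psi (ext (group_lift k \<phi>)) = 0"
 shows "AE h in nuD. psi h = 0"
proof (rule psl_complete[OF psi inv], goal_cases)
 case (1 l)
 define F where "F = psl psi l"
 have F: "F \<in> sqint nuD" "ginv F" "ktype l F" "gen F"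
  unfolding F_def by (rule psl_sqint[OF psi inv], rule ginv_psl[OF inv], rule ktype_psl[OF psi], rule gen_psl[OF psi inv g])
 have "AE xe in lam. omg F m xe = 0" for m unfolding F_def by (rule omg_psl_zero[OF psi inv g sv])
 from cusp_modification[OF F(1-3) this] obtain F' where F': "F' \<in> bmble borel" "ginv F'" "ktype l F'"
  and ae: "AE h in nuD. F' h = F h" and c0: "!!m r. r > 0 ==> cusp_int m F' r = 0" by blast
 obtain \<phi> where \<phi>: "!!h. h \<in> SAff ==> group_lift l \<phi> h = F' h" using lift_of_ktype[OF F'(3)] by blast
 have ex: "ext (group_lift l \<phi>) = ext F'" by (auto simp: fun_eq_iff ext_def indicator_def \<phi>)
 have em: "ext F' \<in> bmble borel" unfolding ext_def[abs_def] using F'(1) by measurable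
 have ae': "AE h in nuD. ext F' h = F h" using ae ext_AE[of F'] by eventually_elim simp
 have es: "ext F' \<in> sqint nuD"
  by (rule sqint_bound[OF _ sqintD(2)[OF F(1)]]) (use em ae' in \<open>auto intro: eventually_mono cong: m_cong\<close>)
 have ginv: "ginv (group_lift l \<phi>)"
  using F'(2) \<phi> by (simp add: ginv_def mul_in SAff_int_sub del: mul_comps)
 have "genuine_cusp_form \<mu> D l \<phi>" unfolding genuine_cusp_form_def
 proof (intro conjI allI impI)
  show "affine_modular_invariant l \<phi>" by (rule invariant_of_lift[OF ginv])
  show "group_lift l \<phi> \<in> L2_gen \<mu> D"
   unfolding L2_gen_iff L2_iff ex using es ginv gen_cong[OF es F(1) ae' F(4)] by simp
  fix m and y :: real assume y: "y > 0"
  define r where "r = 1 / sqrt y"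
  have r: "r > 0" "1 / r^2 = y" using y by (simp_all add: r_def power_divide)
  show "c_H0 \<phi> 0 m y = 0"
   using c_H0_cusp_int[of F' l \<phi>, OF F'(1) _ r(1), of m] \<phi> c0[OF r(1)] unfolding r(2) by simp
 qed
 then have "ip nuD psi (ext F') = 0" using cusp unfolding ex[symmetric] by blast
 then have "ip nuD psi F = 0" using ip_cong_right[OF psi es F(1) ae'] by simp
 then have "nrm2 nuD F = 0" using ip_psl_self[OF psi inv, of l] unfolding F_def by simp
 then show ?case using nrm2_eq_0[OF F(1)] unfolding F_def by simp
qed

text \<open>The cusp condition is translated back to vanishing of every \<open>omg\<close>, after
  which the pairing formula gives 0.\<close>

lemma lift_orthogonal_svr:
 assumes \<phi>: "genuine_cusp_form \<mu> D k \<phi>" and f: "f \<in> Cc_smooth0" and M: "M >= 1"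
 shows "ip nuD (ext (group_lift k \<phi>)) (svr M f) = 0"
proof -
 define F where "F = ext (group_lift k \<phi>)"
 have "group_lift k \<phi> \<in> L2 \<mu> D" using \<phi> by (simp add: genuine_cusp_form_def L2_gen_def)
 then have F: "F \<in> sqint nuD" "ginv F" unfolding F_def by (simp_all add: L2_iff)
 have k: "ktype k F"
  unfolding ktype_def F_def using group_lift_rot by (simp add: mul_in del: mul_comps)
 have "cusp_int m F r = 0" if r: "r > 0" for m r
 proof -
  have "c_H0 \<phi> 0 m (1 / r^2) = of_real r powi k * cusp_int m F r"
   by (rule c_H0_cusp_int[OF sqint_borel[OF F(1)] _ r]) (simp add: F_def)
  moreover have "c_H0 \<phi> 0 m (1 / r^2) = 0" using \<phi> r by (simp add: genuine_cusp_form_def)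
  ultimately show ?thesis using r by simp
 qed
 then have "AE xe in lam. omg F m xe = 0" for m by (intro omg_zero_of_cusp_int[OF F k])
 then show ?thesis unfolding F_def[symmetric] by (intro ip_svr_zero[OF F f M])
qed

lemma decomposition:
 "orthogonal_decomposition \<mu> D (L2_gen \<mu> D) (L2_gen_cusp \<mu> D) (L2_closure \<mu> D (fun_span (\<Union>M\<in>{1..}. SV_space \<mu> D M)))"
proof -
 define X where "X = {group_lift k \<phi> | k \<phi>. genuine_cusp_form \<mu> D k \<phi>}"
 define Y where "Y = (\<Union>M\<in>{1..}. SV_space \<mu> D M)"
 have A: "L2_gen_cusp \<mu> D = L2_closure \<mu> D (fun_span X)" by (simp add: L2_gen_cusp_def X_def)
 have XL: "X \<subseteq> L2 \<mu> D" and Xg: "!!p. p \<in> X ==> gen (ext p)"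
  unfolding X_def genuine_cusp_form_def L2_gen_iff by auto
 have SVL: "SV_rel M f \<in> L2 \<mu> D" if "M >= 1" "f \<in> Cc_smooth0" for M f
  unfolding L2_iff ext_svr using svr_sqint[OF that(2,1)] ginv_SV_rel[OF _ that(1)] by (simp add: ginv_def)
 have YL: "Y \<subseteq> L2 \<mu> D" by (auto simp: Y_def SV_space_def L2_closure_def)
 \<comment> \<open>\<open>Y\<close> consists of closed spaces; the individual transforms have to be
   recognised among its elements before projection onto its span yields orthogonality to
   them.\<close>
 have SVY: "SV_rel M f \<in> Y" if "M >= 1" "f \<in> Cc_smooth0" for M f
 proof -
  have "SV_rel M f \<in> SV_space \<mu> D M" unfolding SV_space_def closure_iff
  proof (intro conjI allI impI SVL[OF that])
   fix e :: real assume "e > 0"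
   moreover have "nrm2 nuD (%x. ext (SV_rel M f) x - ext (SV_rel M f) x) = 0" by (simp add: nrm2_def)
   moreover have "SV_rel M f \<in> fun_span (SV_rel M ` Cc_smooth0)" using that by (intro fun_span_I) simp
   ultimately show "\<exists>s\<in>fun_span (SV_rel M ` Cc_smooth0) \<inter> L2 \<mu> D. nrm2 nuD (%x. ext (SV_rel M f) x - ext s x) < e"
    using SVL[OF that] by (intro bexI[of _ "SV_rel M f"]) auto
  qed
  then show ?thesis using that unfolding Y_def by auto
 qed
 have flip: "ip nuD p q = 0 \<longleftrightarrow> ip nuD q p = 0" for p q using ip_cnj[of nuD p q] ip_cnj[of nuD q p] by auto
 have orthB: "ip nuD (ext b) w = 0"
  if b: "b \<in> L2_closure \<mu> D (fun_span Y)" and w: "w \<in> sqint nuD" and sv: "!!M f. M >= 1 ==> f \<in> Cc_smooth0 ==> ip nuD w (svr M f) = 0" for b w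
 proof (rule span_orthogonal[OF YL w _ b])
  fix p assume "p \<in> Y"
  then obtain M where M: "M >= 1" and p: "p \<in> L2_closure \<mu> D (fun_span (SV_rel M ` Cc_smooth0))" unfolding Y_def SV_space_def by auto
  show "ip nuD (ext p) w = 0"
   by (rule span_orthogonal[OF _ w _ p]) (use SVL[OF M] sv[OF M] flip in \<open>auto simp: ext_svr\<close>)
 qed
 have closureL: "f \<in> L2 \<mu> D" if "f \<in> L2_closure \<mu> D S" for f S using that by (simp add: L2_closure_def)
 have AV: "gen (ext a)" if a: "a \<in> L2_closure \<mu> D (fun_span X)" for a
  unfolding gen_def
 proof (intro ballI impI)
  fix q assume q: "q \<in> sqint nuD" "ginv q" "tinv q"
  show "ip nuD (ext a) q = 0" by (rule span_orthogonal[OF XL q(1) _ a]) (use Xg q in \<open>auto simp: gen_def\<close>)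
 qed
 have BV: "gen (ext b)" if b: "b \<in> L2_closure \<mu> D (fun_span Y)" for b
  unfolding gen_def
 proof (intro ballI impI)
  fix q assume q: "q \<in> sqint nuD" "ginv q" "tinv q"
  show "ip nuD (ext b) q = 0" by (rule orthB[OF b q(1)]) (rule ip_tinv_svr[OF q])
 qed
 have AB: "ip nuD (ext a) (ext b) = 0" if a: "a \<in> L2_closure \<mu> D (fun_span X)" and b: "b \<in> L2_closure \<mu> D (fun_span Y)" for a b
 proof -
  have as: "ext a \<in> sqint nuD" by (rule L2D(1)[OF closureL[OF a]])
  have "ip nuD (ext a) (svr M f) = 0" if M: "M >= 1" and f: "f \<in> Cc_smooth0" for M f
   by (rule span_orthogonal[OF XL svr_sqint[OF f M] _ a]) (auto simp: X_def intro: lift_orthogonal_svr[OF _ f M])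
  from orthB[OF b as this] show ?thesis using flip by blast
 qed
 have gen_add: "gen (%x. p x + q x)" if "gen p" "gen q" "p \<in> sqint nuD" "q \<in> sqint nuD" for p q
  using that unfolding gen_def by (auto simp: ip_add_left)
 have gen_diff: "gen (%x. p x - q x)" if "gen p" "gen q" "p \<in> sqint nuD" "q \<in> sqint nuD" for p q
  using that unfolding gen_def by (auto simp: ip_diff_left)
 have "L2_gen \<mu> D = {(%x. a x + b x) | a b. a \<in> L2_closure \<mu> D (fun_span X) \<and> b \<in> L2_closure \<mu> D (fun_span Y)}"
 proof (intro equalityI subsetI)
  fix v assume "v \<in> {(%x. a x + b x) | a b. a \<in> L2_closure \<mu> D (fun_span X) \<and> b \<in> L2_closure \<mu> D (fun_span Y)}"
  then obtain a b where v: "v = (%x. a x + b x)" and a: "a \<in> L2_closure \<mu> D (fun_span X)" and b: "b \<in> L2_closure \<mu> D (fun_span Y)" by blast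
  show "v \<in> L2_gen \<mu> D" unfolding L2_gen_iff v ext_add
   using gen_add[OF AV[OF a] BV[OF b] L2D(1)[OF closureL[OF a]] L2D(1)[OF closureL[OF b]]] L2_add[OF closureL[OF a] closureL[OF b]] by blast
 next
  fix v assume "v \<in> L2_gen \<mu> D"
  then have vL: "v \<in> L2 \<mu> D" and vg: "gen (ext v)" unfolding L2_gen_iff by auto
  \<comment> \<open>Two successive projections: the remainder \<open>psi\<close> is orthogonal to
    all transforms, and subtracting its cuspidal part preserves this because lifts are orthogonal to
    transforms. What is left satisfies the hypotheses of \<open>complement_trivial\<close>.\<close>
  obtain b where b: "b \<in> L2_closure \<mu> D (fun_span Y)"
   and bo: "!!s. s \<in> fun_span Y \<inter> L2 \<mu> D ==> ip nuD (%x. ext v x - ext b x) (ext s) = 0"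
   using closure_projection[OF vL, of Y] by blast
  define psi where "psi x = v x - b x" for x
  have psiL: "psi \<in> L2 \<mu> D" unfolding psi_def[abs_def] by (rule L2_diff[OF vL closureL[OF b]])
  have psie: "ext psi = (%x. ext v x - ext b x)" unfolding psi_def[abs_def] by (rule ext_diff)
  have psig: "gen (ext psi)" unfolding psie by (rule gen_diff[OF vg BV[OF b] L2D(1)[OF vL] L2D(1)[OF closureL[OF b]]])
  obtain a where a: "a \<in> L2_closure \<mu> D (fun_span X)"
   and ao: "!!s. s \<in> fun_span X \<inter> L2 \<mu> D ==> ip nuD (%x. ext psi x - ext a x) (ext s) = 0"
   using closure_projection[OF psiL, of X] by blast
  have aL: "a \<in> L2 \<mu> D" by (rule closureL[OF a])
  define \<omega> where "\<omega> x = ext psi x - ext a x" for x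
  have \<omega>L: "\<omega> \<in> sqint nuD" unfolding \<omega>_def[abs_def] by (rule sqint_diff[OF L2D(1)[OF psiL] L2D(1)[OF aL]])
  have "AE h in nuD. \<omega> h = 0"
  proof (rule complement_trivial[OF \<omega>L])
   show "ginv \<omega>"
    using L2D(2)[OF psiL] L2D(2)[OF aL] unfolding \<omega>_def[abs_def] ginv_ext[symmetric, of psi] ginv_ext[symmetric, of a] by (simp add: ginv_def del: ginv_ext mul_comps)
   show "gen \<omega>" unfolding \<omega>_def[abs_def] by (rule gen_diff[OF psig AV[OF a] L2D(1)[OF psiL] L2D(1)[OF aL]])
   show "ip nuD \<omega> (svr M f) = 0" if M: "M >= 1" and f: "f \<in> Cc_smooth0" for M f
   proof -
    have "ip nuD (ext psi) (svr M f) = 0"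
     using bo[of "SV_rel M f"] fun_span_I[OF SVY[OF M f]] SVL[OF M f] unfolding psie ext_svr by blast
    moreover have "ip nuD (ext a) (svr M f) = 0"
     by (rule span_orthogonal[OF XL svr_sqint[OF f M] _ a]) (auto simp: X_def intro: lift_orthogonal_svr[OF _ f M])
    ultimately show ?thesis unfolding \<omega>_def[abs_def] ip_diff_left[OF L2D(1)[OF psiL] L2D(1)[OF aL] svr_sqint[OF f M]] by simp
   qed
   show "ip nuD \<omega> (ext (group_lift k \<phi>)) = 0" if "genuine_cusp_form \<mu> D k \<phi>" for k \<phi>
   proof -
    have "group_lift k \<phi> \<in> X" using that by (auto simp: X_def)
    then show ?thesis using ao[of "group_lift k \<phi>"] XL fun_span_I[of "group_lift k \<phi>" X] unfolding \<omega>_def[abs_def] by blast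
   qed
  qed
  then have ae: "AE h in nuD. ext psi h = ext a h" by eventually_elim (simp add: \<omega>_def)
  \<comment> \<open>The decomposition must hold at every point. Hence \<open>psi\<close> itself,
    rather than its projection \<open>a\<close>, is taken as the cuspidal part; the two agree almost
    everywhere and the closure does not distinguish them.\<close>
  have "psi \<in> L2_closure \<mu> D (fun_span X)" unfolding closure_iff
  proof (intro conjI psiL allI impI)
   fix e :: real assume "e > 0"
   then obtain s where s: "s \<in> fun_span X \<inter> L2 \<mu> D" "nrm2 nuD (%x. ext a x - ext s x) < e" using a unfolding closure_iff by blast
   have "nrm2 nuD (%x. ext psi x - ext s x) = nrm2 nuD (%x. ext a x - ext s x)"
    unfolding nrm2_def using sqintD(1)[OF L2D(1)[OF psiL]] sqintD(1)[OF L2D(1)[OF aL]] sqintD(1)[OF L2D(1), of s] s(1)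
    by (intro integral_cong_AE) (auto intro: eventually_mono[OF ae])
   then show "\<exists>s\<in>fun_span X \<inter> L2 \<mu> D. nrm2 nuD (%x. ext psi x - ext s x) < e" using s by (intro bexI[of _ s]) simp_all
  qed
  moreover have "v = (%x. psi x + b x)" by (simp add: psi_def)
  ultimately show "v \<in> {(%x. a x + b x) | a b. a \<in> L2_closure \<mu> D (fun_span X) \<and> b \<in> L2_closure \<mu> D (fun_span Y)}" using b by blast
 qed
 then show ?thesis
  unfolding orthogonal_decomposition_def A Y_def[symmetric] using AB L2_inner_ip closureL by auto
qed

end

theorem theorem1p5:
 fixes \<mu> :: "saff measure" and D :: "saff set"
 assumes "haar_measure \<mu>" and "fundamental_domain \<mu> D"
 shows "orthogonal_decomposition \<mu> D (L2_gen \<mu> D) (L2_gen_cusp \<mu> D)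
     (L2_closure \<mu> D (fun_span (\<Union>M\<in>{1..}. SV_space \<mu> D M)))"
proof -
 interpret haar_quotient \<mu> D using assms by unfold_locales
 show ?thesis by (rule decomposition)
qed

end
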